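(* Let $\mathcal C_0\subset\mathbb X_{\alpha,\beta}$ be a weak-strong uniqueness class of the skeleton equation $$\partial_t\theta=-\Lambda^{2\alpha}\theta-R^\perp\theta\cdot\nabla\theta+\Lambda^{2\beta}g$$ such that its $\mathcal I$-closure $\mathcal C=\overline{\mathcal C_0}^{\mathcal I}$ contains non-empty time-reversible subsets. Let $\mathcal R\subset\mathcal C$ satisfy $\mathcal R=\mathfrak T_T\mathcal R$. Suppose that $\theta\in\mathcal R$ is a weak solution of the skeleton equation for some $g\in L^2([0,T];H)$. Then the $H^{\alpha-2\beta}$-energy equality holds: $$\frac12\|\theta(T)\|_{H^{\alpha-2\beta}(\mathbb T^2)}^2+\int_0^T\|\theta(s)\|_{H^{2\alpha-2\beta}(\mathbb T^2)}^2\,ds=\frac12\|\theta(0)\|_{H^{\alpha-2\beta}(\mathbb T^2)}^2+\int_0^T\langle\Lambda^{2\alpha-2\beta}\theta,g\rangle\,ds.$$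
   Context: $\mathbb T^2=\mathbb R^2/\mathbb Z^2$, $T>0$ fixed; either $\alpha\in(0,1/2)$, $\beta=\alpha/2$, or $\alpha\in[1/2,1)$, $\beta\in\{\alpha/2,\alpha/2+1/4\}$. $H$ is the space of real mean-zero functions in $L^2(\mathbb T^2)$, $\langle\cdot,\cdot\rangle$ its inner product (also used for duality pairings). For $r\in\mathbb R$, $H^r(\mathbb T^2)$ is the space of mean-zero distributions with $\|f\|_{H^r}^2=\sum_{k\ne0}|2\pi k|^{2r}|\hat f(k)|^2<\infty$; $H^\infty=\bigcap_{r>0}H^r$; a subscript $w$ means weak topology. $\Lambda=(-\Delta)^{1/2}$, $R_j=\partial_j\Lambda^{-1}$, $R^\perp\theta=(-R_2\theta,R_1\theta)$. $$\mathbb X_{\alpha,\beta}=L^2([0,T];H^{\alpha-2\beta})\cap L^2_w([0,T];H^{2\alpha-2\beta})\cap C([0,T];H^{\alpha-2\beta}_w)$$ with the intersection topology. $(\mathfrak T_T\theta)(t)=-\theta(T-t)$; a set $\mathcal R$ is time-reversible if $\mathcal R=\mathfrak T_T\mathcal R$. Nonlinearity. $[\Lambda,\partial_i\varphi]h:=\Lambda(\partial_i\varphi\,h)-\partial_i\varphi\,\Lambda h$, and for $\theta\in H^{-1/2}$ the distribution $R^\perp\theta\cdot\nabla\theta=\nabla\cdot(\theta R^\perp\theta)$ is defined by $\langle R^\perp\theta\cdot\nabla\theta,\varphi\rangle:=-\frac12\langle R_2\theta,[\Lambda,\partial_1\varphi]\Lambda^{-1}\theta\rangle+\frac12\langle R_1\theta,[\Lambda,\partial_2\varphi]\Lambda^{-1}\theta\rangle$,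 $\varphi\in H^\infty$, with $H^{-1/2}$–$H^{1/2}$ duality (the classical expression for smooth $\theta$). A weak solution of the skeleton equation with initial data $\theta_0\in H^{\alpha-2\beta}$ is $\theta\in L^\infty([0,T];H^{\alpha-2\beta})\cap L^2([0,T];H^{2\alpha-2\beta})\cap C([0,T];H^{\alpha-2\beta}_w)$ such that for all $\varphi\in C^\infty([0,T];H^\infty)$ and $t\in[0,T]$, $$\langle\theta(t),\varphi(t)\rangle=\langle\theta_0,\varphi(0)\rangle+\int_0^t\big(\langle\theta,\partial_s\varphi\rangle-\langle\theta,\Lambda^{2\alpha}\varphi\rangle-\langle R^\perp\theta\cdot\nabla\theta,\varphi\rangle+\langle\Lambda^{2\beta}\varphi,g\rangle\big)\,ds.$$ Rate function: for $\theta\in\mathbb X_{\alpha,\beta}$, $\mathcal I(\theta)=\|\theta(0)\|_{H^{\alpha-2\beta}}^2+\mathcal I_{dyna}(\theta)$, where $\mathcal I_{dyna}(\theta)=\frac12\inf\|g\|^2_{L^2([0,T];H)}$ over all $g\in L^2([0,T];H)$ for which $\theta$ is a weak solution of the skeleton equation ($+\infty$ if there is none). $\mathcal C_0\subset\mathbb X_{\alpha,\beta}$ is a weak-strong uniqueness class if for every $g\in L^2([0,T];L^2(\mathbb T^2))$ and any two weak solutions $\theta_1,\theta_2$ with control $g$ and $\theta_1(0)=\theta_2(0)$, one has $\theta_1=\theta_2$ whenever $\theta_1\in\mathcal C_0$ and $\theta_2$ satisfies, for every $t\in[0,T]$, $\frac12\|\theta_2(t)\|_{H^{\alpha-2\beta}}^2+\int_0^t\|\theta_2\|_{H^{2\alpha-2\beta}}^2ds\le\frac12\|\theta_2(0)\|_{H^{\alpha-2\beta}}^2+\int_0^t\langle\Lambda^{2\alpha-2\beta}\theta_2,g\rangle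 ds$. Its $\mathcal I$-closure $\overline{\mathcal C_0}^{\mathcal I}$ is the set of $\theta\in\mathbb X_{\alpha,\beta}$ for which there are $\theta^{(n)}\in\mathcal C_0$ with $\theta^{(n)}\to\theta$ in $\mathbb X_{\alpha,\beta}$ and $\mathcal I(\theta^{(n)})\to\mathcal I(\theta)$. *)

theory Defs
  imports "HOL-Analysis.Analysis"
begin

section \<open>Distributions and Sobolev spaces on the torus\<close>

text \<open>
  A real distribution \<open>f\<close> on the torus \<open>R^2/Z^2\<close> is represented by the family of its Fourier
  coefficients \<open>f k = <f, exp(-2 pi i k.x)>\<close>, \<open>k \<in> Z^2\<close>. This identifies the real distributions
  with the Hermitian families of at most polynomial growth, and (Riesz--Fischer, Parseval) the
  space \<open>L^2(R^2/Z^2)\<close> with the Hermitian square-summable families. Differential operators and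
  powers of the Laplacian act as Fourier multipliers, and products act as convolutions.
\<close>

type_synonym fourier = "int \<times> int \<Rightarrow> complex"

definition freq :: "int \<times> int \<Rightarrow> real" where
  "freq k = 2 * pi * sqrt ((real_of_int (fst k))\<^sup>2 + (real_of_int (snd k))\<^sup>2)"

definition torus_distr :: "fourier set" where
  "torus_distr = {f. (\<forall>k. f (- k) = cnj (f k)) \<and>
                     (\<exists>C (N::nat). \<forall>k. cmod (f k) \<le> C * (1 + freq k) ^ N)}"

definition hs_norm :: "real \<Rightarrow> fourier \<Rightarrow> real" where
  "hs_norm r f = sqrt (\<Sum>\<^sub>\<infinity>k\<in>-{0}. freq k powr (2 * r) * (cmod (f k))\<^sup>2)"

definition Hs :: "real \<Rightarrow> fourier set" where
  "Hs r = {f \<in> torus_distr. f 0 = 0 \<and>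
             (\<lambda>k. freq k powr (2 * r) * (cmod (f k))\<^sup>2) summable_on (- {0})}"

definition Hinf :: "fourier set" where
  "Hinf = (\<Inter>r\<in>{0<..}. Hs r)"

text \<open>The full space \<open>L^2(R^2/Z^2)\<close>, without the mean-zero constraint. The space of real
  mean-zero square-integrable functions is \<open>Hs 0\<close>, with \<open>hs_norm 0\<close> the \<open>L^2\<close>-norm.\<close>

definition l2_norm :: "fourier \<Rightarrow> real" where
  "l2_norm f = sqrt (\<Sum>\<^sub>\<infinity>k. (cmod (f k))\<^sup>2)"

definition L2_torus :: "fourier set" where
  "L2_torus = {f \<in> torus_distr. (\<lambda>k. (cmod (f k))\<^sup>2) summable_on UNIV}"

text \<open>The inner product of \<open>L^2\<close>, extended to the \<open>H^r\<close>--\<open>H^{-r}\<close> duality (Parseval). The sum is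
  real for real distributions.\<close>

definition pair :: "fourier \<Rightarrow> fourier \<Rightarrow> real" where
  "pair f g = Re (\<Sum>\<^sub>\<infinity>k. f k * cnj (g k))"

text \<open>\<open>Lam s\<close> is \<open>(-\<Delta>)^{s/2}\<close>; the zero mode is annihilated for every \<open>s\<close>, which for \<open>s \<le> 0\<close>
  is the convention on mean-zero distributions.\<close>

definition Lam :: "real \<Rightarrow> fourier \<Rightarrow> fourier" where
  "Lam s f = (\<lambda>k. if k = 0 then 0 else of_real (freq k powr s) * f k)"

definition partial1 :: "fourier \<Rightarrow> fourier" where
  "partial1 f = (\<lambda>k. 2 * of_real pi * \<i> * of_int (fst k) * f k)"

definition partial2 :: "fourier \<Rightarrow> fourier" where
  "partial2 f = (\<lambda>k. 2 * of_real pi * \<i> * of_int (snd k) * f k)"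

definition riesz1 :: "fourier \<Rightarrow> fourier" where
  "riesz1 f = partial1 (Lam (-1) f)"

definition riesz2 :: "fourier \<Rightarrow> fourier" where
  "riesz2 f = partial2 (Lam (-1) f)"

text \<open>Fourier coefficients of the product of a smooth function and a distribution.\<close>

definition fmult :: "fourier \<Rightarrow> fourier \<Rightarrow> fourier" where
  "fmult a h = (\<lambda>k. \<Sum>\<^sub>\<infinity>l. a (k - l) * h l)"

definition commutator :: "fourier \<Rightarrow> fourier \<Rightarrow> fourier" where
  "commutator a h = Lam 1 (fmult a h) - fmult a (Lam 1 h)"

text \<open>\<open>nonlin \<theta> \<phi>\<close> is the pairing of \<open>R^\<bottom>\<theta> \<cdot> \<nabla>\<theta>\<close> with \<open>\<phi>\<close>, for \<open>\<theta> \<in> H^{-1/2}\<close> and \<open>\<phi> \<in> H^\<infinity>\<close>.\<close>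

definition nonlin :: "fourier \<Rightarrow> fourier \<Rightarrow> real" where
  "nonlin \<theta> \<phi> =
     - (1/2) * pair (riesz2 \<theta>) (commutator (partial1 \<phi>) (Lam (-1) \<theta>))
     + (1/2) * pair (riesz1 \<theta>) (commutator (partial2 \<phi>) (Lam (-1) \<theta>))"


section \<open>Spaces of time-dependent distributions\<close>

text \<open>Bochner (strong) measurability on \<open>[0,T]\<close> with respect to a normed space with carrier \<open>V\<close>
  and norm \<open>nrm\<close>: almost-everywhere limit of simple functions.\<close>

definition bochner_measurable ::
  "fourier set \<Rightarrow> (fourier \<Rightarrow> real) \<Rightarrow> real \<Rightarrow> (real \<Rightarrow> fourier) \<Rightarrow> bool" where
  "bochner_measurable V nrm T f \<longleftrightarrow>
     (\<exists>s :: nat \<Rightarrow> real \<Rightarrow> fourier.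
        (\<forall>n. simple_function (lebesgue_on {0..T}) (s n) \<and> (\<forall>t\<in>{0..T}. s n t \<in> V)) \<and>
        (AE t in lebesgue_on {0..T}. f t \<in> V \<and> (\<lambda>n. nrm (s n t - f t)) \<longlonglongrightarrow> 0))"

definition L2_time ::
  "fourier set \<Rightarrow> (fourier \<Rightarrow> real) \<Rightarrow> real \<Rightarrow> (real \<Rightarrow> fourier) set" where
  "L2_time V nrm T =
     {f. bochner_measurable V nrm T f \<and> integrable (lebesgue_on {0..T}) (\<lambda>t. (nrm (f t))\<^sup>2)}"

definition Linf_time ::
  "fourier set \<Rightarrow> (fourier \<Rightarrow> real) \<Rightarrow> real \<Rightarrow> (real \<Rightarrow> fourier) set" where
  "Linf_time V nrm T =
     {f. bochner_measurable V nrm T f \<and> (\<exists>M. AE t in lebesgue_on {0..T}. nrm (f t) \<le> M)}"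

abbreviation L2Hs :: "real \<Rightarrow> real \<Rightarrow> (real \<Rightarrow> fourier) set" where
  "L2Hs T r \<equiv> L2_time (Hs r) (hs_norm r) T"

abbreviation LinfHs :: "real \<Rightarrow> real \<Rightarrow> (real \<Rightarrow> fourier) set" where
  "LinfHs T r \<equiv> Linf_time (Hs r) (hs_norm r) T"

abbreviation L2L2 :: "real \<Rightarrow> (real \<Rightarrow> fourier) set" where
  "L2L2 T \<equiv> L2_time L2_torus l2_norm T"

definition L2Hs_norm :: "real \<Rightarrow> real \<Rightarrow> (real \<Rightarrow> fourier) \<Rightarrow> real" where
  "L2Hs_norm T r f = sqrt (LINT t|lebesgue_on {0..T}. (hs_norm r (f t))\<^sup>2)"

text \<open>The topology on \<open>S\<close> generated by a family \<open>D\<close> of pseudometrics.\<close>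

definition pseudometrics_topology :: "'a set \<Rightarrow> ('a \<Rightarrow> 'a \<Rightarrow> real) set \<Rightarrow> 'a topology" where
  "pseudometrics_topology S D =
     topology_generated_by {{y \<in> S. d x y < e} |d x e. d \<in> D \<and> x \<in> S \<and> 0 < e}"

definition Hs_weak :: "real \<Rightarrow> fourier topology" where
  "Hs_weak r = pseudometrics_topology (Hs r) {(\<lambda>x y. \<bar>pair (x - y) \<psi>\<bar>) |\<psi>. \<psi> \<in> Hs (- r)}"

text \<open>\<open>C([0,T]; H^r_w)\<close>. Its elements are functions on \<open>[0,T]\<close>, hence extensional, so that equality
  means equality at every time in \<open>[0,T]\<close>.\<close>

definition CwHs :: "real \<Rightarrow> real \<Rightarrow> (real \<Rightarrow> fourier) set" where
  "CwHs T r = {f \<in> extensional {0..T}. continuous_map (top_of_set {0..T}) (Hs_weak r) f}"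

definition L2Hs_strong_metrics :: "real \<Rightarrow> real \<Rightarrow> ((real \<Rightarrow> fourier) \<Rightarrow> (real \<Rightarrow> fourier) \<Rightarrow> real) set" where
  "L2Hs_strong_metrics T r = {(\<lambda>f g. L2Hs_norm T r (\<lambda>t. f t - g t))}"

definition L2Hs_weak_metrics :: "real \<Rightarrow> real \<Rightarrow> ((real \<Rightarrow> fourier) \<Rightarrow> (real \<Rightarrow> fourier) \<Rightarrow> real) set" where
  "L2Hs_weak_metrics T r =
     {(\<lambda>f g. \<bar>LINT t|lebesgue_on {0..T}. pair (f t - g t) (\<psi> t)\<bar>) |\<psi>. \<psi> \<in> L2Hs T (- r)}"

text \<open>Uniform convergence in time with respect to the weak topology of \<open>H^r\<close>
  (equivalently, the compact-open topology).\<close>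

definition CwHs_metrics :: "real \<Rightarrow> real \<Rightarrow> ((real \<Rightarrow> fourier) \<Rightarrow> (real \<Rightarrow> fourier) \<Rightarrow> real) set" where
  "CwHs_metrics T r = {(\<lambda>f g. SUP t\<in>{0..T}. \<bar>pair (f t - g t) \<psi>\<bar>) |\<psi>. \<psi> \<in> Hs (- r)}"

definition Xspace :: "real \<Rightarrow> real \<Rightarrow> real \<Rightarrow> (real \<Rightarrow> fourier) set" where
  "Xspace \<alpha> \<beta> T = L2Hs T (\<alpha> - 2*\<beta>) \<inter> L2Hs T (2*\<alpha> - 2*\<beta>) \<inter> CwHs T (\<alpha> - 2*\<beta>)"

text \<open>The union of the three families of pseudometrics generates the coarsest topology making the
  inclusions into all three spaces continuous.\<close>

definition Xtop :: "real \<Rightarrow> real \<Rightarrow> real \<Rightarrow> (real \<Rightarrow> fourier) topology" where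
  "Xtop \<alpha> \<beta> T = pseudometrics_topology (Xspace \<alpha> \<beta> T)
     (L2Hs_strong_metrics T (\<alpha> - 2*\<beta>) \<union> L2Hs_weak_metrics T (2*\<alpha> - 2*\<beta>) \<union> CwHs_metrics T (\<alpha> - 2*\<beta>))"

definition time_reversal :: "real \<Rightarrow> (real \<Rightarrow> fourier) \<Rightarrow> (real \<Rightarrow> fourier)" where
  "time_reversal T \<theta> = restrict (\<lambda>t. - \<theta> (T - t)) {0..T}"

definition time_reversible :: "real \<Rightarrow> (real \<Rightarrow> fourier) set \<Rightarrow> bool" where
  "time_reversible T R \<longleftrightarrow> R = time_reversal T ` R"


section \<open>Test functions and weak solutions\<close>

text \<open>Differentiability of an \<open>H^\<infinity>\<close>-valued map on \<open>[0,T]\<close> (one-sided at the end points) in the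
  Frechet topology of \<open>H^\<infinity>\<close>, that is, in every \<open>H^r\<close>-norm.\<close>

definition has_Hinf_derivative :: "real \<Rightarrow> (real \<Rightarrow> fourier) \<Rightarrow> real \<Rightarrow> fourier \<Rightarrow> bool" where
  "has_Hinf_derivative T \<phi> s d \<longleftrightarrow> d \<in> Hinf \<and>
     (\<forall>r>0. ((\<lambda>u. hs_norm r (\<lambda>k. (\<phi> u k - \<phi> s k) / of_real (u - s) - d k)) \<longlongrightarrow> 0)
              (at s within {0..T}))"

definition time_deriv :: "real \<Rightarrow> (real \<Rightarrow> fourier) \<Rightarrow> (real \<Rightarrow> fourier)" where
  "time_deriv T \<phi> = (\<lambda>s. THE d. has_Hinf_derivative T \<phi> s d)"

definition smooth_test :: "real \<Rightarrow> (real \<Rightarrow> fourier) set" where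
  "smooth_test T = {\<phi>. (\<forall>s\<in>{0..T}. \<phi> s \<in> Hinf) \<and>
     (\<forall>n. \<forall>s\<in>{0..T}. \<exists>d. has_Hinf_derivative T ((time_deriv T ^^ n) \<phi>) s d)}"

definition weak_solution ::
  "real \<Rightarrow> real \<Rightarrow> real \<Rightarrow> (real \<Rightarrow> fourier) \<Rightarrow> fourier \<Rightarrow> (real \<Rightarrow> fourier) \<Rightarrow> bool" where
  "weak_solution \<alpha> \<beta> T g \<theta>0 \<theta> \<longleftrightarrow>
     \<theta>0 \<in> Hs (\<alpha> - 2*\<beta>) \<and>
     \<theta> \<in> LinfHs T (\<alpha> - 2*\<beta>) \<inter> L2Hs T (2*\<alpha> - 2*\<beta>) \<inter> CwHs T (\<alpha> - 2*\<beta>) \<and>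
     (\<forall>\<phi>\<in>smooth_test T. \<forall>t\<in>{0..T}.
        pair (\<theta> t) (\<phi> t) = pair \<theta>0 (\<phi> 0) +
          (LINT s|lebesgue_on {0..t}.
             pair (\<theta> s) (time_deriv T \<phi> s) - pair (\<theta> s) (Lam (2*\<alpha>) (\<phi> s))
             - nonlin (\<theta> s) (\<phi> s) + pair (Lam (2*\<beta>) (\<phi> s)) (g s)))"


section \<open>Rate function, weak-strong uniqueness classes, closure\<close>

definition I_dyna :: "real \<Rightarrow> real \<Rightarrow> real \<Rightarrow> (real \<Rightarrow> fourier) \<Rightarrow> ennreal" where
  "I_dyna \<alpha> \<beta> T \<theta> = ennreal (1/2) *
     (INF g\<in>{g \<in> L2Hs T 0. weak_solution \<alpha> \<beta> T g (\<theta> 0) \<theta>}. ennreal ((L2Hs_norm T 0 g)\<^sup>2))"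

definition rate :: "real \<Rightarrow> real \<Rightarrow> real \<Rightarrow> (real \<Rightarrow> fourier) \<Rightarrow> ennreal" where
  "rate \<alpha> \<beta> T \<theta> = ennreal ((hs_norm (\<alpha> - 2*\<beta>) (\<theta> 0))\<^sup>2) + I_dyna \<alpha> \<beta> T \<theta>"

definition energy_inequality ::
  "real \<Rightarrow> real \<Rightarrow> real \<Rightarrow> (real \<Rightarrow> fourier) \<Rightarrow> (real \<Rightarrow> fourier) \<Rightarrow> bool" where
  "energy_inequality \<alpha> \<beta> T g \<theta> \<longleftrightarrow> (\<forall>t\<in>{0..T}.
     1/2 * (hs_norm (\<alpha> - 2*\<beta>) (\<theta> t))\<^sup>2
       + (LINT s|lebesgue_on {0..t}. (hs_norm (2*\<alpha> - 2*\<beta>) (\<theta> s))\<^sup>2)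
     \<le> 1/2 * (hs_norm (\<alpha> - 2*\<beta>) (\<theta> 0))\<^sup>2
       + (LINT s|lebesgue_on {0..t}. pair (Lam (2*\<alpha> - 2*\<beta>) (\<theta> s)) (g s)))"

definition weak_strong_uniqueness_class ::
  "real \<Rightarrow> real \<Rightarrow> real \<Rightarrow> (real \<Rightarrow> fourier) set \<Rightarrow> bool" where
  "weak_strong_uniqueness_class \<alpha> \<beta> T C0 \<longleftrightarrow> C0 \<subseteq> Xspace \<alpha> \<beta> T \<and>
     (\<forall>g\<in>L2L2 T. \<forall>\<theta>1 \<theta>2.
        weak_solution \<alpha> \<beta> T g (\<theta>1 0) \<theta>1 \<and> weak_solution \<alpha> \<beta> T g (\<theta>2 0) \<theta>2 \<and> \<theta>1 0 = \<theta>2 0 \<and>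
        \<theta>1 \<in> C0 \<and> energy_inequality \<alpha> \<beta> T g \<theta>2 \<longrightarrow> \<theta>1 = \<theta>2)"

definition I_closure ::
  "real \<Rightarrow> real \<Rightarrow> real \<Rightarrow> (real \<Rightarrow> fourier) set \<Rightarrow> (real \<Rightarrow> fourier) set" where
  "I_closure \<alpha> \<beta> T C0 = {\<theta> \<in> Xspace \<alpha> \<beta> T. \<exists>\<theta>n :: nat \<Rightarrow> real \<Rightarrow> fourier.
     (\<forall>n. \<theta>n n \<in> C0) \<and> limitin (Xtop \<alpha> \<beta> T) \<theta>n \<theta> sequentially \<and>
     (\<lambda>n. rate \<alpha> \<beta> T (\<theta>n n)) \<longlonglongrightarrow> rate \<alpha> \<beta> T \<theta>}"

end

(* Existence of Leray solutions (Galerkin approximation and Arzela-Ascoli in every Fourier mode) and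
   weak-strong uniqueness show that a weak solution in C0 satisfies the energy inequality for each of
   its controls. Along a sequence in C0 with convergent rate function, the initial data and the
   optimal controls converge weakly while the sum of their costs converges to that of the limit; so
   they converge strongly, and the energy inequality at time T passes to the closure. If theta solves
   the equation with control g, then the reversed path -theta(T - t) solves it with control
   g(T - t) - 2 Lam^(2 alpha - 2 beta) theta(T - t), since the nonlinearity is quadratic; the energy
   inequality of the reversed path is the missing inequality for theta. *)

theory Submission
  imports Defs "HOL-Complex_Analysis.Great_Picard" "HOL-Library.Diagonal_Subsequence"
begin

section \<open>Sobolev norms and pairings of Fourier coefficients\<close>

text \<open>For all admissible parameters \<open>\<alpha> - 2 * \<beta>\<close> is \<open>0\<close>
  or \<open>- 1/2\<close>, the two Sobolev exponents whose norms the quadratic term conserves, so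
  Galerkin truncations obey an exact energy identity. The dissipation controls \<alpha> further
  derivatives; since \<alpha> > 0, bounded paths that converge in every Fourier coefficient converge
  strongly in L^2([0,T]; H^{-1/2}), where each coefficient of the nonlinearity is continuous. The
  weak formulation is therefore replaced by one scalar integral equation per frequency, and
  compactness, limits and reversal take place in these equations. A path determines its control: at
  a nonzero frequency the mode equation can be solved for the primitive of the control's
  coefficient. Near-minimal controls of an approximating sequence are thus forced towards the given
  control, without any minimiser and without comparing different controls of the limit. The cost of
  the given control bounds the rate of the limit from above, and this bound already excludes a loss
  of norm in the initial data or in the controls.\<close>

lemma freq_cmod: "freq k = 2 * pi * cmod (Complex (of_int (fst k)) (of_int (snd k)))"
  by (simp add: freq_def cmod_def)

lemma freq_0 [simp]: "freq 0 = 0"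
  by (simp add: freq_def)

lemma freq_nonneg [simp]: "0 \<le> freq k"
  by (simp add: freq_def)

lemma freq_minus [simp]: "freq (- k) = freq k"
  by (simp add: freq_def)

lemma freq_ge_abs: "of_int \<bar>fst k\<bar> \<le> freq k" "of_int \<bar>snd k\<bar> \<le> freq k"
proof -
  have *: "cmod z \<le> 2 * pi * cmod z" for z
    using mult_right_mono[of 1 "2 * pi" "cmod z"] pi_gt3 by simp
  show "of_int \<bar>fst k\<bar> \<le> freq k"
    using order_trans[OF abs_Re_le_cmod *, of "Complex (of_int (fst k)) (of_int (snd k))"]
    by (simp add: freq_cmod)
  show "of_int \<bar>snd k\<bar> \<le> freq k"
    using order_trans[OF abs_Im_le_cmod *, of "Complex (of_int (fst k)) (of_int (snd k))"]
    by (simp add: freq_cmod)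
qed

lemma freq_ge_1: "k \<noteq> 0 \<Longrightarrow> 1 \<le> freq k"
proof -
  assume "k \<noteq> 0"
  then have "1 \<le> \<bar>fst k\<bar> \<or> 1 \<le> \<bar>snd k\<bar>"
    by (auto simp: prod_eq_iff)
  then show ?thesis
    using freq_ge_abs[of k] by (smt (verit) of_int_1_le_iff)
qed

lemma freq_pos: "k \<noteq> 0 \<Longrightarrow> 0 < freq k"
  using freq_ge_1[of k] by linarith

lemma freq_eq_0_iff [simp]: "freq k = 0 \<longleftrightarrow> k = 0"
  by (metis freq_0 freq_pos less_irrefl)

lemma freq_triangle: "freq (k + l) \<le> freq k + freq l"
  unfolding freq_cmod
  using mult_left_mono[OF norm_triangle_ineq, of "2 * pi" "Complex (of_int (fst k)) (of_int (snd k))"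
      "Complex (of_int (fst l)) (of_int (snd l))"]
  by (simp add: distrib_left complex_add)

lemma freq_diff_abs: "\<bar>freq k - freq l\<bar> \<le> freq (k - l)"
proof -
  have "freq k \<le> freq (k - l) + freq l" using freq_triangle[of "k - l" l] by simp
  moreover have "freq l \<le> freq (l - k) + freq k" using freq_triangle[of "l - k" k] by simp
  ultimately show ?thesis using freq_minus[of "k - l"] by auto
qed

text \<open>Contracting a rotated gradient at frequency \<open>l\<close> with a gradient at
  frequency \<open>m\<close> has the symbol \<open>- 4 * pi^2 * cross l m\<close>.\<close>

definition cross :: "int \<times> int \<Rightarrow> int \<times> int \<Rightarrow> real" where
  "cross k l = of_int (fst k * snd l - snd k * fst l)"

lemma cross_le: "4 * pi\<^sup>2 * \<bar>cross k l\<bar> \<le> freq k * freq l"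
proof -
  let ?z = "Complex (of_int (fst k)) (of_int (snd k))" and ?w = "Complex (of_int (fst l)) (of_int (snd l))"
  have "\<bar>cross k l\<bar> = \<bar>Im (cnj ?z * ?w)\<bar>" by (simp add: cross_def)
  also have "\<dots> \<le> cmod ?z * cmod ?w" 
    by (metis abs_Im_le_cmod norm_mult complex_mod_cnj)
  finally have "4 * pi\<^sup>2 * \<bar>cross k l\<bar> \<le> 4 * pi\<^sup>2 * (cmod ?z * cmod ?w)"
    by (intro mult_left_mono) auto
  then show ?thesis by (simp add: freq_cmod power2_eq_square algebra_simps)
qed

lemma cross_diff: "cross k (k - l) = - cross k l" "cross k l = cross (k - l) l"
  by (simp_all add: cross_def algebra_simps)

section \<open>Exhaustion of the frequency lattice by finite boxes\<close>

definition fbox :: "nat \<Rightarrow> (int \<times> int) set" where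
  "fbox n = {- int n..int n} \<times> {- int n..int n}"

lemma finite_box [simp]: "finite (fbox n)"
  by (simp add: fbox_def)

lemma box_mono: "m \<le> n \<Longrightarrow> fbox m \<subseteq> fbox n"
  by (auto simp: fbox_def)

text \<open>Because the boxes are symmetric, cutting a family off outside one of them keeps it
  Hermitian, hence real.\<close>

lemma box_minus: "- k \<in> fbox n \<longleftrightarrow> k \<in> fbox n"
  by (cases k) (auto simp: fbox_def)

lemma freq_not_box: "k \<notin> fbox n \<Longrightarrow> real n \<le> freq k"
  using freq_ge_abs[of k] by (cases k) (auto simp: fbox_def)

lemma ex_box: "\<exists>n. k \<in> fbox n"
  by (rule exI[of _ "nat (max \<bar>fst k\<bar> \<bar>snd k\<bar>)"]) (cases k, auto simp: fbox_def)

lemma finite_subset_box: "finite F \<Longrightarrow> \<exists>n. F \<subseteq> fbox n"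
proof (induction rule: finite_induct)
  case (insert x F)
  then obtain n m where "F \<subseteq> fbox n" "x \<in> fbox m" using ex_box by blast
  then show ?case using box_mono[of n "max n m"] box_mono[of m "max n m"]
    by (intro exI[of _ "max n m"]) auto
qed simp

text \<open>Unordered sums over the lattice thereby become limits of sequences, the form in which
  the convergence theorems for integrals apply.\<close>

lemma filterlim_box: "filterlim fbox (finite_subsets_at_top UNIV) sequentially"
  unfolding filterlim_finite_subsets_at_top
proof safe
  fix X :: "(int \<times> int) set" assume "finite X" 
  then obtain n where "X \<subseteq> fbox n" using finite_subset_box by blast
  then show "\<forall>\<^sub>F n in sequentially. finite (fbox n) \<and> X \<subseteq> fbox n \<and> fbox n \<subseteq> UNIV"
    using box_mono by (intro eventually_sequentiallyI[of n]) (auto dest: box_mono)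
qed

lemma box_sum_tendsto:
  fixes f :: "int \<times> int \<Rightarrow> 'a :: {topological_comm_monoid_add, t2_space}"
  assumes "f summable_on UNIV"
  shows "(\<lambda>n. sum f (fbox n)) \<longlonglongrightarrow> (\<Sum>\<^sub>\<infinity>k. f k)"
  using filterlim_compose[OF infsum_tendsto[OF assms] filterlim_box] .

lemma box_sum_le_infsum:
  fixes f :: "int \<times> int \<Rightarrow> real"
  assumes "f summable_on UNIV" "\<And>k. 0 \<le> f k"
  shows "sum f (fbox n) \<le> (\<Sum>\<^sub>\<infinity>k. f k)"
  using assms by (intro finite_sum_le_infsum) auto

text \<open>Used as a Fatou lemma: a uniform bound on box sums survives coefficientwise limits and
  then yields membership in a Sobolev space.\<close>

lemma summable_on_boxI:
  fixes f :: "int \<times> int \<Rightarrow> real"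
  assumes "\<And>k. 0 \<le> f k" "\<And>n. sum f (fbox n) \<le> B"
  shows "f summable_on UNIV" "(\<Sum>\<^sub>\<infinity>k. f k) \<le> B"
proof -
  show *: "f summable_on UNIV"
  proof (rule nonneg_bdd_above_summable_on)
    show "bdd_above (sum f ` {F. F \<subseteq> UNIV \<and> finite F})"
    proof (rule bdd_aboveI2)
      fix F :: "(int \<times> int) set" assume "F \<in> {F. F \<subseteq> UNIV \<and> finite F}"
      then obtain n where "F \<subseteq> fbox n" using finite_subset_box by auto
      then have "sum f F \<le> sum f (fbox n)" by (intro sum_mono2) (auto simp: assms)
      then show "sum f F \<le> B" using assms(2)[of n] by linarith
    qed
  qed (use assms in auto)
  show "(\<Sum>\<^sub>\<infinity>k. f k) \<le> B"
    by (rule LIMSEQ_le_const2[OF box_sum_tendsto[OF *]]) (use assms in auto)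
qed

section \<open>Cauchy-Schwarz and Minkowski inequalities for unordered sums\<close>

lemma infsum_Cauchy_Schwarz:
  fixes f g :: "'a \<Rightarrow> real"
  assumes "(\<lambda>x. (f x)\<^sup>2) summable_on A" "(\<lambda>x. (g x)\<^sup>2) summable_on A"
  shows "(\<lambda>x. \<bar>f x * g x\<bar>) summable_on A"
    "(\<Sum>\<^sub>\<infinity>x\<in>A. \<bar>f x * g x\<bar>) \<le> sqrt (\<Sum>\<^sub>\<infinity>x\<in>A. (f x)\<^sup>2) * sqrt (\<Sum>\<^sub>\<infinity>x\<in>A. (g x)\<^sup>2)"
proof -
  have *: "(\<Sum>x\<in>F. \<bar>f x * g x\<bar>) \<le> sqrt (\<Sum>\<^sub>\<infinity>x\<in>A. (f x)\<^sup>2) * sqrt (\<Sum>\<^sub>\<infinity>x\<in>A. (g x)\<^sup>2)"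
    if "finite F" "F \<subseteq> A" for F
  proof -
    have "(\<Sum>x\<in>F. \<bar>f x * g x\<bar>) \<le> L2_set f F * L2_set g F"
      using L2_set_mult_ineq[of f g F] by (simp add: abs_mult)
    also have "\<dots> \<le> sqrt (\<Sum>\<^sub>\<infinity>x\<in>A. (f x)\<^sup>2) * sqrt (\<Sum>\<^sub>\<infinity>x\<in>A. (g x)\<^sup>2)"
      unfolding L2_set_def using that assms
      by (intro mult_mono real_sqrt_le_mono finite_sum_le_infsum) (auto intro!: sum_nonneg infsum_nonneg)
    finally show ?thesis .
  qed
  show **: "(\<lambda>x. \<bar>f x * g x\<bar>) summable_on A"
    by (rule nonneg_bdd_above_summable_on) (use * in \<open>auto intro!: bdd_aboveI2\<close>)
  show "(\<Sum>\<^sub>\<infinity>x\<in>A. \<bar>f x * g x\<bar>) \<le> sqrt (\<Sum>\<^sub>\<infinity>x\<in>A. (f x)\<^sup>2) * sqrt (\<Sum>\<^sub>\<infinity>x\<in>A. (g x)\<^sup>2)"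
    by (rule infsum_le_finite_sums[OF **]) (use * in auto)
qed

lemma infsum_Minkowski:
  fixes f g :: "'a \<Rightarrow> real"
  assumes "(\<lambda>x. (f x)\<^sup>2) summable_on A" "(\<lambda>x. (g x)\<^sup>2) summable_on A"
  shows "(\<lambda>x. (f x + g x)\<^sup>2) summable_on A"
    "sqrt (\<Sum>\<^sub>\<infinity>x\<in>A. (f x + g x)\<^sup>2) \<le> sqrt (\<Sum>\<^sub>\<infinity>x\<in>A. (f x)\<^sup>2) + sqrt (\<Sum>\<^sub>\<infinity>x\<in>A. (g x)\<^sup>2)"
proof -
  let ?S = "sqrt (\<Sum>\<^sub>\<infinity>x\<in>A. (f x)\<^sup>2) + sqrt (\<Sum>\<^sub>\<infinity>x\<in>A. (g x)\<^sup>2)"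
  have S: "0 \<le> ?S" by (auto intro!: add_nonneg_nonneg infsum_nonneg)
  have *: "(\<Sum>x\<in>F. (f x + g x)\<^sup>2) \<le> ?S\<^sup>2" if "finite F" "F \<subseteq> A" for F
  proof -
    have "L2_set (\<lambda>x. f x + g x) F \<le> L2_set f F + L2_set g F"
      by (rule L2_set_triangle_ineq)
    also have "\<dots> \<le> ?S"
      unfolding L2_set_def using that assms
      by (intro add_mono real_sqrt_le_mono finite_sum_le_infsum) auto
    finally have "(L2_set (\<lambda>x. f x + g x) F)\<^sup>2 \<le> ?S\<^sup>2"
      by (intro power_mono) (auto simp: L2_set_def intro!: sum_nonneg)
    then show ?thesis by (simp add: L2_set_def sum_nonneg)
  qed
  show **: "(\<lambda>x. (f x + g x)\<^sup>2) summable_on A"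
    by (rule nonneg_bdd_above_summable_on) (use * in \<open>auto intro!: bdd_aboveI2\<close>)
  have "(\<Sum>\<^sub>\<infinity>x\<in>A. (f x + g x)\<^sup>2) \<le> ?S\<^sup>2"
    by (rule infsum_le_finite_sums[OF **]) (use * in auto)
  then show "sqrt (\<Sum>\<^sub>\<infinity>x\<in>A. (f x + g x)\<^sup>2) \<le> ?S" using S real_le_lsqrt by blast
qed

section \<open>Sobolev spaces as weighted square-summable families\<close>

lemma freq_powr_mono: "k \<noteq> 0 \<Longrightarrow> r \<le> q \<Longrightarrow> freq k powr r \<le> freq k powr q"
  using freq_ge_1[of k] by (intro powr_mono) auto

lemma freq_powr_mono': "r \<le> q \<Longrightarrow> freq k powr r \<le> freq k powr q"
  using freq_powr_mono[of k r q] by (cases "k = 0") auto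

lemma freq_weight_sq: "freq k powr (2 * r) * x\<^sup>2 = (freq k powr r * x)\<^sup>2"
  by (simp only: power_mult_distrib mult_2 powr_add power2_eq_square mult.assoc mult.left_commute)

text \<open>Since \<open>0 powr r = 0\<close> for every \<open>r\<close>, the weight vanishes at
  frequency zero, and the sum may run over all frequencies whatever the value of
  \<open>f 0\<close>.\<close>

lemma hs_norm_eq: "hs_norm r f = sqrt (\<Sum>\<^sub>\<infinity>k. (freq k powr r * cmod (f k))\<^sup>2)"
  unfolding hs_norm_def freq_weight_sq
  by (intro arg_cong[of _ _ sqrt] infsum_cong_neutral) auto

lemma hs_norm_nonneg [simp]: "0 \<le> hs_norm r f"
  by (auto simp: hs_norm_eq intro!: infsum_nonneg)

lemma hs_norm_sq: "(hs_norm r f)\<^sup>2 = (\<Sum>\<^sub>\<infinity>k. (freq k powr r * cmod (f k))\<^sup>2)"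
  by (auto simp: hs_norm_eq intro!: infsum_nonneg)

lemma Hs_summable_iff:
  "(\<lambda>k. freq k powr (2 * r) * (cmod (f k))\<^sup>2) summable_on (- {0}) \<longleftrightarrow>
   (\<lambda>k. (freq k powr r * cmod (f k))\<^sup>2) summable_on UNIV"
  unfolding freq_weight_sq by (intro summable_on_cong_neutral) auto

lemma HsD:
  assumes "f \<in> Hs r"
  shows "f (- k) = cnj (f k)" "f 0 = 0" "(\<lambda>k. (freq k powr r * cmod (f k))\<^sup>2) summable_on UNIV"
proof -
  have *: "(\<forall>k. f (- k) = cnj (f k)) \<and> f 0 = 0 \<and>
      (\<lambda>k. (freq k powr r * cmod (f k))\<^sup>2) summable_on UNIV"
    using assms unfolding Hs_def torus_distr_def Hs_summable_iff mem_Collect_eq by argo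
  show "f (- k) = cnj (f k)" "f 0 = 0" "(\<lambda>k. (freq k powr r * cmod (f k))\<^sup>2) summable_on UNIV"
    using * by blast+
qed

text \<open>The growth condition in \<open>torus_distr\<close> comes for free: square summability
  bounds each weighted coefficient by the norm, so a coefficient grows at most like
  \<open>freq k powr (- r)\<close>.\<close>

lemma HsI:
  assumes "\<And>k. f (- k) = cnj (f k)" "f 0 = 0" "(\<lambda>k. (freq k powr r * cmod (f k))\<^sup>2) summable_on UNIV"
  shows "f \<in> Hs r"
proof -
  define N where "N = nat \<lceil>\<bar>r\<bar>\<rceil>"
  have "cmod (f k) \<le> hs_norm r f * (1 + freq k) ^ N" for k
  proof (cases "k = 0")
    case True then show ?thesis using assms by simp
  next
    case False
    have "(freq k powr r * cmod (f k))\<^sup>2 \<le> (hs_norm r f)\<^sup>2"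
      unfolding hs_norm_sq
      using finite_sum_le_infsum[OF assms(3), of "{k}"] by simp
    then have 1: "freq k powr r * cmod (f k) \<le> hs_norm r f"
      using hs_norm_nonneg power2_le_imp_le by blast
    have "cmod (f k) = freq k powr (- r) * (freq k powr r * cmod (f k))"
      using False by (simp add: powr_minus)
    also have "\<dots> \<le> freq k powr (- r) * hs_norm r f"
      using 1 by (intro mult_left_mono) auto
    also have "freq k powr (-r) \<le> (1 + freq k) ^ N"
    proof -
      have "freq k powr (-r) \<le> freq k powr (real N)"
        unfolding N_def by (intro freq_powr_mono[OF False]) linarith
      also have "\<dots> = freq k ^ N" using freq_pos[OF False] by (simp add: powr_realpow)
      also have "\<dots> \<le> (1 + freq k) ^ N" by (intro power_mono) auto
      finally show ?thesis .
    qed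
    finally show ?thesis by (simp add: mult.commute mult_right_mono)
  qed
  then have "\<exists>C (N::nat). \<forall>k. cmod (f k) \<le> C * (1 + freq k) ^ N" by blast
  then show ?thesis using assms unfolding Hs_def torus_distr_def Hs_summable_iff mem_Collect_eq by argo
qed

lemma Hs_coord_le: "f \<in> Hs r \<Longrightarrow> freq k powr r * cmod (f k) \<le> hs_norm r f"
proof -
  assume f: "f \<in> Hs r"
  have "(freq k powr r * cmod (f k))\<^sup>2 \<le> (hs_norm r f)\<^sup>2"
    unfolding hs_norm_sq using finite_sum_le_infsum[OF HsD(3)[OF f], of "{k}"] by simp
  then show ?thesis using hs_norm_nonneg power2_le_imp_le by blast
qed

lemma Hs_cmod_le: "f \<in> Hs r \<Longrightarrow> cmod (f k) \<le> freq k powr (-r) * hs_norm r f"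
  using Hs_coord_le[of f r k] freq_pos[of k]
  by (cases "k = 0") (auto simp: powr_minus field_simps HsD(2))

text \<open>The constant is 1 because every nonzero frequency is at least 1.\<close>

lemma Hs_mono:
  assumes "f \<in> Hs q" "r \<le> q" shows "f \<in> Hs r" "hs_norm r f \<le> hs_norm q f"
proof -
  have *: "(freq k powr r * cmod (f k))\<^sup>2 \<le> (freq k powr q * cmod (f k))\<^sup>2" for k
    using freq_powr_mono'[OF assms(2), of k] by (intro power_mono mult_right_mono) auto
  show "f \<in> Hs r"
    using HsD[OF assms(1)] by (intro HsI summable_on_comparison_test[OF HsD(3)[OF assms(1)]]) (auto simp: *)
  then show "hs_norm r f \<le> hs_norm q f"
    unfolding hs_norm_eq using assms * by (intro real_sqrt_le_mono infsum_mono HsD(3))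
qed

lemma Hs_zero [simp]: "(\<lambda>k. 0) \<in> Hs r" "hs_norm r (\<lambda>k. 0) = 0"
  by (auto intro!: HsI simp: hs_norm_eq)

lemma Hs_add:
  assumes "f \<in> Hs r" "g \<in> Hs r"
  shows "(\<lambda>k. f k + g k) \<in> Hs r" "hs_norm r (\<lambda>k. f k + g k) \<le> hs_norm r f + hs_norm r g"
proof -
  let ?F = "\<lambda>k. freq k powr r * cmod (f k)" and ?G = "\<lambda>k. freq k powr r * cmod (g k)"
  have le: "(freq k powr r * cmod (f k + g k))\<^sup>2 \<le> (?F k + ?G k)\<^sup>2" for k
    using norm_triangle_ineq[of "f k" "g k"]
    by (intro power_mono) (auto simp flip: distrib_left intro!: mult_left_mono)
  note M = infsum_Minkowski[OF HsD(3)[OF assms(1)] HsD(3)[OF assms(2)]]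
  show H: "(\<lambda>k. f k + g k) \<in> Hs r"
    using assms by (intro HsI summable_on_comparison_test[OF M(1)]) (auto simp: HsD le[simplified])
  have "hs_norm r (\<lambda>k. f k + g k) \<le> sqrt (\<Sum>\<^sub>\<infinity>k. (?F k + ?G k)\<^sup>2)"
    unfolding hs_norm_eq by (intro real_sqrt_le_mono infsum_mono HsD(3)[OF H] M(1) le)
  also have "\<dots> \<le> hs_norm r f + hs_norm r g" unfolding hs_norm_eq by (rule M(2))
  finally show "hs_norm r (\<lambda>k. f k + g k) \<le> hs_norm r f + hs_norm r g" .
qed

lemma hs_norm_scale: "hs_norm r (\<lambda>k. of_real c * f k) = \<bar>c\<bar> * hs_norm r f"
proof -
  have "(hs_norm r (\<lambda>k. of_real c * f k))\<^sup>2 = (\<bar>c\<bar> * hs_norm r f)\<^sup>2"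
    unfolding power_mult_distrib hs_norm_sq
    by (subst infsum_cmult_right'[symmetric]) (simp add: norm_mult power_mult_distrib mult.left_commute)
  then show ?thesis by (simp add: power2_eq_iff_nonneg)
qed

lemma Hs_scale: "f \<in> Hs r \<Longrightarrow> (\<lambda>k. of_real c * f k) \<in> Hs r"
proof -
  assume f: "f \<in> Hs r"
  have "(\<lambda>k. c\<^sup>2 * (freq k powr r * cmod (f k))\<^sup>2) summable_on UNIV"
    by (intro summable_on_cmult_right HsD(3)[OF f])
  moreover have "(freq k powr r * cmod (of_real c * f k))\<^sup>2 = c\<^sup>2 * (freq k powr r * cmod (f k))\<^sup>2" for k
    by (simp add: norm_mult power_mult_distrib)
  ultimately show ?thesis by (intro HsI) (simp_all add: HsD(1,2)[OF f])
qed

lemma hs_norm_minus [simp]: "hs_norm r (- f) = hs_norm r f"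
  by (simp add: hs_norm_eq)

lemma Hs_minus: "f \<in> Hs r \<Longrightarrow> - f \<in> Hs r"
proof -
  assume "f \<in> Hs r"
  moreover have "- f = (\<lambda>k. of_real (-1) * f k)" by (rule ext) simp
  ultimately show ?thesis using Hs_scale[of f r "-1"] by (simp only:)
qed

lemma Hs_diff:
  assumes "f \<in> Hs r" "g \<in> Hs r"
  shows "f - g \<in> Hs r" "hs_norm r (f - g) \<le> hs_norm r f + hs_norm r g"
proof -
  have "f - g = (\<lambda>k. f k + (- g) k)" by (rule ext) simp
  then show "f - g \<in> Hs r" "hs_norm r (f - g) \<le> hs_norm r f + hs_norm r g"
    using Hs_add[OF assms(1) Hs_minus[OF assms(2)]] by (simp_all only: hs_norm_minus)
qed

lemma hs_norm_diff_commute: "hs_norm r (f - g) = hs_norm r (g - f)"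
  by (simp add: hs_norm_eq norm_minus_commute)

lemma hs_norm_abs_diff:
  assumes "f \<in> Hs r" "g \<in> Hs r"
  shows "\<bar>hs_norm r f - hs_norm r g\<bar> \<le> hs_norm r (f - g)"
  using Hs_add(2)[OF Hs_diff(1)[OF assms] assms(2)] Hs_add(2)[OF Hs_diff(1)[OF assms(2,1)] assms(1)]
    hs_norm_diff_commute[of r f g] by simp

section \<open>Fourier multipliers and the duality pairing\<close>

lemma Lam_weight: "freq k powr (r - \<sigma>) * cmod (Lam \<sigma> f k) = freq k powr r * cmod (f k)"
  by (cases "k = 0") (auto simp: Lam_def norm_mult powr_diff freq_pos)

lemma Lam_Hs: "f \<in> Hs r \<Longrightarrow> Lam \<sigma> f \<in> Hs (r - \<sigma>)"
proof (rule HsI)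
  fix k assume f: "f \<in> Hs r"
  show "Lam \<sigma> f (- k) = cnj (Lam \<sigma> f k)"
    using HsD(1)[OF f, of k] by (simp add: Lam_def)
qed (simp add: Lam_def, simp only: Lam_weight HsD(3))

lemma hs_norm_Lam: "hs_norm (r - \<sigma>) (Lam \<sigma> f) = hs_norm r f"
  by (simp add: hs_norm_eq Lam_weight)

lemma pair_bound:
  assumes "f \<in> Hs r" "g \<in> Hs (- r)"
  shows "(\<lambda>k. cmod (f k * cnj (g k))) summable_on UNIV"
    "(\<Sum>\<^sub>\<infinity>k. cmod (f k * cnj (g k))) \<le> hs_norm r f * hs_norm (- r) g"
    "\<bar>pair f g\<bar> \<le> hs_norm r f * hs_norm (- r) g"
    "pair f g = (\<Sum>\<^sub>\<infinity>k. Re (f k * cnj (g k)))"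
proof -
  \<comment> \<open>The two weights cancel away from zero; at frequency zero the left-hand side
    vanishes because \<open>f\<close> has mean zero.\<close>
  have eq: "cmod (f k * cnj (g k)) = \<bar>(freq k powr r * cmod (f k)) * (freq k powr (-r) * cmod (g k))\<bar>" for k
    using HsD(2)[OF assms(1)] freq_pos[of k]
    by (cases "k = 0") (auto simp: norm_mult powr_minus)
  note CS = infsum_Cauchy_Schwarz[OF HsD(3)[OF assms(1)] HsD(3)[OF assms(2)]]
  show 1: "(\<lambda>k. cmod (f k * cnj (g k))) summable_on UNIV"
    unfolding eq by (rule CS)
  show 2: "(\<Sum>\<^sub>\<infinity>k. cmod (f k * cnj (g k))) \<le> hs_norm r f * hs_norm (- r) g"
    unfolding eq hs_norm_eq by (rule CS)
  have "\<bar>pair f g\<bar> \<le> cmod (\<Sum>\<^sub>\<infinity>k. f k * cnj (g k))"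
    unfolding pair_def by (rule abs_Re_le_cmod)
  also have "\<dots> \<le> (\<Sum>\<^sub>\<infinity>k. cmod (f k * cnj (g k)))"
    by (rule norm_infsum_bound) (rule 1)
  finally show "\<bar>pair f g\<bar> \<le> hs_norm r f * hs_norm (- r) g" using 2 by linarith
  show "pair f g = (\<Sum>\<^sub>\<infinity>k. Re (f k * cnj (g k)))"
    unfolding pair_def by (rule infsum_Re[symmetric]) (rule abs_summable_summable[OF 1])
qed

lemma pair_summable: "f \<in> Hs r \<Longrightarrow> g \<in> Hs (- r) \<Longrightarrow> (\<lambda>k. f k * cnj (g k)) summable_on UNIV"
  by (rule abs_summable_summable) (rule pair_bound)

lemma infsum_diff':
  fixes f g :: "'a \<Rightarrow> 'b :: {topological_ab_group_add, t2_space}"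
  assumes "f summable_on A" "g summable_on A"
  shows "(\<Sum>\<^sub>\<infinity>x\<in>A. f x - g x) = infsum f A - infsum g A"
  using infsum_add[OF assms(1), of "\<lambda>x. - g x"] assms(2)
  by (simp add: infsum_uminus summable_on_uminus)

lemma pair_diff_left:
  assumes "f \<in> Hs r" "f' \<in> Hs r" "g \<in> Hs (- r)"
  shows "pair (f - f') g = pair f g - pair f' g"
  unfolding pair_def
  using infsum_diff'[OF pair_summable[OF assms(1,3)] pair_summable[OF assms(2,3)]]
  by (simp add: left_diff_distrib)

lemma pair_diff_right:
  assumes "f \<in> Hs r" "g \<in> Hs (- r)" "g' \<in> Hs (- r)"
  shows "pair f (g - g') = pair f g - pair f g'"
  unfolding pair_def
  using infsum_diff'[OF pair_summable[OF assms(1,2)] pair_summable[OF assms(1,3)]]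
  by (simp add: right_diff_distrib)

lemma pair_minus_left: "pair (- f) g = - pair f g"
  unfolding pair_def by (simp add: infsum_uminus)

lemma pair_commute: "pair f g = pair g f"
proof -
  have "(\<Sum>\<^sub>\<infinity>k. f k * cnj (g k)) = cnj (\<Sum>\<^sub>\<infinity>k. g k * cnj (f k))"
    unfolding infsum_cnj[symmetric] by (simp add: mult.commute)
  then show ?thesis by (simp add: pair_def)
qed

lemma pair_Lam: "pair (Lam \<sigma> f) g = pair f (Lam \<sigma> g)"
  unfolding pair_def Lam_def
  by (intro arg_cong[of _ _ Re] infsum_cong) auto

lemma pair_Lam_self: 
  assumes "f \<in> Hs r"
  shows "pair f (Lam (2 * r) f) = (hs_norm r f)\<^sup>2"
proof -
  have "f k * cnj (Lam (2 * r) f k) = of_real ((freq k powr r * cmod (f k))\<^sup>2)" for k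
  proof -
    have "f k * cnj (Lam (2 * r) f k) = of_real (freq k powr (2 * r)) * (f k * cnj (f k))"
      by (cases "k = 0") (simp_all add: Lam_def)
    also have "\<dots> = of_real (freq k powr (2 * r) * (cmod (f k))\<^sup>2)"
      using complex_norm_square[of "f k"] by simp
    finally show ?thesis by (simp only: freq_weight_sq)
  qed
  then have "(\<Sum>\<^sub>\<infinity>k. f k * cnj (Lam (2 * r) f k)) = of_real ((hs_norm r f)\<^sup>2)"
    unfolding hs_norm_sq by (simp only: infsumI[OF has_sum_of_real[OF has_sum_infsum[OF HsD(3)[OF assms]]]])
  then show ?thesis unfolding pair_def by (metis Re_complex_of_real)
qed

lemma pair_self: "f \<in> Hs 0 \<Longrightarrow> pair f f = (hs_norm 0 f)\<^sup>2"
proof -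
  assume f: "f \<in> Hs 0"
  then have "Lam (2 * 0) f = f" by (auto simp: Lam_def HsD(2))
  then show ?thesis using pair_Lam_self[OF f] by simp
qed

section \<open>The advection term\<close>

lemma norm_summable_comparison:
  fixes f :: "'a \<Rightarrow> 'b :: banach"
  assumes "g summable_on A" "\<And>x. x \<in> A \<Longrightarrow> norm (f x) \<le> g x"
  shows "(\<lambda>x. norm (f x)) summable_on A" "f summable_on A" "norm (infsum f A) \<le> infsum g A"
proof -
  show 1: "(\<lambda>x. norm (f x)) summable_on A"
    by (rule summable_on_comparison_test[OF assms(1)]) (use assms(2) in auto)
  show 2: "f summable_on A" by (rule abs_summable_summable[OF 1])
  show "norm (infsum f A) \<le> infsum g A"
    by (rule norm_infsum_le[OF has_sum_infsum[OF 2] has_sum_infsum[OF assms(1)] assms(2)])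
qed

text \<open>Minus one half is the order at which the symmetrised symbol below is absorbed by the
  weights of its two arguments.\<close>

definition s_crit :: real where
  "s_crit = - (1 / 2)"

text \<open>For \<open>R^\<bottom>\<theta> \<cdot> \<nabla>\<theta>\<close> the raw symbol is
  \<open>4 * pi^2 * cross k l / freq l\<close>, where \<open>l\<close> is the frequency of the
  velocity. This is its average under the exchange of \<open>l\<close> and
  \<open>k - l\<close>.\<close>

definition sym :: "int \<times> int \<Rightarrow> int \<times> int \<Rightarrow> real" where
  "sym k l = 2 * pi\<^sup>2 * cross k l * (1 / freq l - 1 / freq (k - l))"

lemma sym_minus: "sym (- k) (- l) = sym k l"
proof -
  have "freq (- k - - l) = freq (k - l)" using freq_minus[of "k - l"] by simp
  then show ?thesis by (simp add: sym_def cross_def)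
qed

text \<open>The determinant has the two bounds \<open>freq k * freq l\<close> and
  \<open>freq k * freq (k - l)\<close>; their geometric mean meets the difference of reciprocals,
  whose numerator is at most \<open>freq k\<close>. What remains is the square of
  \<open>freq k\<close> times the inverse square roots of the other two frequencies.\<close>

lemma sym_le: "\<bar>sym k l\<bar> \<le> (freq k)\<^sup>2 / 2 * (freq l powr s_crit * freq (k - l) powr s_crit)"
proof (cases "l = 0 \<or> k = l")
  case True
  then have "cross k l = 0" by (auto simp: cross_def)
  then show ?thesis by (simp add: sym_def)
next
  case False
  define a b c X where "a = freq l" and "b = freq (k - l)" and "c = freq k"
    and "X = 4 * pi\<^sup>2 * \<bar>cross k l\<bar>"
  have ab: "0 < a" "0 < b" "0 \<le> c" "0 \<le> X"
    using False unfolding a_def b_def c_def X_def by (auto intro!: freq_pos)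
  have X1: "X \<le> c * a" unfolding X_def a_def c_def by (rule cross_le)
  have X2: "X \<le> c * b" unfolding X_def b_def c_def using cross_le[of k "k - l"] by (simp add: cross_diff(1))
  have "X\<^sup>2 \<le> (c * a) * (c * b)" unfolding power2_eq_square using X1 X2 ab by (intro mult_mono) auto
  also have "\<dots> = (c * sqrt (a * b))\<^sup>2" using ab by (simp add: power_mult_distrib power2_eq_square)
  finally have X: "X \<le> c * sqrt (a * b)" by (rule power2_le_imp_le) (use ab in simp)
  have d: "\<bar>b - a\<bar> \<le> c"
    using freq_diff_abs[of "k - l" "- l"] unfolding a_def b_def c_def by simp
  have "\<bar>sym k l\<bar> = X / 2 * (\<bar>b - a\<bar> / (a * b))"
  proof -
    have "1 / a - 1 / b = (b - a) / (a * b)" using ab by (simp add: field_simps)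
    then have "\<bar>1 / a - 1 / b\<bar> = \<bar>b - a\<bar> / (a * b)" using ab by (simp add: abs_divide)
    then show ?thesis unfolding sym_def X_def a_def[symmetric] b_def[symmetric] by (simp add: abs_mult)
  qed
  also have "\<dots> \<le> c * sqrt (a * b) / 2 * (c / (a * b))"
    using ab X d by (intro mult_mono divide_right_mono) auto
  also have "\<dots> = c\<^sup>2 / 2 * (1 / sqrt (a * b))"
  proof -
    have "a * b = sqrt (a * b) * sqrt (a * b)" "0 < sqrt (a * b)" using ab by simp_all
    then show ?thesis by (simp add: power2_eq_square divide_simps) 
  qed
  also have "1 / sqrt (a * b) = a powr s_crit * b powr s_crit"
    using ab by (simp add: s_crit_def powr_minus powr_half_sqrt real_sqrt_mult field_simps)
  finally show ?thesis unfolding a_def b_def c_def .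
qed

lemma bij_diff: "bij (\<lambda>l. k - l :: int \<times> int)"
  by (rule bij_betw_byWitness[of _ "\<lambda>l. k - l"]) auto

text \<open>Polarisation of the quadratic term, so that differences of it can be estimated.\<close>

definition advect2 :: "fourier \<Rightarrow> fourier \<Rightarrow> fourier" where
  "advect2 f g k = (\<Sum>\<^sub>\<infinity>l. of_real (sym k l) * f l * g (k - l))"

text \<open>\<open>advect \<theta>\<close> is the family of Fourier coefficients of \<open>R^\<bottom>\<theta> \<cdot> \<nabla>\<theta>\<close>. Symmetrising the
  symbol in the two factors gains the half derivative which makes sense of it in \<open>H^{-1/2}\<close>.\<close>

definition advect :: "fourier \<Rightarrow> fourier" where
  "advect f = advect2 f f"

text \<open>After \<open>sym_le\<close> this is Cauchy-Schwarz in \<open>l\<close>: reflecting and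
  translating the second factor leaves its square sum unchanged.\<close>

lemma advect2_bound:
  assumes f: "f \<in> Hs s_crit" and g: "g \<in> Hs s_crit"
  shows "(\<lambda>l. cmod (of_real (sym k l) * f l * g (k - l))) summable_on UNIV"
    "(\<lambda>l. of_real (sym k l) * f l * g (k - l)) summable_on UNIV"
    "cmod (advect2 f g k) \<le> (freq k)\<^sup>2 / 2 * (hs_norm s_crit f * hs_norm s_crit g)"
proof -
  let ?F = "\<lambda>l. freq l powr s_crit * cmod (f l)" and ?G = "\<lambda>l. freq l powr s_crit * cmod (g l)"
  have G: "(\<lambda>l. (?G (k - l))\<^sup>2) summable_on UNIV" "(\<Sum>\<^sub>\<infinity>l. (?G (k - l))\<^sup>2) = (\<Sum>\<^sub>\<infinity>l. (?G l)\<^sup>2)"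
    using summable_on_reindex_bij_betw[OF bij_diff, of "\<lambda>l. (?G l)\<^sup>2"]
      infsum_reindex_bij_betw[OF bij_diff, of "\<lambda>l. (?G l)\<^sup>2"] HsD(3)[OF g] by auto
  note CS = infsum_Cauchy_Schwarz[OF HsD(3)[OF f] G(1)]
  let ?H = "\<lambda>l. (freq k)\<^sup>2 / 2 * \<bar>?F l * ?G (k - l)\<bar>"
  have H: "?H summable_on UNIV" by (intro summable_on_cmult_right CS)
  have le: "cmod (of_real (sym k l) * f l * g (k - l)) \<le> ?H l" for l
  proof -
    have "cmod (of_real (sym k l) * f l * g (k - l)) = \<bar>sym k l\<bar> * (cmod (f l) * cmod (g (k - l)))"
      by (simp add: norm_mult)
    also have "\<dots> \<le> (freq k)\<^sup>2 / 2 * (freq l powr s_crit * freq (k - l) powr s_crit) * (cmod (f l) * cmod (g (k - l)))"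
      by (intro mult_right_mono sym_le) auto
    also have "\<dots> = ?H l" by (simp add: abs_mult)
    finally show ?thesis .
  qed
  show "(\<lambda>l. cmod (of_real (sym k l) * f l * g (k - l))) summable_on UNIV"
    "(\<lambda>l. of_real (sym k l) * f l * g (k - l)) summable_on UNIV"
    using norm_summable_comparison[OF H le] by auto
  have "cmod (advect2 f g k) \<le> infsum ?H UNIV"
    unfolding advect2_def by (rule norm_summable_comparison(3)[OF H le])
  also have "\<dots> = (freq k)\<^sup>2 / 2 * (\<Sum>\<^sub>\<infinity>l. \<bar>?F l * ?G (k - l)\<bar>)"
    by (rule infsum_cmult_right) (rule CS)
  also have "\<dots> \<le> (freq k)\<^sup>2 / 2 * (hs_norm s_crit f * hs_norm s_crit g)"
    unfolding hs_norm_eq using CS(2) unfolding G(2) by (intro mult_left_mono) auto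
  finally show "cmod (advect2 f g k) \<le> (freq k)\<^sup>2 / 2 * (hs_norm s_crit f * hs_norm s_crit g)" .
qed

lemma advect_bound:
  assumes "f \<in> Hs s_crit"
  shows "cmod (advect f k) \<le> (freq k)\<^sup>2 / 2 * (hs_norm s_crit f)\<^sup>2"
  unfolding advect_def using advect2_bound(3)[OF assms assms] by (simp add: power2_eq_square)

text \<open>Bilinearity: \<open>B(f,f) - B(g,g) = B(f-g,f) + B(g,f-g)\<close>.\<close>

lemma advect_diff_bound:
  assumes f: "f \<in> Hs s_crit" and g: "g \<in> Hs s_crit"
  shows "cmod (advect f k - advect g k) \<le>
    (freq k)\<^sup>2 / 2 * ((hs_norm s_crit f + hs_norm s_crit g) * hs_norm s_crit (f - g))"
proof -
  note fg = Hs_diff(1)[OF f g]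
  have 1: "advect2 f f k = advect2 (f - g) f k + advect2 g f k"
    unfolding advect2_def infsum_add[OF advect2_bound(2)[OF fg f] advect2_bound(2)[OF g f], symmetric]
    by (simp add: algebra_simps)
  have 2: "advect2 g f k = advect2 g (f - g) k + advect2 g g k"
    unfolding advect2_def infsum_add[OF advect2_bound(2)[OF g fg] advect2_bound(2)[OF g g], symmetric]
    by (simp add: algebra_simps)
  have "cmod (advect f k - advect g k) = cmod (advect2 (f - g) f k + advect2 g (f - g) k)"
    using 1 2 by (simp add: advect_def)
  also have "\<dots> \<le> (freq k)\<^sup>2 / 2 * (hs_norm s_crit (f - g) * hs_norm s_crit f) +
      (freq k)\<^sup>2 / 2 * (hs_norm s_crit g * hs_norm s_crit (f - g))"
    by (intro order_trans[OF norm_triangle_ineq] add_mono advect2_bound fg f g)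
  finally show ?thesis by (simp add: algebra_simps)
qed

lemma advect2_hermitian:
  assumes "\<And>k. f (- k) = cnj (f k)" "\<And>k. g (- k) = cnj (g k)"
  shows "advect2 f g (- k) = cnj (advect2 f g k)"
proof -
  have "advect2 f g (- k) = (\<Sum>\<^sub>\<infinity>l. of_real (sym (- k) (- l)) * f (- l) * g (- k - (- l)))"
    unfolding advect2_def
    by (rule infsum_reindex_bij_betw[symmetric, where g=uminus])
       (rule bij_betw_byWitness[of _ uminus], auto)
  also have "\<dots> = (\<Sum>\<^sub>\<infinity>l. cnj (of_real (sym k l) * f l * g (k - l)))"
  proof (rule infsum_cong)
    fix l
    have "g (- k - - l) = cnj (g (k - l))" using assms(2)[of "k - l"] by simp
    then show "of_real (sym (- k) (- l)) * f (- l) * g (- k - (- l)) = cnj (of_real (sym k l) * f l * g (k - l))"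
      by (simp add: sym_minus assms(1))
  qed
  finally show ?thesis unfolding infsum_cnj advect2_def .
qed

lemma advect_hermitian: "(\<And>k. f (- k) = cnj (f k)) \<Longrightarrow> advect f (- k) = cnj (advect f k)"
  unfolding advect_def by (rule advect2_hermitian)

lemma advect_0 [simp]: "advect f 0 = 0"
  by (simp add: advect_def advect2_def sym_def cross_def)

lemma advect_minus: "advect (- f) = advect f"
  by (auto simp: advect_def advect2_def)

section \<open>Absolute convergence of lattice sums and convolutions\<close>

lemma summable_freq_powr4: "(\<lambda>k. (freq k powr (-2))\<^sup>2) summable_on UNIV"
proof -
  have nat: "(\<lambda>n::nat. 1 / (1 + (real n)\<^sup>2)) summable_on UNIV"
  proof (rule norm_summable_imp_summable_on)
    have "summable (\<lambda>n::nat. 1 / (real n)\<^sup>2)"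
      using inverse_power_summable[of 2, where 'a=real] by (simp add: field_simps)
    then show "summable (\<lambda>n::nat. norm (1 / (1 + (real n)\<^sup>2)))"
    proof (rule summable_comparison_test_ev[rotated])
      show "\<forall>\<^sub>F n in sequentially. norm (norm (1 / (1 + (real n)\<^sup>2))) \<le> 1 / (real n)\<^sup>2"
        using eventually_gt_at_top[of 0]
        by eventually_elim (simp add: frac_le)
    qed
  qed
  \<comment> \<open>The lattice sum is dominated by a product of two one-dimensional sums with this
    summand.\<close>
  let ?h = "\<lambda>n::int. 1 / (1 + (real_of_int n)\<^sup>2)"
  have 1: "?h summable_on range int"
    using nat by (subst summable_on_reindex) (auto simp: o_def inj_on_def)
  have 2: "?h summable_on range (\<lambda>n. - int n)"
    using nat by (subst summable_on_reindex) (auto simp: o_def inj_on_def)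
  have "range int \<union> range (\<lambda>n. - int n) = UNIV"
    by (auto simp: image_iff) (metis int_cases2)
  then have h: "?h summable_on UNIV" using summable_on_union[OF 1 2] by simp
  have hh: "(\<lambda>(a, b). ?h a * ?h b) summable_on UNIV \<times> UNIV"
  proof (rule summable_on_SigmaI[where g="\<lambda>a. ?h a * infsum ?h UNIV"])
    show "((\<lambda>y. case (x, y) of (a, b) \<Rightarrow> ?h a * ?h b) has_sum ?h x * infsum ?h UNIV) UNIV" for x
      using has_sum_cmult_right[OF has_sum_infsum[OF h], of "?h x"] by simp
    show "(\<lambda>a. ?h a * infsum ?h UNIV) summable_on UNIV"
      by (intro summable_on_cmult_left h)
  qed auto
  have "(\<lambda>k. 3 * (case k of (a, b) \<Rightarrow> ?h a * ?h b)) summable_on UNIV"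
    using hh by (intro summable_on_cmult_right) simp
  then show ?thesis
  proof (rule summable_on_comparison_test)
    fix k :: "int \<times> int"
    obtain a b where k: "k = (a, b)" by (cases k)
    show "(freq k powr - 2)\<^sup>2 \<le> 3 * (case k of (a, b) \<Rightarrow> ?h a * ?h b)"
    proof (cases "k = 0")
      case False
      have sq1: "1 \<le> (real_of_int n)\<^sup>2" if "n \<noteq> 0" for n
      proof -
        have "real_of_int 1 \<le> real_of_int (n\<^sup>2)"
          unfolding of_int_le_iff using that zero_less_power2[of n] by linarith
        then show ?thesis by simp
      qed
      define A B where "A = (real_of_int a)\<^sup>2" and "B = (real_of_int b)\<^sup>2"
      have AB: "0 \<le> A" "0 \<le> B" "1 \<le> A \<or> 1 \<le> B"
        using False k sq1[of a] sq1[of b] unfolding A_def B_def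
        by (auto simp: zero_prod_def)
      have "A + B \<le> (freq k)\<^sup>2"
      proof -
        have "1 * (A + B) \<le> (2 * pi)\<^sup>2 * (A + B)"
          using AB pi_gt3 by (intro mult_right_mono one_le_power) auto
        then show ?thesis using AB by (simp add: freq_def k A_def B_def power_mult_distrib)
      qed
      then have "(A + B)\<^sup>2 \<le> ((freq k)\<^sup>2)\<^sup>2" using AB by (intro power_mono) auto
      \<comment> \<open>The constant 3: as \<open>1 \<le> A + B\<close>, each of \<open>1\<close>,
        \<open>A + B\<close> and \<open>A * B\<close> is at most the square of
        \<open>A + B\<close>.\<close>
      moreover have "(1 + A) * (1 + B) \<le> 3 * (A + B)\<^sup>2"
      proof -
        have "1 \<le> A + B" using AB by auto
        then have "A + B \<le> (A + B)\<^sup>2" "1 \<le> (A + B)\<^sup>2"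
          using self_le_power[of "A + B" 2] by auto
        moreover have "A * B \<le> (A + B)\<^sup>2" using AB by (simp add: power2_eq_square algebra_simps)
        ultimately show ?thesis by (simp add: algebra_simps)
      qed
      ultimately have le: "(1 + A) * (1 + B) \<le> 3 * ((freq k)\<^sup>2)\<^sup>2" by linarith
      have "(freq k powr - 2)\<^sup>2 = 1 / ((freq k)\<^sup>2)\<^sup>2"
        using freq_pos[OF False] by (simp add: powr_minus divide_inverse power_inverse)
      also have "\<dots> \<le> 3 / ((1 + A) * (1 + B))"
      proof -
        have "0 < 1 + A" "0 < 1 + B" "0 < ((freq k)\<^sup>2)\<^sup>2" using AB freq_pos[OF False] by (auto intro!: mult_pos_pos)
        then have "3 / (3 * ((freq k)\<^sup>2)\<^sup>2) \<le> 3 / ((1 + A) * (1 + B))"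
          using le by (intro divide_left_mono mult_pos_pos) auto
        then show ?thesis by simp
      qed
      finally show ?thesis by (simp add: k A_def B_def)
    qed (simp add: k split: prod.split)
  qed auto
qed

lemma Hinf_Hs: "f \<in> Hinf \<Longrightarrow> f \<in> Hs r"
  by (rule Hs_mono(1)[of _ "max r 1"]) (auto simp: Hinf_def)

text \<open>Two extra derivatives pay for absolute summability: Cauchy-Schwarz against
  \<open>freq k powr (-2)\<close>, which is square summable on a two-dimensional lattice.\<close>

lemma l1_bound:
  assumes f: "f \<in> Hs (r + 2)"
  shows "(\<lambda>k. freq k powr r * cmod (f k)) summable_on UNIV"
    "(\<Sum>\<^sub>\<infinity>k. freq k powr r * cmod (f k)) \<le> sqrt (\<Sum>\<^sub>\<infinity>k. (freq k powr (-2))\<^sup>2) * hs_norm (r + 2) f"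
proof -
  note CS = infsum_Cauchy_Schwarz[OF summable_freq_powr4 HsD(3)[OF f]]
  have eq: "\<bar>freq k powr (-2) * (freq k powr (r + 2) * cmod (f k))\<bar> = freq k powr r * cmod (f k)" for k
    by (simp add: abs_mult mult.assoc[symmetric] flip: powr_add)
  show "(\<lambda>k. freq k powr r * cmod (f k)) summable_on UNIV"
    using CS(1) unfolding eq .
  show "(\<Sum>\<^sub>\<infinity>k. freq k powr r * cmod (f k)) \<le> sqrt (\<Sum>\<^sub>\<infinity>k. (freq k powr (-2))\<^sup>2) * hs_norm (r + 2) f"
    using CS(2) unfolding eq hs_norm_eq .
qed

text \<open>With the difference \<open>m = k - l\<close> as outer variable, Cauchy-Schwarz bounds
  every inner sum by the same constant, the square sum of \<open>a\<close>; summability of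
  \<open>\<omega>\<close> does the rest.\<close>

lemma summable_convolution:
  fixes \<omega> a :: "int \<times> int \<Rightarrow> real"
  assumes w: "\<omega> summable_on UNIV" "\<And>k. 0 \<le> \<omega> k" and a: "(\<lambda>k. (a k)\<^sup>2) summable_on UNIV"
  shows "(\<lambda>(k, l). \<omega> (k - l) * \<bar>a k * a l\<bar>) summable_on UNIV"
proof -
  have a': "(\<lambda>k. (a (k - m))\<^sup>2) summable_on UNIV" "(\<Sum>\<^sub>\<infinity>k. (a (k - m))\<^sup>2) = (\<Sum>\<^sub>\<infinity>k. (a k)\<^sup>2)" for m
  proof -
    have b: "bij (\<lambda>k. k - m)" by (rule bij_betw_byWitness[of _ "\<lambda>k. k + m"]) auto
    show "(\<lambda>k. (a (k - m))\<^sup>2) summable_on UNIV" "(\<Sum>\<^sub>\<infinity>k. (a (k - m))\<^sup>2) = (\<Sum>\<^sub>\<infinity>k. (a k)\<^sup>2)"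
      using summable_on_reindex_bij_betw[OF b, of "\<lambda>k. (a k)\<^sup>2"]
        infsum_reindex_bij_betw[OF b, of "\<lambda>k. (a k)\<^sup>2"] a by auto
  qed
  note CS = infsum_Cauchy_Schwarz[OF a a'(1)]
  have S: "(\<Sum>\<^sub>\<infinity>k. \<bar>a k * a (k - m)\<bar>) \<le> (\<Sum>\<^sub>\<infinity>k. (a k)\<^sup>2)" for m
    using CS(2)[of m] unfolding a'(2) by (simp add: infsum_nonneg)
  have "(\<lambda>(m, k). \<omega> m * \<bar>a k * a (k - m)\<bar>) summable_on UNIV \<times> UNIV"
  proof (rule summable_on_SigmaI[where g="\<lambda>m. \<omega> m * (\<Sum>\<^sub>\<infinity>k. \<bar>a k * a (k - m)\<bar>)"])
    show "((\<lambda>y. case (m, y) of (m, k) \<Rightarrow> \<omega> m * \<bar>a k * a (k - m)\<bar>) has_sum \<omega> m * (\<Sum>\<^sub>\<infinity>k. \<bar>a k * a (k - m)\<bar>)) UNIV" for m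
      using has_sum_infsum[OF CS(1)[of m]] by (auto intro!: has_sum_cmult_right)
    show "(\<lambda>m. \<omega> m * (\<Sum>\<^sub>\<infinity>k. \<bar>a k * a (k - m)\<bar>)) summable_on UNIV"
      by (rule summable_on_comparison_test[OF summable_on_cmult_left[OF w(1), of "\<Sum>\<^sub>\<infinity>k. (a k)\<^sup>2"]])
         (auto intro!: mult_left_mono mult_nonneg_nonneg infsum_nonneg S w)
  qed (auto simp: w)
  then show ?thesis
    by (subst summable_on_reindex_bij_witness[of UNIV "\<lambda>(m, k). (k, k - m)" "\<lambda>(k, l). (k - l, k)"
          UNIV "\<lambda>(m, k). \<omega> m * \<bar>a k * a (k - m)\<bar>"]) auto
qed

text \<open>Both commutator terms expand into absolutely convergent double sums whose kernel carries
  \<open>freq k - freq l\<close>. With \<open>m = k - l\<close>, the frequency of the test function,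
  as a new variable, the combination of the two sums has the symmetrised symbol as kernel.\<close>

lemma nonlin_eq:
  assumes \<theta>: "\<theta> \<in> Hs s_crit" and \<phi>: "\<phi> \<in> Hinf"
  shows "nonlin \<theta> \<phi> = pair (advect \<theta>) \<phi>"
proof -
  \<comment> \<open>Three powers: two derivatives that land on the test function, and one for the
    factor \<open>1 + freq m\<close> that compares the weights at \<open>k\<close> and
    \<open>l\<close>. The constant is generous.\<close>
  define \<omega> where "\<omega> m = 8 * (freq m powr 3 * cmod (\<phi> m))" for m
  have \<omega>: "\<omega> summable_on UNIV" "\<And>m. 0 \<le> \<omega> m"
    unfolding \<omega>_def by (intro summable_on_cmult_right l1_bound Hinf_Hs \<phi>) auto
  define a where "a k = freq k powr s_crit * cmod (\<theta> k)" for k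
  have a: "(\<lambda>k. (a k)\<^sup>2) summable_on UNIV" "\<And>k. 0 \<le> a k" unfolding a_def by (rule HsD(3)[OF \<theta>]) auto
  note conv = summable_convolution[OF \<omega> a(1)]
  have om: "(1 + freq m) * ((freq m)\<^sup>2 * cmod (\<phi> m)) \<le> \<omega> m" for m
  proof (cases "m = 0")
    case False
    have "(1 + freq m) * (freq m)\<^sup>2 \<le> (8 * freq m) * (freq m)\<^sup>2"
      using freq_ge_1[OF False] by (intro mult_right_mono) auto
    also have "\<dots> = 8 * freq m powr 3"
      using freq_pos[OF False] by (simp add: powr_numeral power3_eq_cube power2_eq_square)
    finally show ?thesis unfolding \<omega>_def
      by (metis (no_types, opaque_lifting) mult.assoc mult_right_mono norm_ge_zero)
  qed (simp add: \<omega>_def)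
  have om1: "(1 + freq m) * (freq m * cmod (\<phi> m)) \<le> \<omega> m" for m
  proof (cases "m = 0")
    case False
    have "freq m * cmod (\<phi> m) \<le> (freq m)\<^sup>2 * cmod (\<phi> m)"
      using freq_ge_1[OF False] by (intro mult_right_mono) (auto simp: power2_eq_square)
    then show ?thesis using om[of m] freq_nonneg[of m]
      by (smt (verit, best) mult_left_mono)
  qed (simp add: \<omega>_def)
  have freq_le: "freq k \<le> freq l * (1 + freq (k - l))" if "l \<noteq> 0" for k l
  proof -
    have "freq k \<le> freq l + freq (k - l)" using freq_triangle[of l "k - l"] by simp
    also have "freq (k - l) \<le> freq l * freq (k - l)" 
      using mult_right_mono[OF freq_ge_1[OF that], of "freq (k - l)"] by simp
    finally show ?thesis by (simp add: algebra_simps)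
  qed
  \<comment> \<open>One commutator term in general form; \<open>p\<close> and \<open>q\<close>
    become the two coordinates, in either order.\<close>
  have part: "pair (\<lambda>k. 2 * of_real pi * \<i> * of_int (p k) * Lam (-1) \<theta> k)
        (commutator (\<lambda>k. 2 * of_real pi * \<i> * of_int (q k) * \<phi> k) (Lam (-1) \<theta>)) =
      Re (\<Sum>\<^sub>\<infinity>(k, l). of_real (4 * pi\<^sup>2 * of_int (p k * q (k - l)) * (freq k - freq l) / (freq k * freq l))
        * \<theta> k * cnj (\<theta> l) * cnj (\<phi> (k - l))) \<and>
      (\<lambda>(k, l). of_real (4 * pi\<^sup>2 * of_int (p k * q (k - l)) * (freq k - freq l) / (freq k * freq l))
        * \<theta> k * cnj (\<theta> l) * cnj (\<phi> (k - l))) summable_on UNIV"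
    if p: "\<And>k. 2 * pi * \<bar>real_of_int (p k)\<bar> \<le> freq k" and q: "\<And>k. 2 * pi * \<bar>real_of_int (q k)\<bar> \<le> freq k"
    for p q :: "int \<times> int \<Rightarrow> int"
  proof -
    let ?A = "\<lambda>k. 2 * of_real pi * \<i> * of_int (q k) * \<phi> k" and ?h = "Lam (-1) \<theta>"
    let ?R = "\<lambda>k. 2 * of_real pi * \<i> * of_int (p k) * Lam (-1) \<theta> k"
    let ?F = "\<lambda>k l. of_real (4 * pi\<^sup>2 * of_int (p k * q (k - l)) * (freq k - freq l) / (freq k * freq l))
        * \<theta> k * cnj (\<theta> l) * cnj (\<phi> (k - l))"
    have A: "cmod (?A k) \<le> freq k * cmod (\<phi> k)" for k
      using mult_right_mono[OF q[of k], of "cmod (\<phi> k)"] by (simp add: norm_mult)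
    \<comment> \<open>The two halves of the commutator are summed separately at this point, so a
      bound growing with \<open>k\<close> suffices; the cancellation between them is exploited in
      \<open>bound\<close>.\<close>
    have sum1: "(\<lambda>l. ?A (k - l) * \<theta> l) summable_on UNIV" for k
    proof (rule norm_summable_comparison(2))
      have "(\<lambda>l. \<omega> (k - l)) summable_on UNIV"
        using summable_on_reindex_bij_betw[OF bij_diff, of \<omega>] \<omega> by simp
      then show "(\<lambda>l. \<omega> (k - l) * ((1 + freq k) * hs_norm s_crit \<theta>)) summable_on UNIV"
        by (rule summable_on_cmult_left)
      fix l
      have "cmod (\<theta> l) \<le> freq l powr (- s_crit) * hs_norm s_crit \<theta>" by (rule Hs_cmod_le[OF \<theta>])
      also have "freq l powr (- s_crit) \<le> 1 + freq l"
      proof -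
        have "freq l \<le> (1 + freq l)\<^sup>2" by (simp add: power2_eq_square algebra_simps)
        then have "sqrt (freq l) \<le> 1 + freq l" by (intro real_le_lsqrt) auto
        then show ?thesis by (simp add: s_crit_def powr_half_sqrt)
      qed
      also have "1 + freq l \<le> (1 + freq k) * (1 + freq (k - l))"
      proof -
        have "freq l \<le> freq k + freq (k - l)" using freq_triangle[of k "l - k"] freq_minus[of "k - l"] by simp
        moreover have "0 \<le> freq k * freq (k - l)" by simp
        ultimately show ?thesis unfolding distrib_left distrib_right by linarith
      qed
      finally have 1: "cmod (\<theta> l) \<le> (1 + freq k) * (1 + freq (k - l)) * hs_norm s_crit \<theta>"
        by (simp add: mult_right_mono)
      have "cmod (?A (k - l) * \<theta> l) \<le> (freq (k - l) * cmod (\<phi> (k - l))) * ((1 + freq k) * (1 + freq (k - l)) * hs_norm s_crit \<theta>)"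
        unfolding norm_mult[of "?A (k - l)"] using A[of "k - l"] 1 by (intro mult_mono) auto
      also have "\<dots> = ((1 + freq (k - l)) * (freq (k - l) * cmod (\<phi> (k - l)))) * ((1 + freq k) * hs_norm s_crit \<theta>)"
        by (simp add: algebra_simps)
      also have "\<dots> \<le> \<omega> (k - l) * ((1 + freq k) * hs_norm s_crit \<theta>)"
        by (intro mult_right_mono om1) auto
      finally show "cmod (?A (k - l) * \<theta> l) \<le> \<omega> (k - l) * ((1 + freq k) * hs_norm s_crit \<theta>)" .
    qed
    have sum2: "(\<lambda>l. ?A (k - l) * ?h l) summable_on UNIV" for k
    proof (rule norm_summable_comparison(2))
      show "(\<lambda>l. cmod (?A (k - l) * \<theta> l)) summable_on UNIV"
        using sum1[of k] by (simp add: summable_on_iff_abs_summable_on_complex)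
      fix l
      have "cmod (?h l) \<le> cmod (\<theta> l)"
      proof (cases "l = 0")
        case False
        then have "inverse (freq l) \<le> 1" using freq_ge_1[of l] by (simp add: inverse_le_1_iff)
        then have "inverse (freq l) * cmod (\<theta> l) \<le> 1 * cmod (\<theta> l)" by (intro mult_right_mono) auto
        then show ?thesis using False by (simp add: Lam_def norm_mult powr_minus norm_inverse)
      qed (simp add: Lam_def)
      then show "cmod (?A (k - l) * ?h l) \<le> cmod (?A (k - l) * \<theta> l)"
        unfolding norm_mult[of "?A (k - l)"] by (intro mult_left_mono) auto
    qed
    have Lam1: "Lam 1 f k = of_real (freq k) * f k" for f k
      by (simp add: Lam_def)
    have Lh: "Lam 1 ?h l = \<theta> l" for l
      using HsD(2)[OF \<theta>] freq_pos[of l] by (auto simp: Lam_def powr_minus)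
    \<comment> \<open>\<open>Lam 1\<close> outside the product contributes \<open>freq k\<close>,
      inside it \<open>freq l\<close>; their difference is the gain of the commutator.\<close>
    have comm: "commutator ?A ?h k = (\<Sum>\<^sub>\<infinity>l. of_real (freq k - freq l) * (?A (k - l) * ?h l))" for k
    proof -
      have "commutator ?A ?h k = of_real (freq k) * (\<Sum>\<^sub>\<infinity>l. ?A (k - l) * ?h l) - (\<Sum>\<^sub>\<infinity>l. ?A (k - l) * Lam 1 ?h l)"
        unfolding commutator_def fmult_def minus_apply Lam1[of "\<lambda>k. \<Sum>\<^sub>\<infinity>l. ?A (k - l) * ?h l"] ..
      also have "of_real (freq k) * (\<Sum>\<^sub>\<infinity>l. ?A (k - l) * ?h l) = (\<Sum>\<^sub>\<infinity>l. of_real (freq k) * (?A (k - l) * ?h l))"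
        by (rule infsum_cmult_right[symmetric]) (rule sum2)
      also have "(\<Sum>\<^sub>\<infinity>l. of_real (freq k) * (?A (k - l) * ?h l)) - (\<Sum>\<^sub>\<infinity>l. ?A (k - l) * Lam 1 ?h l)
         = (\<Sum>\<^sub>\<infinity>l. of_real (freq k) * (?A (k - l) * ?h l) - ?A (k - l) * Lam 1 ?h l)"
        unfolding Lh by (rule infsum_diff'[symmetric]) (intro summable_on_cmult_right sum1 sum2)+
      also have "\<dots> = (\<Sum>\<^sub>\<infinity>l. of_real (freq k - freq l) * (?A (k - l) * ?h l))"
        by (intro infsum_cong) (auto simp: Lam_def algebra_simps)
      finally show ?thesis .
    qed
    have F: "?F k l = ?R k * cnj (of_real (freq k - freq l) * (?A (k - l) * ?h l))" for k l
    proof (cases "k = 0 \<or> l = 0")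
      case False
      then show ?thesis
        using freq_pos[of k] freq_pos[of l]
        by (simp add: Lam_def powr_minus field_simps power2_eq_square)
    qed (auto simp: Lam_def)
    \<comment> \<open>As \<open>freq k - freq l\<close> is at most \<open>freq (k - l)\<close> in
      absolute value, this factor also falls on the test function. Then \<open>freq_le\<close>
      shares the remaining \<open>1 / freq l\<close> between the two weights.\<close>
    have bound: "cmod (?F k l) \<le> \<omega> (k - l) * \<bar>a k * a l\<bar>" for k l
    proof (cases "k = 0 \<or> l = 0")
      case False
      then have pos: "0 < freq k" "0 < freq l" "k \<noteq> 0" "l \<noteq> 0" by (auto intro!: freq_pos)
      define x y m where "x = freq k" and "y = freq l" and "m = freq (k - l)"
      have "cmod (?F k l) = (2 * pi * \<bar>of_int (p k)\<bar>) * (2 * pi * \<bar>of_int (q (k - l))\<bar>) * \<bar>x - y\<bar> / (x * y) * cmod (\<theta> k) * cmod (\<theta> l) * cmod (\<phi> (k - l))"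
        using pos unfolding x_def y_def by (simp add: norm_mult norm_divide abs_mult power2_eq_square flip: of_real_diff)
      also have "\<dots> \<le> x * m * m / (x * y) * cmod (\<theta> k) * cmod (\<theta> l) * cmod (\<phi> (k - l))"
        using p[of k] q[of "k - l"] freq_diff_abs[of k l] pos unfolding x_def y_def m_def
        by (intro mult_right_mono divide_right_mono mult_mono) auto
      also have "\<dots> = (m\<^sup>2 * cmod (\<phi> (k - l))) * (1 / y) * cmod (\<theta> k) * cmod (\<theta> l)"
        using pos unfolding x_def y_def by (simp add: power2_eq_square)
      also have "\<dots> \<le> (m\<^sup>2 * cmod (\<phi> (k - l))) * ((1 + m) * (x powr s_crit * y powr s_crit)) * cmod (\<theta> k) * cmod (\<theta> l)"
      proof (intro mult_right_mono mult_left_mono)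
        have xy: "x \<le> y * (1 + m)" unfolding x_def y_def m_def using False by (intro freq_le) auto
        have m1: "1 \<le> 1 + m" unfolding m_def by simp
        have "x * y \<le> (y * (1 + m))\<^sup>2"
        proof -
          have "x * y \<le> (y * (1 + m)) * y" using xy pos by (intro mult_right_mono) (auto simp: y_def)
          also have "\<dots> \<le> (y * (1 + m)) * (y * (1 + m))"
            using m1 pos by (intro mult_left_mono) (auto simp: y_def mult_le_cancel_left1)
          finally show ?thesis by (simp add: power2_eq_square)
        qed
        then have "sqrt (x * y) \<le> y * (1 + m)"
          using pos m1 by (intro real_le_lsqrt) (auto simp: y_def)
        then have "1 / y \<le> (1 + m) / sqrt (x * y)"
          using pos unfolding x_def y_def by (simp add: field_simps)
        also have "\<dots> = (1 + m) * (x powr s_crit * y powr s_crit)"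
          using pos unfolding x_def y_def
          by (simp add: s_crit_def powr_minus powr_half_sqrt real_sqrt_mult field_simps)
        finally show "1 / y \<le> (1 + m) * (x powr s_crit * y powr s_crit)" .
      qed auto
      also have "\<dots> = ((1 + m) * (m\<^sup>2 * cmod (\<phi> (k - l)))) * \<bar>a k * a l\<bar>"
        by (simp add: a_def x_def y_def abs_mult algebra_simps)
      also have "\<dots> \<le> \<omega> (k - l) * \<bar>a k * a l\<bar>" unfolding m_def by (intro mult_right_mono om) auto
      finally show ?thesis .
    qed (auto simp: \<omega>)
    have sumF: "(\<lambda>(k, l). ?F k l) summable_on UNIV \<times> UNIV"
      by (rule norm_summable_comparison(2)[of "\<lambda>(k, l). \<omega> (k - l) * \<bar>a k * a l\<bar>"])
         (use conv bound in auto)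
    have "pair ?R (commutator ?A ?h) = Re (\<Sum>\<^sub>\<infinity>k. \<Sum>\<^sub>\<infinity>l. ?F k l)"
      unfolding pair_def comm infsum_cnj[symmetric] F infsum_cmult_right' ..
    also have "(\<Sum>\<^sub>\<infinity>k. \<Sum>\<^sub>\<infinity>l. ?F k l) = (\<Sum>\<^sub>\<infinity>(k, l)\<in>UNIV \<times> UNIV. ?F k l)"
      by (rule infsum_Sigma'_banach[OF sumF])
    finally show ?thesis using sumF by simp
  qed
  have fs: "2 * pi * \<bar>real_of_int (fst k)\<bar> \<le> freq k" "2 * pi * \<bar>real_of_int (snd k)\<bar> \<le> freq k" for k
    using abs_Re_le_cmod[of "Complex (of_int (fst k)) (of_int (snd k))"]
      abs_Im_le_cmod[of "Complex (of_int (fst k)) (of_int (snd k))"] by (simp_all add: freq_cmod)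
  let ?F = "\<lambda>p q k l. complex_of_real (4 * pi\<^sup>2 * of_int (p k * q (k - l)) * (freq k - freq l) / (freq k * freq l))
        * \<theta> k * cnj (\<theta> l) * cnj (\<phi> (k - l))"
  note P1 = part[OF fs(2) fs(1)] and P2 = part[OF fs(1) fs(2)]
  let ?F1 = "\<lambda>(k, l). ?F snd fst k l" and ?F2 = "\<lambda>(k, l). ?F fst snd k l"
  let ?G = "\<lambda>m l. of_real (sym m l) * \<theta> l * \<theta> (m - l) * cnj (\<phi> m)"
  \<comment> \<open>Hermitian symmetry reads \<open>cnj (\<theta> l)\<close> as the coefficient at
    \<open>(k - l) - k\<close>, so \<open>k\<close> is the summation index of \<open>advect\<close>
    at the output frequency \<open>k - l\<close>.\<close>
  have G: "?G (k - l) k = - (1/2) * ?F snd fst k l + (1/2) * ?F fst snd k l" for k l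
  proof -
    have "\<theta> (k - l - k) = cnj (\<theta> l)" using HsD(1)[OF \<theta>, of l] by simp
    moreover have "sym (k - l) k = - (1/2) * (4 * pi\<^sup>2 * of_int (snd k * fst (k - l)) * (freq k - freq l) / (freq k * freq l))
       + (1/2) * (4 * pi\<^sup>2 * of_int (fst k * snd (k - l)) * (freq k - freq l) / (freq k * freq l))"
    proof (cases "k = 0 \<or> l = 0")
      case True
      then show ?thesis by (auto simp: sym_def cross_def)
    next
      case False
      have fl: "freq (k - l - k) = freq l" by simp
      show ?thesis unfolding sym_def fl using freq_pos[of k] freq_pos[of l] False
        by (simp add: cross_def field_simps)
    qed
    ultimately show ?thesis
      by (simp only: of_real_add of_real_mult of_real_minus of_real_divide of_real_1 of_real_numeral distrib_right distrib_left mult.assoc)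
  qed
  have sumG: "(\<lambda>(m, l). ?G m l) summable_on UNIV \<and>
     (\<Sum>\<^sub>\<infinity>(m, l). ?G m l) = (\<Sum>\<^sub>\<infinity>x. - (1/2) * ?F1 x + (1/2) * ?F2 x)"
  proof -
    have b: "bij (\<lambda>(k, l). (k - l, k) :: (int \<times> int) \<times> (int \<times> int))"
      by (rule bij_betw_byWitness[of _ "\<lambda>(m, k). (k, k - m)"]) auto
    have eq: "(\<lambda>x. case (case x of (k, l) \<Rightarrow> (k - l, k)) of (m, l) \<Rightarrow> ?G m l) = (\<lambda>x. - (1/2) * ?F1 x + (1/2) * ?F2 x)"
    proof (rule ext, goal_cases)
      case (1 x)
      obtain k l where x: "x = (k, l)" by (cases x)
      show ?case unfolding x prod.case by (rule G)
    qed
    have "(\<lambda>x. - (1/2) * ?F1 x + (1/2) * ?F2 x) summable_on UNIV"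
      using P1 P2 by (intro summable_on_add summable_on_cmult_right) auto
    then show ?thesis
      using summable_on_reindex_bij_betw[OF b, of "\<lambda>(m, l). ?G m l"]
        infsum_reindex_bij_betw[OF b, of "\<lambda>(m, l). ?G m l"] unfolding eq by auto
  qed
  have "nonlin \<theta> \<phi> = - (1/2) * Re (infsum ?F1 UNIV) + (1/2) * Re (infsum ?F2 UNIV)"
    unfolding nonlin_def riesz1_def riesz2_def partial1_def partial2_def conjunct1[OF P1] conjunct1[OF P2] ..
  also have "\<dots> = Re (\<Sum>\<^sub>\<infinity>x. - (1/2) * ?F1 x + (1/2) * ?F2 x)"
  proof -
    have "(\<Sum>\<^sub>\<infinity>x. - (1/2) * ?F1 x + (1/2) * ?F2 x) = - (1/2) * infsum ?F1 UNIV + (1/2) * infsum ?F2 UNIV"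
      using infsum_add[OF summable_on_cmult_right[OF conjunct2[OF P1], of "- (1/2)"]
          summable_on_cmult_right[OF conjunct2[OF P2], of "1/2"]]
      unfolding infsum_cmult_right' .
    then show ?thesis by simp
  qed
  also have "\<dots> = Re (\<Sum>\<^sub>\<infinity>(m, l)\<in>UNIV \<times> UNIV. ?G m l)" using sumG by simp
  also have "(\<Sum>\<^sub>\<infinity>(m, l)\<in>UNIV \<times> UNIV. ?G m l) = (\<Sum>\<^sub>\<infinity>m. \<Sum>\<^sub>\<infinity>l. ?G m l)"
    by (rule infsum_Sigma'_banach[symmetric]) (use sumG in simp)
  also have "\<dots> = (\<Sum>\<^sub>\<infinity>m. advect \<theta> m * cnj (\<phi> m))"
    unfolding advect_def advect2_def infsum_cmult_left' ..
  finally show ?thesis by (simp add: pair_def)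
qed

text \<open>The coefficients of \<open>advect\<close> grow like the square of \<open>freq k\<close>,
  and \<open>l1_bound\<close> at order 2 asks for the norm of order 4 of the test function.\<close>

lemma advect_pair_bound:
  assumes \<theta>: "\<theta> \<in> Hs s_crit" and \<phi>: "\<phi> \<in> Hinf"
  shows "(\<lambda>k. cmod (advect \<theta> k * cnj (\<phi> k))) summable_on UNIV"
    "(\<Sum>\<^sub>\<infinity>k. cmod (advect \<theta> k * cnj (\<phi> k))) \<le> sqrt (\<Sum>\<^sub>\<infinity>k. (freq k powr (-2))\<^sup>2) * hs_norm 4 \<phi> * (hs_norm s_crit \<theta>)\<^sup>2"
proof -
  have L: "\<phi> \<in> Hs (2 + 2)" by (rule Hinf_Hs[OF \<phi>])
  let ?N = "(hs_norm s_crit \<theta>)\<^sup>2"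
  have le: "cmod (advect \<theta> k * cnj (\<phi> k)) \<le> freq k powr 2 * cmod (\<phi> k) * ?N" for k
  proof -
    have "cmod (advect \<theta> k * cnj (\<phi> k)) \<le> ((freq k)\<^sup>2 / 2 * ?N) * cmod (\<phi> k)"
      unfolding norm_mult complex_mod_cnj by (intro mult_right_mono advect_bound[OF \<theta>]) auto
    also have "\<dots> \<le> ((freq k)\<^sup>2 * ?N) * cmod (\<phi> k)"
      by (intro mult_right_mono) auto
    finally show ?thesis by (simp add: algebra_simps)
  qed
  have S: "(\<lambda>k. freq k powr 2 * cmod (\<phi> k) * ?N) summable_on UNIV"
    by (intro summable_on_cmult_left l1_bound(1) L)
  show 1: "(\<lambda>k. cmod (advect \<theta> k * cnj (\<phi> k))) summable_on UNIV"
    by (rule norm_summable_comparison(1)[OF S le])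
  have "(\<Sum>\<^sub>\<infinity>k. cmod (advect \<theta> k * cnj (\<phi> k))) \<le> (\<Sum>\<^sub>\<infinity>k. freq k powr 2 * cmod (\<phi> k) * ?N)"
    by (rule infsum_mono[OF 1 S le])
  also have "\<dots> = (\<Sum>\<^sub>\<infinity>k. freq k powr 2 * cmod (\<phi> k)) * ?N" by (rule infsum_cmult_left')
  also have "\<dots> \<le> (sqrt (\<Sum>\<^sub>\<infinity>k. (freq k powr (-2))\<^sup>2) * hs_norm (2 + 2) \<phi>) * ?N"
    by (intro mult_right_mono l1_bound(2) L) auto
  finally show "(\<Sum>\<^sub>\<infinity>k. cmod (advect \<theta> k * cnj (\<phi> k))) \<le> sqrt (\<Sum>\<^sub>\<infinity>k. (freq k powr (-2))\<^sup>2) * hs_norm 4 \<phi> * ?N"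
    by simp
qed

lemma sum_pairs_involution:
  fixes h :: "'a \<Rightarrow> 'b \<Rightarrow> 'c :: comm_monoid_add"
  assumes "\<And>k l. (k, l) \<in> P \<Longrightarrow> (i k l, j k l) \<in> P"
    and "\<And>k l. (k, l) \<in> P \<Longrightarrow> i (i k l) (j k l) = k \<and> j (i k l) (j k l) = l"
  shows "(\<Sum>(k, l)\<in>P. h (i k l) (j k l)) = (\<Sum>(k, l)\<in>P. h k l)"
  using assms
  by (intro sum.reindex_bij_witness[of P "\<lambda>(k, l). (i k l, j k l)" "\<lambda>(k, l). (i k l, j k l)"])
     (auto split: prod.splits)

text \<open>The nonlinearity conserves the \<open>H^s\<close>-norm exactly for \<open>s = 0\<close> and \<open>s = -1/2\<close>: in these
  cases the trilinear sum is antisymmetric under an exchange of two of the three frequencies.\<close>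

lemma advect_conserve:
  assumes herm: "\<And>k. x (- k) = cnj (x k)" and supp: "\<And>k. k \<notin> fbox N \<Longrightarrow> x k = 0"
    and s: "s = 0 \<or> s = s_crit"
  shows "(\<Sum>k\<in>fbox N. freq k powr (2 * s) * Re (advect x k * cnj (x k))) = 0"
proof -
  \<comment> \<open>Triads whose three frequencies all lie in the box.\<close>
  define P where "P = {(k, l). k \<in> fbox N \<and> l \<in> fbox N \<and> k - l \<in> fbox N}"
  have finP: "finite P" unfolding P_def by (rule finite_subset[of _ "fbox N \<times> fbox N"]) auto
  define w :: "int \<times> int \<Rightarrow> real" where "w k = freq k powr (2 * s)" for k
  \<comment> \<open>One half of the symmetrised kernel. The other half is
    \<open>H k (k - l)\<close>, and both contribute equally to the sum.\<close>
  define H where "H k l = w k * (2 * pi\<^sup>2 * cross k l / freq l)" for k l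
  let ?t = "\<lambda>k l. x l * x (k - l) * x (- k)"
  have m: "- k \<in> fbox N \<longleftrightarrow> k \<in> fbox N" for k by (rule box_minus)
  have m2: "k - l \<in> fbox N \<longleftrightarrow> l - k \<in> fbox N" for k l using m[of "k - l"] by simp
  have adv: "advect x k = (\<Sum>l\<in>{l\<in>fbox N. k - l \<in> fbox N}. of_real (sym k l) * x l * x (k - l))" for k
    unfolding advect_def advect2_def
    by (rule infsumI, rule has_sum_finite_neutralI) (auto simp: supp)
  have H0: "(\<Sum>(k, l)\<in>P. of_real (H k l) * ?t k l) = 0"
  proof -
    have "(\<Sum>(k, l)\<in>P. of_real (H k l) * ?t k l) = (\<Sum>(k, l)\<in>P. - (of_real (H k l) * ?t k l))"
      using s
    proof
      assume s: "s = 0"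
      \<comment> \<open>Replacing \<open>k\<close> by \<open>l - k\<close> permutes the three
        coefficients and changes the sign of the determinant. The weight is 1 only off zero, since
        \<open>0 powr 0 = 0\<close>; for the excluded pairs the determinant is zero.\<close>
      have "H (l - k) l = - H k l" if "k \<noteq> 0" "k \<noteq> l" for k l
      proof -
        have "cross (l - k) l = - cross k l" by (simp add: cross_def algebra_simps)
        then show ?thesis using that freq_pos[of k] freq_pos[of "l - k"] by (simp add: H_def w_def s)
      qed
      moreover have "H (l - k) l = - H k l" if "k = 0 \<or> k = l" for k l
        using that by (auto simp: H_def w_def s cross_def)
      ultimately have H: "H (l - k) l = - H k l" for k l by blast
      have key: "of_real (H (l - k) l) * ?t (l - k) l = - (of_real (H k l) * ?t k l)" for k l
        unfolding H by simp
      show ?thesis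
        using sum_pairs_involution[of P "\<lambda>k l. l - k" "\<lambda>k l. l" "\<lambda>k l. of_real (H k l) * ?t k l"]
        unfolding key by (simp add: P_def m m2)
    next
      assume s: "s = s_crit"
      \<comment> \<open>Here \<open>H k l\<close> is a constant times the determinant divided by
        \<open>freq k * freq l\<close>, hence odd under \<open>(k, l) \<mapsto> (- l, - k)\<close>,
        which permutes the triad.\<close>
      have H: "H (- l) (- k) = - H k l" for k l
      proof (cases "k = 0 \<or> l = 0")
        case False
        have "cross (- l) (- k) = - cross k l" by (simp add: cross_def algebra_simps)
        moreover have "w j = 1 / freq j" "w (- j) = 1 / freq j" if "j \<noteq> 0" for j
        proof -
          have "2 * s = - 1" by (simp add: s s_crit_def)
          then show "w j = 1 / freq j" "w (- j) = 1 / freq j"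
            using freq_pos[OF that] by (simp_all add: w_def powr_minus_divide)
        qed
        ultimately show ?thesis using False by (simp add: H_def)
      qed (auto simp: H_def cross_def)
      have key: "of_real (H (- l) (- k)) * ?t (- l) (- k) = - (of_real (H k l) * ?t k l)" for k l
        unfolding H by simp
      show ?thesis
        using sum_pairs_involution[of P "\<lambda>k l. - l" "\<lambda>k l. - k" "\<lambda>k l. of_real (H k l) * ?t k l"]
        unfolding key by (simp add: P_def m m2)
    qed
    then show ?thesis by (simp add: case_prod_unfold sum_negf)
  qed
  have H1: "(\<Sum>(k, l)\<in>P. of_real (w k * sym k l) * ?t k l) = 2 * (\<Sum>(k, l)\<in>P. of_real (H k l) * ?t k l)"
  proof -
    have "w k * sym k l = H k l + H k (k - l)" for k l
      by (simp add: H_def sym_def cross_diff(1) algebra_simps)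
    then have "(\<Sum>(k, l)\<in>P. of_real (w k * sym k l) * ?t k l) =
        (\<Sum>(k, l)\<in>P. of_real (H k l) * ?t k l) + (\<Sum>(k, l)\<in>P. of_real (H k (k - l)) * ?t k l)"
      by (simp add: case_prod_unfold sum.distrib algebra_simps)
    also have "(\<Sum>(k, l)\<in>P. of_real (H k (k - l)) * ?t k l) = (\<Sum>(k, l)\<in>P. of_real (H k l) * ?t k l)"
    proof -
      have key: "of_real (H k (k - l)) * ?t k (k - l) = of_real (H k (k - l)) * ?t k l" for k l
        by (simp add: mult.commute mult.left_commute)
      show ?thesis
        using sum_pairs_involution[of P "\<lambda>k l. k" "\<lambda>k l. k - l" "\<lambda>k l. of_real (H k l) * ?t k l"]
        unfolding key by (simp add: P_def m m2)
    qed
    finally show ?thesis by simp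
  qed
  have "(\<Sum>k\<in>fbox N. of_real (w k) * (advect x k * cnj (x k))) =
     (\<Sum>k\<in>fbox N. \<Sum>l\<in>{l\<in>fbox N. k - l \<in> fbox N}. of_real (w k * sym k l) * ?t k l)"
    unfolding adv by (simp add: herm sum_distrib_left sum_distrib_right algebra_simps)
  also have "\<dots> = (\<Sum>(k, l)\<in>P. of_real (w k * sym k l) * ?t k l)"
    unfolding P_def by (subst sum.Sigma) (auto intro!: sum.cong)
  also have "\<dots> = 0" using H0 H1 by simp
  finally have "Re (\<Sum>k\<in>fbox N. of_real (w k) * (advect x k * cnj (x k))) = 0" by simp
  then show ?thesis by (simp add: w_def)
qed

section \<open>Measurability\<close>

text \<open>Frequencies are pairs; the simplifier would otherwise split every quantifier over
  \<open>k\<close> into two integer quantifiers.\<close>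

declare split_paired_All [simp del] split_paired_Ex [simp del]

lemma complete_measure_lebesgue_on:
  assumes S: "S \<in> sets lebesgue"
  shows "complete_measure (lebesgue_on S)"
proof
  fix A B assume "B \<subseteq> A" "A \<in> null_sets (lebesgue_on S)"
  then have A: "A \<subseteq> S" "A \<in> null_sets lebesgue"
    using S by (auto simp: null_sets_restrict_space)
  then have "B \<in> null_sets lebesgue"
    using \<open>B \<subseteq> A\<close> completion.complete_measure_axioms complete_measure.complete2 by blast
  then show "B \<in> sets (lebesgue_on S)"
    using A \<open>B \<subseteq> A\<close> S by (auto simp: sets_restrict_space_iff)
qed

text \<open>By completeness of the measure: preimages under \<open>f\<close> and \<open>g\<close>
  differ by a null set.\<close>

lemma borel_measurable_lebesgue_on_AE:
  assumes S: "S \<in> sets lebesgue" and g: "g \<in> borel_measurable (lebesgue_on S)"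
    and ae: "AE x in lebesgue_on S. f x = g x"
  shows "f \<in> borel_measurable (lebesgue_on S)"
proof (rule measurableI)
  fix A :: "'b set" assume A: "A \<in> sets borel"
  interpret complete_measure "lebesgue_on S" by (rule complete_measure_lebesgue_on[OF S])
  show "f -` A \<inter> space (lebesgue_on S) \<in> sets (lebesgue_on S)"
  proof (rule in_sets_AE)
    show "g -` A \<inter> space (lebesgue_on S) \<in> sets (lebesgue_on S)"
      using g A by (rule measurable_sets)
    show "AE x in lebesgue_on S. (x \<in> g -` A \<inter> space (lebesgue_on S)) = (x \<in> f -` A \<inter> space (lebesgue_on S))"
      using ae by eventually_elim auto
  qed auto
qed simp

lemma borel_measurable_lebesgue_on_lim:
  fixes f :: "nat \<Rightarrow> 'a::euclidean_space \<Rightarrow> 'b :: {banach, second_countable_topology}"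
  assumes S: "S \<in> sets lebesgue" and f: "\<And>n. f n \<in> borel_measurable (lebesgue_on S)"
    and lim: "AE x in lebesgue_on S. (\<lambda>n. f n x) \<longlonglongrightarrow> g x"
  shows "g \<in> borel_measurable (lebesgue_on S)"
proof (rule borel_measurable_lebesgue_on_AE[OF S])
  show "(\<lambda>x. lim (\<lambda>n. f n x)) \<in> borel_measurable (lebesgue_on S)"
    by (intro borel_measurable_lim_metric f)
  show "AE x in lebesgue_on S. g x = lim (\<lambda>n. f n x)"
    using lim by eventually_elim (simp add: limI)
qed

lemma borel_measurable_infsum:
  fixes f :: "int \<times> int \<Rightarrow> real \<Rightarrow> 'b :: {banach, second_countable_topology}"
  assumes "\<And>k. f k \<in> borel_measurable (lebesgue_on {a..b})"
    and "AE t in lebesgue_on {a..b}. (\<lambda>k. f k t) summable_on UNIV"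
  shows "(\<lambda>t. \<Sum>\<^sub>\<infinity>k. f k t) \<in> borel_measurable (lebesgue_on {a..b})"
proof (rule borel_measurable_lebesgue_on_lim)
  show "(\<lambda>t. \<Sum>k\<in>fbox n. f k t) \<in> borel_measurable (lebesgue_on {a..b})" for n
    by (intro borel_measurable_sum assms)
  show "AE t in lebesgue_on {a..b}. (\<lambda>n. \<Sum>k\<in>fbox n. f k t) \<longlonglongrightarrow> (\<Sum>\<^sub>\<infinity>k. f k t)"
    using assms(2) by eventually_elim (rule box_sum_tendsto)
qed simp

text \<open>Equivalent to Bochner measurability for paths that lie in \<open>Hs r\<close> almost
  everywhere, by \<open>bochner_measurable_iff\<close>. It does not mention \<open>r\<close>, so a
  path can be moved between Sobolev orders.\<close>

definition coord_measurable :: "real \<Rightarrow> (real \<Rightarrow> fourier) \<Rightarrow> bool" where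
  "coord_measurable T f \<longleftrightarrow> (\<forall>k. (\<lambda>t. f t k) \<in> borel_measurable (lebesgue_on {0..T}))"

lemma coord_measurableD: "coord_measurable T f \<Longrightarrow> (\<lambda>t. f t k) \<in> borel_measurable (lebesgue_on {0..T})"
  unfolding coord_measurable_def by blast

lemma borel_measurable_hs_norm:
  assumes f: "coord_measurable T f" and ae: "AE t in lebesgue_on {0..T}. f t \<in> Hs r"
  shows "(\<lambda>t. hs_norm r (f t)) \<in> borel_measurable (lebesgue_on {0..T})"
proof -
  note [measurable] = coord_measurableD[OF f]
  have "(\<lambda>t. \<Sum>\<^sub>\<infinity>k. (freq k powr r * cmod (f t k))\<^sup>2) \<in> borel_measurable (lebesgue_on {0..T})"
  proof (rule borel_measurable_infsum)
    show "AE t in lebesgue_on {0..T}. (\<lambda>k. (freq k powr r * cmod (f t k))\<^sup>2) summable_on UNIV"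
      using ae by eventually_elim (rule HsD(3))
  qed measurable
  then show ?thesis unfolding hs_norm_eq by measurable
qed

lemma borel_measurable_pair:
  assumes f: "coord_measurable T f" and g: "coord_measurable T g"
    and ae: "AE t in lebesgue_on {0..T}. (\<lambda>k. f t k * cnj (g t k)) summable_on UNIV"
  shows "(\<lambda>t. pair (f t) (g t)) \<in> borel_measurable (lebesgue_on {0..T})"
proof -
  note [measurable] = coord_measurableD[OF f] coord_measurableD[OF g]
  have [measurable]: "cnj \<in> borel_measurable borel" by (intro borel_measurable_continuous_onI continuous_intros)
  have "(\<lambda>t. \<Sum>\<^sub>\<infinity>k. f t k * cnj (g t k)) \<in> borel_measurable (lebesgue_on {0..T})"
    by (rule borel_measurable_infsum[OF _ ae]) measurable
  then show ?thesis unfolding pair_def by measurable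
qed

lemma coord_measurable_advect:
  assumes f: "coord_measurable T f" and ae: "AE t in lebesgue_on {0..T}. f t \<in> Hs s_crit"
  shows "coord_measurable T (\<lambda>t. advect (f t))"
  unfolding coord_measurable_def
proof
  fix k
  note [measurable] = coord_measurableD[OF f]
  show "(\<lambda>t. advect (f t) k) \<in> borel_measurable (lebesgue_on {0..T})"
    unfolding advect_def advect2_def
  proof (rule borel_measurable_infsum)
    show "AE t in lebesgue_on {0..T}. (\<lambda>l. of_real (sym k l) * f t l * f t (k - l)) summable_on UNIV"
      using ae by eventually_elim (rule advect2_bound)
  qed measurable
qed

lemma coord_measurable_Lam:
  assumes f: "coord_measurable T f"
  shows "coord_measurable T (\<lambda>t. Lam \<sigma> (f t))"
  unfolding coord_measurable_def Lam_def
proof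
  fix k
  note [measurable] = coord_measurableD[OF f]
  show "(\<lambda>t. if k = 0 then 0 else of_real (freq k powr \<sigma>) * f t k) \<in> borel_measurable (lebesgue_on {0..T})"
    by measurable
qed

lemma coord_measurable_diff: "coord_measurable T f \<Longrightarrow> coord_measurable T g \<Longrightarrow> coord_measurable T (\<lambda>t. f t - g t)"
  unfolding coord_measurable_def minus_apply by (intro allI borel_measurable_diff) auto

text \<open>Rounding towards zero is odd, so that it preserves the Hermitian symmetry.\<close>

definition round_real :: "nat \<Rightarrow> real \<Rightarrow> real" where
  "round_real m x = (if 0 \<le> x then of_int \<lfloor>real m * x\<rfloor> / real m else - of_int \<lfloor>- (real m * x)\<rfloor> / real m)"

definition round_complex :: "nat \<Rightarrow> complex \<Rightarrow> complex" where
  "round_complex m z = Complex (round_real m (Re z)) (round_real m (Im z))"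

lemma round_real_minus: "round_real m (- x) = - round_real m x"
  by (cases x "0 :: real" rule: linorder_cases) (auto simp: round_real_def)

lemma round_complex_cnj: "round_complex m (cnj z) = cnj (round_complex m z)"
  by (simp add: round_complex_def round_real_minus complex_eq_iff)

lemma round_real_le:
  assumes "0 < m" shows "\<bar>round_real m x - x\<bar> \<le> 1 / real m"
proof -
  have *: "\<bar>of_int \<lfloor>real m * y\<rfloor> / real m - y\<bar> \<le> 1 / real m" for y
  proof -
    have "\<bar>of_int \<lfloor>real m * y\<rfloor> - real m * y\<bar> \<le> 1" by linarith
    then have "\<bar>of_int \<lfloor>real m * y\<rfloor> - real m * y\<bar> / real m \<le> 1 / real m"
      by (intro divide_right_mono) auto
    moreover have "\<bar>of_int \<lfloor>real m * y\<rfloor> - real m * y\<bar> / real m = \<bar>of_int \<lfloor>real m * y\<rfloor> / real m - y\<bar>"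
    proof -
      have "of_int \<lfloor>real m * y\<rfloor> / real m - y = (of_int \<lfloor>real m * y\<rfloor> - real m * y) / real m"
        using assms by (simp add: diff_divide_distrib)
      then show ?thesis by (simp only: abs_divide abs_of_nat)
    qed
    ultimately show ?thesis by simp
  qed
  show ?thesis
  proof (cases "0 \<le> x")
    case False
    have "round_real m x - x = - (of_int \<lfloor>real m * (- x)\<rfloor> / real m - (- x))"
      using False by (simp add: round_real_def)
    then show ?thesis using *[of "- x"] by (simp only: abs_minus_cancel)
  qed (use *[of x] in \<open>simp add: round_real_def\<close>)
qed

lemma round_complex_le:
  assumes "0 < m" shows "cmod (round_complex m z - z) \<le> 2 / real m"
  using cmod_le[of "round_complex m z - z"] round_real_le[OF assms, of "Re z"] round_real_le[OF assms, of "Im z"]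
  by (simp add: round_complex_def)

lemma borel_measurable_round_complex [measurable]: "round_complex m \<in> borel_measurable borel"
proof -
  have [measurable]: "round_real m \<in> borel_measurable borel"
    unfolding round_real_def by measurable
  show ?thesis unfolding borel_measurable_complex_iff round_complex_def by simp
qed

text \<open>Finiteness of the range is what makes the approximants in
  \<open>bochner_measurableI\<close> simple functions.\<close>

lemma finite_round_complex: "finite (round_complex m ` {z. cmod z \<le> B})"
proof -
  define J where "J = \<lceil>real m * B\<rceil>"
  let ?V = "(\<lambda>j. real_of_int j / real m) ` {- J..J}"
  have *: "round_real m x \<in> ?V" if "\<bar>x\<bar> \<le> B" for x
  proof -
    have "real m * \<bar>x\<bar> \<le> real m * B" using that by (intro mult_left_mono) auto
    moreover have "0 \<le> real m * \<bar>x\<bar>" by simp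
    ultimately have le: "\<lfloor>real m * \<bar>x\<bar>\<rfloor> \<le> J" "0 \<le> \<lfloor>real m * \<bar>x\<bar>\<rfloor>" "0 \<le> J"
      unfolding J_def by linarith+
    show ?thesis
    proof (cases "0 \<le> x")
      case True
      have "\<lfloor>real m * x\<rfloor> \<in> {- J..J}"
        using le unfolding abs_of_nonneg[OF True] atLeastAtMost_iff by linarith
      then show ?thesis using True by (auto simp: round_real_def)
    next
      case False
      then have "\<bar>x\<bar> = - x" by simp
      then have "- \<lfloor>real m * - x\<rfloor> \<in> {- J..J}"
        using le unfolding atLeastAtMost_iff by (simp only:) linarith
      then show ?thesis using False
        by (intro image_eqI[of _ _ "- \<lfloor>real m * - x\<rfloor>"]) (simp_all add: round_real_def)
    qed
  qed
  have "round_complex m ` {z. cmod z \<le> B} \<subseteq> (\<lambda>(a, b). Complex a b) ` (?V \<times> ?V)"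
  proof
    fix w assume "w \<in> round_complex m ` {z. cmod z \<le> B}"
    then obtain z where z: "w = round_complex m z" "cmod z \<le> B" by auto
    have "round_real m (Re z) \<in> ?V" "round_real m (Im z) \<in> ?V"
      using z(2) by (auto intro!: * order_trans[OF abs_Re_le_cmod] order_trans[OF abs_Im_le_cmod])
    then show "w \<in> (\<lambda>(a, b). Complex a b) ` (?V \<times> ?V)"
      unfolding z(1) round_complex_def by force
  qed
  then show ?thesis by (rule finite_subset) auto
qed

lemma Hs_finite_support:
  assumes "\<And>k. f (- k) = cnj (f k)" "f 0 = 0" "\<And>k. k \<notin> fbox n \<Longrightarrow> f k = 0"
  shows "f \<in> Hs r" "(hs_norm r f)\<^sup>2 = (\<Sum>k\<in>fbox n. (freq k powr r * cmod (f k))\<^sup>2)"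
proof -
  have *: "((\<lambda>k. (freq k powr r * cmod (f k))\<^sup>2) has_sum (\<Sum>k\<in>fbox n. (freq k powr r * cmod (f k))\<^sup>2)) UNIV"
    by (rule has_sum_finite_neutralI[where B="fbox n"]) (auto simp: assms(3))
  then show "(hs_norm r f)\<^sup>2 = (\<Sum>k\<in>fbox n. (freq k powr r * cmod (f k))\<^sup>2)"
    unfolding hs_norm_sq by (rule infsumI)
  show "f \<in> Hs r" by (rule HsI[OF assms(1,2) has_sum_imp_summable[OF *]])
qed

lemma bochner_measurable_coord:
  assumes b: "bochner_measurable (Hs r) (hs_norm r) T f"
  shows "AE t in lebesgue_on {0..T}. f t \<in> Hs r" "coord_measurable T f"
proof -
  obtain s :: "nat \<Rightarrow> real \<Rightarrow> fourier" where s: "\<And>n. simple_function (lebesgue_on {0..T}) (s n)" "\<And>n t. t \<in> {0..T} \<Longrightarrow> s n t \<in> Hs r"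
    and lim: "AE t in lebesgue_on {0..T}. f t \<in> Hs r \<and> (\<lambda>n. hs_norm r (s n t - f t)) \<longlonglongrightarrow> 0"
    using b unfolding bochner_measurable_def by blast
  show "AE t in lebesgue_on {0..T}. f t \<in> Hs r" using lim by eventually_elim simp
  show "coord_measurable T f"
    unfolding coord_measurable_def
  proof
    fix k
    show "(\<lambda>t. f t k) \<in> borel_measurable (lebesgue_on {0..T})"
    proof (rule borel_measurable_lebesgue_on_lim[where f="\<lambda>n t. s n t k"])
      show "(\<lambda>t. s n t k) \<in> borel_measurable (lebesgue_on {0..T})" for n
        using simple_function_compose1[OF s(1), of "\<lambda>y. y k"] by (rule borel_measurable_simple_function)
      have sp: "AE t in lebesgue_on {0..T}. t \<in> {0..T}" using AE_space[of "lebesgue_on {0..T}"] by simp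
      show "AE t in lebesgue_on {0..T}. (\<lambda>n. s n t k) \<longlonglongrightarrow> f t k"
        using lim sp
      proof eventually_elim
        case (elim t)
        have "(\<lambda>n. s n t k - f t k) \<longlonglongrightarrow> 0"
        proof (rule Lim_null_comparison)
          show "\<forall>\<^sub>F n in sequentially. norm (s n t k - f t k) \<le> freq k powr (-r) * hs_norm r (s n t - f t)"
            using Hs_cmod_le[OF Hs_diff(1)[OF s(2)]] elim by (intro always_eventually) auto
          show "(\<lambda>n. freq k powr (-r) * hs_norm r (s n t - f t)) \<longlonglongrightarrow> 0"
            using elim by (intro tendsto_mult_right_zero) auto
        qed
        then show ?case by (rule LIM_zero_cancel)
      qed
    qed simp
  qed
qed

text \<open>The approximants keep the modes in a box, vanish at times where the path is too large or
  not Hermitian there, and round the remaining coefficients to a grid fine enough for the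
  box.\<close>

lemma bochner_measurableI:
  assumes ae: "AE t in lebesgue_on {0..T}. f t \<in> Hs r" and f: "coord_measurable T f"
  shows "bochner_measurable (Hs r) (hs_norm r) T f"
proof -
  note [measurable] = coord_measurableD[OF f]
  define C where "C n = (\<Sum>k\<in>fbox n. (freq k powr r)\<^sup>2)" for n
  \<comment> \<open>Rounding moves a coefficient by at most \<open>2 / m n\<close>. The mesh is
    chosen so that the squared rounding error over the box, \<open>C n\<close> times the square of
    \<open>2 / m n\<close>, is at most the inverse square of \<open>n + 1\<close>.\<close>
  define m where "m n = Suc (nat \<lceil>2 * (real n + 1) * (1 + C n)\<rceil>)" for n
  have m_pos: "0 < m n" for n by (simp add: m_def)
  have C0: "0 \<le> C n" for n unfolding C_def by (auto intro!: sum_nonneg)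
  have m_ge: "2 * (real n + 1) * (1 + C n) \<le> real (m n)" for n
    unfolding m_def by (simp; linarith)
  \<comment> \<open>The approximants must lie in \<open>Hs r\<close> at every time, so symmetry and
    size are tested through this finite condition; the size bound also keeps their range
    finite.\<close>
  define good where "good n t \<longleftrightarrow> (\<forall>k\<in>fbox n. f t (- k) = cnj (f t k) \<and> cmod (f t k) \<le> real n * freq k powr (- r))" for n t
  define s where "s n t = (\<lambda>k. if k \<in> fbox n \<and> good n t then round_complex (m n) (f t k) else 0)" for n t
  have r0: "round_complex j 0 = 0" for j
    by (simp add: round_complex_def round_real_def complex_eq_iff)
  have s_supp: "s n t k = 0" if "k \<notin> fbox n" for n t k using that by (simp add: s_def)
  \<comment> \<open>At frequency zero the size bound in \<open>good\<close> reads
    \<open>cmod (f t 0) \<le> 0\<close>.\<close>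
  have s0: "s n t 0 = 0" for n t
  proof (cases "0 \<in> fbox n \<and> good n t")
    case True
    then have "f t 0 = 0" unfolding good_def by fastforce
    then show ?thesis by (simp add: s_def r0)
  qed (auto simp: s_def)
  have s_herm: "s n t (- k) = cnj (s n t k)" for n t k
  proof (cases "k \<in> fbox n \<and> good n t")
    case True
    then have "f t (- k) = cnj (f t k)" by (auto simp: good_def)
    then show ?thesis using True by (simp add: s_def box_minus round_complex_cnj)
  qed (auto simp: s_def box_minus)
  have good_measurable: "{t \<in> space (lebesgue_on {0..T}). good n t} \<in> sets (lebesgue_on {0..T})" for n
  proof -
    have [measurable]: "cnj \<in> borel_measurable borel" by (intro borel_measurable_continuous_onI continuous_intros)
    show ?thesis unfolding good_def
      by (intro sets.sets_Collect_finite_All finite_box sets.sets_Collect_conj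
          borel_measurable_eq borel_measurable_le) measurable
  qed
  have s_meas: "(\<lambda>t. s n t k) \<in> borel_measurable (lebesgue_on {0..T})" for n k
  proof (cases "k \<in> fbox n")
    case True
    have "(\<lambda>t. if good n t then round_complex (m n) (f t k) else 0) \<in> borel_measurable (lebesgue_on {0..T})"
      using good_measurable by measurable
    then show ?thesis using True by (simp add: s_def)
  qed (simp add: s_def)
  have simple: "simple_function (lebesgue_on {0..T}) (s n)" for n
  proof -
    define B where "B = (\<Sum>k\<in>fbox n. real n * freq k powr (- r))"
    define V where "V = insert 0 (round_complex (m n) ` {z. cmod z \<le> B})"
    have finV: "finite V" unfolding V_def using finite_round_complex by simp
    have sV: "s n t k \<in> V" for t k
    proof (cases "k \<in> fbox n \<and> good n t")
      case True
      then have "cmod (f t k) \<le> real n * freq k powr (- r)" by (auto simp: good_def)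
      also have "\<dots> \<le> B" unfolding B_def using True by (intro member_le_sum) auto
      finally show ?thesis using True by (simp add: s_def V_def)
    qed (auto simp: s_def V_def)
    have "range (s n) \<subseteq> {y. \<forall>k. (k \<in> fbox n \<longrightarrow> y k \<in> V) \<and> (k \<notin> fbox n \<longrightarrow> y k = 0)}"
      using sV s_supp by blast
    then have fin: "finite (range (s n))"
      by (rule finite_subset) (rule finite_set_of_finite_funs[OF finite_box finV])
    show ?thesis unfolding simple_function_def
    proof (intro conjI ballI)
      show "finite (s n ` space (lebesgue_on {0..T}))" by (rule finite_subset[OF _ fin]) auto
      fix y assume "y \<in> s n ` space (lebesgue_on {0..T})"
      then obtain x where x: "y = s n x" by (rule imageE)
      have y: "y k = 0" if "k \<notin> fbox n" for k unfolding x using that by (rule s_supp)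
      have "s n t = y \<longleftrightarrow> (\<forall>k\<in>fbox n. s n t k = y k)" for t
        using y s_supp by (metis ext)
      then have "s n -` {y} \<inter> space (lebesgue_on {0..T}) = {t \<in> space (lebesgue_on {0..T}). \<forall>k\<in>fbox n. s n t k = y k}"
        by (intro set_eqI) (simp only: vimage_singleton_eq Int_iff mem_Collect_eq conj_commute)
      also have "\<dots> \<in> sets (lebesgue_on {0..T})"
      proof (intro sets.sets_Collect_finite_All finite_box)
        fix k
        note [measurable] = s_meas[of n k]
        show "{t \<in> space (lebesgue_on {0..T}). s n t k = y k} \<in> sets (lebesgue_on {0..T})" by measurable
      qed
      finally show "s n -` {y} \<inter> space (lebesgue_on {0..T}) \<in> sets (lebesgue_on {0..T})" .
    qed
  qed
  have conv: "(\<lambda>n. hs_norm r (s n t - f t)) \<longlonglongrightarrow> 0" if H: "f t \<in> Hs r" for t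
  proof -
    let ?F = "\<lambda>k. (freq k powr r * cmod (f t k))\<^sup>2"
    let ?R = "\<lambda>n. 1 / (real n + 1)\<^sup>2 + ((hs_norm r (f t))\<^sup>2 - sum ?F (fbox n))"
    have good: "good n t" if "hs_norm r (f t) \<le> real n" for n
      unfolding good_def
    proof (intro ballI conjI HsD(1)[OF H])
      fix k
      have "cmod (f t k) \<le> freq k powr (-r) * hs_norm r (f t)" by (rule Hs_cmod_le[OF H])
      also have "\<dots> \<le> freq k powr (-r) * real n" using that by (intro mult_left_mono) auto
      finally show "cmod (f t k) \<le> real n * freq k powr (- r)" by (simp add: mult.commute)
    qed
    \<comment> \<open>Rounding error inside the box plus the tail of \<open>f t\<close> outside
      it.\<close>
    have bound: "(hs_norm r (s n t - f t))\<^sup>2 \<le> ?R n" if n: "hs_norm r (f t) \<le> real n" for n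
    proof -
      let ?A = "\<lambda>k. if k \<in> fbox n then (freq k powr r * (2 / real (m n)))\<^sup>2 else 0"
      let ?B = "\<lambda>k. if k \<in> fbox n then 0 else ?F k"
      have A: "(?A has_sum (\<Sum>k\<in>fbox n. (freq k powr r * (2 / real (m n)))\<^sup>2)) UNIV"
        by (rule has_sum_finite_neutralI[where B="fbox n"]) (auto intro!: sum.cong)
      have B0: "((\<lambda>k. if k \<in> fbox n then ?F k else 0) has_sum sum ?F (fbox n)) UNIV"
        by (rule has_sum_finite_neutralI[where B="fbox n"]) (auto intro!: sum.cong)
      have F: "(?F has_sum (hs_norm r (f t))\<^sup>2) UNIV"
        unfolding hs_norm_sq by (rule has_sum_infsum[OF HsD(3)[OF H]])
      have "((\<lambda>k. ?F k + - (if k \<in> fbox n then ?F k else 0)) has_sum ((hs_norm r (f t))\<^sup>2 + - sum ?F (fbox n))) UNIV"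
        by (intro has_sum_add F has_sum_uminusI B0)
      also have "(\<lambda>k. ?F k + - (if k \<in> fbox n then ?F k else 0)) = ?B" by (rule ext) simp
      finally have B: "(?B has_sum ((hs_norm r (f t))\<^sup>2 + - sum ?F (fbox n))) UNIV" .
      have "(hs_norm r (s n t - f t))\<^sup>2 \<le> (\<Sum>k\<in>fbox n. (freq k powr r * (2 / real (m n)))\<^sup>2) + ((hs_norm r (f t))\<^sup>2 + - sum ?F (fbox n))"
        unfolding hs_norm_sq
      proof (rule has_sum_mono[OF has_sum_infsum has_sum_add[OF A B, unfolded hs_norm_sq]])
        have "s n t \<in> Hs r" by (rule Hs_finite_support(1)[OF s_herm s0 s_supp])
        then show "(\<lambda>k. (freq k powr r * cmod ((s n t - f t) k))\<^sup>2) summable_on UNIV"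
          by (rule HsD(3)[OF Hs_diff(1)[OF _ H]])
        fix k
        show "(freq k powr r * cmod ((s n t - f t) k))\<^sup>2 \<le> ?A k + ?B k"
        proof (cases "k \<in> fbox n")
          case True
          then have "cmod ((s n t - f t) k) \<le> 2 / real (m n)"
            using good[OF n] round_complex_le[OF m_pos] by (simp add: s_def)
          then have "(freq k powr r * cmod ((s n t - f t) k))\<^sup>2 \<le> (freq k powr r * (2 / real (m n)))\<^sup>2"
            by (intro power_mono mult_left_mono) auto
          then show ?thesis using True by simp
        qed (simp add: s_supp)
      qed
      also have "(\<Sum>k\<in>fbox n. (freq k powr r * (2 / real (m n)))\<^sup>2) = C n * (2 / real (m n))\<^sup>2"
        by (simp only: C_def power_mult_distrib sum_distrib_right)
      also have "\<dots> \<le> 1 / (real n + 1)\<^sup>2"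
      proof -
        have "2 / real (m n) \<le> 2 / (2 * (real n + 1) * (1 + C n))"
          using m_ge[of n] C0[of n] by (intro divide_left_mono) (auto intro!: mult_pos_pos add_pos_nonneg simp: m_pos)
        also have "\<dots> = 1 / ((real n + 1) * (1 + C n))" by (simp only: mult.assoc divide_divide_eq_left[symmetric])
        finally have "(2 / real (m n))\<^sup>2 \<le> (1 / ((real n + 1) * (1 + C n)))\<^sup>2"
          by (intro power_mono) auto
        then have "C n * (2 / real (m n))\<^sup>2 \<le> (1 + C n)\<^sup>2 * (1 / ((real n + 1) * (1 + C n)))\<^sup>2"
          using C0[of n] by (intro mult_mono) (auto simp: power2_eq_square algebra_simps)
        also have "\<dots> = 1 / (real n + 1)\<^sup>2"
          using C0[of n] by (simp add: power_divide power_mult_distrib)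
        finally show ?thesis .
      qed
      finally show ?thesis by (simp only: add_uminus_conv_diff)
    qed
    have "(\<lambda>n. 1 / (real n + 1)\<^sup>2) \<longlonglongrightarrow> 0"
    proof -
      have "(\<lambda>n. (inverse (real (Suc n)))\<^sup>2) \<longlonglongrightarrow> 0\<^sup>2"
        by (intro tendsto_power LIMSEQ_inverse_real_of_nat)
      then show ?thesis by (simp add: power_inverse divide_inverse add.commute)
    qed
    moreover have "(\<lambda>n. (hs_norm r (f t))\<^sup>2 - sum ?F (fbox n)) \<longlonglongrightarrow> (hs_norm r (f t))\<^sup>2 - (hs_norm r (f t))\<^sup>2"
      unfolding hs_norm_sq by (intro tendsto_diff tendsto_const box_sum_tendsto HsD(3)[OF H])
    ultimately have "?R \<longlonglongrightarrow> 0 + ((hs_norm r (f t))\<^sup>2 - (hs_norm r (f t))\<^sup>2)" by (rule tendsto_add)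
    then have R: "?R \<longlonglongrightarrow> 0" by simp
    have "(\<lambda>n. (hs_norm r (s n t - f t))\<^sup>2) \<longlonglongrightarrow> 0"
    proof (rule Lim_null_comparison[OF _ R])
      obtain n0 where n0: "hs_norm r (f t) \<le> real n0" using real_arch_simple by blast
      show "\<forall>\<^sub>F n in sequentially. norm ((hs_norm r (s n t - f t))\<^sup>2) \<le> ?R n"
        using bound n0 by (intro eventually_sequentiallyI[of n0]) (auto intro!: bound)
    qed
    then have "(\<lambda>n. sqrt ((hs_norm r (s n t - f t))\<^sup>2)) \<longlonglongrightarrow> sqrt 0" by (rule tendsto_real_sqrt)
    then show ?thesis by simp
  qed
  show ?thesis unfolding bochner_measurable_def
  proof (rule exI[of _ s], intro conjI allI ballI)
    show "simple_function (lebesgue_on {0..T}) (s n)" for n by (rule simple)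
    show "s n t \<in> Hs r" for n t by (rule Hs_finite_support(1)[OF s_herm s0 s_supp])
    show "AE t in lebesgue_on {0..T}. f t \<in> Hs r \<and> (\<lambda>n. hs_norm r (s n t - f t)) \<longlonglongrightarrow> 0"
      using ae by eventually_elim (simp add: conv)
  qed
qed

lemma bochner_measurable_iff:
  "bochner_measurable (Hs r) (hs_norm r) T f \<longleftrightarrow>
   (AE t in lebesgue_on {0..T}. f t \<in> Hs r) \<and> coord_measurable T f"
  using bochner_measurable_coord bochner_measurableI by blast

lemma L2Hs_iff:
  "f \<in> L2Hs T r \<longleftrightarrow> (AE t in lebesgue_on {0..T}. f t \<in> Hs r) \<and> coord_measurable T f \<and>
     integrable (lebesgue_on {0..T}) (\<lambda>t. (hs_norm r (f t))\<^sup>2)"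
  unfolding L2_time_def mem_Collect_eq bochner_measurable_iff by blast

lemma LinfHs_iff:
  "f \<in> LinfHs T r \<longleftrightarrow> (AE t in lebesgue_on {0..T}. f t \<in> Hs r) \<and> coord_measurable T f \<and>
     (\<exists>M. AE t in lebesgue_on {0..T}. hs_norm r (f t) \<le> M)"
  unfolding Linf_time_def mem_Collect_eq bochner_measurable_iff by blast

section \<open>Integrals over initial intervals\<close>

lemma integrable_initial:
  fixes f :: "real \<Rightarrow> 'b :: euclidean_space"
  assumes "integrable (lebesgue_on {0..T}) f" "t \<le> T"
  shows "integrable (lebesgue_on {0..t}) f"
proof -
  have "set_integrable lebesgue {0..T} f"
    using assms(1) by (simp add: integrable_restrict_space set_integrable_def)
  then have "set_integrable lebesgue {0..t} f"
    by (rule set_integrable_subset) (use assms in auto)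
  then show ?thesis by (simp add: integrable_restrict_space set_integrable_def)
qed

lemma AE_initial:
  assumes "AE s in lebesgue_on {0..T}. P s" "t \<le> (T :: real)"
  shows "AE s in lebesgue_on {0..t}. P s"
proof -
  have "AE s in lebesgue. s \<in> {0..T} \<longrightarrow> P s" using assms(1) by (simp add: AE_restrict_space_iff)
  then have "AE s in lebesgue. s \<in> {0..t} \<longrightarrow> P s" by (rule eventually_mono) (use assms(2) in auto)
  then show ?thesis by (simp add: AE_restrict_space_iff)
qed

lemma AE_in_interval: "AE s in lebesgue_on {0..t}. s \<in> {0..t :: real}"
  using AE_space[of "lebesgue_on {0..t}"] by simp

lemma coord_measurable_initial:
  assumes "coord_measurable T f" "t \<le> T" shows "coord_measurable t f"
  unfolding coord_measurable_def
proof
  fix k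
  have "lebesgue_on {0..t} = restrict_space (lebesgue_on {0..T}) {0..t}"
    using assms(2) by (simp add: restrict_restrict_space Int_absorb1)
  then show "(\<lambda>t. f t k) \<in> borel_measurable (lebesgue_on {0..t})"
    using measurable_restrict_space1[OF coord_measurableD[OF assms(1), of k], of "{0..t}"] by simp
qed

lemma L2Hs_initial: "f \<in> L2Hs T r \<Longrightarrow> t \<le> T \<Longrightarrow> f \<in> L2Hs t r"
  unfolding L2Hs_iff using AE_initial coord_measurable_initial integrable_initial by blast

text \<open>Moves a variable upper limit into the integrand, so that Fubini and dominated
  convergence can work over a fixed interval.\<close>

lemma integral_initial_part:
  fixes f :: "real \<Rightarrow> 'b :: euclidean_space"
  assumes "s \<le> t"
  shows "(LINT r|lebesgue_on {0..t}. (if r \<le> s then f r else 0)) = (LINT r|lebesgue_on {0..s}. f r)"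
proof -
  have "(LINT r|lebesgue_on {0..t}. (if r \<le> s then f r else 0)) = (LINT r|lebesgue_on {0..t}. (if r \<in> {0..s} then f r else 0))"
    by (rule Bochner_Integration.integral_cong) auto
  also have "\<dots> = (LINT r|lebesgue_on {0..s}. f r)"
    by (rule integral_restrict) (use assms in auto)
  finally show ?thesis .
qed

lemma AE_neq_lebesgue_on: "AE x in lebesgue_on S. x \<noteq> (a :: real)" if "S \<in> sets lebesgue"
proof -
  have "AE x in lebesgue. x \<noteq> a"
    using AE_lborel_singleton[of a] by (rule AE_completion)
  then show ?thesis using that by (simp add: AE_restrict_space_iff eventually_mono)
qed

lemma integrable_prod_mult:
  fixes f h :: "real \<Rightarrow> complex"
  assumes "integrable (lebesgue_on {0..t}) f" "integrable (lebesgue_on {0..t}) h"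
  shows "integrable (lebesgue_on {0..t} \<Otimes>\<^sub>M lebesgue_on {0..t}) (\<lambda>(s, r). f s * h r)"
proof -
  interpret finite_measure "lebesgue_on {0..t}" by (rule finite_measure_lebesgue_on) simp
  interpret pair_sigma_finite "lebesgue_on {0..t}" "lebesgue_on {0..t}" ..
  note [measurable] = borel_measurable_integrable[OF assms(1)] borel_measurable_integrable[OF assms(2)]
  show ?thesis
  proof (rule Fubini_integrable)
    show "integrable (lebesgue_on {0..t}) (\<lambda>x. LINT y|lebesgue_on {0..t}. norm (case (x, y) of (s, r) \<Rightarrow> f s * h r))"
      using assms by (simp add: norm_mult)
    show "AE x in lebesgue_on {0..t}. integrable (lebesgue_on {0..t}) (\<lambda>y. case (x, y) of (s, r) \<Rightarrow> f s * h r)"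
      using assms by simp
  qed measurable
qed

text \<open>Fubini on the square: the double integral of \<open>f s * h r\<close> splits along the
  diagonal, and each half is an iterated integral with one primitive inside.\<close>

lemma integral_by_parts0:
  fixes f h :: "real \<Rightarrow> complex"
  assumes f: "integrable (lebesgue_on {0..t}) f" and h: "integrable (lebesgue_on {0..t}) h"
  defines "U \<equiv> \<lambda>s. LINT r|lebesgue_on {0..s}. f r" and "V \<equiv> \<lambda>s. LINT r|lebesgue_on {0..s}. h r"
  shows "integrable (lebesgue_on {0..t}) (\<lambda>s. f s * V s)" "integrable (lebesgue_on {0..t}) (\<lambda>s. U s * h s)"
    "U t * V t = (LINT s|lebesgue_on {0..t}. f s * V s) + (LINT s|lebesgue_on {0..t}. U s * h s)"
proof -
  let ?M = "lebesgue_on {0..t}"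
  interpret finite_measure ?M by (rule finite_measure_lebesgue_on) simp
  interpret pair_sigma_finite ?M ?M ..
  note [measurable] = borel_measurable_integrable[OF f] borel_measurable_integrable[OF h]
  have id [measurable]: "(\<lambda>x. x) \<in> borel_measurable ?M"
    by (rule measurable_restrict_space1) (rule measurable_completion, simp)
  note F = integrable_prod_mult[OF f h]
  let ?F1 = "\<lambda>s r. if r \<le> s then f s * h r else 0" and ?F2 = "\<lambda>s r. if r \<le> s then 0 else f s * h r"
  have F1: "integrable (?M \<Otimes>\<^sub>M ?M) (case_prod ?F1)"
    by (rule Bochner_Integration.integrable_bound[OF F]) (measurable, auto)
  have F2: "integrable (?M \<Otimes>\<^sub>M ?M) (case_prod ?F2)"
    by (rule Bochner_Integration.integrable_bound[OF F]) (measurable, auto)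
  have e1: "(LINT r|?M. ?F1 s r) = f s * V s" if "s \<in> {0..t}" for s
  proof -
    have "(LINT r|?M. ?F1 s r) = (LINT r|?M. f s * (if r \<le> s then h r else 0))"
      by (rule Bochner_Integration.integral_cong) auto
    also have "\<dots> = f s * (LINT r|?M. (if r \<le> s then h r else 0))" by simp
    also have "(LINT r|?M. (if r \<le> s then h r else 0)) = V s"
      unfolding V_def by (rule integral_initial_part) (use that in auto)
    finally show ?thesis .
  qed
  have e2: "(LINT s|?M. ?F2 s r) = U r * h r" if "r \<in> {0..t}" for r
  proof -
    have "(LINT s|?M. ?F2 s r) = (LINT s|?M. (if s \<le> r then f s else 0) * h r)"
    proof (rule integral_cong_AE)
      \<comment> \<open>The strict half becomes the closed one off the single point
        \<open>s = r\<close>.\<close>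
      show "AE s in ?M. ?F2 s r = (if s \<le> r then f s else 0) * h r"
        by (rule eventually_mono[OF AE_neq_lebesgue_on[of "{0..t}" r]]) auto
    qed measurable
    also have "\<dots> = (LINT s|?M. (if s \<le> r then f s else 0)) * h r" by simp
    also have "(LINT s|?M. (if s \<le> r then f s else 0)) = U r"
      unfolding U_def by (rule integral_initial_part) (use that in auto)
    finally show ?thesis .
  qed
  have "integrable ?M (\<lambda>s. LINT r|?M. ?F1 s r)" using integrable_fst[OF F1] by simp
  then show i1: "integrable ?M (\<lambda>s. f s * V s)"
    by (rule Bochner_Integration.integrable_cong[THEN iffD1, rotated 2]) (auto simp: e1)
  have "integrable ?M (\<lambda>r. LINT s|?M. ?F2 s r)" using integrable_snd[OF F2] by simp
  then show i2: "integrable ?M (\<lambda>s. U s * h s)"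
    by (rule Bochner_Integration.integrable_cong[THEN iffD1, rotated 2]) (auto simp: e2)
  have "U t * V t = (LINT s|?M. (LINT r|?M. f s * h r))" by (simp add: U_def V_def)
  also have "\<dots> = integral\<^sup>L (?M \<Otimes>\<^sub>M ?M) (\<lambda>(s, r). f s * h r)"
    using integral_fst[OF F] by simp
  also have "(\<lambda>(s, r). f s * h r) = (\<lambda>x. case_prod ?F1 x + case_prod ?F2 x)" by auto
  also have "integral\<^sup>L (?M \<Otimes>\<^sub>M ?M) \<dots> = integral\<^sup>L (?M \<Otimes>\<^sub>M ?M) (case_prod ?F1) + integral\<^sup>L (?M \<Otimes>\<^sub>M ?M) (case_prod ?F2)"
    by (rule Bochner_Integration.integral_add[OF F1 F2])
  also have "integral\<^sup>L (?M \<Otimes>\<^sub>M ?M) (case_prod ?F1) = (LINT s|?M. LINT r|?M. ?F1 s r)"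
    using integral_fst[OF F1] by simp
  also have "\<dots> = (LINT s|?M. f s * V s)" by (rule Bochner_Integration.integral_cong) (auto simp: e1)
  also have "integral\<^sup>L (?M \<Otimes>\<^sub>M ?M) (case_prod ?F2) = (LINT r|?M. LINT s|?M. ?F2 s r)"
    using integral_snd[OF F2] by simp
  also have "\<dots> = (LINT r|?M. U r * h r)" by (rule Bochner_Integration.integral_cong) (auto simp: e2)
  finally show "U t * V t = (LINT s|?M. f s * V s) + (LINT s|?M. U s * h s)" .
qed

text \<open>Takes the place of the product rule, since the mode equations hold in integrated form
  only.\<close>

lemma integral_by_parts:
  fixes f h u v :: "real \<Rightarrow> complex"
  assumes f: "integrable (lebesgue_on {0..t}) f" and h: "integrable (lebesgue_on {0..t}) h"
    and u: "\<And>s. s \<in> {0..t} \<Longrightarrow> u s = a + (LINT r|lebesgue_on {0..s}. f r)"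
    and v: "\<And>s. s \<in> {0..t} \<Longrightarrow> v s = b + (LINT r|lebesgue_on {0..s}. h r)"
    and t: "0 \<le> t"
  shows "integrable (lebesgue_on {0..t}) (\<lambda>s. f s * v s + u s * h s)"
    "u t * v t = a * b + (LINT s|lebesgue_on {0..t}. f s * v s + u s * h s)"
proof -
  define U V where "U = (\<lambda>s. LINT r|lebesgue_on {0..s}. f r)" and "V = (\<lambda>s. LINT r|lebesgue_on {0..s}. h r)"
  have P: "integrable (lebesgue_on {0..t}) (\<lambda>s. f s * V s)" "integrable (lebesgue_on {0..t}) (\<lambda>s. U s * h s)"
    "U t * V t = (LINT s|lebesgue_on {0..t}. f s * V s) + (LINT s|lebesgue_on {0..t}. U s * h s)"
    unfolding U_def V_def by (rule integral_by_parts0[OF f h])+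
  have eq: "f s * v s + u s * h s = (f s * V s + U s * h s) + (f s * b + a * h s)" if "s \<in> {0..t}" for s
    using u[OF that] v[OF that] by (simp add: U_def V_def algebra_simps)
  have i: "integrable (lebesgue_on {0..t}) (\<lambda>s. (f s * V s + U s * h s) + (f s * b + a * h s))"
    using P(1,2) f h by (intro Bochner_Integration.integrable_add) auto
  show "integrable (lebesgue_on {0..t}) (\<lambda>s. f s * v s + u s * h s)"
    by (rule Bochner_Integration.integrable_cong[THEN iffD2, OF refl _ i]) (simp add: eq)
  have "(LINT s|lebesgue_on {0..t}. f s * v s + u s * h s) =
      (LINT s|lebesgue_on {0..t}. (f s * V s + U s * h s) + (f s * b + a * h s))"
    by (rule Bochner_Integration.integral_cong) (simp_all add: eq)
  also have "\<dots> = ((LINT s|lebesgue_on {0..t}. f s * V s) + (LINT s|lebesgue_on {0..t}. U s * h s)) + (U t * b + a * V t)"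
  proof -
    have "(LINT s|lebesgue_on {0..t}. f s * b + a * h s) = U t * b + a * V t"
      using f h by (simp add: U_def V_def)
    then show ?thesis using P(1,2) f h by simp
  qed
  also have "\<dots> = U t * V t + (U t * b + a * V t)" using P(3) by simp
  finally show "u t * v t = a * b + (LINT s|lebesgue_on {0..t}. f s * v s + u s * h s)"
    using u[of t] v[of t] t by (simp add: U_def V_def algebra_simps)
qed

lemma integrable_mult_L2:
  fixes u v :: "'a \<Rightarrow> real"
  assumes [measurable]: "u \<in> borel_measurable M" "v \<in> borel_measurable M"
    and "integrable M (\<lambda>x. (u x)\<^sup>2)" "integrable M (\<lambda>x. (v x)\<^sup>2)"
  shows "integrable M (\<lambda>x. u x * v x)"
proof (rule Bochner_Integration.integrable_bound[OF Bochner_Integration.integrable_add[OF assms(3,4)]])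
  show "AE x in M. norm (u x * v x) \<le> norm ((u x)\<^sup>2 + (v x)\<^sup>2)"
  proof (rule AE_I2)
    fix x
    have "2 * (\<bar>u x\<bar> * \<bar>v x\<bar>) \<le> (u x)\<^sup>2 + (v x)\<^sup>2"
      using sum_squares_bound[of "\<bar>u x\<bar>" "\<bar>v x\<bar>"] by simp
    moreover have "0 \<le> \<bar>u x\<bar> * \<bar>v x\<bar>" by simp
    moreover have "norm (u x * v x) = \<bar>u x\<bar> * \<bar>v x\<bar>" "norm ((u x)\<^sup>2 + (v x)\<^sup>2) = (u x)\<^sup>2 + (v x)\<^sup>2"
      by (simp_all add: abs_mult)
    ultimately show "norm (u x * v x) \<le> norm ((u x)\<^sup>2 + (v x)\<^sup>2)" by linarith
  qed
qed measurable

text \<open>Integrating a square gives a polynomial in \<open>y\<close> that is nonnegative for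
  \<open>y \<ge> 0\<close>; a suitable value of \<open>y\<close> yields the inequality.\<close>

lemma Cauchy_Schwarz_integral:
  fixes u v :: "'a \<Rightarrow> real"
  assumes m: "u \<in> borel_measurable M" "v \<in> borel_measurable M"
    and i: "integrable M (\<lambda>x. (u x)\<^sup>2)" "integrable M (\<lambda>x. (v x)\<^sup>2)"
  shows "(LINT x|M. \<bar>u x * v x\<bar>) \<le> sqrt (LINT x|M. (u x)\<^sup>2) * sqrt (LINT x|M. (v x)\<^sup>2)"
proof -
  define A B C where "A = (LINT x|M. (u x)\<^sup>2)" and "B = (LINT x|M. \<bar>u x * v x\<bar>)" and "C = (LINT x|M. (v x)\<^sup>2)"
  have uv: "integrable M (\<lambda>x. \<bar>u x * v x\<bar>)" using integrable_mult_L2[OF m i] by simp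
  have AC: "0 \<le> A" "0 \<le> C" "0 \<le> B" unfolding A_def B_def C_def by simp_all
  have key: "2 * y * B \<le> A + y\<^sup>2 * C" if "0 \<le> y" for y
  proof -
    have "2 * y * B = (LINT x|M. 2 * y * \<bar>u x * v x\<bar>)" unfolding B_def by simp
    also have "\<dots> \<le> (LINT x|M. (u x)\<^sup>2 + y\<^sup>2 * (v x)\<^sup>2)"
    proof (rule integral_mono)
      fix x
      show "2 * y * \<bar>u x * v x\<bar> \<le> (u x)\<^sup>2 + y\<^sup>2 * (v x)\<^sup>2"
        using sum_squares_bound[of "\<bar>u x\<bar>" "y * \<bar>v x\<bar>"] by (simp add: abs_mult power_mult_distrib mult_ac)
    qed (use uv i in auto)
    also have "\<dots> = A + y\<^sup>2 * C" unfolding A_def C_def using i by simp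
    finally show ?thesis .
  qed
  have "B\<^sup>2 \<le> A * C"
  proof (cases "C = 0")
    case True
    have "B = 0"
    proof (rule ccontr)
      assume "B \<noteq> 0"
      then have "0 < B" using AC by simp
      \<comment> \<open>With \<open>C = 0\<close> the inequality is linear in \<open>y\<close>, and
        this choice makes its left-hand side \<open>2 * (A + 1)\<close>.\<close>
      then have "2 * ((A + 1) / B) * B \<le> A" using key[of "(A + 1) / B"] True AC by simp
      then show False using \<open>0 < B\<close> AC by simp
    qed
    then show ?thesis using AC by simp
  next
    case False
    then have C: "0 < C" using AC by simp
    \<comment> \<open>The minimiser of the polynomial.\<close>
    have "2 * (B / C) * B \<le> A + (B / C)\<^sup>2 * C" using key[of "B / C"] AC by simp
    then have "B\<^sup>2 / C \<le> A" using C by (simp add: power2_eq_square)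
    then show ?thesis using C by (simp add: field_simps)
  qed
  then have "B \<le> sqrt (A * C)" by (rule real_le_rsqrt)
  then show ?thesis unfolding A_def B_def C_def by (simp add: real_sqrt_mult)
qed

text \<open>Dominated convergence along the boxes exchanges lattice sum and time integral; this is
  the passage from the mode equations to the weak formulation.\<close>

lemma integral_box_sum_tendsto:
  fixes f :: "int \<times> int \<Rightarrow> real \<Rightarrow> complex"
  assumes f: "\<And>k. f k \<in> borel_measurable (lebesgue_on {0..t})"
    and w: "integrable (lebesgue_on {0..t}) w"
    and ae: "AE s in lebesgue_on {0..t}. (\<lambda>k. cmod (f k s)) summable_on UNIV \<and> (\<Sum>\<^sub>\<infinity>k. cmod (f k s)) \<le> w s"
  shows "integrable (lebesgue_on {0..t}) (\<lambda>s. (\<Sum>\<^sub>\<infinity>k. f k s))" "integrable (lebesgue_on {0..t}) (f k)"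
    "(\<lambda>n. \<Sum>k\<in>fbox n. LINT s|lebesgue_on {0..t}. f k s) \<longlonglongrightarrow> (LINT s|lebesgue_on {0..t}. (\<Sum>\<^sub>\<infinity>k. f k s))"
proof -
  let ?M = "lebesgue_on {0..t}"
  have m: "(\<lambda>s. (\<Sum>\<^sub>\<infinity>k. f k s)) \<in> borel_measurable ?M"
    by (rule borel_measurable_infsum[OF f]) (rule eventually_mono[OF ae], auto intro: abs_summable_summable)
  have m': "(\<lambda>s. \<Sum>k\<in>fbox n. f k s) \<in> borel_measurable ?M" for n by (intro borel_measurable_sum f)
  have lim: "AE s in ?M. (\<lambda>n. \<Sum>k\<in>fbox n. f k s) \<longlonglongrightarrow> (\<Sum>\<^sub>\<infinity>k. f k s)"
    using ae by eventually_elim (elim conjE, rule box_sum_tendsto, rule abs_summable_summable)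
  have bd: "AE s in ?M. norm (\<Sum>k\<in>fbox n. f k s) \<le> w s" for n
    using ae
  proof eventually_elim
    case (elim s)
    have "norm (\<Sum>k\<in>fbox n. f k s) \<le> (\<Sum>k\<in>fbox n. cmod (f k s))" by (rule norm_sum)
    also have "\<dots> \<le> (\<Sum>\<^sub>\<infinity>k. cmod (f k s))" using elim by (intro box_sum_le_infsum) auto
    finally show ?case using elim by linarith
  qed
  show "integrable ?M (\<lambda>s. (\<Sum>\<^sub>\<infinity>k. f k s))"
    by (rule integrable_dominated_convergence[OF m m' w lim bd])
  show fi: "integrable ?M (f k)" for k
  proof (rule Bochner_Integration.integrable_bound[OF w f])
    show "AE s in ?M. norm (f k s) \<le> norm (w s)"
      using ae
    proof eventually_elim
      case (elim s)
      have "(\<Sum>k\<in>{k}. cmod (f k s)) \<le> (\<Sum>\<^sub>\<infinity>k. cmod (f k s))" using elim by (intro finite_sum_le_infsum) auto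
      then show ?case using elim by auto
    qed
  qed
  have "(\<lambda>n. LINT s|?M. (\<Sum>k\<in>fbox n. f k s)) \<longlonglongrightarrow> (LINT s|?M. (\<Sum>\<^sub>\<infinity>k. f k s))"
    by (rule integral_dominated_convergence[OF m m' w lim bd])
  then show "(\<lambda>n. \<Sum>k\<in>fbox n. LINT s|?M. f k s) \<longlonglongrightarrow> (LINT s|?M. (\<Sum>\<^sub>\<infinity>k. f k s))"
    by (simp add: Bochner_Integration.integral_sum[OF fi])
qed

lemma has_bochner_integral_reflect:
  fixes f :: "real \<Rightarrow> 'b :: euclidean_space"
  assumes "has_bochner_integral (lebesgue_on {a..b}) f i"
  shows "has_bochner_integral (lebesgue_on {T - b..T - a}) (\<lambda>x. f (T - x)) i"
proof -
  have eq: "indicat_real {a..b} (T - x) *\<^sub>R f (T - x) = indicat_real {T - b..T - a} x *\<^sub>R f (T - x)" for x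
    by (auto simp: indicator_def)
  have "has_bochner_integral lebesgue (\<lambda>x. indicator {a..b} x *\<^sub>R f x) i"
    using assms by (auto simp: has_bochner_integral_restrict_space)
  then have "has_bochner_integral lebesgue (\<lambda>x. indicator {T - b..T - a} x *\<^sub>R f (T - x)) i"
    using has_bochner_integral_lebesgue_real_affine_iff [of "-1" "(\<lambda>x. indicator {a..b} x *\<^sub>R f x)" i T]
    by (auto simp: eq)
  then show ?thesis by (auto simp: has_bochner_integral_restrict_space)
qed

lemma measurable_reflect: "(\<lambda>x. T - x) \<in> lebesgue_on {0..T} \<rightarrow>\<^sub>M lebesgue_on {0..T :: real}"
proof -
  have "(\<lambda>x :: real. T + (-1) * x) \<in> lebesgue \<rightarrow>\<^sub>M lebesgue"
    using lebesgue_affine_measurable[where c="\<lambda>x :: real. -1" and t=T] by simp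
  then have 1: "(\<lambda>x :: real. T - x) \<in> lebesgue \<rightarrow>\<^sub>M lebesgue" by simp
  show ?thesis
    by (rule measurable_restrict_space2) (auto intro: measurable_restrict_space1 1)
qed

text \<open>A null set is reflected by reflecting the integral of its indicator function.\<close>

lemma AE_reflect:
  assumes "AE x in lebesgue_on {0..T}. P x"
  shows "AE x in lebesgue_on {0..T :: real}. P (T - x)"
proof -
  obtain N where N: "{x \<in> space (lebesgue_on {0..T}). \<not> P x} \<subseteq> N" "emeasure (lebesgue_on {0..T}) N = 0" "N \<in> sets (lebesgue_on {0..T})"
    using assms by (rule AE_E)
  have NT: "N \<subseteq> {0..T}" using sets.sets_into_space[OF N(3)] by simp
  have "has_bochner_integral (lebesgue_on {0..T}) (indicat_real N) (measure (lebesgue_on {0..T}) N)"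
    using N by (intro has_bochner_integral_real_indicator) auto
  then have "has_bochner_integral (lebesgue_on {0..T}) (indicat_real N) 0"
    using N(2) by (simp add: measure_def)
  from has_bochner_integral_reflect[OF this, of T]
  have R: "integrable (lebesgue_on {0..T}) (\<lambda>x. indicat_real N (T - x))"
    "(LINT x|lebesgue_on {0..T}. indicat_real N (T - x)) = 0"
    by (simp_all add: has_bochner_integral_iff)
  then have "AE x in lebesgue_on {0..T}. indicat_real N (T - x) = 0"
    by (subst (asm) integral_nonneg_eq_0_iff_AE) auto
  then show ?thesis using AE_in_interval[of T]
  proof eventually_elim
    case (elim x)
    have "T - x \<notin> N" "T - x \<in> {0..T}" using elim by (auto simp: indicator_def split: if_splits)
    show ?case
    proof (rule ccontr)
      assume "\<not> P (T - x)"
      then have "T - x \<in> {x \<in> space (lebesgue_on {0..T}). \<not> P x}" using \<open>T - x \<in> {0..T}\<close> by simp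
      then show False using N(1) \<open>T - x \<notin> N\<close> by blast
    qed
  qed
qed

lemma coord_measurable_reflect:
  assumes "coord_measurable T f" shows "coord_measurable T (\<lambda>t. f (T - t))"
  unfolding coord_measurable_def
  using measurable_compose[OF measurable_reflect coord_measurableD[OF assms]] by blast

lemma integral_reflect:
  fixes f :: "real \<Rightarrow> 'b :: euclidean_space"
  assumes "integrable (lebesgue_on {0..T}) f"
  shows "integrable (lebesgue_on {0..T}) (\<lambda>t. f (T - t))"
    "(LINT t|lebesgue_on {0..T}. f (T - t)) = (LINT t|lebesgue_on {0..T}. f t)"
  using has_bochner_integral_reflect[OF has_bochner_integral_integrable[OF assms], of T]
  by (simp_all add: has_bochner_integral_iff)

lemma L2Hs_reflect: "f \<in> L2Hs T r \<Longrightarrow> (\<lambda>t. f (T - t)) \<in> L2Hs T r"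
  unfolding L2Hs_iff
  using AE_reflect[where T=T and P="\<lambda>t. f t \<in> Hs r"] coord_measurable_reflect[of T f]
    integral_reflect(1)[of T "\<lambda>t. (hs_norm r (f t))\<^sup>2"] by blast

section \<open>Picard-Lindelof for integrable controls\<close>

text \<open>The forcing is carried as a continuous function \<open>G\<close> rather than through a
  derivative, so that a merely square-integrable control can enter by its primitive. A global
  Lipschitz constant yields a solution on the whole interval.\<close>

lemma Picard_Lindelof_integral:
  fixes F :: "'a::banach \<Rightarrow> 'a" and G :: "real \<Rightarrow> 'a"
  assumes L: "\<And>x y. norm (F x - F y) \<le> L * norm (x - y)" "0 < L"
    and G: "continuous_on {0..T} G" and T: "0 \<le> T"
  obtains x where "continuous_on {0..T} x"
    "\<And>t. t \<in> {0..T} \<Longrightarrow> x t = G t + integral {0..t} (\<lambda>s. F (x s))"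
proof -
  define X where "X = rec_nat G (\<lambda>_ x t. G t + integral {0..t} (\<lambda>s. F (x s)))"
  have X0: "X 0 = G" and XS: "X (Suc n) = (\<lambda>t. G t + integral {0..t} (\<lambda>s. F (X n s)))" for n
    by (simp_all add: X_def)
  have F: "continuous_on UNIV F"
  proof (rule continuous_onI)
    fix x e assume "0 < (e :: real)"
    show "\<exists>d>0. \<forall>x'\<in>UNIV. dist x' x < d \<longrightarrow> dist (F x') (F x) \<le> e"
    proof (intro exI[of _ "e / L"] conjI ballI impI)
      fix x' assume "dist x' x < e / L"
      then have "L * norm (x' - x) \<le> e" using L(2) by (simp add: dist_norm field_simps)
      then show "dist (F x') (F x) \<le> e" using L(1)[of x' x] by (simp add: dist_norm)
    qed (use \<open>0 < e\<close> L in simp)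
  qed
  have FX: "continuous_on {0..t} (\<lambda>s. F (x s))" if "continuous_on {0..T} x" "t \<le> T" for x t
    by (rule continuous_on_compose2[OF F continuous_on_subset[OF that(1)]]) (use that in auto)
  have cont: "continuous_on {0..T} (X n)" for n
  proof (induction n)
    case (Suc n)
    have "(\<lambda>s. F (X n s)) integrable_on {0..T}"
      by (rule integrable_continuous_real) (rule FX[OF Suc order_refl])
    then show ?case unfolding XS by (intro continuous_intros G indefinite_integral_continuous_1)
  qed (simp add: X0 G)
  have FXi: "(\<lambda>s. F (X n s)) integrable_on {0..t}" if "t \<le> T" for n t
    by (rule integrable_continuous_real) (rule FX[OF cont that])
  obtain K where K: "\<And>t. t \<in> {0..T} \<Longrightarrow> norm (X 1 t - X 0 t) \<le> K" "0 \<le> K"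
  proof -
    have "bounded ((\<lambda>t. X 1 t - X 0 t) ` {0..T})"
      by (intro compact_imp_bounded compact_continuous_image continuous_intros cont) auto
    then obtain K where "\<forall>x\<in>(\<lambda>t. X 1 t - X 0 t) ` {0..T}. norm x \<le> K" using bounded_iff by blast
    then show thesis by (intro that[of "max K 0"]) (auto simp: le_max_iff_disj)
  qed
  have expi: "((\<lambda>s. exp (2 * L * s) * (2 * L)) has_integral (exp (2 * L * t) - exp (2 * L * 0))) {0..t}" if "0 \<le> t" for t
    by (rule fundamental_theorem_of_calculus[OF that])
       (auto intro!: derivative_eq_intros simp: has_real_derivative_iff_has_vector_derivative[symmetric])
  \<comment> \<open>Against the weight \<open>exp (2 * L * t)\<close>, integrating the Lipschitz
    bound gains a factor \<open>1/2\<close>, however large \<open>T\<close> is.\<close>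
  have step: "norm (X (Suc n) t - X n t) \<le> K * exp (2 * L * t) / 2 ^ n" if "t \<in> {0..T}" for n t
    using that
  proof (induction n arbitrary: t)
    case 0
    have "K * 1 \<le> K * exp (2 * L * t)" using K(2) L(2) 0 by (intro mult_left_mono) auto
    then show ?case using K(1)[OF 0] by simp
  next
    case (Suc n)
    then have t: "0 \<le> t" "t \<le> T" by auto
    let ?g = "\<lambda>s. K / 2 ^ Suc n * (exp (2 * L * s) * (2 * L))"
    have g: "(?g has_integral (K / 2 ^ Suc n * (exp (2 * L * t) - exp (2 * L * 0)))) {0..t}"
      by (intro has_integral_mult_right expi t)
    have "X (Suc (Suc n)) t - X (Suc n) t = integral {0..t} (\<lambda>s. F (X (Suc n) s)) - integral {0..t} (\<lambda>s. F (X n s))"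
      unfolding XS[of "Suc n"] XS[of n] by (simp add: XS)
    also have "\<dots> = integral {0..t} (\<lambda>s. F (X (Suc n) s) - F (X n s))"
      by (rule Henstock_Kurzweil_Integration.integral_diff[symmetric]) (intro FXi t)+
    also have "norm \<dots> \<le> integral {0..t} ?g"
    proof (rule Henstock_Kurzweil_Integration.integral_norm_bound_integral)
      show "(\<lambda>s. F (X (Suc n) s) - F (X n s)) integrable_on {0..t}"
        by (intro integrable_diff FXi t)
      show "?g integrable_on {0..t}" using g by (rule has_integral_integrable)
      fix s assume s: "s \<in> {0..t}"
      have "norm (F (X (Suc n) s) - F (X n s)) \<le> L * norm (X (Suc n) s - X n s)" by (rule L)
      also have "\<dots> \<le> L * (K * exp (2 * L * s) / 2 ^ n)"
        using s t L(2) by (intro mult_left_mono Suc.IH) auto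
      finally show "norm (F (X (Suc n) s) - F (X n s)) \<le> ?g s" by (simp add: field_simps)
    qed
    also have "\<dots> = K / 2 ^ Suc n * (exp (2 * L * t) - 1)" using integral_unique[OF g] by simp
    also have "\<dots> \<le> K / 2 ^ Suc n * exp (2 * L * t)" using K(2) by (intro mult_left_mono) auto
    finally show ?case by simp
  qed
  define x where "x t = G t + (\<Sum>n. X (Suc n) t - X n t)" for t
  have Xsum: "X n t = G t + (\<Sum>i<n. X (Suc i) t - X i t)" for n t
    by (induction n) (simp_all add: X0)
  have "uniform_limit {0..T} (\<lambda>n t. \<Sum>i<n. X (Suc i) t - X i t) (\<lambda>t. \<Sum>n. X (Suc n) t - X n t) sequentially"
  proof (rule Weierstrass_m_test)
    show "norm (X (Suc n) t - X n t) \<le> K * exp (2 * L * T) * (1 / 2) ^ n" if "t \<in> {0..T}" for n t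
    proof -
      have "norm (X (Suc n) t - X n t) \<le> K * exp (2 * L * t) / 2 ^ n" by (rule step[OF that])
      also have "\<dots> \<le> K * exp (2 * L * T) / 2 ^ n"
        using that K L by (intro divide_right_mono mult_left_mono) auto
      finally show ?thesis by (simp add: power_one_over)
    qed
    show "summable (\<lambda>n. K * exp (2 * L * T) * (1 / 2) ^ n)"
      by (intro summable_mult summable_geometric) simp
  qed
  then have "uniform_limit {0..T} (\<lambda>n t. G t + (\<Sum>i<n. X (Suc i) t - X i t)) x sequentially"
    unfolding x_def by (intro uniform_limit_add uniform_limit_const)
  moreover have "(\<lambda>n t. G t + (\<Sum>i<n. X (Suc i) t - X i t)) = X"
    by (intro ext) (rule Xsum[symmetric])
  ultimately have lim: "uniform_limit {0..T} X x sequentially" by (simp only:)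
  have xc: "continuous_on {0..T} x"
    by (rule uniform_limit_theorem[OF _ lim]) (auto simp: cont)
  have "x t = G t + integral {0..t} (\<lambda>s. F (x s))" if t: "t \<in> {0..T}" for t
  proof -
    have "uniform_limit {0..t} (\<lambda>n s. F (X n s)) (\<lambda>s. F (x s)) sequentially"
      unfolding uniform_limit_iff
    proof (intro allI impI)
      fix e :: real assume e: "0 < e"
      have "\<forall>\<^sub>F n in sequentially. \<forall>s\<in>{0..T}. dist (X n s) (x s) < e / L"
        using lim e L(2) unfolding uniform_limit_iff by simp
      then show "\<forall>\<^sub>F n in sequentially. \<forall>s\<in>{0..t}. dist (F (X n s)) (F (x s)) < e"
      proof eventually_elim
        case (elim n)
        show ?case
        proof
          fix s assume "s \<in> {0..t}"
          then have "norm (X n s - x s) < e / L" using elim t by (auto simp: dist_norm)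
          then have "L * norm (X n s - x s) < e" using L(2) by (simp add: field_simps)
          then show "dist (F (X n s)) (F (x s)) < e" using L(1)[of "X n s" "x s"] by (simp add: dist_norm)
        qed
      qed
    qed
    then obtain I J where IJ: "\<And>n. ((\<lambda>s. F (X n s)) has_integral I n) {0..t}" "((\<lambda>s. F (x s)) has_integral J) {0..t}"
      "I \<longlonglongrightarrow> J"
    proof (rule uniform_limit_integral)
      show "continuous_on {0..t} (\<lambda>s. F (X n s))" for n by (rule FX[OF cont]) (use t in simp)
    qed auto
    have "(\<lambda>n. X (Suc n) t) \<longlonglongrightarrow> x t"
      using tendsto_uniform_limitI[OF lim t] by (rule LIMSEQ_Suc)
    moreover have "(\<lambda>n. X (Suc n) t) \<longlonglongrightarrow> G t + J"
      unfolding XS integral_unique[OF IJ(1)] by (intro tendsto_intros IJ)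
    ultimately have "x t = G t + J" by (rule LIMSEQ_unique)
    then show ?thesis using integral_unique[OF IJ(2)] by simp
  qed
  then show thesis using that[of x] xc by blast
qed

definition retract :: "real \<Rightarrow> 'a::real_normed_vector \<Rightarrow> 'a" where
  "retract R x = (if norm x \<le> R then x else (R / norm x) *\<^sub>R x)"

lemma norm_retract: "0 \<le> R \<Longrightarrow> norm (retract R x) \<le> R"
  by (auto simp: retract_def)

text \<open>The constant 2 is good for every norm, here the supremum norm: moving \<open>x\<close>
  onto the sphere, or changing the scaling factor, costs at most \<open>norm (x - y)\<close> on top
  of the distance itself.\<close>

lemma retract_Lipschitz:
  assumes R: "0 < R"
  shows "norm (retract R x - retract R y) \<le> 2 * norm (x - y)"
proof -
  have *: "norm (retract R x - retract R y) \<le> 2 * norm (x - y)" if xy: "norm y \<le> norm x" for x y :: 'a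
  proof -
    have tri: "norm x - norm y \<le> norm (x - y)" by (rule norm_triangle_ineq2)
    consider "norm x \<le> R" | "norm y \<le> R" "R < norm x" | "R < norm y" "R < norm x" using xy by linarith
    then show ?thesis
    proof cases
      case 1
      then show ?thesis using xy by (simp add: retract_def)
    next
      case 2
      have "norm ((R / norm x) *\<^sub>R x - x) = norm x - R"
      proof -
        have "(R / norm x) *\<^sub>R x - x = - ((1 - R / norm x) *\<^sub>R x)" by (simp add: algebra_simps)
        then have e: "norm ((R / norm x) *\<^sub>R x - x) = \<bar>1 - R / norm x\<bar> * norm x" by (simp only: norm_minus_cancel norm_scaleR)
        have x0: "0 < norm x" using 2 R by linarith
        then have "R / norm x \<le> 1" using 2 by simp
        then have "\<bar>1 - R / norm x\<bar> * norm x = norm x - R" using x0 by (simp add: left_diff_distrib)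
        then show ?thesis using e by simp
      qed
      moreover have "(R / norm x) *\<^sub>R x - y = ((R / norm x) *\<^sub>R x - x) + (x - y)" by simp
      ultimately have "norm ((R / norm x) *\<^sub>R x - y) \<le> (norm x - R) + norm (x - y)"
        by (metis norm_triangle_ineq)
      then show ?thesis using 2 tri by (simp add: retract_def)
    next
      case 3
      have p: "0 < norm x" "0 < norm y" using 3 R by linarith+
      have "(R / norm x) *\<^sub>R x - (R / norm y) *\<^sub>R y = (R / norm x) *\<^sub>R (x - y) + (R / norm x - R / norm y) *\<^sub>R y"
        by (simp add: algebra_simps)
      then have "norm ((R / norm x) *\<^sub>R x - (R / norm y) *\<^sub>R y) \<le>
          norm ((R / norm x) *\<^sub>R (x - y)) + norm ((R / norm x - R / norm y) *\<^sub>R y)"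
        by (metis norm_triangle_ineq)
      also have "norm ((R / norm x) *\<^sub>R (x - y)) \<le> 1 * norm (x - y)"
        unfolding norm_scaleR using 3 R p by (intro mult_right_mono) auto
      also have "norm ((R / norm x - R / norm y) *\<^sub>R y) \<le> norm (x - y)"
      proof -
        have "R / norm x \<le> R / norm y" using xy p R by (intro divide_left_mono) auto
        then have "norm ((R / norm x - R / norm y) *\<^sub>R y) = (R / norm y - R / norm x) * norm y" by simp
        also have "\<dots> = R / norm x * (norm x - norm y)" using p by (simp add: field_simps)
        also have "\<dots> \<le> 1 * (norm x - norm y)" using xy 3 R p by (intro mult_right_mono) auto
        finally show ?thesis using tri by simp
      qed
      finally show ?thesis using 3 by (simp add: retract_def)
    qed
  qed
  show ?thesis using *[of x y] *[of y x] by (cases "norm y \<le> norm x") (auto simp: norm_minus_commute)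
qed

lemma finite_support_bcontfun:
  fixes f :: "int \<times> int \<Rightarrow> complex"
  assumes "\<And>k. k \<notin> fbox N \<Longrightarrow> f k = 0"
  shows "f \<in> bcontfun"
proof (rule bcontfun_normI)
  \<comment> \<open>The lattice is discrete, so every function on it is continuous.\<close>
  have op: "open S" for S :: "(int \<times> int) set"
  proof -
    have "S = (\<Union>k\<in>S. {fst k} \<times> {snd k})" by auto
    also have "open \<dots>" by (intro open_UN ballI open_Times open_discrete)
    finally show ?thesis .
  qed
  show "continuous_on UNIV f" by (auto simp: continuous_on_open_vimage intro: op)
  show "norm (f k) \<le> (\<Sum>j\<in>fbox N. cmod (f j))" for k
  proof (cases "k \<in> fbox N")
    case True
    then show ?thesis by (intro member_le_sum) auto
  qed (simp add: assms sum_nonneg)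
qed

lemma bounded_linear_apply_bcontfun:
  "bounded_linear (\<lambda>x :: (int \<times> int) \<Rightarrow>\<^sub>C complex. apply_bcontfun x k)"
  by (rule bounded_linear_intro[where K=1]) (simp_all add: norm_bounded plus_bcontfun.rep_eq scaleR_bcontfun.rep_eq)

section \<open>Weakly continuous and square-integrable paths\<close>

definition trunc :: "nat \<Rightarrow> fourier \<Rightarrow> fourier" where
  "trunc n f = (\<lambda>k. if k \<in> fbox n then f k else 0)"

lemma trunc_Hs: "f \<in> Hs r \<Longrightarrow> trunc n f \<in> Hs q"
  by (rule Hs_finite_support(1)[where n=n]) (auto simp: trunc_def box_minus HsD)

lemma hs_norm_tail:
  assumes f: "f \<in> Hs r"
  shows "(hs_norm r (f - trunc n f))\<^sup>2 = (hs_norm r f)\<^sup>2 - (\<Sum>k\<in>fbox n. (freq k powr r * cmod (f k))\<^sup>2)"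
proof -
  let ?F = "\<lambda>k. (freq k powr r * cmod (f k))\<^sup>2"
  have B0: "((\<lambda>k. if k \<in> fbox n then ?F k else 0) has_sum sum ?F (fbox n)) UNIV"
    by (rule has_sum_finite_neutralI[where B="fbox n"]) auto
  have "((\<lambda>k. ?F k + - (if k \<in> fbox n then ?F k else 0)) has_sum ((hs_norm r f)\<^sup>2 + - sum ?F (fbox n))) UNIV"
    unfolding hs_norm_sq by (intro has_sum_add has_sum_uminusI B0 has_sum_infsum HsD(3)[OF f])
  also have "(\<lambda>k. ?F k + - (if k \<in> fbox n then ?F k else 0)) = (\<lambda>k. (freq k powr r * cmod ((f - trunc n f) k))\<^sup>2)"
    by (rule ext) (simp add: trunc_def)
  finally show ?thesis unfolding hs_norm_sq[of r "f - trunc n f"] by (simp add: infsumI)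
qed

lemma hs_norm_tail_le: "f \<in> Hs r \<Longrightarrow> hs_norm r (f - trunc n f) \<le> hs_norm r f"
proof -
  assume f: "f \<in> Hs r"
  have "0 \<le> (\<Sum>k\<in>fbox n. (freq k powr r * cmod (f k))\<^sup>2)" by (intro sum_nonneg) simp
  then have "(hs_norm r (f - trunc n f))\<^sup>2 \<le> (hs_norm r f)\<^sup>2" using hs_norm_tail[OF f, of n] by linarith
  then show ?thesis by (rule power2_le_imp_le) (rule hs_norm_nonneg)
qed

lemma hs_norm_tail_tendsto:
  assumes f: "f \<in> Hs r" shows "(\<lambda>n. hs_norm r (f - trunc n f)) \<longlonglongrightarrow> 0"
proof -
  have "(\<lambda>n. (hs_norm r f)\<^sup>2 - (\<Sum>k\<in>fbox n. (freq k powr r * cmod (f k))\<^sup>2)) \<longlonglongrightarrow> (hs_norm r f)\<^sup>2 - (hs_norm r f)\<^sup>2"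
    unfolding hs_norm_sq by (intro tendsto_diff tendsto_const box_sum_tendsto HsD(3)[OF f])
  then have "(\<lambda>n. (hs_norm r (f - trunc n f))\<^sup>2) \<longlonglongrightarrow> 0" unfolding hs_norm_tail[OF f] by simp
  then have "(\<lambda>n. sqrt ((hs_norm r (f - trunc n f))\<^sup>2)) \<longlonglongrightarrow> sqrt 0" by (rule tendsto_real_sqrt)
  then show ?thesis by simp
qed

lemma pair_trunc: "pair f (trunc n g) = (\<Sum>k\<in>fbox n. Re (f k * cnj (g k)))"
proof -
  have "((\<lambda>k. f k * cnj (trunc n g k)) has_sum (\<Sum>k\<in>fbox n. f k * cnj (g k))) UNIV"
    by (rule has_sum_finite_neutralI[where B="fbox n"]) (auto simp: trunc_def intro!: sum.cong)
  then show ?thesis unfolding pair_def by (simp add: infsumI)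
qed

lemma topspace_Hs_weak: "topspace (Hs_weak r) \<subseteq> Hs r"
  unfolding Hs_weak_def pseudometrics_topology_def by auto

lemma CwHsD:
  assumes f: "f \<in> CwHs T r"
  shows "f \<in> extensional {0..T}" "\<And>t. t \<in> {0..T} \<Longrightarrow> f t \<in> Hs r"
    "\<And>\<psi>. \<psi> \<in> Hs (- r) \<Longrightarrow> continuous_on {0..T} (\<lambda>t. pair (f t) \<psi>)"
proof -
  have c: "continuous_map (top_of_set {0..T}) (Hs_weak r) f" and e: "f \<in> extensional {0..T}"
    using f by (auto simp: CwHs_def)
  show "f \<in> extensional {0..T}" by (rule e)
  show H: "f t \<in> Hs r" if "t \<in> {0..T}" for t
  proof -
    have "f t \<in> topspace (Hs_weak r)"
      using continuous_map_image_subset_topspace[OF c] that by auto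
    then show ?thesis using topspace_Hs_weak by blast
  qed
  fix \<psi> assume \<psi>: "\<psi> \<in> Hs (- r)"
  show "continuous_on {0..T} (\<lambda>t. pair (f t) \<psi>)"
  proof (rule continuous_onI)
    fix t and e :: real assume t: "t \<in> {0..T}" and e: "0 < e"
    define U where "U = {y \<in> Hs r. \<bar>pair (f t - y) \<psi>\<bar> < e}"
    have "openin (Hs_weak r) U"
      unfolding Hs_weak_def pseudometrics_topology_def U_def
      by (rule topology_generated_by_Basis, rule CollectI, rule exI[of _ "\<lambda>x y. \<bar>pair (x - y) \<psi>\<bar>"],
          rule exI[of _ "f t"], rule exI[of _ e])
         (intro conjI refl CollectI exI[of _ \<psi>] H[OF t] e \<psi>)
    then have "openin (top_of_set {0..T}) {x \<in> topspace (top_of_set {0..T}). f x \<in> U}"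
      using c by (rule openin_continuous_map_preimage[rotated])
    moreover have "t \<in> {x \<in> topspace (top_of_set {0..T}). f x \<in> U}"
      using t H[OF t] e by (simp add: U_def pair_diff_left[OF H[OF t] H[OF t] \<psi>])
    ultimately obtain d where d: "0 < d" "\<And>x'. x' \<in> {0..T} \<Longrightarrow> dist x' t < d \<Longrightarrow> f x' \<in> U"
      unfolding openin_euclidean_subtopology_iff by (auto simp: )
    show "\<exists>d>0. \<forall>x'\<in>{0..T}. dist x' t < d \<longrightarrow> dist (pair (f x') \<psi>) (pair (f t) \<psi>) \<le> e"
    proof (intro exI[of _ d] conjI ballI impI d(1))
      fix x' assume x': "x' \<in> {0..T}" "dist x' t < d"
      have "\<bar>pair (f t - f x') \<psi>\<bar> < e" using d(2)[OF x'] by (simp add: U_def)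
      then show "dist (pair (f x') \<psi>) (pair (f t) \<psi>) \<le> e"
        unfolding pair_diff_left[OF H[OF t] H[OF x'(1)] \<psi>] by (simp add: dist_real_def)
    qed
  qed
qed

lemma CwHsI:
  assumes e: "f \<in> extensional {0..T}" and H: "\<And>t. t \<in> {0..T} \<Longrightarrow> f t \<in> Hs r"
    and c: "\<And>\<psi>. \<psi> \<in> Hs (- r) \<Longrightarrow> continuous_on {0..T} (\<lambda>t. pair (f t) \<psi>)"
  shows "f \<in> CwHs T r"
proof -
  have "continuous_map (top_of_set {0..T}) (Hs_weak r) f"
    unfolding Hs_weak_def pseudometrics_topology_def
  proof (rule continuous_on_generated_topo)
    fix U assume "U \<in> {{y \<in> Hs r. d x y < e} |d x e. d \<in> {\<lambda>x y. \<bar>pair (x - y) \<psi>\<bar> |\<psi>. \<psi> \<in> Hs (- r)} \<and> x \<in> Hs r \<and> 0 < e}"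
    then obtain x e \<psi> where U: "U = {y \<in> Hs r. \<bar>pair (x - y) \<psi>\<bar> < e}" "x \<in> Hs r" "\<psi> \<in> Hs (- r)" by blast
    have "f -` U \<inter> topspace (top_of_set {0..T}) = {0..T} \<inter> (\<lambda>t. pair (f t) \<psi>) -` {y. \<bar>pair x \<psi> - y\<bar> < e}"
      unfolding U(1) using H pair_diff_left[OF U(2) H U(3)] by auto
    then show "openin (top_of_set {0..T}) (f -` U \<inter> topspace (top_of_set {0..T}))"
      by (simp only:) (intro continuous_openin_preimage_gen[OF c[OF U(3)]] open_Collect_less continuous_intros)
  next
    show "f ` topspace (top_of_set {0..T}) \<subseteq> \<Union> {{y \<in> Hs r. d x y < e} |d x e. d \<in> {\<lambda>x y. \<bar>pair (x - y) \<psi>\<bar> |\<psi>. \<psi> \<in> Hs (- r)} \<and> x \<in> Hs r \<and> 0 < e}"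
    proof
      fix y assume "y \<in> f ` topspace (top_of_set {0..T})"
      then have y: "y \<in> Hs r" using H by auto
      \<comment> \<open>The zero functional gives a subbasic set equal to the whole carrier, so the
        subbasis covers \<open>Hs r\<close>.\<close>
      let ?U = "{z \<in> Hs r. \<bar>pair (y - z) (\<lambda>k. 0)\<bar> < 1}"
      have "?U \<in> {{y \<in> Hs r. d x y < e} |d x e. d \<in> {\<lambda>x y. \<bar>pair (x - y) \<psi>\<bar> |\<psi>. \<psi> \<in> Hs (- r)} \<and> x \<in> Hs r \<and> 0 < e}"
        by (rule CollectI, rule exI[of _ "\<lambda>x y. \<bar>pair (x - y) (\<lambda>k. 0)\<bar>"],
            rule exI[of _ y], rule exI[of _ 1])
           (intro conjI refl CollectI exI[of _ "\<lambda>k. 0"] y Hs_zero(1) zero_less_one)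
      moreover have "y \<in> ?U" using y by (simp add: pair_def)
      ultimately show "y \<in> \<Union> {{y \<in> Hs r. d x y < e} |d x e. d \<in> {\<lambda>x y. \<bar>pair (x - y) \<psi>\<bar> |\<psi>. \<psi> \<in> Hs (- r)} \<and> x \<in> Hs r \<and> 0 < e}"
        by (rule UnionI)
    qed
  qed
  then show ?thesis using e by (simp add: CwHs_def)
qed

text \<open>The uniform norm bound makes truncation of the test element an approximation uniform in
  time, and truncated pairings are finite sums of continuous coefficients.\<close>

lemma pair_continuous:
  assumes H: "\<And>t. t \<in> {0..T} \<Longrightarrow> f t \<in> Hs r" and M: "\<And>t. t \<in> {0..T} \<Longrightarrow> hs_norm r (f t) \<le> M"
    and c: "\<And>k. continuous_on {0..T} (\<lambda>t. f t k)" and \<psi>: "\<psi> \<in> Hs (- r)"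
  shows "continuous_on {0..T} (\<lambda>t. pair (f t) \<psi>)"
proof (rule uniform_limit_theorem)
  show "\<forall>\<^sub>F n in sequentially. continuous_on {0..T} (\<lambda>t. pair (f t) (trunc n \<psi>))"
    unfolding pair_trunc by (intro always_eventually allI continuous_intros c)
  show "uniform_limit {0..T} (\<lambda>n t. pair (f t) (trunc n \<psi>)) (\<lambda>t. pair (f t) \<psi>) sequentially"
    unfolding uniform_limit_iff
  proof (intro allI impI)
    fix e :: real assume e: "0 < e"
    have "(\<lambda>n. M * hs_norm (- r) (\<psi> - trunc n \<psi>)) \<longlonglongrightarrow> M * 0"
      by (intro tendsto_intros hs_norm_tail_tendsto \<psi>)
    then have "\<forall>\<^sub>F n in sequentially. M * hs_norm (- r) (\<psi> - trunc n \<psi>) < e"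
      using e order_tendstoD(2)[of _ "M * 0"] by fastforce
    then show "\<forall>\<^sub>F n in sequentially. \<forall>t\<in>{0..T}. dist (pair (f t) (trunc n \<psi>)) (pair (f t) \<psi>) < e"
    proof eventually_elim
      case (elim n)
      show ?case
      proof
        fix t assume t: "t \<in> {0..T}"
        note d = Hs_diff(1)[OF \<psi> trunc_Hs[OF \<psi>]]
        have "\<bar>pair (f t) (\<psi> - trunc n \<psi>)\<bar> \<le> hs_norm r (f t) * hs_norm (- r) (\<psi> - trunc n \<psi>)"
          by (rule pair_bound(3)[OF H[OF t] d])
        also have "\<dots> \<le> M * hs_norm (- r) (\<psi> - trunc n \<psi>)" by (intro mult_right_mono M t) auto
        finally show "dist (pair (f t) (trunc n \<psi>)) (pair (f t) \<psi>) < e"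
          using elim unfolding pair_diff_right[OF H[OF t] \<psi> trunc_Hs[OF \<psi>]] by (simp add: dist_real_def)
      qed
    qed
  qed
qed simp

text \<open>A real trigonometric monomial. Pairing with it for \<open>z = 1\<close> and
  \<open>z = \<i>\<close> reads off the real and the imaginary part of one coefficient.\<close>

definition single_mode :: "int \<times> int \<Rightarrow> complex \<Rightarrow> fourier" where
  "single_mode k z = (\<lambda>j. if j = k then z else if j = - k then cnj z else 0)"

lemma neq_minus_self: "k \<noteq> 0 \<Longrightarrow> k \<noteq> - (k :: int \<times> int)"
  by (cases k) (auto simp: zero_prod_def)

lemma single_mode_Hs: "k \<noteq> 0 \<Longrightarrow> single_mode k z \<in> Hs r"
proof -
  assume k: "k \<noteq> 0"
  obtain n where n: "k \<in> fbox n" using ex_box by blast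
  show ?thesis
  proof (rule Hs_finite_support(1)[where n=n])
    show "single_mode k z (- j) = cnj (single_mode k z j)" for j
    proof -
      have "- j = k \<longleftrightarrow> j = - k" by auto
      then show ?thesis using neq_minus_self[OF k] unfolding single_mode_def by auto
    qed
    show "single_mode k z 0 = 0" using k by (simp add: single_mode_def)
    show "single_mode k z j = 0" if "j \<notin> fbox n" for j
    proof -
      have "j \<noteq> k" "j \<noteq> - k" using that n box_minus[of k n] by blast+
      then show ?thesis by (simp add: single_mode_def)
    qed
  qed
qed

lemma pair_single_mode:
  assumes k: "k \<noteq> 0" and f: "f (- k) = cnj (f k)"
  shows "pair f (single_mode k z) = 2 * Re (f k * cnj z)"
proof -
  have "((\<lambda>j. f j * cnj (single_mode k z j)) has_sum (\<Sum>j\<in>{k, - k}. f j * cnj (single_mode k z j))) UNIV"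
    by (rule has_sum_finite_neutralI[where B="{k, - k}"]) (auto simp: single_mode_def)
  also have "(\<Sum>j\<in>{k, - k}. f j * cnj (single_mode k z j)) = f k * cnj z + cnj (f k) * z"
    using neq_minus_self[OF k] f by (simp add: single_mode_def)
  finally have "pair f (single_mode k z) = Re (f k * cnj z + cnj (f k) * z)"
    unfolding pair_def by (simp add: infsumI)
  then show ?thesis by simp
qed

lemma Lam_single_mode: "k \<noteq> 0 \<Longrightarrow> Lam \<sigma> (single_mode k z) = single_mode k (of_real (freq k powr \<sigma>) * z)"
  by (auto simp: Lam_def single_mode_def)

lemma CwHs_coord_continuous:
  assumes f: "f \<in> CwHs T r" shows "continuous_on {0..T} (\<lambda>t. f t k)"
proof (cases "k = 0")
  case True
  have "continuous_on {0..T} (\<lambda>t. 0 :: complex)" by simp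
  then show ?thesis by (rule continuous_on_eq) (simp add: True HsD(2)[OF CwHsD(2)[OF f]])
next
  case False
  have "continuous_on {0..T} (\<lambda>t. Complex (pair (f t) (single_mode k 1) / 2) (pair (f t) (single_mode k \<i>) / 2))"
    unfolding Complex_eq by (intro continuous_intros CwHsD(3)[OF f] single_mode_Hs False) auto
  then show ?thesis
  proof (rule continuous_on_eq)
    fix t assume t: "t \<in> {0..T}"
    show "Complex (pair (f t) (single_mode k 1) / 2) (pair (f t) (single_mode k \<i>) / 2) = f t k"
      using pair_single_mode[where f="f t", OF False HsD(1)[OF CwHsD(2)[OF f t]]] by (simp add: complex_eq_iff)
  qed
qed

section \<open>Square-integrable paths in Sobolev spaces\<close>

lemma L2Hs_mono:
  assumes f: "f \<in> L2Hs T q" and r: "r \<le> q" shows "f \<in> L2Hs T r"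
proof -
  have ae: "AE t in lebesgue_on {0..T}. f t \<in> Hs q" and c: "coord_measurable T f"
    and i: "integrable (lebesgue_on {0..T}) (\<lambda>t. (hs_norm q (f t))\<^sup>2)"
    using f unfolding L2Hs_iff by blast+
  have ae': "AE t in lebesgue_on {0..T}. f t \<in> Hs r"
    using ae by eventually_elim (rule Hs_mono(1)[OF _ r])
  note [measurable] = borel_measurable_hs_norm[OF c ae']
  have "integrable (lebesgue_on {0..T}) (\<lambda>t. (hs_norm r (f t))\<^sup>2)"
  proof (rule Bochner_Integration.integrable_bound[OF i])
    show "AE t in lebesgue_on {0..T}. norm ((hs_norm r (f t))\<^sup>2) \<le> norm ((hs_norm q (f t))\<^sup>2)"
      using ae by eventually_elim (simp add: Hs_mono(2)[OF _ r] power_mono)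
  qed measurable
  then show ?thesis unfolding L2Hs_iff using ae' c by blast
qed

lemma L2Hs_norm_integrable:
  assumes f: "f \<in> L2Hs T r"
  shows "(\<lambda>t. hs_norm r (f t)) \<in> borel_measurable (lebesgue_on {0..T})"
    "integrable (lebesgue_on {0..T}) (\<lambda>t. (hs_norm r (f t))\<^sup>2)"
    "integrable (lebesgue_on {0..T}) (\<lambda>t. hs_norm r (f t))"
proof -
  have ae: "AE t in lebesgue_on {0..T}. f t \<in> Hs r" and c: "coord_measurable T f"
    and i: "integrable (lebesgue_on {0..T}) (\<lambda>t. (hs_norm r (f t))\<^sup>2)"
    using f unfolding L2Hs_iff by blast+
  interpret finite_measure "lebesgue_on {0..T}" by (rule finite_measure_lebesgue_on) simp
  show m: "(\<lambda>t. hs_norm r (f t)) \<in> borel_measurable (lebesgue_on {0..T})"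
    by (rule borel_measurable_hs_norm[OF c ae])
  show "integrable (lebesgue_on {0..T}) (\<lambda>t. (hs_norm r (f t))\<^sup>2)" by (rule i)
  show "integrable (lebesgue_on {0..T}) (\<lambda>t. hs_norm r (f t))"
    using integrable_mult_L2[OF m, of "\<lambda>_. 1"] i by simp
qed

lemma L2Hs_pair_integrable:
  assumes f: "f \<in> L2Hs T r" and g: "g \<in> L2Hs T (- r)"
  shows "integrable (lebesgue_on {0..T}) (\<lambda>t. pair (f t) (g t))"
    "\<bar>LINT t|lebesgue_on {0..T}. pair (f t) (g t)\<bar> \<le> L2Hs_norm T r f * L2Hs_norm T (- r) g"
proof -
  note F = L2Hs_norm_integrable[OF f] and G = L2Hs_norm_integrable[OF g]
  have ae: "AE t in lebesgue_on {0..T}. f t \<in> Hs r \<and> g t \<in> Hs (- r)"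
    using f g unfolding L2Hs_iff by (intro AE_conjI) blast+
  have m: "(\<lambda>t. pair (f t) (g t)) \<in> borel_measurable (lebesgue_on {0..T})"
  proof (rule borel_measurable_pair)
    show "coord_measurable T f" "coord_measurable T g" using f g unfolding L2Hs_iff by blast+
    show "AE t in lebesgue_on {0..T}. (\<lambda>k. f t k * cnj (g t k)) summable_on UNIV"
      using ae by eventually_elim (auto intro: pair_summable)
  qed
  have fg: "integrable (lebesgue_on {0..T}) (\<lambda>t. hs_norm r (f t) * hs_norm (- r) (g t))"
    by (rule integrable_mult_L2[OF F(1) G(1) F(2) G(2)])
  show i: "integrable (lebesgue_on {0..T}) (\<lambda>t. pair (f t) (g t))"
  proof (rule Bochner_Integration.integrable_bound[OF fg m])
    show "AE t in lebesgue_on {0..T}. norm (pair (f t) (g t)) \<le> norm (hs_norm r (f t) * hs_norm (- r) (g t))"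
      using ae by eventually_elim (simp add: pair_bound(3))
  qed
  have "\<bar>LINT t|lebesgue_on {0..T}. pair (f t) (g t)\<bar> \<le> (LINT t|lebesgue_on {0..T}. \<bar>pair (f t) (g t)\<bar>)"
    using integral_norm_bound[of "lebesgue_on {0..T}" "\<lambda>t. pair (f t) (g t)"] by simp
  also have "\<dots> \<le> (LINT t|lebesgue_on {0..T}. \<bar>hs_norm r (f t) * hs_norm (- r) (g t)\<bar>)"
  proof (rule integral_mono_AE)
    show "AE t in lebesgue_on {0..T}. \<bar>pair (f t) (g t)\<bar> \<le> \<bar>hs_norm r (f t) * hs_norm (- r) (g t)\<bar>"
      using ae by eventually_elim (simp add: pair_bound(3))
  qed (use i fg in auto)
  also have "\<dots> \<le> L2Hs_norm T r f * L2Hs_norm T (- r) g"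
    unfolding L2Hs_norm_def by (rule Cauchy_Schwarz_integral[OF F(1) G(1) F(2) G(2)])
  finally show "\<bar>LINT t|lebesgue_on {0..T}. pair (f t) (g t)\<bar> \<le> L2Hs_norm T r f * L2Hs_norm T (- r) g" .
qed

lemma L2Hs_Lam:
  assumes f: "f \<in> L2Hs T r" shows "(\<lambda>t. Lam \<sigma> (f t)) \<in> L2Hs T (r - \<sigma>)"
proof -
  have "AE t in lebesgue_on {0..T}. f t \<in> Hs r" using f unfolding L2Hs_iff by blast
  then have "AE t in lebesgue_on {0..T}. Lam \<sigma> (f t) \<in> Hs (r - \<sigma>)"
    by eventually_elim (rule Lam_Hs)
  then show ?thesis using f coord_measurable_Lam unfolding L2Hs_iff hs_norm_Lam by blast
qed

lemma L2Hs_diff: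
  assumes f: "f \<in> L2Hs T r" and g: "g \<in> L2Hs T r" shows "(\<lambda>t. f t - g t) \<in> L2Hs T r"
proof -
  note F = L2Hs_norm_integrable[OF f] and G = L2Hs_norm_integrable[OF g]
  have ae: "AE t in lebesgue_on {0..T}. f t \<in> Hs r \<and> g t \<in> Hs r"
    using f g unfolding L2Hs_iff by (intro AE_conjI) blast+
  then have ae': "AE t in lebesgue_on {0..T}. f t - g t \<in> Hs r"
    by eventually_elim (auto intro: Hs_diff)
  have c: "coord_measurable T (\<lambda>t. f t - g t)" using f g coord_measurable_diff unfolding L2Hs_iff by blast
  note [measurable] = borel_measurable_hs_norm[OF c ae']
  have i: "integrable (lebesgue_on {0..T}) (\<lambda>t. 2 * (hs_norm r (f t))\<^sup>2 + 2 * (hs_norm r (g t))\<^sup>2)"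
    using F G by simp
  have "integrable (lebesgue_on {0..T}) (\<lambda>t. (hs_norm r (f t - g t))\<^sup>2)"
  proof (rule Bochner_Integration.integrable_bound[OF i])
    show "AE t in lebesgue_on {0..T}. norm ((hs_norm r (f t - g t))\<^sup>2) \<le> norm (2 * (hs_norm r (f t))\<^sup>2 + 2 * (hs_norm r (g t))\<^sup>2)"
      using ae
    proof eventually_elim
      case (elim t)
      have "(hs_norm r (f t - g t))\<^sup>2 \<le> (hs_norm r (f t) + hs_norm r (g t))\<^sup>2"
        using Hs_diff(2)[of "f t" r "g t"] elim by (intro power_mono) auto
      also have "\<dots> \<le> 2 * (hs_norm r (f t))\<^sup>2 + 2 * (hs_norm r (g t))\<^sup>2"
        using sum_squares_bound[of "hs_norm r (f t)" "hs_norm r (g t)"] by (simp add: power2_sum)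
      finally show ?case by simp
    qed
  qed measurable
  then show ?thesis unfolding L2Hs_iff using ae' c by blast
qed

section \<open>Weak solutions mode by mode\<close>

definition mode_rhs :: "real \<Rightarrow> real \<Rightarrow> fourier \<Rightarrow> fourier \<Rightarrow> fourier" where
  "mode_rhs \<alpha> \<beta> f h = (\<lambda>k. - of_real (freq k powr (2 * \<alpha>)) * f k - advect f k + of_real (freq k powr (2 * \<beta>)) * h k)"

text \<open>The weak formulation tested with single Fourier modes. It mentions no Sobolev space, so
  it can be passed to limits and reversed in time before regularity is added.\<close>

definition mode_solution :: "real \<Rightarrow> real \<Rightarrow> real \<Rightarrow> (real \<Rightarrow> fourier) \<Rightarrow> (real \<Rightarrow> fourier) \<Rightarrow> bool" where
  "mode_solution \<alpha> \<beta> T g \<theta> \<longleftrightarrow> (\<forall>k. \<forall>t\<in>{0..T}.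
     \<theta> t k = \<theta> 0 k + (LINT s|lebesgue_on {0..t}. mode_rhs \<alpha> \<beta> (\<theta> s) (g s) k))"

lemma L2Hs_coord_integrable:
  assumes f: "f \<in> L2Hs T r"
  shows "integrable (lebesgue_on {0..T}) (\<lambda>t. f t k)"
proof (rule Bochner_Integration.integrable_bound)
  show "integrable (lebesgue_on {0..T}) (\<lambda>t. freq k powr (- r) * hs_norm r (f t))"
    using L2Hs_norm_integrable(3)[OF f] by simp
  show "(\<lambda>t. f t k) \<in> borel_measurable (lebesgue_on {0..T})"
    using f coord_measurableD unfolding L2Hs_iff by blast
  have "AE t in lebesgue_on {0..T}. f t \<in> Hs r" using f unfolding L2Hs_iff by blast
  then show "AE t in lebesgue_on {0..T}. norm (f t k) \<le> norm (freq k powr (- r) * hs_norm r (f t))"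
  proof eventually_elim
    case (elim t)
    have "norm (freq k powr (- r) * hs_norm r (f t)) = freq k powr (- r) * hs_norm r (f t)" by simp
    then show ?case using Hs_cmod_le[OF elim, of k] by simp
  qed
qed

lemma advect_integrable:
  assumes f: "f \<in> L2Hs T s_crit"
  shows "integrable (lebesgue_on {0..T}) (\<lambda>t. advect (f t) k)"
proof (rule Bochner_Integration.integrable_bound)
  have ae: "AE t in lebesgue_on {0..T}. f t \<in> Hs s_crit" and c: "coord_measurable T f"
    using f unfolding L2Hs_iff by blast+
  show "integrable (lebesgue_on {0..T}) (\<lambda>t. (freq k)\<^sup>2 / 2 * (hs_norm s_crit (f t))\<^sup>2)"
    using L2Hs_norm_integrable(2)[OF f] by simp
  show "(\<lambda>t. advect (f t) k) \<in> borel_measurable (lebesgue_on {0..T})"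
    by (rule coord_measurableD[OF coord_measurable_advect[OF c ae]])
  show "AE t in lebesgue_on {0..T}. norm (advect (f t) k) \<le> norm ((freq k)\<^sup>2 / 2 * (hs_norm s_crit (f t))\<^sup>2)"
    using ae
  proof eventually_elim
    case (elim t)
    have "norm ((freq k)\<^sup>2 / 2 * (hs_norm s_crit (f t))\<^sup>2) = (freq k)\<^sup>2 / 2 * (hs_norm s_crit (f t))\<^sup>2" by simp
    then show ?case using advect_bound[OF elim, of k] by simp
  qed
qed

lemma mode_rhs_integrable:
  assumes "f \<in> L2Hs T s_crit" "g \<in> L2Hs T 0"
  shows "integrable (lebesgue_on {0..T}) (\<lambda>t. mode_rhs \<alpha> \<beta> (f t) (g t) k)"
  unfolding mode_rhs_def
  by (intro Bochner_Integration.integrable_add Bochner_Integration.integrable_diff integrable_mult_right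
      L2Hs_coord_integrable[OF assms(1)] L2Hs_coord_integrable[OF assms(2)] advect_integrable[OF assms(1)])

lemma Hinf_Lam: "\<phi> \<in> Hinf \<Longrightarrow> Lam \<sigma> \<phi> \<in> Hs q"
  using Lam_Hs[OF Hinf_Hs[of \<phi> "q + \<sigma>"], of \<sigma>] by simp

lemma hs_norm_Lam': "hs_norm q (Lam \<sigma> f) = hs_norm (q + \<sigma>) f"
  using hs_norm_Lam[of "q + \<sigma>" \<sigma> f] by simp

text \<open>\<open>F\<close> is the integrand that the product rule yields in mode \<open>k\<close>;
  its sum over the modes is the integrand of the weak formulation. The bound is integrable in time
  because \<open>f\<close> enters at most quadratically, in the norm of order
  \<open>s_crit\<close>.\<close>

lemma mode_rhs_pair:
  fixes f h \<phi> \<psi> :: fourier and \<alpha> \<beta> :: real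
  assumes f: "f \<in> Hs s_crit" and h: "h \<in> Hs 0" and \<phi>: "\<phi> \<in> Hinf" and \<psi>: "\<psi> \<in> Hinf"
  defines "F \<equiv> \<lambda>k. mode_rhs \<alpha> \<beta> f h k * cnj (\<phi> k) + f k * cnj (\<psi> k)"
  shows "(\<lambda>k. cmod (F k)) summable_on UNIV"
    "(\<Sum>\<^sub>\<infinity>k. cmod (F k)) \<le> hs_norm s_crit f * hs_norm (- s_crit + 2 * \<alpha>) \<phi>
       + sqrt (\<Sum>\<^sub>\<infinity>k. (freq k powr (-2))\<^sup>2) * hs_norm 4 \<phi> * (hs_norm s_crit f)\<^sup>2
       + hs_norm 0 h * hs_norm (2 * \<beta>) \<phi> + hs_norm s_crit f * hs_norm (- s_crit) \<psi>"
    "Re (\<Sum>\<^sub>\<infinity>k. F k) = pair f \<psi> - pair f (Lam (2 * \<alpha>) \<phi>) - nonlin f \<phi> + pair (Lam (2 * \<beta>) \<phi>) h"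
proof -
  let ?A = "\<lambda>k. f k * cnj (Lam (2 * \<alpha>) \<phi> k)" and ?B = "\<lambda>k. advect f k * cnj (\<phi> k)"
    and ?C = "\<lambda>k. h k * cnj (Lam (2 * \<beta>) \<phi> k)" and ?D = "\<lambda>k. f k * cnj (\<psi> k)"
  note A = pair_bound[OF f Hinf_Lam[OF \<phi>, of "2 * \<alpha>"], unfolded hs_norm_Lam']
  note B = advect_pair_bound[OF f \<phi>]
  have h': "h \<in> Hs 0" "Lam (2 * \<beta>) \<phi> \<in> Hs (- 0)" using h Hinf_Lam[OF \<phi>] by auto
  note C = pair_bound[OF h', unfolded hs_norm_Lam']
  note D = pair_bound[OF f Hinf_Hs[OF \<psi>]]
  have F: "F k = ?D k - ?A k - ?B k + ?C k" for k
  proof (cases "k = 0")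
    case True
    then show ?thesis by (simp add: F_def mode_rhs_def Lam_def)
  next
    case False
    then show ?thesis by (simp add: F_def mode_rhs_def Lam_def algebra_simps)
  qed
  let ?W = "\<lambda>k. cmod (?A k) + cmod (?B k) + cmod (?C k) + cmod (?D k)"
  have W: "?W summable_on UNIV" by (intro summable_on_add A(1) B(1) C(1) D(1))
  have le: "cmod (F k) \<le> ?W k" for k
  proof -
    have "cmod (F k) \<le> cmod (?D k - ?A k - ?B k) + cmod (?C k)" unfolding F by (rule norm_triangle_ineq)
    also have "cmod (?D k - ?A k - ?B k) \<le> cmod (?D k - ?A k) + cmod (?B k)" by (rule norm_triangle_ineq4)
    also have "cmod (?D k - ?A k) \<le> cmod (?D k) + cmod (?A k)" by (rule norm_triangle_ineq4)
    finally show ?thesis by linarith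
  qed
  show S: "(\<lambda>k. cmod (F k)) summable_on UNIV" by (rule norm_summable_comparison(1)[OF W le])
  have "(\<Sum>\<^sub>\<infinity>k. cmod (F k)) \<le> infsum ?W UNIV" by (rule infsum_mono[OF S W le])
  also have "infsum ?W UNIV = (\<Sum>\<^sub>\<infinity>k. cmod (?A k)) + (\<Sum>\<^sub>\<infinity>k. cmod (?B k)) + (\<Sum>\<^sub>\<infinity>k. cmod (?C k)) + (\<Sum>\<^sub>\<infinity>k. cmod (?D k))"
    by (rule infsumI) (intro has_sum_add has_sum_infsum A(1) B(1) C(1) D(1))
  finally show "(\<Sum>\<^sub>\<infinity>k. cmod (F k)) \<le> hs_norm s_crit f * hs_norm (- s_crit + 2 * \<alpha>) \<phi>
       + sqrt (\<Sum>\<^sub>\<infinity>k. (freq k powr (-2))\<^sup>2) * hs_norm 4 \<phi> * (hs_norm s_crit f)\<^sup>2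
       + hs_norm 0 h * hs_norm (2 * \<beta>) \<phi> + hs_norm s_crit f * hs_norm (- s_crit) \<psi>"
    using A(2) B(2) C(2) D(2) by simp
  have "((\<lambda>k. ?D k - ?A k - ?B k + ?C k) has_sum (infsum ?D UNIV - infsum ?A UNIV - infsum ?B UNIV + infsum ?C UNIV)) UNIV"
    unfolding diff_conv_add_uminus
    by (rule has_sum_add[OF has_sum_add[OF has_sum_add[OF _ has_sum_uminusI] has_sum_uminusI]];
        rule has_sum_infsum, rule abs_summable_summable, rule A(1) B(1) C(1) D(1))
  then have "infsum F UNIV = infsum ?D UNIV - infsum ?A UNIV - infsum ?B UNIV + infsum ?C UNIV"
    by (simp only: F[symmetric] infsumI)
  then show "Re (\<Sum>\<^sub>\<infinity>k. F k) = pair f \<psi> - pair f (Lam (2 * \<alpha>) \<phi>) - nonlin f \<phi> + pair (Lam (2 * \<beta>) \<phi>) h"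
    unfolding nonlin_eq[OF f \<phi>] pair_commute[of "Lam (2 * \<beta>) \<phi>" h] by (simp add: pair_def)
qed

section \<open>Derivatives and bounds of test functions\<close>

lemma Icc_nontrivial_limit:
  fixes s T :: real assumes "s \<in> {0..T}" "0 < T" shows "at s within {0..T} \<noteq> bot"
proof -
  have "s islimpt {0..T}"
  proof (rule connected_imp_perfect)
    show "{0..T} \<noteq> {x}" for x
    proof
      assume "{0..T} = {x}"
      then have "0 \<in> {x}" "T \<in> {x}" using assms(2) by auto
      then show False using assms(2) by auto
    qed
  qed (use assms in auto)
  then show ?thesis by (simp add: trivial_limit_within)
qed

lemma Hinf_derivative_quotient_Hs:
  assumes "\<phi> u \<in> Hinf" "\<phi> s \<in> Hinf" "d \<in> Hinf"
  shows "(\<lambda>k. (\<phi> u k - \<phi> s k) / of_real (u - s) - d k) \<in> Hs r"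
proof -
  have 1: "(\<lambda>k. of_real (1 / (u - s)) * (\<phi> u - \<phi> s) k) \<in> Hs r"
    by (intro Hs_scale Hs_diff Hinf_Hs assms)
  have "(\<lambda>k. of_real (1 / (u - s)) * (\<phi> u - \<phi> s) k) - d = (\<lambda>k. (\<phi> u k - \<phi> s k) / of_real (u - s) - d k)"
    by (rule ext) simp
  then show ?thesis using Hs_diff(1)[OF 1 Hinf_Hs[OF assms(3)]] by (simp only:)
qed

lemma has_Hinf_derivative_coord:
  assumes d: "has_Hinf_derivative T \<phi> s d" and \<phi>: "\<And>u. u \<in> {0..T} \<Longrightarrow> \<phi> u \<in> Hinf" and s: "s \<in> {0..T}"
  shows "((\<lambda>u. \<phi> u k) has_vector_derivative d k) (at s within {0..T})"
proof -
  have dH: "d \<in> Hinf" and lim: "((\<lambda>u. hs_norm 1 (\<lambda>k. (\<phi> u k - \<phi> s k) / of_real (u - s) - d k)) \<longlongrightarrow> 0) (at s within {0..T})"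
    using d unfolding has_Hinf_derivative_def by (blast, force)
  have "((\<lambda>u. (\<phi> u k - \<phi> s k) / of_real (u - s) - d k) \<longlongrightarrow> 0) (at s within {0..T})"
  proof (rule Lim_null_comparison)
    show "((\<lambda>u. freq k powr (- 1) * hs_norm 1 (\<lambda>k. (\<phi> u k - \<phi> s k) / of_real (u - s) - d k)) \<longlongrightarrow> 0) (at s within {0..T})"
      by (rule tendsto_mult_right_zero[OF lim])
    have "\<forall>\<^sub>F u in at s within {0..T}. u \<in> {0..T}" by (simp add: eventually_at_filter)
    then show "\<forall>\<^sub>F u in at s within {0..T}. norm ((\<phi> u k - \<phi> s k) / of_real (u - s) - d k)
        \<le> freq k powr (- 1) * hs_norm 1 (\<lambda>k. (\<phi> u k - \<phi> s k) / of_real (u - s) - d k)"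
    proof eventually_elim
      case (elim u)
      show ?case
        by (rule Hs_cmod_le[OF Hinf_derivative_quotient_Hs[OF \<phi>[OF elim] \<phi>[OF s] dH]])
    qed
  qed
  then have lim0: "((\<lambda>u. norm ((\<phi> u k - \<phi> s k) / of_real (u - s) - d k)) \<longlongrightarrow> 0) (at s within {0..T})"
    by (rule tendsto_norm_zero)
  have "((\<lambda>u. norm (\<phi> u k - \<phi> s k - (u - s) *\<^sub>R d k) / norm (u - s)) \<longlongrightarrow> 0) (at s within {0..T})"
  proof (rule Lim_transform_eventually[OF lim0])
    have "\<forall>\<^sub>F u in at s within {0..T}. u \<noteq> s" by (simp add: eventually_at_filter)
    then show "\<forall>\<^sub>F u in at s within {0..T}. norm ((\<phi> u k - \<phi> s k) / of_real (u - s) - d k) =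
        norm (\<phi> u k - \<phi> s k - (u - s) *\<^sub>R d k) / norm (u - s)"
    proof eventually_elim
      case (elim u)
      then have "(\<phi> u k - \<phi> s k) / of_real (u - s) - d k = (\<phi> u k - \<phi> s k - (u - s) *\<^sub>R d k) / of_real (u - s)"
        by (simp add: diff_divide_distrib scaleR_conv_of_real flip: of_real_diff)
      then show ?case by (simp only: norm_divide norm_of_real real_norm_def)
    qed
  qed
  then show ?thesis
    unfolding has_vector_derivative_def has_derivative_iff_norm
    by (intro conjI bounded_linear_scaleR_left)
qed

text \<open>Lets the definite description in \<open>time_deriv\<close> denote the derivative. On a
  one-point interval every candidate would be a derivative, hence \<open>0 < T\<close>.\<close>

lemma has_Hinf_derivative_unique:
  assumes "has_Hinf_derivative T \<phi> s d" "has_Hinf_derivative T \<phi> s d'"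
    and \<phi>: "\<And>u. u \<in> {0..T} \<Longrightarrow> \<phi> u \<in> Hinf" and s: "s \<in> {0..T}" and T: "0 < T"
  shows "d = d'"
proof
  fix k
  show "d k = d' k"
    by (rule vector_derivative_unique_within[OF Icc_nontrivial_limit[OF s T]
        has_Hinf_derivative_coord[OF assms(1) \<phi> s] has_Hinf_derivative_coord[OF assms(2) \<phi> s]])
qed

lemma time_deriv_eq:
  assumes "has_Hinf_derivative T \<phi> s d" "\<And>u. u \<in> {0..T} \<Longrightarrow> \<phi> u \<in> Hinf" "s \<in> {0..T}" "0 < T"
  shows "time_deriv T \<phi> s = d"
  unfolding time_deriv_def using assms has_Hinf_derivative_unique by blast

text \<open>Differentiability in norm makes the norm a continuous function of time, and the interval
  is compact.\<close>

lemma Hinf_differentiable_bounded: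
  assumes \<phi>: "\<And>u. u \<in> {0..T} \<Longrightarrow> \<phi> u \<in> Hinf" and d: "\<And>s. s \<in> {0..T} \<Longrightarrow> \<exists>d. has_Hinf_derivative T \<phi> s d"
  shows "\<exists>B\<ge>0. \<forall>s\<in>{0..T}. hs_norm r (\<phi> s) \<le> B"
proof -
  \<comment> \<open>Derivatives are known in norms of positive order only.\<close>
  define q where "q = max r 1"
  have q: "0 < q" "r \<le> q" by (auto simp: q_def)
  have "continuous_on {0..T} (\<lambda>s. hs_norm q (\<phi> s))"
    unfolding continuous_on_def
  proof
    fix s assume s: "s \<in> {0..T}"
    obtain d where d: "has_Hinf_derivative T \<phi> s d" using d[OF s] by blast
    let ?Q = "\<lambda>u k. (\<phi> u k - \<phi> s k) / of_real (u - s) - d k"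
    have dH: "d \<in> Hinf" and lim: "((\<lambda>u. hs_norm q (?Q u)) \<longlongrightarrow> 0) (at s within {0..T})"
      using d q(1) unfolding has_Hinf_derivative_def by blast+
    have "((\<lambda>u. hs_norm q (\<phi> u) - hs_norm q (\<phi> s)) \<longlongrightarrow> 0) (at s within {0..T})"
    proof (rule Lim_null_comparison)
      have "((\<lambda>u. \<bar>u - s\<bar> * (hs_norm q (?Q u) + hs_norm q d)) \<longlongrightarrow> \<bar>s - s\<bar> * (0 + hs_norm q d)) (at s within {0..T})"
        by (intro tendsto_intros lim)
      then show "((\<lambda>u. \<bar>u - s\<bar> * (hs_norm q (?Q u) + hs_norm q d)) \<longlongrightarrow> 0) (at s within {0..T})" by simp
      have "\<forall>\<^sub>F u in at s within {0..T}. u \<in> {0..T} \<and> u \<noteq> s" by (simp add: eventually_at_filter)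
      then show "\<forall>\<^sub>F u in at s within {0..T}. norm (hs_norm q (\<phi> u) - hs_norm q (\<phi> s)) \<le> \<bar>u - s\<bar> * (hs_norm q (?Q u) + hs_norm q d)"
      proof eventually_elim
        case (elim u)
        then have u: "u \<in> {0..T}" "u \<noteq> s" by auto
        have QH: "?Q u \<in> Hs q" by (rule Hinf_derivative_quotient_Hs[OF \<phi>[OF u(1)] \<phi>[OF s] dH])
        have eq: "\<phi> u - \<phi> s = (\<lambda>k. of_real (u - s) * (?Q u k + d k))"
          by (rule ext) (use u(2) in \<open>simp add: field_simps\<close>)
        have "\<bar>hs_norm q (\<phi> u) - hs_norm q (\<phi> s)\<bar> \<le> hs_norm q (\<phi> u - \<phi> s)"
          by (intro hs_norm_abs_diff Hinf_Hs \<phi> u s)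
        also have "\<dots> = \<bar>u - s\<bar> * hs_norm q (\<lambda>k. ?Q u k + d k)" unfolding eq by (rule hs_norm_scale)
        also have "\<dots> \<le> \<bar>u - s\<bar> * (hs_norm q (?Q u) + hs_norm q d)"
          by (intro mult_left_mono Hs_add(2) QH Hinf_Hs dH) auto
        finally show ?case by simp
      qed
    qed
    then show "((\<lambda>s. hs_norm q (\<phi> s)) \<longlongrightarrow> hs_norm q (\<phi> s)) (at s within {0..T})" by (rule LIM_zero_cancel)
  qed
  then have "bounded ((\<lambda>s. hs_norm q (\<phi> s)) ` {0..T})"
    by (intro compact_imp_bounded compact_continuous_image) auto
  then obtain B where B: "\<forall>x\<in>(\<lambda>s. hs_norm q (\<phi> s)) ` {0..T}. norm x \<le> B" using bounded_iff by blast
  have "hs_norm r (\<phi> s) \<le> max B 0" if s: "s \<in> {0..T}" for s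
  proof -
    have "hs_norm r (\<phi> s) \<le> hs_norm q (\<phi> s)" by (rule Hs_mono(2)[OF Hinf_Hs[OF \<phi>[OF s]] q(2)])
    moreover have "hs_norm q (\<phi> s) \<le> B" using B s by auto
    ultimately show ?thesis by simp
  qed
  then show ?thesis by (intro exI[of _ "max B 0"]) auto
qed

lemma smooth_testD:
  assumes \<phi>: "\<phi> \<in> smooth_test T" and T: "0 < T"
  shows "\<And>s. s \<in> {0..T} \<Longrightarrow> \<phi> s \<in> Hinf" "\<And>s. s \<in> {0..T} \<Longrightarrow> time_deriv T \<phi> s \<in> Hinf"
    "\<And>s. s \<in> {0..T} \<Longrightarrow> has_Hinf_derivative T \<phi> s (time_deriv T \<phi> s)"
    "\<And>s. s \<in> {0..T} \<Longrightarrow> \<exists>d. has_Hinf_derivative T (time_deriv T \<phi>) s d"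
proof -
  have H: "\<forall>s\<in>{0..T}. \<phi> s \<in> Hinf" and D: "\<And>n s. s \<in> {0..T} \<Longrightarrow> \<exists>d. has_Hinf_derivative T ((time_deriv T ^^ n) \<phi>) s d"
    using \<phi> unfolding smooth_test_def by blast+
  show H': "\<And>s. s \<in> {0..T} \<Longrightarrow> \<phi> s \<in> Hinf" using H by blast
  show D1: "has_Hinf_derivative T \<phi> s (time_deriv T \<phi> s)" if s: "s \<in> {0..T}" for s
  proof -
    obtain d where d: "has_Hinf_derivative T \<phi> s d" using D[OF s, of 0] by auto
    then show ?thesis using time_deriv_eq[OF d H' s T] by simp
  qed
  then show "\<And>s. s \<in> {0..T} \<Longrightarrow> time_deriv T \<phi> s \<in> Hinf" unfolding has_Hinf_derivative_def by blast
  show "\<exists>d. has_Hinf_derivative T (time_deriv T \<phi>) s d" if s: "s \<in> {0..T}" for s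
    using D[OF s, of 1] by simp
qed

lemma constant_smooth_test:
  assumes c: "c \<in> Hinf" and T: "0 < T"
  shows "(\<lambda>_. c) \<in> smooth_test T" "s \<in> {0..T} \<Longrightarrow> time_deriv T (\<lambda>_. c) s = (\<lambda>k. 0)"
proof -
  have z: "(\<lambda>k. 0) \<in> Hinf" by (simp add: Hinf_def)
  have const: "has_Hinf_derivative T \<phi> s (\<lambda>k. 0)" if "\<And>u. u \<in> {0..T} \<Longrightarrow> \<phi> u = a" "s \<in> {0..T}" for \<phi> s a
  proof -
    have "((\<lambda>u. hs_norm r (\<lambda>k. (\<phi> u k - \<phi> s k) / of_real (u - s) - 0)) \<longlongrightarrow> 0) (at s within {0..T})" for r
    proof (rule tendsto_eventually)
      have "\<forall>\<^sub>F u in at s within {0..T}. u \<in> {0..T}" by (simp add: eventually_at_filter)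
      then show "\<forall>\<^sub>F u in at s within {0..T}. hs_norm r (\<lambda>k. (\<phi> u k - \<phi> s k) / of_real (u - s) - 0) = 0"
        by eventually_elim (simp add: that(1)[OF that(2)] that(1))
    qed
    then show ?thesis unfolding has_Hinf_derivative_def using z by blast
  qed
  have td: "time_deriv T \<phi> s = (\<lambda>k. 0)" if "\<And>u. u \<in> {0..T} \<Longrightarrow> \<phi> u = a" "a \<in> Hinf" "s \<in> {0..T}" for \<phi> s a
    using that by (intro time_deriv_eq[OF const[of \<phi> a]] T) auto
  show "s \<in> {0..T} \<Longrightarrow> time_deriv T (\<lambda>_. c) s = (\<lambda>k. 0)" by (rule td[of _ c]) (auto simp: c)
  \<comment> \<open>Only values on the interval are tracked: outside it, \<open>time_deriv\<close>
    is an unspecified choice.\<close>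
  have iter: "\<exists>a\<in>Hinf. \<forall>u\<in>{0..T}. (time_deriv T ^^ n) (\<lambda>_. c) u = a" for n
  proof (induction n)
    case 0
    then show ?case using c by auto
  next
    case (Suc n)
    then obtain a where a: "a \<in> Hinf" "\<forall>u\<in>{0..T}. (time_deriv T ^^ n) (\<lambda>_. c) u = a" by blast
    have "(time_deriv T ^^ Suc n) (\<lambda>_. c) u = (\<lambda>k. 0)" if "u \<in> {0..T}" for u
      using td[of "(time_deriv T ^^ n) (\<lambda>_. c)" a u] a that by simp
    then show ?case using z by blast
  qed
  show "(\<lambda>_. c) \<in> smooth_test T"
    unfolding smooth_test_def
  proof (intro CollectI conjI ballI allI)
    fix n s assume s: "s \<in> {0..T}"
    obtain a where "\<forall>u\<in>{0..T}. (time_deriv T ^^ n) (\<lambda>_. c) u = a" using iter by blast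
    then show "\<exists>d. has_Hinf_derivative T ((time_deriv T ^^ n) (\<lambda>_. c)) s d"
      using const[of _ a s] s by blast
  qed (rule c)
qed

text \<open>Test with a single mode that is constant in time: the term with the time derivative
  drops out, and two values of \<open>z\<close> recover the complex equation.\<close>

lemma weak_solution_imp_mode_solution:
  assumes w: "weak_solution \<alpha> \<beta> T g (\<theta> 0) \<theta>" and g: "g \<in> L2Hs T 0" and T: "0 < T"
    and s: "s_crit \<le> \<alpha> - 2 * \<beta>" "0 \<le> \<alpha>"
  shows "mode_solution \<alpha> \<beta> T g \<theta>"
  unfolding mode_solution_def
proof (intro allI ballI)
  fix k t assume t: "t \<in> {0..T}"
  have C: "\<theta> \<in> CwHs T (\<alpha> - 2 * \<beta>)" and L: "\<theta> \<in> L2Hs T (2 * \<alpha> - 2 * \<beta>)"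
    and eq: "\<And>\<phi> t. \<phi> \<in> smooth_test T \<Longrightarrow> t \<in> {0..T} \<Longrightarrow> pair (\<theta> t) (\<phi> t) = pair (\<theta> 0) (\<phi> 0) +
          (LINT s|lebesgue_on {0..t}.
             pair (\<theta> s) (time_deriv T \<phi> s) - pair (\<theta> s) (Lam (2*\<alpha>) (\<phi> s))
             - nonlin (\<theta> s) (\<phi> s) + pair (Lam (2*\<beta>) (\<phi> s)) (g s))"
    using w unfolding weak_solution_def by blast+
  have L': "\<theta> \<in> L2Hs T s_crit" by (rule L2Hs_mono[OF L]) (use s in linarith)
  have H: "\<theta> s \<in> Hs s_crit" if "s \<in> {0..T}" for s by (rule Hs_mono(1)[OF CwHsD(2)[OF C that] s(1)])
  have gae: "AE s in lebesgue_on {0..T}. g s \<in> Hs 0" using g unfolding L2Hs_iff by blast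
  show "\<theta> t k = \<theta> 0 k + (LINT s|lebesgue_on {0..t}. mode_rhs \<alpha> \<beta> (\<theta> s) (g s) k)"
  proof (cases "k = 0")
    case True
    have "mode_rhs \<alpha> \<beta> f h 0 = 0" for f h by (simp add: mode_rhs_def)
    then show ?thesis using True HsD(2)[OF H[OF t]] HsD(2)[OF H[of 0]] T by simp
  next
    case False
    have i: "integrable (lebesgue_on {0..t}) (\<lambda>s. mode_rhs \<alpha> \<beta> (\<theta> s) (g s) k)"
      by (rule integrable_initial[OF mode_rhs_integrable[OF L' g]]) (use t in simp)
    have key: "Re (\<theta> t k * cnj z) = Re (\<theta> 0 k * cnj z) + (LINT s|lebesgue_on {0..t}. Re (mode_rhs \<alpha> \<beta> (\<theta> s) (g s) k * cnj z))" for z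
    proof -
      let ?\<phi> = "single_mode k z"
      have \<phi>: "?\<phi> \<in> Hinf" unfolding Hinf_def using single_mode_Hs[OF False] by blast
      have pz: "pair f (\<lambda>k. 0) = 0" for f by (simp add: pair_def)
      have e: "pair (\<theta> s) (time_deriv T (\<lambda>_. ?\<phi>) s) - pair (\<theta> s) (Lam (2*\<alpha>) ?\<phi>)
             - nonlin (\<theta> s) ?\<phi> + pair (Lam (2*\<beta>) ?\<phi>) (g s) = 2 * Re (mode_rhs \<alpha> \<beta> (\<theta> s) (g s) k * cnj z)"
        if gs: "g s \<in> Hs 0" and s: "s \<in> {0..T}" for s
      proof -
        note hz = HsD(1)[OF H[OF s]]
        have "pair (\<theta> s) (Lam (2*\<alpha>) ?\<phi>) = 2 * Re (of_real (freq k powr (2 * \<alpha>)) * \<theta> s k * cnj z)"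
          unfolding Lam_single_mode[OF False] pair_single_mode[where f="\<theta> s", OF False hz] by (simp add: algebra_simps)
        moreover have "pair (Lam (2*\<beta>) ?\<phi>) (g s) = 2 * Re (of_real (freq k powr (2 * \<beta>)) * g s k * cnj z)"
          unfolding pair_commute[of _ "g s"] Lam_single_mode[OF False] pair_single_mode[where f="g s", OF False HsD(1)[OF gs]]
          by (simp add: algebra_simps)
        moreover have "nonlin (\<theta> s) ?\<phi> = 2 * Re (advect (\<theta> s) k * cnj z)"
          unfolding nonlin_eq[OF H[OF s] \<phi>]
          by (rule pair_single_mode[OF False]) (rule advect_hermitian, rule hz)
        moreover have "pair (\<theta> s) (time_deriv T (\<lambda>_. ?\<phi>) s) = 0"
          unfolding constant_smooth_test(2)[OF \<phi> T s] by (rule pz)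
        ultimately show ?thesis by (simp add: mode_rhs_def algebra_simps)
      qed
      have ae: "AE s in lebesgue_on {0..t}. g s \<in> Hs 0 \<and> s \<in> {0..T}"
        using AE_initial[OF gae, of t] AE_in_interval[of t] t by (intro AE_conjI) (auto elim: eventually_mono)
      have "(LINT s|lebesgue_on {0..t}. pair (\<theta> s) (time_deriv T (\<lambda>_. ?\<phi>) s) - pair (\<theta> s) (Lam (2*\<alpha>) ?\<phi>)
             - nonlin (\<theta> s) ?\<phi> + pair (Lam (2*\<beta>) ?\<phi>) (g s)) = (LINT s|lebesgue_on {0..t}. 2 * Re (mode_rhs \<alpha> \<beta> (\<theta> s) (g s) k * cnj z))"
      proof (rule integral_cong_AE)
        show ae': "AE s in lebesgue_on {0..t}. pair (\<theta> s) (time_deriv T (\<lambda>_. ?\<phi>) s) - pair (\<theta> s) (Lam (2*\<alpha>) ?\<phi>)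
             - nonlin (\<theta> s) ?\<phi> + pair (Lam (2*\<beta>) ?\<phi>) (g s) = 2 * Re (mode_rhs \<alpha> \<beta> (\<theta> s) (g s) k * cnj z)"
          using ae by eventually_elim (use e in blast)
        note [measurable] = borel_measurable_integrable[OF i]
        show m: "(\<lambda>s. 2 * Re (mode_rhs \<alpha> \<beta> (\<theta> s) (g s) k * cnj z)) \<in> borel_measurable (lebesgue_on {0..t})"
          by measurable
        show "(\<lambda>s. pair (\<theta> s) (time_deriv T (\<lambda>_. ?\<phi>) s) - pair (\<theta> s) (Lam (2*\<alpha>) ?\<phi>)
             - nonlin (\<theta> s) ?\<phi> + pair (Lam (2*\<beta>) ?\<phi>) (g s)) \<in> borel_measurable (lebesgue_on {0..t})"
          by (rule borel_measurable_lebesgue_on_AE[OF _ m ae']) simp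
      qed
      also have "\<dots> = 2 * (LINT s|lebesgue_on {0..t}. Re (mode_rhs \<alpha> \<beta> (\<theta> s) (g s) k * cnj z))"
        by (rule Bochner_Integration.integral_mult_right_zero)
      finally have "pair (\<theta> t) ?\<phi> = pair (\<theta> 0) ?\<phi> + 2 * (LINT s|lebesgue_on {0..t}. Re (mode_rhs \<alpha> \<beta> (\<theta> s) (g s) k * cnj z))"
        using eq[OF constant_smooth_test(1)[OF \<phi> T] t] by simp
      moreover have "0 \<in> {0..T}" using T by simp
      ultimately show ?thesis
        using pair_single_mode[where f="\<theta> t" and z=z, OF False HsD(1)[OF H[OF t]]] pair_single_mode[where f="\<theta> 0" and z=z, OF False HsD(1)[OF H]]
        by simp
    qed
    have "(LINT s|lebesgue_on {0..t}. Re (mode_rhs \<alpha> \<beta> (\<theta> s) (g s) k * cnj z)) = Re ((LINT s|lebesgue_on {0..t}. mode_rhs \<alpha> \<beta> (\<theta> s) (g s) k) * cnj z)" for z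
    proof -
      have "integrable (lebesgue_on {0..t}) (\<lambda>s. mode_rhs \<alpha> \<beta> (\<theta> s) (g s) k * cnj z)" using i by simp
      from integral_Re[OF this] show ?thesis by (simp only: integral_mult_left_zero)
    qed
    note key' = key[unfolded this]
    show ?thesis using key'[of 1] key'[of \<i>] by (simp add: complex_eq_iff)
  qed
qed

text \<open>In each mode, integration by parts multiplies the equation by the conjugate coefficient
  of the test function; dominated convergence over the boxes then sums the modes.\<close>

lemma mode_solution_imp_weak_solution:
  assumes m: "mode_solution \<alpha> \<beta> T g \<theta>" and g: "g \<in> L2Hs T 0" and T: "0 < T"
    and s: "s_crit \<le> \<alpha> - 2 * \<beta>" "0 \<le> \<alpha>"
    and R: "\<theta> \<in> LinfHs T (\<alpha> - 2 * \<beta>)" and L: "\<theta> \<in> L2Hs T (2 * \<alpha> - 2 * \<beta>)" and C: "\<theta> \<in> CwHs T (\<alpha> - 2 * \<beta>)"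
  shows "weak_solution \<alpha> \<beta> T g (\<theta> 0) \<theta>"
  unfolding weak_solution_def
proof (intro conjI IntI R L C ballI)
  show "\<theta> 0 \<in> Hs (\<alpha> - 2 * \<beta>)" using CwHsD(2)[OF C] T by simp
  fix \<phi> t assume \<phi>: "\<phi> \<in> smooth_test T" and t: "t \<in> {0..T}"
  note P = smooth_testD[OF \<phi> T]
  define \<psi> where "\<psi> = time_deriv T \<phi>"
  note P = P[folded \<psi>_def]
  have L': "\<theta> \<in> L2Hs T s_crit" by (rule L2Hs_mono[OF L]) (use s in linarith)
  have Lt: "\<theta> \<in> L2Hs t s_crit" and gt: "g \<in> L2Hs t 0" using L2Hs_initial[OF L'] L2Hs_initial[OF g] t by auto
  have H: "\<theta> s \<in> Hs s_crit" if "s \<in> {0..T}" for s by (rule Hs_mono(1)[OF CwHsD(2)[OF C that] s(1)])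
  have gae: "AE s in lebesgue_on {0..t}. g s \<in> Hs 0" using gt unfolding L2Hs_iff by blast
  have sub: "s \<in> {0..T}" if "s \<in> {0..t}" for s using that t by auto
  obtain B1 where B1: "0 \<le> B1" "\<And>s. s \<in> {0..T} \<Longrightarrow> hs_norm (- s_crit + 2 * \<alpha>) (\<phi> s) \<le> B1"
    using Hinf_differentiable_bounded[of T \<phi> "- s_crit + 2 * \<alpha>"] P by blast
  obtain B2 where B2: "0 \<le> B2" "\<And>s. s \<in> {0..T} \<Longrightarrow> hs_norm 4 (\<phi> s) \<le> B2"
    using Hinf_differentiable_bounded[of T \<phi> 4] P by blast
  obtain B3 where B3: "0 \<le> B3" "\<And>s. s \<in> {0..T} \<Longrightarrow> hs_norm (2 * \<beta>) (\<phi> s) \<le> B3"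
    using Hinf_differentiable_bounded[of T \<phi> "2 * \<beta>"] P by blast
  obtain B4 where B4: "0 \<le> B4" "\<And>s. s \<in> {0..T} \<Longrightarrow> hs_norm (- s_crit) (\<psi> s) \<le> B4"
    using Hinf_differentiable_bounded[of T \<psi> "- s_crit"] P by blast
  define S4 where "S4 = sqrt (\<Sum>\<^sub>\<infinity>k. (freq k powr (-2))\<^sup>2)"
  have S4: "0 \<le> S4" unfolding S4_def by (auto intro!: infsum_nonneg)
  \<comment> \<open>The bound of \<open>mode_rhs_pair\<close> with the norms of the test function
    replaced by bounds uniform in time.\<close>
  define w where "w s = hs_norm s_crit (\<theta> s) * B1 + S4 * B2 * (hs_norm s_crit (\<theta> s))\<^sup>2
       + hs_norm 0 (g s) * B3 + hs_norm s_crit (\<theta> s) * B4" for s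
  have w: "integrable (lebesgue_on {0..t}) w"
    unfolding w_def using L2Hs_norm_integrable[OF Lt] L2Hs_norm_integrable[OF gt] by simp
  define F where "F k s = mode_rhs \<alpha> \<beta> (\<theta> s) (g s) k * cnj (\<phi> s k) + \<theta> s k * cnj (\<psi> s k)" for k s
  have dv: "((\<lambda>u. cnj (\<phi> u k)) has_vector_derivative cnj (\<psi> s k)) (at s within {0..T})" if "s \<in> {0..T}" for s k
    by (rule has_vector_derivative_cnj) (rule has_Hinf_derivative_coord[OF P(3)[OF that] P(1) that])
  have cpsi: "continuous_on {0..T} (\<lambda>s. cnj (\<psi> s k))" for k
  proof (intro continuous_on_cnj)
    show "continuous_on {0..T} (\<lambda>s. \<psi> s k)"
      unfolding continuous_on_eq_continuous_within
    proof
      fix s assume s: "s \<in> {0..T}"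
      obtain d where "has_Hinf_derivative T \<psi> s d" using P(4)[OF s] by blast
      from has_Hinf_derivative_coord[OF this P(2) s]
      show "continuous (at s within {0..T}) (\<lambda>s. \<psi> s k)" by (rule has_vector_derivative_continuous)
    qed
  qed
  have hi: "integrable (lebesgue_on {0..t}) (\<lambda>s. cnj (\<psi> s k))" for k
    by (rule continuous_imp_integrable_real[OF continuous_on_subset[OF cpsi]]) (use t in auto)
  have ftc: "cnj (\<phi> s k) = cnj (\<phi> 0 k) + (LINT r|lebesgue_on {0..s}. cnj (\<psi> r k))" if s: "s \<in> {0..t}" for s k
  proof -
    have "((\<lambda>r. cnj (\<psi> r k)) has_integral (cnj (\<phi> s k) - cnj (\<phi> 0 k))) {0..s}"
    proof (rule fundamental_theorem_of_calculus)
      show "0 \<le> s" using s by simp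
      fix r assume "r \<in> {0..s}"
      then have "r \<in> {0..T}" using s t by auto
      then show "((\<lambda>u. cnj (\<phi> u k)) has_vector_derivative cnj (\<psi> r k)) (at r within {0..s})"
        by (rule has_vector_derivative_within_subset[OF dv]) (use s t in auto)
    qed
    then have "integral {0..s} (\<lambda>r. cnj (\<psi> r k)) = cnj (\<phi> s k) - cnj (\<phi> 0 k)" by (rule integral_unique)
    moreover have "(LINT r|lebesgue_on {0..s}. cnj (\<psi> r k)) = integral {0..s} (\<lambda>r. cnj (\<psi> r k))"
      by (rule lebesgue_integral_eq_integral[OF integrable_initial[OF hi]]) (use s in auto)
    ultimately show ?thesis by simp
  qed
  have ri: "integrable (lebesgue_on {0..t}) (\<lambda>s. mode_rhs \<alpha> \<beta> (\<theta> s) (g s) k)" for k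
    by (rule mode_rhs_integrable[OF Lt gt])
  have me: "\<theta> s k = \<theta> 0 k + (LINT r|lebesgue_on {0..s}. mode_rhs \<alpha> \<beta> (\<theta> r) (g r) k)" if "s \<in> {0..t}" for s k
    using m sub[OF that] unfolding mode_solution_def by blast
  have t0: "0 \<le> t" using t by simp
  have ibp: "integrable (lebesgue_on {0..t}) (F k)"
    "\<theta> t k * cnj (\<phi> t k) = \<theta> 0 k * cnj (\<phi> 0 k) + (LINT s|lebesgue_on {0..t}. F k s)" for k
    unfolding F_def[abs_def]
    by (rule integral_by_parts[OF ri hi _ _ t0], rule me, assumption, rule ftc, assumption)+
  have Fae: "AE s in lebesgue_on {0..t}. (\<lambda>k. cmod (F k s)) summable_on UNIV \<and> (\<Sum>\<^sub>\<infinity>k. cmod (F k s)) \<le> w s \<and>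
     Re (\<Sum>\<^sub>\<infinity>k. F k s) = pair (\<theta> s) (\<psi> s) - pair (\<theta> s) (Lam (2*\<alpha>) (\<phi> s))
             - nonlin (\<theta> s) (\<phi> s) + pair (Lam (2*\<beta>) (\<phi> s)) (g s)"
    using gae AE_in_interval[of t]
  proof eventually_elim
    case (elim s)
    then have s: "s \<in> {0..T}" using sub by blast
    note M = mode_rhs_pair[OF H[OF s] elim(1) P(1)[OF s] P(2)[OF s], of \<alpha> \<beta>, folded F_def S4_def]
    have "hs_norm s_crit (\<theta> s) * hs_norm (- s_crit + 2 * \<alpha>) (\<phi> s)
       + S4 * hs_norm 4 (\<phi> s) * (hs_norm s_crit (\<theta> s))\<^sup>2
       + hs_norm 0 (g s) * hs_norm (2 * \<beta>) (\<phi> s) + hs_norm s_crit (\<theta> s) * hs_norm (- s_crit) (\<psi> s) \<le> w s"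
      unfolding w_def using S4
      by (intro add_mono mult_left_mono mult_right_mono B1(2) B2(2) B3(2) B4(2) s) auto
    then show ?case using M by linarith
  qed
  have Fae': "AE s in lebesgue_on {0..t}. (\<lambda>k. cmod (F k s)) summable_on UNIV \<and> (\<Sum>\<^sub>\<infinity>k. cmod (F k s)) \<le> w s"
    using Fae by eventually_elim blast
  have Fm: "F k \<in> borel_measurable (lebesgue_on {0..t})" for k
    using borel_measurable_integrable[OF ibp(1)[of k]] .
  note box = integral_box_sum_tendsto[OF Fm w Fae']
  have l1: "(\<lambda>n. \<Sum>k\<in>fbox n. \<theta> t k * cnj (\<phi> t k)) \<longlonglongrightarrow> (\<Sum>\<^sub>\<infinity>k. \<theta> t k * cnj (\<phi> t k))"
    by (rule box_sum_tendsto[OF pair_summable[OF H[OF t] Hinf_Hs[OF P(1)[OF t]]]])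
  have z: "0 \<in> {0..T}" using T by simp
  have l2: "(\<lambda>n. \<Sum>k\<in>fbox n. \<theta> 0 k * cnj (\<phi> 0 k)) \<longlonglongrightarrow> (\<Sum>\<^sub>\<infinity>k. \<theta> 0 k * cnj (\<phi> 0 k))"
    by (rule box_sum_tendsto[OF pair_summable[OF H[OF z] Hinf_Hs[OF P(1)[OF z]]]])
  have "(\<lambda>n. \<Sum>k\<in>fbox n. \<theta> t k * cnj (\<phi> t k)) \<longlonglongrightarrow> (\<Sum>\<^sub>\<infinity>k. \<theta> 0 k * cnj (\<phi> 0 k)) + (LINT s|lebesgue_on {0..t}. (\<Sum>\<^sub>\<infinity>k. F k s))"
    unfolding ibp(2) sum.distrib by (intro tendsto_add l2 box(3))
  then have E: "(\<Sum>\<^sub>\<infinity>k. \<theta> t k * cnj (\<phi> t k)) = (\<Sum>\<^sub>\<infinity>k. \<theta> 0 k * cnj (\<phi> 0 k)) + (LINT s|lebesgue_on {0..t}. (\<Sum>\<^sub>\<infinity>k. F k s))"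
    by (rule LIMSEQ_unique[OF l1])
  have "Re (LINT s|lebesgue_on {0..t}. (\<Sum>\<^sub>\<infinity>k. F k s)) = (LINT s|lebesgue_on {0..t}. Re (\<Sum>\<^sub>\<infinity>k. F k s))"
    using box(1) by (rule integral_Re[symmetric])
  also have "\<dots> = (LINT s|lebesgue_on {0..t}. pair (\<theta> s) (\<psi> s) - pair (\<theta> s) (Lam (2*\<alpha>) (\<phi> s))
             - nonlin (\<theta> s) (\<phi> s) + pair (Lam (2*\<beta>) (\<phi> s)) (g s))"
  proof (rule integral_cong_AE)
    show m: "(\<lambda>s. Re (\<Sum>\<^sub>\<infinity>k. F k s)) \<in> borel_measurable (lebesgue_on {0..t})"
      using borel_measurable_integrable[OF box(1)] by measurable
    show ae: "AE s in lebesgue_on {0..t}. Re (\<Sum>\<^sub>\<infinity>k. F k s) = pair (\<theta> s) (\<psi> s) - pair (\<theta> s) (Lam (2*\<alpha>) (\<phi> s))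
             - nonlin (\<theta> s) (\<phi> s) + pair (Lam (2*\<beta>) (\<phi> s)) (g s)"
      using Fae by eventually_elim blast
    \<comment> \<open>Measurability of the weak integrand is inherited from the mode sum, with which
      it agrees almost everywhere.\<close>
    show "(\<lambda>s. pair (\<theta> s) (\<psi> s) - pair (\<theta> s) (Lam (2*\<alpha>) (\<phi> s))
             - nonlin (\<theta> s) (\<phi> s) + pair (Lam (2*\<beta>) (\<phi> s)) (g s)) \<in> borel_measurable (lebesgue_on {0..t})"
    proof (rule borel_measurable_lebesgue_on_AE[OF _ m])
      show "AE s in lebesgue_on {0..t}. pair (\<theta> s) (\<psi> s) - pair (\<theta> s) (Lam (2*\<alpha>) (\<phi> s))
             - nonlin (\<theta> s) (\<phi> s) + pair (Lam (2*\<beta>) (\<phi> s)) (g s) = Re (\<Sum>\<^sub>\<infinity>k. F k s)"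
        using ae by eventually_elim (rule sym)
    qed simp
  qed
  finally show "pair (\<theta> t) (\<phi> t) = pair (\<theta> 0) (\<phi> 0) +
          (LINT s|lebesgue_on {0..t}.
             pair (\<theta> s) (time_deriv T \<phi> s) - pair (\<theta> s) (Lam (2*\<alpha>) (\<phi> s))
             - nonlin (\<theta> s) (\<phi> s) + pair (Lam (2*\<beta>) (\<phi> s)) (g s))"
    unfolding \<psi>_def[symmetric] using arg_cong[OF E, of Re] by (simp add: pair_def)
qed

section \<open>Galerkin approximation\<close>

text \<open>Bounded functions on the index set are handled by the Banach space \<open>bcontfun\<close>, whose
  completeness is only available over metric spaces.\<close>

instantiation int :: metric_space
begin

definition dist_int :: "int \<Rightarrow> int \<Rightarrow> real" where
  "dist_int m n = \<bar>real_of_int m - real_of_int n\<bar>"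

definition uniformity_int :: "(int \<times> int) filter" where
  "uniformity_int = (INF e\<in>{0 <..}. principal {(x, y). dist x y < e})"

instance
proof
  show "open U \<longleftrightarrow> (\<forall>x\<in>U. \<forall>\<^sub>F (x', y) in uniformity. x' = x \<longrightarrow> y \<in> U)" for U :: "int set"
  proof -
    have "\<forall>\<^sub>F (x', y) in uniformity. x' = x \<longrightarrow> y \<in> U" if "x \<in> U" for x
      unfolding uniformity_int_def
    proof (rule eventually_INF1[of 1])
      have "x = y" if "\<bar>real_of_int x - real_of_int y\<bar> < 1" for x y using that by linarith
      then show "\<forall>\<^sub>F (x', y) in principal {(x, y). dist x y < 1}. x' = x \<longrightarrow> y \<in> U"
        using that unfolding eventually_principal dist_int_def by blast
    qed simp
    then show ?thesis by (simp add: open_discrete)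
  qed
qed (auto simp: dist_int_def uniformity_int_def)

end

instance bcontfun :: (metric_space, banach) banach ..

text \<open>The Galerkin vector field is made globally Lipschitz by retracting the argument of the
  quadratic term onto a ball. The retraction only rescales by a positive factor, so the
  energy identity still holds and shows that the ball is never left. Averaging with the reflected
  conjugate enforces Hermitian symmetry.\<close>

definition hermitize :: "nat \<Rightarrow> ((int \<times> int) \<Rightarrow>\<^sub>C complex) \<Rightarrow> fourier" where
  "hermitize N x = (\<lambda>k. if k \<in> fbox N \<and> k \<noteq> 0 then (apply_bcontfun x k + cnj (apply_bcontfun x (- k))) / 2 else 0)"

definition galerkin_field :: "real \<Rightarrow> nat \<Rightarrow> real \<Rightarrow> ((int \<times> int) \<Rightarrow>\<^sub>C complex) \<Rightarrow> fourier" where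
  "galerkin_field \<alpha> N R x = (\<lambda>k. if k \<in> fbox N then
     - of_real (freq k powr (2 * \<alpha>)) * hermitize N x k - advect (hermitize N (retract R x)) k else 0)"

lemma hermitize_props:
  "hermitize N x (- k) = cnj (hermitize N x k)" "hermitize N x 0 = 0" "k \<notin> fbox N \<Longrightarrow> hermitize N x k = 0"
  by (auto simp: hermitize_def box_minus add.commute)

lemma hermitize_diff: "hermitize N x k - hermitize N y k = hermitize N (x - y) k"
  by (simp add: hermitize_def minus_bcontfun.rep_eq field_simps)

lemma hermitize_scaleR: "hermitize N (c *\<^sub>R x) k = of_real c * hermitize N x k"
  by (simp add: hermitize_def scaleR_bcontfun.rep_eq scaleR_conv_of_real field_simps)

lemma hermitize_le: "cmod (hermitize N x k) \<le> norm x"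
proof (cases "k \<in> fbox N \<and> k \<noteq> 0")
  case True
  have "cmod (hermitize N x k) = cmod (apply_bcontfun x k + cnj (apply_bcontfun x (- k))) / 2"
    using True by (simp add: hermitize_def norm_divide)
  also have "\<dots> \<le> (cmod (apply_bcontfun x k) + cmod (cnj (apply_bcontfun x (- k)))) / 2"
    by (intro divide_right_mono norm_triangle_ineq) simp
  also have "\<dots> \<le> norm x" using norm_bounded[of x k] norm_bounded[of x "- k"] by simp
  finally show ?thesis .
qed (auto simp: hermitize_def)

lemma hermitize_Hs: "hermitize N x \<in> Hs r"
  by (rule Hs_finite_support(1)[where n=N]) (auto simp: hermitize_props)

lemma hs_norm_hermitize_le:
  "hs_norm r (hermitize N x) \<le> sqrt (\<Sum>k\<in>fbox N. (freq k powr r)\<^sup>2) * norm x"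
proof -
  have "(hs_norm r (hermitize N x))\<^sup>2 = (\<Sum>k\<in>fbox N. (freq k powr r * cmod (hermitize N x k))\<^sup>2)"
    by (rule Hs_finite_support(2)) (auto simp: hermitize_props)
  also have "\<dots> \<le> (\<Sum>k\<in>fbox N. (freq k powr r * norm x)\<^sup>2)"
    by (intro sum_mono power_mono mult_left_mono hermitize_le) auto
  also have "\<dots> = (sqrt (\<Sum>k\<in>fbox N. (freq k powr r)\<^sup>2) * norm x)\<^sup>2"
    by (simp add: power_mult_distrib sum_distrib_right sum_nonneg)
  finally show ?thesis
    by (rule power2_le_imp_le) (simp add: sum_nonneg)
qed

lemma galerkin_field_bcontfun: "galerkin_field \<alpha> N R x \<in> bcontfun"
  by (rule finite_support_bcontfun[of N]) (simp add: galerkin_field_def)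

lemma galerkin_field_Lipschitz:
  assumes R: "0 < R"
  shows "\<exists>L>0. \<forall>x y. norm (Bcontfun (galerkin_field \<alpha> N R x) - Bcontfun (galerkin_field \<alpha> N R y)) \<le> L * norm (x - y)"
proof -
  define C where "C = sqrt (\<Sum>k\<in>fbox N. (freq k powr s_crit)\<^sup>2)"
  have C: "0 \<le> C" unfolding C_def by (simp add: sum_nonneg)
  \<comment> \<open>Each coefficient bound is dominated by the sum over the box. The factor
    \<open>4 * C^2 * R\<close> collects \<open>2 * C * R\<close>, from the norms of both retracted
    arguments, and \<open>2 * C * norm (x - y)\<close>, from their difference.\<close>
  define L where "L = (\<Sum>k\<in>fbox N. freq k powr (2 * \<alpha>) + (freq k)\<^sup>2 / 2 * (4 * C\<^sup>2 * R)) + 1"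
  have nn: "0 \<le> freq k powr (2 * \<alpha>) + (freq k)\<^sup>2 / 2 * (4 * C\<^sup>2 * R)" for k using R by simp
  have L: "0 < L" unfolding L_def using nn by (intro add_nonneg_pos sum_nonneg) auto
  have "norm (Bcontfun (galerkin_field \<alpha> N R x) - Bcontfun (galerkin_field \<alpha> N R y)) \<le> L * norm (x - y)" for x y
  proof (rule norm_bound)
    fix k
    have ap: "apply_bcontfun (Bcontfun (galerkin_field \<alpha> N R x) - Bcontfun (galerkin_field \<alpha> N R y)) k =
        galerkin_field \<alpha> N R x k - galerkin_field \<alpha> N R y k"
      by (simp add: minus_bcontfun.rep_eq Bcontfun_inverse[OF galerkin_field_bcontfun])
    show "norm (apply_bcontfun (Bcontfun (galerkin_field \<alpha> N R x) - Bcontfun (galerkin_field \<alpha> N R y)) k) \<le> L * norm (x - y)"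
    proof (cases "k \<in> fbox N")
      case False
      then show ?thesis using L unfolding ap by (simp add: galerkin_field_def)
    next
      case True
      let ?a = "hermitize N (retract R x)" and ?b = "hermitize N (retract R y)"
      have ab: "?a - ?b = hermitize N (retract R x - retract R y)"
        by (rule ext) (simp add: hermitize_diff)
      have na: "hs_norm s_crit (hermitize N (retract R z)) \<le> C * R" for z
        using hs_norm_hermitize_le[of s_crit N "retract R z"] norm_retract[of R z] R C
        unfolding C_def[symmetric] by (meson less_imp_le mult_left_mono order_trans)
      have nd: "hs_norm s_crit (?a - ?b) \<le> C * (2 * norm (x - y))"
        unfolding ab using hs_norm_hermitize_le[of s_crit N "retract R x - retract R y"] retract_Lipschitz[OF R, of x y] C
        unfolding C_def[symmetric] by (meson mult_left_mono order_trans)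
      have adv: "cmod (advect ?a k - advect ?b k) \<le> (freq k)\<^sup>2 / 2 * ((C * R + C * R) * (C * (2 * norm (x - y))))"
        by (rule order_trans[OF advect_diff_bound[OF hermitize_Hs hermitize_Hs]])
           (use R C in \<open>intro mult_left_mono mult_mono add_mono na nd; simp\<close>)
      have "galerkin_field \<alpha> N R x k - galerkin_field \<alpha> N R y k =
          - (of_real (freq k powr (2 * \<alpha>)) * hermitize N (x - y) k) - (advect ?a k - advect ?b k)"
        using True unfolding hermitize_diff[symmetric] by (simp add: galerkin_field_def algebra_simps)
      then have "cmod (galerkin_field \<alpha> N R x k - galerkin_field \<alpha> N R y k) \<le>
          cmod (- (of_real (freq k powr (2 * \<alpha>)) * hermitize N (x - y) k)) + cmod (advect ?a k - advect ?b k)"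
        by (metis norm_triangle_ineq4)
      also have "cmod (- (of_real (freq k powr (2 * \<alpha>)) * hermitize N (x - y) k)) \<le> freq k powr (2 * \<alpha>) * norm (x - y)"
        unfolding norm_minus_cancel norm_mult by (simp add: mult_left_mono hermitize_le)
      also have "freq k powr (2 * \<alpha>) * norm (x - y) + cmod (advect ?a k - advect ?b k)
          \<le> freq k powr (2 * \<alpha>) * norm (x - y) + (freq k)\<^sup>2 / 2 * ((C * R + C * R) * (C * (2 * norm (x - y))))"
        using adv by simp
      also have "\<dots> = (freq k powr (2 * \<alpha>) + (freq k)\<^sup>2 / 2 * (4 * C\<^sup>2 * R)) * norm (x - y)"
        by (simp add: algebra_simps power2_eq_square)
      also have "\<dots> \<le> L * norm (x - y)"
      proof (rule mult_right_mono)
        have "freq k powr (2 * \<alpha>) + (freq k)\<^sup>2 / 2 * (4 * C\<^sup>2 * R) \<le> (\<Sum>k\<in>fbox N. freq k powr (2 * \<alpha>) + (freq k)\<^sup>2 / 2 * (4 * C\<^sup>2 * R))"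
          using True nn by (intro member_le_sum) auto
        then show "freq k powr (2 * \<alpha>) + (freq k)\<^sup>2 / 2 * (4 * C\<^sup>2 * R) \<le> L" unfolding L_def by linarith
      qed simp
      finally show ?thesis unfolding ap by simp
    qed
  qed
  then show ?thesis using L by blast
qed

text \<open>The control enters by its primitive, so the truncated system is a fixed point equation
  with continuous forcing. The scalar \<open>c\<close> records the cut-off of the quadratic term and
  is 1 while no coefficient exceeds \<open>R\<close>.\<close>

lemma galerkin_cutoff_exists:
  assumes R: "0 < R" and T: "0 \<le> T" and \<theta>0: "\<theta>0 \<in> Hs r" and g: "g \<in> L2Hs T 0"
  shows "\<exists>x c. (\<forall>k. continuous_on {0..T} (\<lambda>t. x t k)) \<and>
    (\<forall>t\<in>{0..T}. (\<forall>k. x t (- k) = cnj (x t k)) \<and> x t 0 = 0 \<and> (\<forall>k. k \<notin> fbox N \<longrightarrow> x t k = 0)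
      \<and> ((\<forall>k. cmod (x t k) \<le> R) \<longrightarrow> c t = 1)) \<and>
    (\<forall>k\<in>fbox N. continuous_on {0..T} (\<lambda>t. of_real (c t) * advect (x t) k) \<and>
      (\<forall>t\<in>{0..T}. x t k = \<theta>0 k + (LINT s|lebesgue_on {0..t}.
        - of_real (freq k powr (2 * \<alpha>)) * x s k - of_real (c s) * advect (x s) k + of_real (freq k powr (2 * \<beta>)) * g s k)))"
proof -
  define \<gamma> where "\<gamma> t k = (LINT s|lebesgue_on {0..t}. of_real (freq k powr (2 * \<beta>)) * g s k)" for t k
  define Gf where "Gf t = (\<lambda>k. if k \<in> fbox N then \<theta>0 k + \<gamma> t k else 0)" for t
  define G where "G t = Bcontfun (Gf t)" for t
  have Gb: "Gf t \<in> bcontfun" for t by (rule finite_support_bcontfun[of N]) (simp add: Gf_def)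
  have Gap: "apply_bcontfun (G t) = Gf t" for t unfolding G_def by (rule Bcontfun_inverse[OF Gb])
  have gi: "integrable (lebesgue_on {0..T}) (\<lambda>s. of_real (freq k powr (2 * \<beta>)) * g s k)" for k
    using L2Hs_coord_integrable[OF g] by simp
  have \<gamma>c: "continuous_on {0..T} (\<lambda>t. \<gamma> t k)" for k
    unfolding \<gamma>_def by (rule indefinite_integral_continuous_real[OF gi])
  have Gc: "continuous_on {0..T} G"
    unfolding continuous_on_def
  proof
    fix t assume t: "t \<in> {0..T}"
    have "((\<lambda>u. G u - G t) \<longlongrightarrow> 0) (at t within {0..T})"
    proof (rule Lim_null_comparison)
      have "((\<lambda>u. \<Sum>k\<in>fbox N. cmod (\<gamma> u k - \<gamma> t k)) \<longlongrightarrow> (\<Sum>k\<in>fbox N. cmod (\<gamma> t k - \<gamma> t k))) (at t within {0..T})"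
        using \<gamma>c t unfolding continuous_on_def by (intro tendsto_intros) blast
      then show "((\<lambda>u. \<Sum>k\<in>fbox N. cmod (\<gamma> u k - \<gamma> t k)) \<longlongrightarrow> 0) (at t within {0..T})" by simp
      show "\<forall>\<^sub>F u in at t within {0..T}. norm (G u - G t) \<le> (\<Sum>k\<in>fbox N. cmod (\<gamma> u k - \<gamma> t k))"
      proof (intro always_eventually allI norm_bound)
        fix u k
        show "norm (apply_bcontfun (G u - G t) k) \<le> (\<Sum>k\<in>fbox N. cmod (\<gamma> u k - \<gamma> t k))"
        proof (cases "k \<in> fbox N")
          case True
          have "norm (apply_bcontfun (G u - G t) k) = cmod (\<gamma> u k - \<gamma> t k)"
            using True by (simp add: minus_bcontfun.rep_eq Gap Gf_def)
          also have "\<dots> \<le> (\<Sum>k\<in>fbox N. cmod (\<gamma> u k - \<gamma> t k))"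
            by (rule member_le_sum[OF True]) auto
          finally show ?thesis .
        qed (simp add: minus_bcontfun.rep_eq Gap Gf_def sum_nonneg)
      qed
    qed
    then show "(G \<longlongrightarrow> G t) (at t within {0..T})" by (rule LIM_zero_cancel)
  qed
  let ?V = "\<lambda>x. Bcontfun (galerkin_field \<alpha> N R x)"
  obtain L where L: "0 < L" "\<And>x y. norm (?V x - ?V y) \<le> L * norm (x - y)"
    using galerkin_field_Lipschitz[OF R, of \<alpha> N] by blast
  obtain y where yc: "continuous_on {0..T} y"
    and y: "\<And>t. t \<in> {0..T} \<Longrightarrow> y t = G t + integral {0..t} (\<lambda>s. ?V (y s))"
    using Picard_Lindelof_integral[where F="?V" and L=L and G=G and T=T] L Gc T by blast
  have Vc: "continuous_on UNIV ?V"
  proof (rule continuous_onI)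
    fix x and e :: real assume "0 < e"
    show "\<exists>d>0. \<forall>x'\<in>UNIV. dist x' x < d \<longrightarrow> dist (?V x') (?V x) \<le> e"
    proof (intro exI[of _ "e / L"] conjI ballI impI)
      fix x' assume "dist x' x < e / L"
      then have "L * norm (x' - x) \<le> e" using L(1) by (simp add: dist_norm field_simps)
      then show "dist (?V x') (?V x) \<le> e" using L(2)[of x' x] by (simp add: dist_norm)
    qed (use \<open>0 < e\<close> L in simp)
  qed
  have Vyc: "continuous_on {0..T} (\<lambda>s. ?V (y s))"
    by (rule continuous_on_compose2[OF Vc yc]) simp
  have coordc: "continuous_on {0..T} (\<lambda>s. apply_bcontfun (z s) k)" if "continuous_on {0..T} z" for z :: "real \<Rightarrow> (int \<times> int) \<Rightarrow>\<^sub>C complex" and k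
    by (rule bounded_linear.continuous_on[OF bounded_linear_apply_bcontfun that])
  have gfc: "continuous_on {0..T} (\<lambda>s. galerkin_field \<alpha> N R (y s) k)" for k
    using coordc[OF Vyc, of k] by (simp add: Bcontfun_inverse[OF galerkin_field_bcontfun])
  have gfi: "integrable (lebesgue_on {0..t}) (\<lambda>s. galerkin_field \<alpha> N R (y s) k)" if "t \<in> {0..T}" for t k
    by (rule continuous_imp_integrable_real[OF continuous_on_subset[OF gfc]]) (use that in auto)
  have yk: "apply_bcontfun (y t) k = Gf t k + (LINT s|lebesgue_on {0..t}. galerkin_field \<alpha> N R (y s) k)" if t: "t \<in> {0..T}" for t k
  proof -
    have i: "(\<lambda>s. ?V (y s)) integrable_on {0..t}"
      by (rule integrable_continuous_real[OF continuous_on_subset[OF Vyc]]) (use t in auto)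
    have "apply_bcontfun (integral {0..t} (\<lambda>s. ?V (y s))) k = integral {0..t} (\<lambda>s. apply_bcontfun (?V (y s)) k)"
      using integral_linear[OF i bounded_linear_apply_bcontfun[of k]] by (simp add: o_def)
    also have "\<dots> = (LINT s|lebesgue_on {0..t}. galerkin_field \<alpha> N R (y s) k)"
      unfolding Bcontfun_inverse[OF galerkin_field_bcontfun]
      by (rule lebesgue_integral_eq_integral[OF gfi[OF t], symmetric]) simp
    finally have "apply_bcontfun (integral {0..t} (\<lambda>s. ?V (y s))) k = (LINT s|lebesgue_on {0..t}. galerkin_field \<alpha> N R (y s) k)" .
    then show ?thesis using y[OF t] by (simp add: plus_bcontfun.rep_eq Gap)
  qed
  have gae: "AE s in lebesgue_on {0..T}. g s \<in> Hs 0" using g unfolding L2Hs_iff by blast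
  \<comment> \<open>Vector field, initial data and forcing all respect conjugate reflection, so the
    solution inherits Hermitian symmetry from its own integral equation.\<close>
  have gf_herm: "galerkin_field \<alpha> N R z (- k) = cnj (galerkin_field \<alpha> N R z k)" for z k
    unfolding galerkin_field_def box_minus hermitize_props(1) freq_minus
      advect_hermitian[where f="hermitize N (retract R z)" for z, OF hermitize_props(1)] by simp
  have \<gamma>_herm: "\<gamma> t (- k) = cnj (\<gamma> t k)" if t: "t \<in> {0..T}" for t k
  proof -
    have i: "integrable (lebesgue_on {0..t}) (\<lambda>s. of_real (freq k powr (2 * \<beta>)) * g s k)" for k
      by (rule integrable_initial[OF gi]) (use t in simp)
    have "\<gamma> t (- k) = (LINT s|lebesgue_on {0..t}. cnj (of_real (freq k powr (2 * \<beta>)) * g s k))"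
      unfolding \<gamma>_def
    proof (rule integral_cong_AE)
      show "(\<lambda>s. of_real (freq (- k) powr (2 * \<beta>)) * g s (- k)) \<in> borel_measurable (lebesgue_on {0..t})"
        by (rule borel_measurable_integrable[OF i])
      show "(\<lambda>s. cnj (of_real (freq k powr (2 * \<beta>)) * g s k)) \<in> borel_measurable (lebesgue_on {0..t})"
        using integrable_cnj[OF i[of k]] by (rule borel_measurable_integrable)
      show "AE s in lebesgue_on {0..t}. of_real (freq (- k) powr (2 * \<beta>)) * g s (- k) = cnj (of_real (freq k powr (2 * \<beta>)) * g s k)"
      proof (rule eventually_mono)
        show "AE s in lebesgue_on {0..t}. g s \<in> Hs 0" by (rule AE_initial[OF gae]) (use t in simp)
      qed (simp add: HsD(1)[where r=0])
    qed
    also have "\<dots> = cnj (\<gamma> t k)" unfolding \<gamma>_def by (rule Bochner_Integration.integral_cnj)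
    finally show ?thesis .
  qed
  define x where "x t = apply_bcontfun (y t)" for t
  have x_supp: "x t k = 0" if "t \<in> {0..T}" "k \<notin> fbox N" for t k
    unfolding x_def yk[OF that(1)] using that(2) by (simp add: Gf_def galerkin_field_def)
  have x0: "x t 0 = 0" if t: "t \<in> {0..T}" for t
    unfolding x_def yk[OF t] by (simp add: Gf_def galerkin_field_def \<gamma>_def HsD(2)[OF \<theta>0] hermitize_props(2))
  have x_herm: "x t (- k) = cnj (x t k)" if t: "t \<in> {0..T}" for t k
  proof -
    have "(LINT s|lebesgue_on {0..t}. galerkin_field \<alpha> N R (y s) (- k)) = cnj (LINT s|lebesgue_on {0..t}. galerkin_field \<alpha> N R (y s) k)"
      unfolding gf_herm by (rule Bochner_Integration.integral_cnj)
    then show ?thesis unfolding x_def yk[OF t]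
      by (simp add: Gf_def box_minus \<gamma>_herm[OF t] HsD(1)[OF \<theta>0])
  qed
  \<comment> \<open>The solution is already Hermitian and supported in the box, so symmetrising it
    changes nothing.\<close>
  have hx: "hermitize N (y t) = x t" if t: "t \<in> {0..T}" for t
  proof
    fix k
    show "hermitize N (y t) k = x t k"
      using x_herm[OF t, of k] x0[OF t] x_supp[OF t, of k] by (auto simp: hermitize_def x_def)
  qed
  \<comment> \<open>The square appears because \<open>advect\<close> is homogeneous of degree
    two.\<close>
  define c where "c t = (if norm (y t) \<le> R then 1 else (R / norm (y t))\<^sup>2)" for t
  have adv: "advect (hermitize N (retract R (y t))) k = of_real (c t) * advect (x t) k" if t: "t \<in> {0..T}" for t k
  proof (cases "norm (y t) \<le> R")
    case True
    then show ?thesis using hx[OF t] by (simp add: c_def retract_def)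
  next
    case False
    define \<rho> where "\<rho> = R / norm (y t)"
    have "hermitize N (retract R (y t)) = (\<lambda>k. of_real \<rho> * x t k)"
      using False by (simp add: retract_def \<rho>_def[symmetric] hermitize_scaleR[abs_def] hx[OF t])
    moreover have "advect (\<lambda>k. of_real \<rho> * f k) k = of_real (\<rho>\<^sup>2) * advect f k" for f
    proof -
      have "advect (\<lambda>k. of_real \<rho> * f k) k = (\<Sum>\<^sub>\<infinity>l. of_real (\<rho>\<^sup>2) * (of_real (sym k l) * f l * f (k - l)))"
        unfolding advect_def advect2_def by (rule infsum_cong) (simp add: power2_eq_square mult_ac)
      also have "\<dots> = of_real (\<rho>\<^sup>2) * advect f k" unfolding advect_def advect2_def by (rule infsum_cmult_right')
      finally show ?thesis .
    qed
    ultimately show ?thesis using False by (simp add: c_def \<rho>_def)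
  qed
  have gf: "galerkin_field \<alpha> N R (y t) k = - of_real (freq k powr (2 * \<alpha>)) * x t k - of_real (c t) * advect (x t) k"
    if "t \<in> {0..T}" "k \<in> fbox N" for t k
    unfolding galerkin_field_def using that by (simp add: hx adv)
  have xc: "continuous_on {0..T} (\<lambda>t. x t k)" for k unfolding x_def by (rule coordc[OF yc])
  show ?thesis
  proof (rule exI[of _ x], rule exI[of _ c], intro conjI allI ballI impI)
    show "continuous_on {0..T} (\<lambda>t. x t k)" for k by (rule xc)
    fix t assume t: "t \<in> {0..T}"
    show "x t (- k) = cnj (x t k)" for k by (rule x_herm[OF t])
    show "x t 0 = 0" by (rule x0[OF t])
    show "x t k = 0" if "k \<notin> fbox N" for k by (rule x_supp[OF t that])
    show "c t = 1" if "\<forall>k. cmod (x t k) \<le> R"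
    proof -
      have "norm (y t) \<le> R" by (rule norm_bound) (use that in \<open>simp add: x_def\<close>)
      then show ?thesis by (simp add: c_def)
    qed
  next
    fix k assume k: "k \<in> fbox N"
    have "continuous_on {0..T} (\<lambda>t. - of_real (freq k powr (2 * \<alpha>)) * x t k - galerkin_field \<alpha> N R (y t) k)"
      by (intro continuous_intros xc gfc)
    then show "continuous_on {0..T} (\<lambda>t. of_real (c t) * advect (x t) k)"
      by (rule continuous_on_eq) (use k in \<open>simp add: gf\<close>)
    fix t assume t: "t \<in> {0..T}"
    have i: "integrable (lebesgue_on {0..t}) (\<lambda>s. of_real (freq k powr (2 * \<beta>)) * g s k)"
      by (rule integrable_initial[OF gi]) (use t in simp)
    have "x t k = \<theta>0 k + ((LINT s|lebesgue_on {0..t}. galerkin_field \<alpha> N R (y s) k) + (LINT s|lebesgue_on {0..t}. of_real (freq k powr (2 * \<beta>)) * g s k))"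
      unfolding x_def yk[OF t] using k by (simp add: Gf_def \<gamma>_def)
    also have "(LINT s|lebesgue_on {0..t}. galerkin_field \<alpha> N R (y s) k) + (LINT s|lebesgue_on {0..t}. of_real (freq k powr (2 * \<beta>)) * g s k) =
        (LINT s|lebesgue_on {0..t}. galerkin_field \<alpha> N R (y s) k + of_real (freq k powr (2 * \<beta>)) * g s k)"
      by (rule Bochner_Integration.integral_add[OF gfi[OF t] i, symmetric])
    also have "\<dots> = (LINT s|lebesgue_on {0..t}. - of_real (freq k powr (2 * \<alpha>)) * x s k - of_real (c s) * advect (x s) k + of_real (freq k powr (2 * \<beta>)) * g s k)"
      by (rule Bochner_Integration.integral_cong) (use k t in \<open>auto simp: gf\<close>)
    finally show "x t k = \<theta>0 k + (LINT s|lebesgue_on {0..t}.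
        - of_real (freq k powr (2 * \<alpha>)) * x s k - of_real (c s) * advect (x s) k + of_real (freq k powr (2 * \<beta>)) * g s k)" .
  qed
qed

section \<open>Energy identity and a priori bound for finitely many modes\<close>

lemma continuous_coord_measurable:
  assumes "\<And>k. continuous_on {0..T} (\<lambda>t. x t k)" shows "coord_measurable T x"
  unfolding coord_measurable_def
  using assms continuous_imp_measurable_on_sets_lebesgue[of "{0..T}"] by auto

lemma pair_Lam_sum:
  assumes "\<And>k. k \<notin> fbox N \<Longrightarrow> x k = 0"
  shows "pair (Lam \<sigma> x) g = (\<Sum>k\<in>fbox N. freq k powr \<sigma> * Re (x k * cnj (g k)))"
proof -
  have "((\<lambda>k. Lam \<sigma> x k * cnj (g k)) has_sum (\<Sum>k\<in>fbox N. of_real (freq k powr \<sigma>) * (x k * cnj (g k)))) UNIV"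
    by (rule has_sum_finite_neutralI[where B="fbox N"]) (auto simp: assms Lam_def intro!: sum.cong)
  then have "pair (Lam \<sigma> x) g = Re (\<Sum>k\<in>fbox N. of_real (freq k powr \<sigma>) * (x k * cnj (g k)))"
    unfolding pair_def by (simp add: infsumI)
  then show ?thesis by simp
qed

text \<open>Multiply each mode equation by the conjugate coefficient and sum with the weight
  \<open>freq k powr (2 * r)\<close>. The quadratic term drops out by
  \<open>advect_conserve\<close>, even with the cut-off: \<open>c\<close> depends on time alone and
  factors out of the sum.\<close>

lemma finite_mode_energy_identity:
  fixes x :: "real \<Rightarrow> fourier" and c :: "real \<Rightarrow> real"
  assumes T: "0 \<le> T" and \<theta>0: "\<theta>0 \<in> Hs (\<alpha> - 2 * \<beta>)" and g: "g \<in> L2Hs T 0"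
    and s: "\<alpha> - 2 * \<beta> = 0 \<or> \<alpha> - 2 * \<beta> = s_crit"
    and xc: "\<And>k. continuous_on {0..T} (\<lambda>t. x t k)"
    and herm: "\<And>t k. t \<in> {0..T} \<Longrightarrow> x t (- k) = cnj (x t k)"
    and supp: "\<And>t k. t \<in> {0..T} \<Longrightarrow> k \<notin> fbox N \<Longrightarrow> x t k = 0"
    and x0: "\<And>t. t \<in> {0..T} \<Longrightarrow> x t 0 = 0"
    and advc: "\<And>k. k \<in> fbox N \<Longrightarrow> continuous_on {0..T} (\<lambda>t. of_real (c t) * advect (x t) k)"
    and eq: "\<And>k t. k \<in> fbox N \<Longrightarrow> t \<in> {0..T} \<Longrightarrow> x t k = \<theta>0 k + (LINT s|lebesgue_on {0..t}.
        - of_real (freq k powr (2 * \<alpha>)) * x s k - of_real (c s) * advect (x s) k + of_real (freq k powr (2 * \<beta>)) * g s k)"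
    and t: "t \<in> {0..T}"
  shows "x \<in> L2Hs T (2 * \<alpha> - 2 * \<beta>)"
    "(hs_norm (\<alpha> - 2 * \<beta>) (x t))\<^sup>2 + 2 * (LINT s|lebesgue_on {0..t}. (hs_norm (2 * \<alpha> - 2 * \<beta>) (x s))\<^sup>2) =
     (hs_norm (\<alpha> - 2 * \<beta>) (trunc N \<theta>0))\<^sup>2 + 2 * (LINT s|lebesgue_on {0..t}. pair (Lam (2 * \<alpha> - 2 * \<beta>) (x s)) (g s))"
proof -
  define r where "r = \<alpha> - 2 * \<beta>"
  define w where "w k = freq k powr (2 * r)" for k
  have hsq: "(hs_norm q f)\<^sup>2 = (\<Sum>k\<in>fbox N. freq k powr (2 * q) * (cmod (f k))\<^sup>2)"
    if "\<And>k. f (- k) = cnj (f k)" "f 0 = 0" "\<And>k. k \<notin> fbox N \<Longrightarrow> f k = 0" for f q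
    unfolding freq_weight_sq by (rule Hs_finite_support(2)) (fact that)+
  have xH: "x u \<in> Hs q" if "u \<in> {0..T}" for u q
    by (rule Hs_finite_support(1)[where n=N]) (use that herm x0 supp in blast)+
  have xsq: "(hs_norm q (x u))\<^sup>2 = (\<Sum>k\<in>fbox N. freq k powr (2 * q) * (cmod (x u k))\<^sup>2)" if "u \<in> {0..T}" for u q
    by (rule hsq) (use that herm x0 supp in blast)+
  have "continuous_on {0..T} (\<lambda>u. \<Sum>k\<in>fbox N. freq k powr (2 * q) * (cmod (x u k))\<^sup>2)" for q
    by (intro continuous_intros xc)
  then have nc: "continuous_on {0..T} (\<lambda>u. (hs_norm q (x u))\<^sup>2)" for q
    by (rule continuous_on_eq) (simp add: xsq)
  show xL: "x \<in> L2Hs T (2 * \<alpha> - 2 * \<beta>)"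
    unfolding L2Hs_iff
  proof (intro conjI)
    show "AE t in lebesgue_on {0..T}. x t \<in> Hs (2 * \<alpha> - 2 * \<beta>)"
      using AE_in_interval by eventually_elim (rule xH)
    show "coord_measurable T x" by (rule continuous_coord_measurable[OF xc])
    show "integrable (lebesgue_on {0..T}) (\<lambda>t. (hs_norm (2 * \<alpha> - 2 * \<beta>) (x t))\<^sup>2)"
      by (rule continuous_imp_integrable_real[OF nc])
  qed
  have sub: "u \<in> {0..T}" if "u \<in> {0..t}" for u using that t by auto
  have gt: "g \<in> L2Hs t 0" using L2Hs_initial[OF g] t by auto
  define f where "f k s = - of_real (freq k powr (2 * \<alpha>)) * x s k - of_real (c s) * advect (x s) k + of_real (freq k powr (2 * \<beta>)) * g s k" for k s
  have fi: "integrable (lebesgue_on {0..t}) (f k)" if k: "k \<in> fbox N" for k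
  proof -
    have c1: "continuous_on {0..T} (\<lambda>s. - of_real (freq k powr (2 * \<alpha>)) * x s k - of_real (c s) * advect (x s) k)"
      by (intro continuous_intros xc advc k)
    have "integrable (lebesgue_on {0..t}) (\<lambda>s. - of_real (freq k powr (2 * \<alpha>)) * x s k - of_real (c s) * advect (x s) k)"
      by (rule continuous_imp_integrable_real[OF continuous_on_subset[OF c1]]) (use t in auto)
    then show ?thesis unfolding f_def[abs_def] using L2Hs_coord_integrable[OF gt, of k]
      by (intro Bochner_Integration.integrable_add) auto
  qed
  have t0: "0 \<le> t" using t by simp
  have ibp: "integrable (lebesgue_on {0..t}) (\<lambda>s. f k s * cnj (x s k) + x s k * cnj (f k s))"
    "x t k * cnj (x t k) = \<theta>0 k * cnj (\<theta>0 k) + (LINT s|lebesgue_on {0..t}. f k s * cnj (x s k) + x s k * cnj (f k s))"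
    if k: "k \<in> fbox N" for k
  proof -
    have e1: "x u k = \<theta>0 k + (LINT s|lebesgue_on {0..u}. f k s)" if "u \<in> {0..t}" for u
      unfolding f_def by (rule eq[OF k sub[OF that]])
    have e2: "cnj (x u k) = cnj (\<theta>0 k) + (LINT s|lebesgue_on {0..u}. cnj (f k s))" if "u \<in> {0..t}" for u
      using arg_cong[OF e1[OF that], of cnj] Bochner_Integration.integral_cnj[of "lebesgue_on {0..u}" "f k"] by simp
    note P = integral_by_parts[OF fi[OF k] integrable_cnj[OF fi[OF k]] e1 e2 t0]
    show "integrable (lebesgue_on {0..t}) (\<lambda>s. f k s * cnj (x s k) + x s k * cnj (f k s))" by (rule P)
    show "x t k * cnj (x t k) = \<theta>0 k * cnj (\<theta>0 k) + (LINT s|lebesgue_on {0..t}. f k s * cnj (x s k) + x s k * cnj (f k s))" by (rule P)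
  qed
  have re: "f k s * cnj (x s k) + x s k * cnj (f k s) = of_real (2 * Re (f k s * cnj (x s k)))" for k s
    by (simp add: complex_eq_iff)
  have modei: "integrable (lebesgue_on {0..t}) (\<lambda>s. 2 * Re (f k s * cnj (x s k)))" if k: "k \<in> fbox N" for k
    using integrable_Re[OF ibp(1)[OF k]] unfolding re by simp
  have mode: "(cmod (x t k))\<^sup>2 = (cmod (\<theta>0 k))\<^sup>2 + (LINT s|lebesgue_on {0..t}. 2 * Re (f k s * cnj (x s k)))" if k: "k \<in> fbox N" for k
  proof -
    have "of_real ((cmod (x t k))\<^sup>2) = of_real ((cmod (\<theta>0 k))\<^sup>2) + complex_of_real (LINT s|lebesgue_on {0..t}. 2 * Re (f k s * cnj (x s k)))"
      using ibp(2)[OF k] unfolding re integral_complex_of_real complex_norm_square[symmetric] .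
    then show ?thesis by (simp only: of_real_add[symmetric] of_real_eq_iff)
  qed
  have "(hs_norm r (x t))\<^sup>2 = (\<Sum>k\<in>fbox N. w k * (cmod (x t k))\<^sup>2)" unfolding w_def by (rule xsq[OF t])
  also have "\<dots> = (\<Sum>k\<in>fbox N. w k * (cmod (\<theta>0 k))\<^sup>2 + (LINT s|lebesgue_on {0..t}. w k * (2 * Re (f k s * cnj (x s k)))))"
    by (rule sum.cong) (simp_all only: mode distrib_left Bochner_Integration.integral_mult_right_zero)
  also have "\<dots> = (\<Sum>k\<in>fbox N. w k * (cmod (\<theta>0 k))\<^sup>2) + (LINT s|lebesgue_on {0..t}. (\<Sum>k\<in>fbox N. w k * (2 * Re (f k s * cnj (x s k)))))"
    unfolding sum.distrib by (subst Bochner_Integration.integral_sum) (use modei in auto)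
  also have "(\<Sum>k\<in>fbox N. w k * (cmod (\<theta>0 k))\<^sup>2) = (hs_norm r (trunc N \<theta>0))\<^sup>2"
    unfolding w_def by (subst hsq) (auto simp: trunc_def box_minus HsD[OF \<theta>0])
  also have "(LINT s|lebesgue_on {0..t}. (\<Sum>k\<in>fbox N. w k * (2 * Re (f k s * cnj (x s k))))) =
     (LINT s|lebesgue_on {0..t}. 2 * pair (Lam (2 * \<alpha> - 2 * \<beta>) (x s)) (g s) - 2 * (hs_norm (2 * \<alpha> - 2 * \<beta>) (x s))\<^sup>2)"
  proof (rule Bochner_Integration.integral_cong[OF refl])
    fix u assume "u \<in> space (lebesgue_on {0..t})"
    then have u: "u \<in> {0..T}" using sub by simp
    \<comment> \<open>The exponents fit: \<open>2 * r + 2 * \<alpha>\<close> is twice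
      \<open>2 * \<alpha> - 2 * \<beta>\<close>, the order of the dissipation, and
      \<open>2 * r + 2 * \<beta>\<close> is that order once.\<close>
    have e1: "w k * freq k powr (2 * \<alpha>) = freq k powr (2 * (2 * \<alpha> - 2 * \<beta>))" for k
      unfolding w_def r_def by (simp add: powr_add[symmetric])
    have e2: "w k * freq k powr (2 * \<beta>) = freq k powr (2 * \<alpha> - 2 * \<beta>)" for k
      unfolding w_def r_def by (simp add: powr_add[symmetric])
    have termeq: "w k * (2 * Re (f k u * cnj (x u k))) = - 2 * (freq k powr (2 * (2 * \<alpha> - 2 * \<beta>)) * (cmod (x u k))\<^sup>2)
        - 2 * c u * (w k * Re (advect (x u) k * cnj (x u k))) + 2 * (freq k powr (2 * \<alpha> - 2 * \<beta>) * Re (x u k * cnj (g u k)))" for k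
    proof -
      have R: "Re (f k u * cnj (x u k)) = - (freq k powr (2 * \<alpha>) * (cmod (x u k))\<^sup>2) - c u * Re (advect (x u) k * cnj (x u k))
          + freq k powr (2 * \<beta>) * Re (x u k * cnj (g u k))"
        unfolding cmod_power2 by (simp add: f_def power2_eq_square algebra_simps)
      show ?thesis unfolding e1[symmetric] e2[symmetric] R
        by (simp add: algebra_simps)
    qed
    have pl: "pair (Lam (2 * \<alpha> - 2 * \<beta>) (x u)) (g u) = (\<Sum>k\<in>fbox N. freq k powr (2 * \<alpha> - 2 * \<beta>) * Re (x u k * cnj (g u k)))"
      by (rule pair_Lam_sum) (rule supp[OF u])
    have cons: "(\<Sum>k\<in>fbox N. w k * Re (advect (x u) k * cnj (x u k))) = 0"
      unfolding w_def r_def by (rule advect_conserve) (use u herm supp s in blast)+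
    have "(\<Sum>k\<in>fbox N. w k * (2 * Re (f k u * cnj (x u k)))) =
      - 2 * (\<Sum>k\<in>fbox N. freq k powr (2 * (2 * \<alpha> - 2 * \<beta>)) * (cmod (x u k))\<^sup>2)
      - 2 * c u * (\<Sum>k\<in>fbox N. w k * Re (advect (x u) k * cnj (x u k)))
      + 2 * (\<Sum>k\<in>fbox N. freq k powr (2 * \<alpha> - 2 * \<beta>) * Re (x u k * cnj (g u k)))"
      unfolding termeq sum.distrib sum_subtractf sum_distrib_left[symmetric] ..
    also have "\<dots> = 2 * pair (Lam (2 * \<alpha> - 2 * \<beta>) (x u)) (g u) - 2 * (hs_norm (2 * \<alpha> - 2 * \<beta>) (x u))\<^sup>2"
      unfolding cons xsq[OF u] pl by simp
    finally show "(\<Sum>k\<in>fbox N. w k * (2 * Re (f k u * cnj (x u k)))) = \<dots>" .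
  qed
  also have "\<dots> = 2 * (LINT s|lebesgue_on {0..t}. pair (Lam (2 * \<alpha> - 2 * \<beta>) (x s)) (g s))
      - 2 * (LINT s|lebesgue_on {0..t}. (hs_norm (2 * \<alpha> - 2 * \<beta>) (x s))\<^sup>2)"
  proof -
    have xLt: "x \<in> L2Hs t (2 * \<alpha> - 2 * \<beta>)" using L2Hs_initial[OF xL] t by auto
    have "integrable (lebesgue_on {0..t}) (\<lambda>s. pair (Lam (2 * \<alpha> - 2 * \<beta>) (x s)) (g s))"
      by (rule L2Hs_pair_integrable(1)[where r=0]) (use L2Hs_Lam[OF xLt, of "2 * \<alpha> - 2 * \<beta>"] gt in auto)
    then show ?thesis using L2Hs_norm_integrable(2)[OF xLt] by simp
  qed
  finally show "(hs_norm (\<alpha> - 2 * \<beta>) (x t))\<^sup>2 + 2 * (LINT s|lebesgue_on {0..t}. (hs_norm (2 * \<alpha> - 2 * \<beta>) (x s))\<^sup>2) =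
     (hs_norm (\<alpha> - 2 * \<beta>) (trunc N \<theta>0))\<^sup>2 + 2 * (LINT s|lebesgue_on {0..t}. pair (Lam (2 * \<alpha> - 2 * \<beta>) (x s)) (g s))"
    unfolding r_def by simp
qed

text \<open>Young's inequality: half of the dissipation in the energy balance pays for the work of
  the control.\<close>

lemma energy_absorb:
  assumes x: "x \<in> L2Hs t q" and g: "g \<in> L2Hs t 0"
  shows "2 * (LINT s|lebesgue_on {0..t}. pair (Lam q (x s)) (g s)) \<le>
     (LINT s|lebesgue_on {0..t}. (hs_norm q (x s))\<^sup>2) + (L2Hs_norm t 0 g)\<^sup>2"
proof -
  have xL: "(\<lambda>s. Lam q (x s)) \<in> L2Hs t 0" using L2Hs_Lam[OF x, of q] by simp
  have nn: "0 \<le> (LINT s|lebesgue_on {0..t}. (hs_norm 0 (Lam q (x s)))\<^sup>2)" "0 \<le> (LINT s|lebesgue_on {0..t}. (hs_norm 0 (g s))\<^sup>2)"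
    by simp_all
  have "(LINT s|lebesgue_on {0..t}. pair (Lam q (x s)) (g s)) \<le> L2Hs_norm t 0 (\<lambda>s. Lam q (x s)) * L2Hs_norm t 0 g"
    using L2Hs_pair_integrable(2)[OF xL, of g] g by simp
  moreover have "2 * (L2Hs_norm t 0 (\<lambda>s. Lam q (x s)) * L2Hs_norm t 0 g) \<le> (L2Hs_norm t 0 (\<lambda>s. Lam q (x s)))\<^sup>2 + (L2Hs_norm t 0 g)\<^sup>2"
    using sum_squares_bound[of "L2Hs_norm t 0 (\<lambda>s. Lam q (x s))" "L2Hs_norm t 0 g"] by simp
  moreover have "(L2Hs_norm t 0 (\<lambda>s. Lam q (x s)))\<^sup>2 = (LINT s|lebesgue_on {0..t}. (hs_norm q (x s))\<^sup>2)"
    using nn(1) hs_norm_Lam[of q q] by (simp add: L2Hs_norm_def)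
  ultimately show ?thesis by linarith
qed

lemma L2Hs_norm_initial_le:
  assumes g: "g \<in> L2Hs T r" and t: "t \<in> {0..T}"
  shows "(L2Hs_norm t r g)\<^sup>2 \<le> (L2Hs_norm T r g)\<^sup>2"
proof -
  have "(LINT s|lebesgue_on {0..t}. (hs_norm r (g s))\<^sup>2) \<le> (LINT s|lebesgue_on {0..T}. (hs_norm r (g s))\<^sup>2)"
    by (rule integral_mono_lebesgue_on_AE[OF L2Hs_norm_integrable(2)[OF g]]) (use t in auto)
  then show ?thesis by (simp add: L2Hs_norm_def)
qed

lemma trunc_norm_le: "f \<in> Hs r \<Longrightarrow> hs_norm r (trunc n f) \<le> hs_norm r f"
proof -
  assume f: "f \<in> Hs r"
  have "(hs_norm r (trunc n f))\<^sup>2 \<le> (hs_norm r f)\<^sup>2"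
    unfolding hs_norm_sq
    by (rule infsum_mono[OF HsD(3)[OF trunc_Hs[OF f]] HsD(3)[OF f]]) (simp add: trunc_def)
  then show ?thesis by (rule power2_le_imp_le) simp
qed

lemma galerkin_exists:
  assumes T: "0 < T" and \<theta>0: "\<theta>0 \<in> Hs (\<alpha> - 2 * \<beta>)" and g: "g \<in> L2Hs T 0"
    and s: "\<alpha> - 2 * \<beta> = 0 \<or> \<alpha> - 2 * \<beta> = s_crit" and \<alpha>: "0 \<le> \<alpha>"
  shows "\<exists>x. (\<forall>k. continuous_on {0..T} (\<lambda>t. x t k)) \<and>
    (\<forall>t\<in>{0..T}. x t \<in> Hs (2 * \<alpha> - 2 * \<beta>)) \<and> x \<in> L2Hs T (2 * \<alpha> - 2 * \<beta>) \<and>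
    (\<forall>k\<in>fbox N. \<forall>t\<in>{0..T}. x t k = \<theta>0 k + (LINT s|lebesgue_on {0..t}. mode_rhs \<alpha> \<beta> (x s) (g s) k)) \<and>
    (\<forall>t\<in>{0..T}. (hs_norm (\<alpha> - 2 * \<beta>) (x t))\<^sup>2 + 2 * (LINT s|lebesgue_on {0..t}. (hs_norm (2 * \<alpha> - 2 * \<beta>) (x s))\<^sup>2)
      \<le> (hs_norm (\<alpha> - 2 * \<beta>) \<theta>0)\<^sup>2 + 2 * (LINT s|lebesgue_on {0..t}. pair (Lam (2 * \<alpha> - 2 * \<beta>) (x s)) (g s)))"
proof -
  \<comment> \<open>A priori bound on the energy, valid even while the cut-off is active.\<close>
  define M where "M = (hs_norm (\<alpha> - 2 * \<beta>) \<theta>0)\<^sup>2 + (L2Hs_norm T 0 g)\<^sup>2"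
  \<comment> \<open>Larger than every coefficient of a path with energy at most \<open>M\<close>, so
    the cut-off is never felt.\<close>
  define R where "R = 1 + (\<Sum>k\<in>fbox N. freq k powr (- (\<alpha> - 2 * \<beta>)) * sqrt M)"
  have M: "0 \<le> M" by (simp add: M_def)
  have R: "0 < R" unfolding R_def using M by (intro add_pos_nonneg sum_nonneg) auto
  have T0: "0 \<le> T" using T by simp
  obtain x c where xc: "\<And>k. continuous_on {0..T} (\<lambda>t. x t k)"
    and xt: "\<And>t. t \<in> {0..T} \<Longrightarrow> (\<forall>k. x t (- k) = cnj (x t k)) \<and> x t 0 = 0 \<and> (\<forall>k. k \<notin> fbox N \<longrightarrow> x t k = 0)
      \<and> ((\<forall>k. cmod (x t k) \<le> R) \<longrightarrow> c t = (1 :: real))"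
    and advc: "\<And>k. k \<in> fbox N \<Longrightarrow> continuous_on {0..T} (\<lambda>t. of_real (c t) * advect (x t) k)"
    and eq: "\<And>k t. k \<in> fbox N \<Longrightarrow> t \<in> {0..T} \<Longrightarrow> x t k = \<theta>0 k + (LINT s|lebesgue_on {0..t}.
        - of_real (freq k powr (2 * \<alpha>)) * x s k - of_real (c s) * advect (x s) k + of_real (freq k powr (2 * \<beta>)) * g s k)"
    using galerkin_cutoff_exists[OF R T0 \<theta>0 g, of N \<alpha> \<beta>] by blast
  have xt1: "x t (- k) = cnj (x t k)" "x t 0 = 0" "k \<notin> fbox N \<Longrightarrow> x t k = 0" if "t \<in> {0..T}" for t k
    using xt[OF that] by blast+
  have E: "x \<in> L2Hs T (2 * \<alpha> - 2 * \<beta>)"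
    "(hs_norm (\<alpha> - 2 * \<beta>) (x t))\<^sup>2 + 2 * (LINT s|lebesgue_on {0..t}. (hs_norm (2 * \<alpha> - 2 * \<beta>) (x s))\<^sup>2) =
     (hs_norm (\<alpha> - 2 * \<beta>) (trunc N \<theta>0))\<^sup>2 + 2 * (LINT s|lebesgue_on {0..t}. pair (Lam (2 * \<alpha> - 2 * \<beta>) (x s)) (g s))"
    if t: "t \<in> {0..T}" for t
    by (rule finite_mode_energy_identity[where c=c and N=N, OF T0 \<theta>0 g s xc _ _ _ _ _ t];
        ((rule xt1(1) xt1(2) xt1(3) advc eq); assumption))+
  have xH: "x t \<in> Hs q" if "t \<in> {0..T}" for t q
    by (rule Hs_finite_support(1)[where n=N]) (use xt1[OF that] in blast)+
  have xL: "x \<in> L2Hs T (2 * \<alpha> - 2 * \<beta>)" by (rule E(1)[of T]) (use T in auto)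
  have bound: "(hs_norm (\<alpha> - 2 * \<beta>) (x t))\<^sup>2 \<le> M" if t: "t \<in> {0..T}" for t
  proof -
    have "(hs_norm (\<alpha> - 2 * \<beta>) (trunc N \<theta>0))\<^sup>2 \<le> (hs_norm (\<alpha> - 2 * \<beta>) \<theta>0)\<^sup>2"
      by (intro power_mono trunc_norm_le \<theta>0) simp
    moreover have "2 * (LINT s|lebesgue_on {0..t}. pair (Lam (2 * \<alpha> - 2 * \<beta>) (x s)) (g s)) \<le>
        (LINT s|lebesgue_on {0..t}. (hs_norm (2 * \<alpha> - 2 * \<beta>) (x s))\<^sup>2) + (L2Hs_norm t 0 g)\<^sup>2"
      by (rule energy_absorb) (use L2Hs_initial[OF xL] L2Hs_initial[OF g] t in auto)
    moreover have "0 \<le> (LINT s|lebesgue_on {0..t}. (hs_norm (2 * \<alpha> - 2 * \<beta>) (x s))\<^sup>2)" by simp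
    ultimately show ?thesis
      using E(2)[OF t] L2Hs_norm_initial_le[OF g t] unfolding M_def by linarith
  qed
  have c1: "c t = 1" if t: "t \<in> {0..T}" for t
  proof -
    have "cmod (x t k) \<le> R" for k
    proof (cases "k \<in> fbox N")
      case True
      have "hs_norm (\<alpha> - 2 * \<beta>) (x t) \<le> sqrt M" using bound[OF t] by (rule real_le_rsqrt)
      then have "cmod (x t k) \<le> freq k powr (- (\<alpha> - 2 * \<beta>)) * sqrt M"
        using Hs_cmod_le[OF xH[OF t], of k "\<alpha> - 2 * \<beta>"] by (meson mult_left_mono order_trans powr_ge_zero)
      also have "\<dots> \<le> (\<Sum>k\<in>fbox N. freq k powr (- (\<alpha> - 2 * \<beta>)) * sqrt M)"
        using M by (intro member_le_sum[OF True]) auto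
      finally show ?thesis unfolding R_def by linarith
    qed (use xt1(3)[OF t] R in simp)
    then show ?thesis using xt[OF t] by blast
  qed
  have eq': "x t k = \<theta>0 k + (LINT s|lebesgue_on {0..t}. mode_rhs \<alpha> \<beta> (x s) (g s) k)" if k: "k \<in> fbox N" and t: "t \<in> {0..T}" for k t
  proof -
    have "(LINT s|lebesgue_on {0..t}. - of_real (freq k powr (2 * \<alpha>)) * x s k - of_real (c s) * advect (x s) k + of_real (freq k powr (2 * \<beta>)) * g s k)
      = (LINT s|lebesgue_on {0..t}. mode_rhs \<alpha> \<beta> (x s) (g s) k)"
      by (rule Bochner_Integration.integral_cong) (use t c1 in \<open>auto simp: mode_rhs_def\<close>)
    then show ?thesis using eq[OF k t] by simp
  qed
  have energy: "(hs_norm (\<alpha> - 2 * \<beta>) (x t))\<^sup>2 + 2 * (LINT s|lebesgue_on {0..t}. (hs_norm (2 * \<alpha> - 2 * \<beta>) (x s))\<^sup>2)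
      \<le> (hs_norm (\<alpha> - 2 * \<beta>) \<theta>0)\<^sup>2 + 2 * (LINT s|lebesgue_on {0..t}. pair (Lam (2 * \<alpha> - 2 * \<beta>) (x s)) (g s))" if t: "t \<in> {0..T}" for t
  proof -
    have "(hs_norm (\<alpha> - 2 * \<beta>) (trunc N \<theta>0))\<^sup>2 \<le> (hs_norm (\<alpha> - 2 * \<beta>) \<theta>0)\<^sup>2"
      by (intro power_mono trunc_norm_le \<theta>0) simp
    then show ?thesis using E(2)[OF t] by linarith
  qed
  show ?thesis using xc xH xL eq' energy by blast
qed

section \<open>Limits and existence of Leray solutions\<close>

text \<open>Fatou: a box sum is finite and passes to the limit together with its bound.\<close>

lemma Hs_box_limit:
  assumes f: "\<And>i. f i \<in> Hs r" and M: "\<And>i. (hs_norm r (f i))\<^sup>2 \<le> M" and lim: "\<And>k. (\<lambda>i. f i k) \<longlonglongrightarrow> h k"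
  shows "h \<in> Hs r" "(hs_norm r h)\<^sup>2 \<le> M"
proof -
  have le: "(\<Sum>k\<in>fbox n. (freq k powr r * cmod (h k))\<^sup>2) \<le> M" for n
  proof (rule LIMSEQ_le_const2)
    show "(\<lambda>i. \<Sum>k\<in>fbox n. (freq k powr r * cmod (f i k))\<^sup>2) \<longlonglongrightarrow> (\<Sum>k\<in>fbox n. (freq k powr r * cmod (h k))\<^sup>2)"
      by (intro tendsto_intros lim)
    have "(\<Sum>k\<in>fbox n. (freq k powr r * cmod (f i k))\<^sup>2) \<le> M" for i
      using box_sum_le_infsum[OF HsD(3)[OF f], of i n] M[of i] unfolding hs_norm_sq by simp
    then show "\<exists>N. \<forall>i\<ge>N. (\<Sum>k\<in>fbox n. (freq k powr r * cmod (f i k))\<^sup>2) \<le> M" by blast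
  qed
  note B = summable_on_boxI[OF zero_le_power2 le]
  show "(hs_norm r h)\<^sup>2 \<le> M" unfolding hs_norm_sq by (rule B(2))
  show "h \<in> Hs r"
  proof (rule HsI[OF _ _ B(1)])
    fix k
    have "(\<lambda>i. cnj (f i k)) \<longlonglongrightarrow> cnj (h k)" by (intro tendsto_intros lim)
    then have "(\<lambda>i. f i (- k)) \<longlonglongrightarrow> cnj (h k)" by (simp only: HsD(1)[OF f])
    then show "h (- k) = cnj (h k)" by (rule LIMSEQ_unique[OF lim])
  next
    have "(\<lambda>i. f i 0) \<longlonglongrightarrow> 0" by (simp only: HsD(2)[OF f] tendsto_const)
    then show "h 0 = 0" by (rule LIMSEQ_unique[OF lim])
  qed
qed

text \<open>Fatou in space and time: monotone convergence of the box sums makes their supremum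
  finite at almost every time, hence the path lies in \<open>Hs r\<close> there.\<close>

lemma L2Hs_boxI:
  assumes c: "coord_measurable T f" and herm: "\<And>t k. t \<in> {0..T} \<Longrightarrow> f t (- k) = cnj (f t k)"
    and z: "\<And>t. t \<in> {0..T} \<Longrightarrow> f t 0 = 0"
    and i: "\<And>n. integrable (lebesgue_on {0..T}) (\<lambda>t. \<Sum>k\<in>fbox n. (freq k powr r * cmod (f t k))\<^sup>2)"
    and M: "\<And>n. (LINT t|lebesgue_on {0..T}. (\<Sum>k\<in>fbox n. (freq k powr r * cmod (f t k))\<^sup>2)) \<le> M"
  shows "f \<in> L2Hs T r"
proof -
  let ?M = "lebesgue_on {0..T}"
  define u where "u n t = (\<Sum>k\<in>fbox n. (freq k powr r * cmod (f t k))\<^sup>2)" for n t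
  have u0: "0 \<le> u n t" for n t unfolding u_def by (intro sum_nonneg) simp
  have um: "u n \<in> borel_measurable ?M" for n
    using borel_measurable_integrable[OF i[of n]] unfolding u_def[abs_def] .
  have inc: "incseq (\<lambda>n t. ennreal (u n t))"
    unfolding incseq_def le_fun_def u_def
    by (intro allI impI ennreal_leI sum_mono2 box_mono) auto
  have "(\<integral>\<^sup>+ t. (SUP n. ennreal (u n t)) \<partial>?M) = (SUP n. \<integral>\<^sup>+ t. ennreal (u n t) \<partial>?M)"
    by (rule nn_integral_monotone_convergence_SUP[OF inc]) (use um in measurable)
  also have "\<dots> \<le> ennreal M"
  proof (rule SUP_least)
    fix n
    have "(\<integral>\<^sup>+ t. ennreal (u n t) \<partial>?M) = ennreal (LINT t|?M. u n t)"
      by (rule nn_integral_eq_integral) (use i[of n] u0 in \<open>auto simp: u_def[abs_def]\<close>)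
    also have "\<dots> \<le> ennreal M" using M[of n] unfolding u_def by (rule ennreal_leI)
    finally show "(\<integral>\<^sup>+ t. ennreal (u n t) \<partial>?M) \<le> ennreal M" .
  qed
  finally have fin: "(\<integral>\<^sup>+ t. (SUP n. ennreal (u n t)) \<partial>?M) \<le> ennreal M" .
  have "AE t in ?M. (SUP n. ennreal (u n t)) \<noteq> \<infinity>"
    by (rule nn_integral_noteq_infinite) (use um fin in \<open>auto simp: top_unique\<close>)
  then have ae: "AE t in ?M. f t \<in> Hs r \<and> ennreal ((hs_norm r (f t))\<^sup>2) \<le> (SUP n. ennreal (u n t))"
    using AE_in_interval[of T]
  proof eventually_elim
    case (elim t)
    define B where "B = enn2real (SUP n. ennreal (u n t))"
    have B: "(SUP n. ennreal (u n t)) = ennreal B" "0 \<le> B"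
    proof -
      have "(SUP n. ennreal (u n t)) < top" using elim(1) unfolding infinity_ennreal_def less_top .
      then show "(SUP n. ennreal (u n t)) = ennreal B" unfolding B_def by (rule ennreal_enn2real[symmetric])
    qed (simp add: B_def)
    have le: "(\<Sum>k\<in>fbox n. (freq k powr r * cmod (f t k))\<^sup>2) \<le> B" for n
    proof -
      have "ennreal (u n t) \<le> ennreal B" unfolding B(1)[symmetric] by (rule SUP_upper) simp
      then show ?thesis using B(2) by (simp add: u_def)
    qed
    note S = summable_on_boxI[OF zero_le_power2 le]
    have "f t \<in> Hs r" by (rule HsI[OF herm[OF elim(2)] z[OF elim(2)] S(1)])
    moreover have "(hs_norm r (f t))\<^sup>2 \<le> B" unfolding hs_norm_sq by (rule S(2))
    ultimately show ?case unfolding B(1) using ennreal_leI by blast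
  qed
  have ae1: "AE t in ?M. f t \<in> Hs r" using ae by eventually_elim simp
  note m = borel_measurable_hs_norm[OF c ae1]
  have "integrable ?M (\<lambda>t. (hs_norm r (f t))\<^sup>2)"
  proof (rule integrableI_nonneg)
    show "(\<lambda>t. (hs_norm r (f t))\<^sup>2) \<in> borel_measurable ?M" using m by measurable
    have "(\<integral>\<^sup>+ t. ennreal ((hs_norm r (f t))\<^sup>2) \<partial>?M) \<le> (\<integral>\<^sup>+ t. (SUP n. ennreal (u n t)) \<partial>?M)"
      by (rule nn_integral_mono_AE) (use ae in \<open>eventually_elim, simp\<close>)
    also have "\<dots> < \<infinity>" using fin by (rule le_less_trans) simp
    finally show "(\<integral>\<^sup>+ t. ennreal ((hs_norm r (f t))\<^sup>2) \<partial>?M) < \<infinity>" .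
  qed simp
  then show ?thesis unfolding L2Hs_iff using ae1 c by blast
qed

lemma L2Hs_trunc:
  assumes G: "G \<in> L2Hs T r" shows "(\<lambda>t. trunc m (G t)) \<in> L2Hs T r"
    "(\<lambda>t. G t - trunc m (G t)) \<in> L2Hs T r"
proof -
  have ae: "AE t in lebesgue_on {0..T}. G t \<in> Hs r" and c: "coord_measurable T G" using G unfolding L2Hs_iff by blast+
  have ae': "AE t in lebesgue_on {0..T}. trunc m (G t) \<in> Hs r" using ae by eventually_elim (rule trunc_Hs)
  have c': "coord_measurable T (\<lambda>t. trunc m (G t))"
    unfolding coord_measurable_def trunc_def
  proof
    fix k show "(\<lambda>t. if k \<in> fbox m then G t k else 0) \<in> borel_measurable (lebesgue_on {0..T})"
      using coord_measurableD[OF c, of k] by (cases "k \<in> fbox m") auto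
  qed
  note mm = borel_measurable_hs_norm[OF c' ae']
  have "integrable (lebesgue_on {0..T}) (\<lambda>t. (hs_norm r (trunc m (G t)))\<^sup>2)"
  proof (rule Bochner_Integration.integrable_bound[OF L2Hs_norm_integrable(2)[OF G]])
    show "(\<lambda>t. (hs_norm r (trunc m (G t)))\<^sup>2) \<in> borel_measurable (lebesgue_on {0..T})" using mm by measurable
    show "AE t in lebesgue_on {0..T}. norm ((hs_norm r (trunc m (G t)))\<^sup>2) \<le> norm ((hs_norm r (G t))\<^sup>2)"
      using ae by eventually_elim (simp add: power_mono trunc_norm_le)
  qed
  then show t: "(\<lambda>t. trunc m (G t)) \<in> L2Hs T r" unfolding L2Hs_iff using ae' c' by blast
  show "(\<lambda>t. G t - trunc m (G t)) \<in> L2Hs T r" by (rule L2Hs_diff[OF G t])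
qed

lemma L2Hs_tail_tendsto:
  assumes G: "G \<in> L2Hs T r"
  shows "(\<lambda>m. L2Hs_norm T r (\<lambda>t. G t - trunc m (G t))) \<longlonglongrightarrow> 0"
proof -
  have ae: "AE t in lebesgue_on {0..T}. G t \<in> Hs r" using G unfolding L2Hs_iff by blast
  have "(\<lambda>m. LINT t|lebesgue_on {0..T}. (hs_norm r (G t - trunc m (G t)))\<^sup>2) \<longlonglongrightarrow> (LINT t|lebesgue_on {0..T}. 0)"
  proof (rule integral_dominated_convergence[where w="\<lambda>t. (hs_norm r (G t))\<^sup>2"])
    show "integrable (lebesgue_on {0..T}) (\<lambda>t. (hs_norm r (G t))\<^sup>2)" by (rule L2Hs_norm_integrable(2)[OF G])
    show "(\<lambda>t. (hs_norm r (G t - trunc m (G t)))\<^sup>2) \<in> borel_measurable (lebesgue_on {0..T})" for m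
      by (rule borel_measurable_integrable[OF L2Hs_norm_integrable(2)[OF L2Hs_trunc(2)[OF G]]])
    show "AE t in lebesgue_on {0..T}. (\<lambda>m. (hs_norm r (G t - trunc m (G t)))\<^sup>2) \<longlonglongrightarrow> 0"
      using ae
    proof eventually_elim
      case (elim t)
      show ?case using tendsto_power[OF hs_norm_tail_tendsto[OF elim], of 2] by simp
    qed
    show "AE t in lebesgue_on {0..T}. norm ((hs_norm r (G t - trunc m (G t)))\<^sup>2) \<le> (hs_norm r (G t))\<^sup>2" for m
      using ae
    proof eventually_elim
      case (elim t)
      show ?case using power_mono[OF hs_norm_tail_le[OF elim, of m], of 2] by simp
    qed
  qed simp
  then have "(\<lambda>m. sqrt (LINT t|lebesgue_on {0..T}. (hs_norm r (G t - trunc m (G t)))\<^sup>2)) \<longlonglongrightarrow> sqrt 0"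
    by (intro tendsto_real_sqrt) simp
  then show ?thesis unfolding L2Hs_norm_def by simp
qed

text \<open>Truncating the test path \<open>G\<close> leaves finitely many modes, where convergence
  is assumed, and a tail that is small uniformly in \<open>i\<close> by the norm bound.\<close>

lemma weak_pair_limit:
  assumes D: "\<And>i :: nat. D i \<in> L2Hs T r" and C: "\<And>i. L2Hs_norm T r (D i) \<le> C"
    and G: "G \<in> L2Hs T (- r)"
    and modes: "\<And>k. (\<lambda>i. LINT s|lebesgue_on {0..T}. Re (D i s k * cnj (G s k))) \<longlonglongrightarrow> 0"
  shows "(\<lambda>i. LINT s|lebesgue_on {0..T}. pair (D i s) (G s)) \<longlonglongrightarrow> 0"
proof (rule LIMSEQ_I)
  fix e :: real assume e: "0 < e"
  let ?M = "lebesgue_on {0..T}"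
  have "(\<lambda>m. C * L2Hs_norm T (- r) (\<lambda>t. G t - trunc m (G t))) \<longlonglongrightarrow> C * 0"
    by (intro tendsto_intros L2Hs_tail_tendsto G)
  then have "\<forall>\<^sub>F m in sequentially. C * L2Hs_norm T (- r) (\<lambda>t. G t - trunc m (G t)) < e / 2"
    using e order_tendstoD(2)[of _ "C * 0" _ "e / 2"] by simp
  then obtain m where m: "C * L2Hs_norm T (- r) (\<lambda>t. G t - trunc m (G t)) < e / 2"
    unfolding eventually_sequentially by blast
  note Gt = L2Hs_trunc[OF G, of m]
  have ae: "AE s in ?M. D i s \<in> Hs r \<and> G s \<in> Hs (- r)" for i
    using D[of i] G unfolding L2Hs_iff by (intro AE_conjI) blast+
  have Ri: "integrable ?M (\<lambda>s. Re (D i s k * cnj (G s k)))" for i k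
  proof -
    have cD: "coord_measurable T (D i)" and cG: "coord_measurable T G" using D[of i] G unfolding L2Hs_iff by blast+
    note [measurable] = coord_measurableD[OF cD] coord_measurableD[OF cG]
    have [measurable]: "cnj \<in> borel_measurable borel" by (intro borel_measurable_continuous_onI continuous_intros)
    have i: "integrable ?M (\<lambda>s. hs_norm r (D i s) * hs_norm (- r) (G s))"
      by (rule integrable_mult_L2) (intro L2Hs_norm_integrable D G)+
    show ?thesis
    proof (rule Bochner_Integration.integrable_bound[OF i])
      show "(\<lambda>s. Re (D i s k * cnj (G s k))) \<in> borel_measurable ?M" by measurable
      show "AE s in ?M. norm (Re (D i s k * cnj (G s k))) \<le> norm (hs_norm r (D i s) * hs_norm (- r) (G s))"
        using ae[of i]
      proof eventually_elim
        case (elim s)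
        then have h: "D i s \<in> Hs r" "G s \<in> Hs (- r)" by auto
        have "norm (Re (D i s k * cnj (G s k))) \<le> cmod (D i s k * cnj (G s k))" by (simp only: real_norm_def abs_Re_le_cmod)
        also have "\<dots> \<le> (\<Sum>\<^sub>\<infinity>k. cmod (D i s k * cnj (G s k)))"
          using finite_sum_le_infsum[OF pair_bound(1)[OF h], of "{k}"] by simp
        also have "\<dots> \<le> hs_norm r (D i s) * hs_norm (- r) (G s)" by (rule pair_bound(2)[OF h])
        finally show ?case by simp
      qed
    qed
  qed
  have split: "(LINT s|?M. pair (D i s) (G s)) = (\<Sum>k\<in>fbox m. LINT s|?M. Re (D i s k * cnj (G s k))) + (LINT s|?M. pair (D i s) (G s - trunc m (G s)))" for i
  proof -
    note i1 = L2Hs_pair_integrable(1)[OF D[of i] Gt(1)] and i2 = L2Hs_pair_integrable(1)[OF D[of i] Gt(2)]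
    have "(LINT s|?M. pair (D i s) (G s)) = (LINT s|?M. pair (D i s) (trunc m (G s)) + pair (D i s) (G s - trunc m (G s)))"
    proof (rule integral_cong_AE)
      show "(\<lambda>s. pair (D i s) (G s)) \<in> borel_measurable ?M"
        by (rule borel_measurable_integrable[OF L2Hs_pair_integrable(1)[OF D G]])
      show "(\<lambda>s. pair (D i s) (trunc m (G s)) + pair (D i s) (G s - trunc m (G s))) \<in> borel_measurable ?M"
        by (intro borel_measurable_add borel_measurable_integrable[OF i1] borel_measurable_integrable[OF i2])
      show "AE s in ?M. pair (D i s) (G s) = pair (D i s) (trunc m (G s)) + pair (D i s) (G s - trunc m (G s))"
        using ae[of i]
      proof eventually_elim
        case (elim s)
        then have h: "D i s \<in> Hs r" "G s \<in> Hs (- r)" by auto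
        show ?case unfolding pair_diff_right[OF h trunc_Hs[OF h(2)]] by simp
      qed
    qed
    also have "\<dots> = (LINT s|?M. pair (D i s) (trunc m (G s))) + (LINT s|?M. pair (D i s) (G s - trunc m (G s)))"
      by (rule Bochner_Integration.integral_add[OF i1 i2])
    also have "(LINT s|?M. pair (D i s) (trunc m (G s))) = (\<Sum>k\<in>fbox m. LINT s|?M. Re (D i s k * cnj (G s k)))"
      unfolding pair_trunc by (rule Bochner_Integration.integral_sum) (rule Ri)
    finally show ?thesis .
  qed
  have "(\<lambda>i. \<Sum>k\<in>fbox m. LINT s|?M. Re (D i s k * cnj (G s k))) \<longlonglongrightarrow> (\<Sum>k\<in>fbox m. 0)"
    by (intro tendsto_sum modes)
  then have "(\<lambda>i. \<Sum>k\<in>fbox m. LINT s|?M. Re (D i s k * cnj (G s k))) \<longlonglongrightarrow> 0" by simp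
  from LIMSEQ_D[OF this, of "e / 2"] e obtain n0 where n0: "\<And>i. n0 \<le> i \<Longrightarrow> norm ((\<Sum>k\<in>fbox m. LINT s|?M. Re (D i s k * cnj (G s k))) - 0) < e / 2"
    by auto
  show "\<exists>no. \<forall>n\<ge>no. norm ((LINT s|?M. pair (D n s) (G s)) - 0) < e"
  proof (intro exI[of _ n0] allI impI)
    fix i assume "n0 \<le> i"
    have "\<bar>LINT s|?M. pair (D i s) (G s - trunc m (G s))\<bar> \<le> L2Hs_norm T r (D i) * L2Hs_norm T (- r) (\<lambda>t. G t - trunc m (G t))"
      by (rule L2Hs_pair_integrable(2)[OF D Gt(2)])
    also have "\<dots> \<le> C * L2Hs_norm T (- r) (\<lambda>t. G t - trunc m (G t))"
      by (intro mult_right_mono C) (simp add: L2Hs_norm_def)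
    finally have "\<bar>LINT s|?M. pair (D i s) (G s - trunc m (G s))\<bar> < e / 2" using m by linarith
    then show "norm ((LINT s|?M. pair (D i s) (G s)) - 0) < e"
      unfolding split using n0[OF \<open>n0 \<le> i\<close>] by simp
  qed
qed

text \<open>Frequencies outside the box of size \<open>m\<close> contribute at most
  \<open>m powr (- (2 * \<alpha>))\<close> times the bound in the stronger norm, uniformly in
  \<open>i\<close>; the finitely many others converge by assumption. This is where positivity of
  \<alpha> yields compactness.\<close>

lemma strong_limit:
  assumes D: "\<And>i :: nat. D i \<in> L2Hs T q" and C: "\<And>i. (LINT s|lebesgue_on {0..T}. (hs_norm q (D i s))\<^sup>2) \<le> C"
    and \<alpha>: "0 < \<alpha>" "s_crit + \<alpha> \<le> q"
    and modes: "\<And>k. (\<lambda>i. LINT s|lebesgue_on {0..T}. (cmod (D i s k))\<^sup>2) \<longlonglongrightarrow> 0"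
  shows "(\<lambda>i. LINT s|lebesgue_on {0..T}. (hs_norm s_crit (D i s))\<^sup>2) \<longlonglongrightarrow> 0"
proof (rule LIMSEQ_I)
  fix e :: real assume e: "0 < e"
  let ?M = "lebesgue_on {0..T}"
  have C0: "0 \<le> C" using C[of 0] by (meson Bochner_Integration.integral_nonneg order_trans zero_le_power2)
  have "(\<lambda>m. real m powr (- (2 * \<alpha>))) \<longlonglongrightarrow> 0"
    using tendsto_neg_powr[of "- (2 * \<alpha>)" "\<lambda>m. real m" sequentially] \<alpha> filterlim_real_sequentially by simp
  then have "(\<lambda>m. real m powr (- (2 * \<alpha>)) * C) \<longlonglongrightarrow> 0" by (rule tendsto_mult_left_zero)
  from LIMSEQ_D[OF this, of "e / 2"] e obtain m0 where m0: "\<And>m. m0 \<le> m \<Longrightarrow> norm (real m powr (- (2 * \<alpha>)) * C - 0) < e / 2" by auto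
  define m where "m = max m0 1"
  have m: "real m powr (- (2 * \<alpha>)) * C < e / 2" "1 \<le> m" using m0[of m] by (auto simp: m_def)
  have tail: "(hs_norm s_crit f)\<^sup>2 \<le> (\<Sum>k\<in>fbox m. (freq k powr s_crit * cmod (f k))\<^sup>2) + real m powr (- (2 * \<alpha>)) * (hs_norm q f)\<^sup>2"
    if f: "f \<in> Hs q" for f
  proof -
    have fc: "f \<in> Hs s_crit" by (rule Hs_mono(1)[OF f]) (use \<alpha> in simp)
    have "(hs_norm s_crit (f - trunc m f))\<^sup>2 \<le> real m powr (- (2 * \<alpha>)) * (hs_norm q f)\<^sup>2"
      unfolding hs_norm_sq
    proof (subst infsum_cmult_right'[symmetric], rule infsum_mono)
      show "(\<lambda>k. (freq k powr s_crit * cmod ((f - trunc m f) k))\<^sup>2) summable_on UNIV"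
        by (rule HsD(3)[OF Hs_diff(1)[OF fc trunc_Hs[OF fc]]])
      show "(\<lambda>k. real m powr (- (2 * \<alpha>)) * (freq k powr q * cmod (f k))\<^sup>2) summable_on UNIV"
        by (rule summable_on_cmult_right[OF HsD(3)[OF f]])
      fix k
      show "(freq k powr s_crit * cmod ((f - trunc m f) k))\<^sup>2 \<le> real m powr (- (2 * \<alpha>)) * (freq k powr q * cmod (f k))\<^sup>2"
      proof (cases "k \<in> fbox m")
        case False
        have mk: "real m \<le> freq k" by (rule freq_not_box[OF False])
        then have k0: "k \<noteq> 0" using m(2) by auto
        have "freq k powr s_crit \<le> freq k powr (q - \<alpha>)" by (rule freq_powr_mono[OF k0]) (use \<alpha> in simp)
        also have "\<dots> = freq k powr (- \<alpha>) * freq k powr q" by (simp add: powr_add[symmetric])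
        also have "\<dots> \<le> real m powr (- \<alpha>) * freq k powr q"
          using mk m(2) \<alpha> by (intro mult_right_mono powr_mono2') auto
        finally have "(freq k powr s_crit * cmod (f k))\<^sup>2 \<le> (real m powr (- \<alpha>) * freq k powr q * cmod (f k))\<^sup>2"
          by (intro power_mono mult_right_mono) auto
        also have "\<dots> = real m powr (- (2 * \<alpha>)) * (freq k powr q * cmod (f k))\<^sup>2"
        proof -
          have "(real m powr (- \<alpha>))\<^sup>2 = real m powr (- (2 * \<alpha>))" by (simp add: power2_eq_square powr_add[symmetric])
          then show ?thesis by (simp only: power_mult_distrib mult.assoc)
        qed
        finally show ?thesis using False by (simp add: trunc_def)
      qed (simp add: trunc_def)
    qed
    then show ?thesis using hs_norm_tail[OF fc, of m] by simp
  qed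
  have Dc: "D i \<in> L2Hs T s_crit" for i by (rule L2Hs_mono[OF D]) (use \<alpha> in simp)
  have sqi: "integrable ?M (\<lambda>s. (cmod (D i s k))\<^sup>2)" for i k
  proof (rule Bochner_Integration.integrable_bound)
    show "integrable ?M (\<lambda>s. (freq k powr (- q))\<^sup>2 * (hs_norm q (D i s))\<^sup>2)"
      using L2Hs_norm_integrable(2)[OF D[of i]] by simp
    have cD: "coord_measurable T (D i)" and ae: "AE s in ?M. D i s \<in> Hs q" using D[of i] unfolding L2Hs_iff by blast+
    note [measurable] = coord_measurableD[OF cD]
    show "(\<lambda>s. (cmod (D i s k))\<^sup>2) \<in> borel_measurable ?M" by measurable
    show "AE s in ?M. norm ((cmod (D i s k))\<^sup>2) \<le> norm ((freq k powr (- q))\<^sup>2 * (hs_norm q (D i s))\<^sup>2)"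
      using ae
    proof eventually_elim
      case (elim s)
      have "(cmod (D i s k))\<^sup>2 \<le> (freq k powr (- q) * hs_norm q (D i s))\<^sup>2"
        by (intro power_mono Hs_cmod_le[OF elim]) simp
      then show ?case by (simp add: power_mult_distrib)
    qed
  qed
  have sumi: "integrable ?M (\<lambda>s. \<Sum>k\<in>fbox m. (freq k powr s_crit * cmod (D i s k))\<^sup>2)" for i
    unfolding power_mult_distrib using sqi by simp
  have le: "(LINT s|?M. (hs_norm s_crit (D i s))\<^sup>2) \<le> (\<Sum>k\<in>fbox m. (freq k powr s_crit)\<^sup>2 * (LINT s|?M. (cmod (D i s k))\<^sup>2)) + e / 2" for i
  proof -
    have ae: "AE s in ?M. D i s \<in> Hs q" using D[of i] unfolding L2Hs_iff by blast
    have "(LINT s|?M. (hs_norm s_crit (D i s))\<^sup>2) \<le> (LINT s|?M. (\<Sum>k\<in>fbox m. (freq k powr s_crit * cmod (D i s k))\<^sup>2) + real m powr (- (2 * \<alpha>)) * (hs_norm q (D i s))\<^sup>2)"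
    proof (rule integral_mono_AE)
      show "AE s in ?M. (hs_norm s_crit (D i s))\<^sup>2 \<le> (\<Sum>k\<in>fbox m. (freq k powr s_crit * cmod (D i s k))\<^sup>2) + real m powr (- (2 * \<alpha>)) * (hs_norm q (D i s))\<^sup>2"
        using ae by eventually_elim (rule tail)
    qed (use L2Hs_norm_integrable(2)[OF Dc[of i]] L2Hs_norm_integrable(2)[OF D[of i]] sumi[of i] in auto)
    also have "\<dots> = (\<Sum>k\<in>fbox m. (freq k powr s_crit)\<^sup>2 * (LINT s|?M. (cmod (D i s k))\<^sup>2)) + real m powr (- (2 * \<alpha>)) * (LINT s|?M. (hs_norm q (D i s))\<^sup>2)"
    proof -
      have "(LINT s|?M. (\<Sum>k\<in>fbox m. (freq k powr s_crit * cmod (D i s k))\<^sup>2)) = (\<Sum>k\<in>fbox m. (freq k powr s_crit)\<^sup>2 * (LINT s|?M. (cmod (D i s k))\<^sup>2))"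
        unfolding power_mult_distrib using sqi by (subst Bochner_Integration.integral_sum) auto
      then show ?thesis using sumi[of i] L2Hs_norm_integrable(2)[OF D[of i]] by (subst Bochner_Integration.integral_add) auto
    qed
    also have "real m powr (- (2 * \<alpha>)) * (LINT s|?M. (hs_norm q (D i s))\<^sup>2) \<le> real m powr (- (2 * \<alpha>)) * C"
      by (intro mult_left_mono C) simp
    finally show ?thesis using m(1) by linarith
  qed
  have "(\<lambda>i. \<Sum>k\<in>fbox m. (freq k powr s_crit)\<^sup>2 * (LINT s|?M. (cmod (D i s k))\<^sup>2)) \<longlonglongrightarrow> (\<Sum>k\<in>fbox m. (freq k powr s_crit)\<^sup>2 * 0)"
    by (intro tendsto_sum tendsto_mult tendsto_const modes)
  then have "(\<lambda>i. \<Sum>k\<in>fbox m. (freq k powr s_crit)\<^sup>2 * (LINT s|?M. (cmod (D i s k))\<^sup>2)) \<longlonglongrightarrow> 0" by simp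
  from LIMSEQ_D[OF this, of "e / 2"] e obtain n0 where n0: "\<And>i. n0 \<le> i \<Longrightarrow> norm ((\<Sum>k\<in>fbox m. (freq k powr s_crit)\<^sup>2 * (LINT s|?M. (cmod (D i s k))\<^sup>2)) - 0) < e / 2" by auto
  show "\<exists>no. \<forall>n\<ge>no. norm ((LINT s|?M. (hs_norm s_crit (D n s))\<^sup>2) - 0) < e"
  proof (intro exI[of _ n0] allI impI)
    fix i assume "n0 \<le> i"
    have "0 \<le> (LINT s|?M. (hs_norm s_crit (D i s))\<^sup>2)" by simp
    then show "norm ((LINT s|?M. (hs_norm s_crit (D i s))\<^sup>2) - 0) < e"
      using le[of i] n0[OF \<open>n0 \<le> i\<close>] unfolding real_norm_def diff_0_right by linarith
  qed
qed

text \<open>The local Lipschitz bound for \<open>advect\<close> is integrated by Cauchy-Schwarz in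
  time: bounded norms times a norm that tends to zero.\<close>

lemma advect_integral_limit:
  assumes X: "\<And>i :: nat. X i \<in> L2Hs T s_crit" and \<theta>: "\<theta> \<in> L2Hs T s_crit"
    and C: "\<And>i. L2Hs_norm T s_crit (X i) \<le> C"
    and lim: "(\<lambda>i. LINT s|lebesgue_on {0..T}. (hs_norm s_crit (X i s - \<theta> s))\<^sup>2) \<longlonglongrightarrow> 0"
    and t: "t \<in> {0..T}"
  shows "(\<lambda>i. LINT s|lebesgue_on {0..t}. advect (X i s) k) \<longlonglongrightarrow> (LINT s|lebesgue_on {0..t}. advect (\<theta> s) k)"
proof -
  let ?M = "lebesgue_on {0..T}"
  let ?n = "hs_norm s_crit"
  have XD: "(\<lambda>s. X i s - \<theta> s) \<in> L2Hs T s_crit" for i by (rule L2Hs_diff[OF X \<theta>])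
  define B where "B i = (freq k)\<^sup>2 / 2 * (L2Hs_norm T s_crit (X i) + L2Hs_norm T s_crit \<theta>) * L2Hs_norm T s_crit (\<lambda>s. X i s - \<theta> s)" for i
  have "(\<lambda>i. (LINT s|lebesgue_on {0..t}. advect (X i s) k) - (LINT s|lebesgue_on {0..t}. advect (\<theta> s) k)) \<longlonglongrightarrow> 0"
  proof (rule Lim_null_comparison)
    show "(\<lambda>i. (freq k)\<^sup>2 / 2 * (C + L2Hs_norm T s_crit \<theta>) * L2Hs_norm T s_crit (\<lambda>s. X i s - \<theta> s)) \<longlonglongrightarrow> 0"
    proof (rule tendsto_mult_right_zero)
      show "(\<lambda>i. L2Hs_norm T s_crit (\<lambda>s. X i s - \<theta> s)) \<longlonglongrightarrow> 0"
        unfolding L2Hs_norm_def using tendsto_real_sqrt[OF lim] by simp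
    qed
    show "\<forall>\<^sub>F i in sequentially. norm ((LINT s|lebesgue_on {0..t}. advect (X i s) k) - (LINT s|lebesgue_on {0..t}. advect (\<theta> s) k))
      \<le> (freq k)\<^sup>2 / 2 * (C + L2Hs_norm T s_crit \<theta>) * L2Hs_norm T s_crit (\<lambda>s. X i s - \<theta> s)"
    proof (intro always_eventually allI)
      fix i
      note aX = advect_integrable[OF X[of i], of k] and a\<theta> = advect_integrable[OF \<theta>, of k]
      have tT: "t \<le> T" using t by simp
      have "(LINT s|lebesgue_on {0..t}. advect (X i s) k) - (LINT s|lebesgue_on {0..t}. advect (\<theta> s) k) =
          (LINT s|lebesgue_on {0..t}. advect (X i s) k - advect (\<theta> s) k)"
        by (rule Bochner_Integration.integral_diff[symmetric]) (intro integrable_initial[OF _ tT] aX a\<theta>)+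
      also have "norm \<dots> \<le> (LINT s|lebesgue_on {0..t}. norm (advect (X i s) k - advect (\<theta> s) k))"
        by (rule integral_norm_bound)
      also have "\<dots> \<le> (LINT s|?M. norm (advect (X i s) k - advect (\<theta> s) k))"
        by (rule integral_mono_lebesgue_on_AE) (use t aX a\<theta> in auto)
      also have "\<dots> \<le> (LINT s|?M. (freq k)\<^sup>2 / 2 * (\<bar>?n (X i s) * ?n (X i s - \<theta> s)\<bar> + \<bar>?n (\<theta> s) * ?n (X i s - \<theta> s)\<bar>))"
      proof (rule integral_mono_AE)
        show "integrable ?M (\<lambda>s. norm (advect (X i s) k - advect (\<theta> s) k))" using aX a\<theta> by auto
        have 1: "integrable ?M (\<lambda>s. ?n (X i s) * ?n (X i s - \<theta> s))" 
          by (rule integrable_mult_L2) (intro L2Hs_norm_integrable X XD)+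
        have 2: "integrable ?M (\<lambda>s. ?n (\<theta> s) * ?n (X i s - \<theta> s))" 
          by (rule integrable_mult_L2) (intro L2Hs_norm_integrable \<theta> XD)+
        show "integrable ?M (\<lambda>s. (freq k)\<^sup>2 / 2 * (\<bar>?n (X i s) * ?n (X i s - \<theta> s)\<bar> + \<bar>?n (\<theta> s) * ?n (X i s - \<theta> s)\<bar>))"
          using 1 2 by auto
        have "AE s in ?M. X i s \<in> Hs s_crit \<and> \<theta> s \<in> Hs s_crit"
          using X[of i] \<theta> unfolding L2Hs_iff by (intro AE_conjI) blast+
        then show "AE s in ?M. norm (advect (X i s) k - advect (\<theta> s) k) \<le> (freq k)\<^sup>2 / 2 * (\<bar>?n (X i s) * ?n (X i s - \<theta> s)\<bar> + \<bar>?n (\<theta> s) * ?n (X i s - \<theta> s)\<bar>)"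
        proof eventually_elim
          case (elim s)
          then have "norm (advect (X i s) k - advect (\<theta> s) k) \<le> (freq k)\<^sup>2 / 2 * ((?n (X i s) + ?n (\<theta> s)) * ?n (X i s - \<theta> s))"
            by (intro advect_diff_bound) auto
          then show ?case by (simp add: abs_mult distrib_right)
        qed
      qed
      also have "\<dots> = (freq k)\<^sup>2 / 2 * ((LINT s|?M. \<bar>?n (X i s) * ?n (X i s - \<theta> s)\<bar>) + (LINT s|?M. \<bar>?n (\<theta> s) * ?n (X i s - \<theta> s)\<bar>))"
      proof -
        have 1: "integrable ?M (\<lambda>s. \<bar>?n (X i s) * ?n (X i s - \<theta> s)\<bar>)" 
          by (rule integrable_abs, rule integrable_mult_L2) (intro L2Hs_norm_integrable X XD)+
        have 2: "integrable ?M (\<lambda>s. \<bar>?n (\<theta> s) * ?n (X i s - \<theta> s)\<bar>)" 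
          by (rule integrable_abs, rule integrable_mult_L2) (intro L2Hs_norm_integrable \<theta> XD)+
        show ?thesis unfolding Bochner_Integration.integral_mult_right_zero Bochner_Integration.integral_add[OF 1 2] ..
      qed
      also have "\<dots> \<le> (freq k)\<^sup>2 / 2 * (L2Hs_norm T s_crit (X i) * L2Hs_norm T s_crit (\<lambda>s. X i s - \<theta> s) + L2Hs_norm T s_crit \<theta> * L2Hs_norm T s_crit (\<lambda>s. X i s - \<theta> s))"
        unfolding L2Hs_norm_def
        by (intro mult_left_mono add_mono Cauchy_Schwarz_integral L2Hs_norm_integrable X \<theta> XD) auto
      also have "\<dots> = (freq k)\<^sup>2 / 2 * (L2Hs_norm T s_crit (X i) + L2Hs_norm T s_crit \<theta>) * L2Hs_norm T s_crit (\<lambda>s. X i s - \<theta> s)"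
        by (simp add: algebra_simps)
      also have "\<dots> \<le> (freq k)\<^sup>2 / 2 * (C + L2Hs_norm T s_crit \<theta>) * L2Hs_norm T s_crit (\<lambda>s. X i s - \<theta> s)"
        by (intro mult_right_mono mult_left_mono add_right_mono C) (auto simp: L2Hs_norm_def)
      finally show "norm ((LINT s|lebesgue_on {0..t}. advect (X i s) k) - (LINT s|lebesgue_on {0..t}. advect (\<theta> s) k))
        \<le> (freq k)\<^sup>2 / 2 * (C + L2Hs_norm T s_crit \<theta>) * L2Hs_norm T s_crit (\<lambda>s. X i s - \<theta> s)" .
    qed
  qed
  then show ?thesis by (rule LIM_zero_cancel)
qed

text \<open>The primitive of \<open>w\<close> becomes a modulus of continuity shared by all paths
  whose right-hand side it dominates.\<close>

lemma integral_increment_le: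
  fixes f :: "real \<Rightarrow> complex" and w :: "real \<Rightarrow> real"
  assumes f: "integrable (lebesgue_on {0..t}) f" and w: "integrable (lebesgue_on {0..t}) w"
    and le: "\<And>s. s \<in> {0..t} \<Longrightarrow> cmod (f s) \<le> w s" and t: "t' \<le> t"
  shows "cmod ((LINT s|lebesgue_on {0..t}. f s) - (LINT s|lebesgue_on {0..t'}. f s)) \<le>
    (LINT s|lebesgue_on {0..t}. w s) - (LINT s|lebesgue_on {0..t'}. w s)"
proof -
  let ?M = "lebesgue_on {0..t}"
  have id [measurable]: "(\<lambda>x. x) \<in> borel_measurable ?M"
    by (rule measurable_restrict_space1) (rule measurable_completion, simp)
  note [measurable] = borel_measurable_integrable[OF f] borel_measurable_integrable[OF w]
  have fi: "integrable ?M (\<lambda>s. if s \<le> t' then f s else 0)"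
    by (rule Bochner_Integration.integrable_bound[OF f]) auto
  have wi: "integrable ?M (\<lambda>s. if s \<le> t' then w s else 0)"
    by (rule Bochner_Integration.integrable_bound[OF w]) auto
  have "(LINT s|?M. f s) - (LINT s|lebesgue_on {0..t'}. f s) = (LINT s|?M. f s - (if s \<le> t' then f s else 0))"
    unfolding integral_initial_part[OF t, of f, symmetric] by (rule Bochner_Integration.integral_diff[OF f fi, symmetric])
  also have "cmod \<dots> \<le> (LINT s|?M. cmod (f s - (if s \<le> t' then f s else 0)))" by (rule integral_norm_bound)
  also have "\<dots> \<le> (LINT s|?M. w s - (if s \<le> t' then w s else 0))"
  proof (rule integral_mono)
    show "integrable ?M (\<lambda>s. cmod (f s - (if s \<le> t' then f s else 0)))" using f fi by auto
    show "integrable ?M (\<lambda>s. w s - (if s \<le> t' then w s else 0))" using w wi by auto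
  qed (use le in auto)
  also have "\<dots> = (LINT s|?M. w s) - (LINT s|lebesgue_on {0..t'}. w s)"
    unfolding integral_initial_part[OF t, of w, symmetric] by (rule Bochner_Integration.integral_diff[OF w wi])
  finally show ?thesis .
qed

lemma integral_point: "(LINT s|lebesgue_on {0..0 :: real}. f s) = (0 :: 'b :: {banach, second_countable_topology})"
proof (rule integral_eq_zero_AE)
  have "AE s in lebesgue_on {0..0 :: real}. s \<noteq> 0" by (rule AE_neq_lebesgue_on) simp
  then show "AE s in lebesgue_on {0..0 :: real}. f s = 0" using AE_in_interval[of 0] by eventually_elim auto
qed

lemma bounded_convergence_interval:
  fixes f :: "nat \<Rightarrow> real \<Rightarrow> 'b :: euclidean_space"
  assumes c: "\<And>i. continuous_on {0..T} (f i)" and hc: "continuous_on {0..T} h"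
    and lim: "\<And>s. s \<in> {0..T} \<Longrightarrow> (\<lambda>i. f i s) \<longlonglongrightarrow> h s" and B: "\<And>i s. s \<in> {0..T} \<Longrightarrow> norm (f i s) \<le> B"
    and t: "t \<le> T"
  shows "(\<lambda>i. LINT s|lebesgue_on {0..t}. f i s) \<longlonglongrightarrow> (LINT s|lebesgue_on {0..t}. h s)"
proof (rule integral_dominated_convergence[where w="\<lambda>_. B"])
  interpret finite_measure "lebesgue_on {0..t}" by (rule finite_measure_lebesgue_on) simp
  have sub: "{0..t} \<subseteq> {0..T}" using t by auto
  show "h \<in> borel_measurable (lebesgue_on {0..t})"
    by (rule borel_measurable_integrable[OF continuous_imp_integrable_real[OF continuous_on_subset[OF hc sub]]])
  show "f i \<in> borel_measurable (lebesgue_on {0..t})" for i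
    by (rule borel_measurable_integrable[OF continuous_imp_integrable_real[OF continuous_on_subset[OF c sub]]])
  show "integrable (lebesgue_on {0..t}) (\<lambda>_. B)" by simp
  show "AE s in lebesgue_on {0..t}. (\<lambda>i. f i s) \<longlonglongrightarrow> h s"
    using AE_in_interval by eventually_elim (rule lim, use sub in blast)
  show "AE s in lebesgue_on {0..t}. norm (f i s) \<le> B" for i
    using AE_in_interval by eventually_elim (rule B, use sub in blast)
qed

lemma mode_compactness:
  fixes X :: "nat \<Rightarrow> real \<Rightarrow> fourier"
  assumes K: "\<And>n t k. t \<in> {0..T} \<Longrightarrow> cmod (X n t k) \<le> K k"
    and W: "\<And>k. continuous_on {0..T} (W k)"
    and inc: "\<And>n k t t'. k \<in> fbox n \<Longrightarrow> t \<in> {0..T} \<Longrightarrow> t' \<in> {0..T} \<Longrightarrow> t' \<le> t \<Longrightarrow>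
      cmod (X n t k - X n t' k) \<le> W k t - W k t'"
  obtains d h where "strict_mono (d :: nat \<Rightarrow> nat)"
    "\<And>k. uniform_limit {0..T} (\<lambda>i t. X (d i) t k) (h k) sequentially"
proof -
  let ?P = "\<lambda>j \<sigma>. \<exists>h. uniform_limit {0..T} (\<lambda>i t. X (\<sigma> i) t (from_nat j :: int \<times> int)) h sequentially"
  have equi: "cmod (X n t k - X n t' k) \<le> \<bar>W k t - W k t'\<bar>" if "k \<in> fbox n" "t \<in> {0..T}" "t' \<in> {0..T}" for n k t t'
    using inc[OF that(1,2,3)] inc[OF that(1,3,2)] by (cases "t' \<le> t") (auto simp: norm_minus_commute abs_minus_commute)
  interpret subseqs ?P
  proof
    fix j and \<sigma> :: "nat \<Rightarrow> nat" assume \<sigma>: "strict_mono \<sigma>"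
    define k where "k = (from_nat j :: int \<times> int)"
    \<comment> \<open>Mode \<open>k\<close> is controlled only for indices whose box contains it, so
      an initial segment is skipped.\<close>
    obtain n0 where n0: "k \<in> fbox n0" using ex_box by blast
    have kin: "k \<in> fbox (\<sigma> (i + n0))" for i
    proof -
      have "n0 \<le> \<sigma> (i + n0)" using seq_suble[OF \<sigma>, of "i + n0"] by simp
      then show ?thesis using box_mono n0 by blast
    qed
    obtain g \<kappa> where g: "continuous_on {0..T} g" "strict_mono (\<kappa> :: nat \<Rightarrow> nat)"
      "\<And>e. 0 < e \<Longrightarrow> \<exists>N. \<forall>n x. n \<ge> N \<and> x \<in> {0..T} \<longrightarrow> norm (X (\<sigma> (\<kappa> n + n0)) x k - g x) < e"
    proof (rule Arzela_Ascoli[of "{0..T}" "\<lambda>i t. X (\<sigma> (i + n0)) t k" "K k"])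
      show "norm (X (\<sigma> (i + n0)) t k) \<le> K k" if "t \<in> {0..T}" for i t using K[OF that] .
      fix t and e :: real assume t: "t \<in> {0..T}" and e: "0 < e"
      obtain d where d: "0 < d" "\<And>t'. t' \<in> {0..T} \<Longrightarrow> dist t' t < d \<Longrightarrow> dist (W k t') (W k t) < e"
        using W[of k] t e unfolding continuous_on_iff by blast
      show "\<exists>d>0. \<forall>i y. y \<in> {0..T} \<and> norm (t - y) < d \<longrightarrow> norm (X (\<sigma> (i + n0)) t k - X (\<sigma> (i + n0)) y k) < e"
      proof (intro exI[of _ d] conjI allI impI d(1))
        fix i y assume y: "y \<in> {0..T} \<and> norm (t - y) < d"
        then have "\<bar>W k t - W k y\<bar> < e" using d(2)[of y] by (simp add: dist_real_def abs_minus_commute)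
        then show "norm (X (\<sigma> (i + n0)) t k - X (\<sigma> (i + n0)) y k) < e"
          using equi[OF kin t, of y i] y by auto
      qed
    qed auto
    have "uniform_limit {0..T} (\<lambda>i t. X ((\<sigma> \<circ> (\<lambda>i. \<kappa> i + n0)) i) t k) g sequentially"
      unfolding uniform_limit_iff eventually_sequentially using g(3) by (fastforce simp: dist_norm)
    moreover have "strict_mono (\<lambda>i. \<kappa> i + n0)" using g(2) by (simp add: strict_mono_def)
    ultimately show "\<exists>r'. strict_mono r' \<and> (\<exists>h. uniform_limit {0..T} (\<lambda>i t. X ((\<sigma> \<circ> r') i) t (from_nat j)) h sequentially)"
      unfolding k_def by blast
  qed
  have ex: "\<exists>h. uniform_limit {0..T} (\<lambda>i t. X (diagseq i) t k) h sequentially" for k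
  proof -
    have "?P (to_nat k) (diagseq \<circ> ((+) (Suc (to_nat k))))"
    proof (rule diagseq_holds)
      fix r s :: "nat \<Rightarrow> nat" and n assume r: "strict_mono r" and P: "?P n s"
      then obtain h where h: "uniform_limit {0..T} (\<lambda>i t. X (s i) t (from_nat n)) h sequentially" by blast
      have "uniform_limit {0..T} (\<lambda>i t. X ((s \<circ> r) i) t (from_nat n)) h sequentially"
        unfolding o_def by (rule filterlim_compose[OF h filterlim_subseq[OF r]])
      then show "?P n (s \<circ> r)" by blast
    qed
    then obtain h where h: "uniform_limit {0..T} (\<lambda>i t. X (diagseq (Suc (to_nat k) + i)) t k) h sequentially"
      by (auto simp: o_def)
    \<comment> \<open>The diagonal sequence is a convergent subsequence for mode \<open>k\<close>
      only from some index on; the shift of the index is undone here.\<close>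
    have "((\<forall>\<^sub>F i in sequentially. \<forall>t\<in>{0..T}. dist (X (diagseq i) t k) (h t) < e))" if "0 < e" for e
    proof -
      have "\<forall>\<^sub>F i in sequentially. \<forall>t\<in>{0..T}. dist (X (diagseq (i + Suc (to_nat k))) t k) (h t) < e"
        using h that unfolding uniform_limit_iff by (simp only: add.commute)
      then show ?thesis
        by (rule eventually_sequentially_seg[where k="Suc (to_nat k)", THEN iffD1])
    qed
    then have "uniform_limit {0..T} (\<lambda>i t. X (diagseq i) t k) h sequentially"
      unfolding uniform_limit_iff by blast
    then show ?thesis by blast
  qed
  define h where "h k = (SOME h. uniform_limit {0..T} (\<lambda>i t. X (diagseq i) t k) h sequentially)" for k
  have "uniform_limit {0..T} (\<lambda>i t. X (diagseq i) t k) (h k) sequentially" for k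
    unfolding h_def by (rule someI_ex[OF ex])
  then show thesis by (rule that[OF subseq_diagseq])
qed

lemma L2Hs_diff_sq_le:
  assumes f: "f \<in> L2Hs T r" and g: "g \<in> L2Hs T r"
  shows "(LINT s|lebesgue_on {0..T}. (hs_norm r (f s - g s))\<^sup>2) \<le>
    2 * (LINT s|lebesgue_on {0..T}. (hs_norm r (f s))\<^sup>2) + 2 * (LINT s|lebesgue_on {0..T}. (hs_norm r (g s))\<^sup>2)"
proof -
  note F = L2Hs_norm_integrable(2)[OF f] and G = L2Hs_norm_integrable(2)[OF g]
  have ae: "AE t in lebesgue_on {0..T}. f t \<in> Hs r \<and> g t \<in> Hs r"
    using f g unfolding L2Hs_iff by (intro AE_conjI) blast+
  have "(LINT s|lebesgue_on {0..T}. (hs_norm r (f s - g s))\<^sup>2) \<le>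
    (LINT s|lebesgue_on {0..T}. 2 * (hs_norm r (f s))\<^sup>2 + 2 * (hs_norm r (g s))\<^sup>2)"
  proof (rule integral_mono_AE)
    show "integrable (lebesgue_on {0..T}) (\<lambda>s. (hs_norm r (f s - g s))\<^sup>2)"
      by (rule L2Hs_norm_integrable(2)[OF L2Hs_diff[OF f g]])
    show "AE s in lebesgue_on {0..T}. (hs_norm r (f s - g s))\<^sup>2 \<le> 2 * (hs_norm r (f s))\<^sup>2 + 2 * (hs_norm r (g s))\<^sup>2"
      using ae
    proof eventually_elim
      case (elim t)
      have "(hs_norm r (f t - g t))\<^sup>2 \<le> (hs_norm r (f t) + hs_norm r (g t))\<^sup>2"
        using Hs_diff(2)[of "f t" r "g t"] elim by (intro power_mono) auto
      also have "\<dots> \<le> 2 * (hs_norm r (f t))\<^sup>2 + 2 * (hs_norm r (g t))\<^sup>2"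
        using sum_squares_bound[of "hs_norm r (f t)" "hs_norm r (g t)"] by (simp add: power2_sum)
      finally show ?case .
    qed
  qed (use F G in auto)
  then show ?thesis using F G by simp
qed

text \<open>Three kinds of convergence of the Galerkin paths are combined: strong in order
  \<open>s_crit\<close> for the quadratic term, weak in order \<open>q\<close> for the work of the
  control, and lower semicontinuity for the energies.\<close>

lemma Leray_solution_exists:
  assumes T: "0 < T" and \<theta>0: "\<theta>0 \<in> Hs (\<alpha> - 2 * \<beta>)" and g: "g \<in> L2Hs T 0"
    and s: "\<alpha> - 2 * \<beta> = 0 \<or> \<alpha> - 2 * \<beta> = s_crit" and \<alpha>: "0 < \<alpha>"
  shows "\<exists>\<theta>. \<theta> 0 = \<theta>0 \<and> weak_solution \<alpha> \<beta> T g (\<theta> 0) \<theta> \<and> energy_inequality \<alpha> \<beta> T g \<theta>"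
proof -
  define r where "r = \<alpha> - 2 * \<beta>"
  define q where "q = 2 * \<alpha> - 2 * \<beta>"
  have rq: "s_crit \<le> r" "r \<le> q" "s_crit \<le> q" "s_crit + \<alpha> \<le> q" using s \<alpha> unfolding r_def q_def s_crit_def by auto
  define P where "P N x \<longleftrightarrow> (\<forall>k. continuous_on {0..T} (\<lambda>t. x t k)) \<and> (\<forall>t\<in>{0..T}. x t \<in> Hs q) \<and> x \<in> L2Hs T q \<and>
    (\<forall>k\<in>fbox N. \<forall>t\<in>{0..T}. x t k = \<theta>0 k + (LINT s|lebesgue_on {0..t}. mode_rhs \<alpha> \<beta> (x s) (g s) k)) \<and>
    (\<forall>t\<in>{0..T}. (hs_norm r (x t))\<^sup>2 + 2 * (LINT s|lebesgue_on {0..t}. (hs_norm q (x s))\<^sup>2)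
      \<le> (hs_norm r \<theta>0)\<^sup>2 + 2 * (LINT s|lebesgue_on {0..t}. pair (Lam q (x s)) (g s)))" for N x
  have exP: "\<exists>x. P N x" for N
    unfolding P_def r_def q_def by (rule galerkin_exists[OF T \<theta>0 g s]) (use \<alpha> in simp)
  define X where "X N = (SOME x. P N x)" for N
  have PX: "P N (X N)" for N unfolding X_def by (rule someI_ex[OF exP])
  have Xc: "continuous_on {0..T} (\<lambda>t. X N t k)" and XH: "t \<in> {0..T} \<Longrightarrow> X N t \<in> Hs q" and XL: "X N \<in> L2Hs T q"
    and Xeq: "k \<in> fbox N \<Longrightarrow> t \<in> {0..T} \<Longrightarrow> X N t k = \<theta>0 k + (LINT s|lebesgue_on {0..t}. mode_rhs \<alpha> \<beta> (X N s) (g s) k)"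
    and XE: "t \<in> {0..T} \<Longrightarrow> (hs_norm r (X N t))\<^sup>2 + 2 * (LINT s|lebesgue_on {0..t}. (hs_norm q (X N s))\<^sup>2)
      \<le> (hs_norm r \<theta>0)\<^sup>2 + 2 * (LINT s|lebesgue_on {0..t}. pair (Lam q (X N s)) (g s))" for N k t
    using PX[of N] unfolding P_def by blast+
  define M where "M = (hs_norm r \<theta>0)\<^sup>2 + (L2Hs_norm T 0 g)\<^sup>2"
  have M0: "0 \<le> M" by (simp add: M_def)
  have XHr: "X N t \<in> Hs r" "X N t \<in> Hs s_crit" if "t \<in> {0..T}" for N t
    using Hs_mono(1)[OF XH[OF that]] rq by auto
  have XM: "(hs_norm r (X N t))\<^sup>2 + (LINT s|lebesgue_on {0..t}. (hs_norm q (X N s))\<^sup>2) \<le> M" if t: "t \<in> {0..T}" for N t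
  proof -
    have "2 * (LINT s|lebesgue_on {0..t}. pair (Lam q (X N s)) (g s)) \<le> (LINT s|lebesgue_on {0..t}. (hs_norm q (X N s))\<^sup>2) + (L2Hs_norm t 0 g)\<^sup>2"
      by (rule energy_absorb) (use L2Hs_initial[OF XL] L2Hs_initial[OF g] t in auto)
    then show ?thesis using XE[OF t, of N] L2Hs_norm_initial_le[OF g t] unfolding M_def by linarith
  qed
  have XMr: "(hs_norm r (X N t))\<^sup>2 \<le> M" if t: "t \<in> {0..T}" for N t
  proof -
    have "0 \<le> (LINT s|lebesgue_on {0..t}. (hs_norm q (X N s))\<^sup>2)" by simp
    then show ?thesis using XM[OF t, of N] by linarith
  qed
  have TT: "T \<in> {0..T}" "0 \<in> {0..T}" using T by auto
  have XMq: "(LINT s|lebesgue_on {0..T}. (hs_norm q (X N s))\<^sup>2) \<le> M" for N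
  proof -
    have "0 \<le> (hs_norm r (X N T))\<^sup>2" by simp
    then show ?thesis using XM[OF TT(1), of N] by linarith
  qed
  define K where "K k = freq k powr (- r) * sqrt M" for k
  have K: "cmod (X N t k) \<le> K k" if t: "t \<in> {0..T}" for N t k
  proof -
    have "cmod (X N t k) \<le> freq k powr (- r) * hs_norm r (X N t)" by (rule Hs_cmod_le[OF XHr(1)[OF t]])
    also have "\<dots> \<le> K k" unfolding K_def using XMr[OF t, of N] by (intro mult_left_mono real_le_rsqrt) auto
    finally show ?thesis .
  qed
  \<comment> \<open>A bound for the right-hand side of mode \<open>k\<close>, uniform in the
    truncation; it is integrable rather than bounded in time because of the control.\<close>
  define w where "w k s = (freq k powr (2 * \<alpha>) * K k + (freq k)\<^sup>2 / 2 * M) + freq k powr (2 * \<beta>) * cmod (g s k)" for k s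
  have wi: "integrable (lebesgue_on {0..t}) (w k)" if "t \<le> T" for k t
  proof -
    interpret finite_measure "lebesgue_on {0..t}" by (rule finite_measure_lebesgue_on) simp
    have "integrable (lebesgue_on {0..t}) (\<lambda>s. cmod (g s k))"
      by (rule integrable_norm) (rule integrable_initial[OF L2Hs_coord_integrable[OF g] that])
    then show ?thesis unfolding w_def[abs_def] by simp
  qed
  have rhs_le: "cmod (mode_rhs \<alpha> \<beta> (X N u) (g u) k) \<le> w k u" if u: "u \<in> {0..T}" for N u k
  proof -
    have "cmod (mode_rhs \<alpha> \<beta> (X N u) (g u) k) \<le> cmod (- of_real (freq k powr (2 * \<alpha>)) * X N u k - advect (X N u) k) + cmod (of_real (freq k powr (2 * \<beta>)) * g u k)"
      unfolding mode_rhs_def by (rule norm_triangle_ineq)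
    also have "cmod (- of_real (freq k powr (2 * \<alpha>)) * X N u k - advect (X N u) k) \<le> cmod (- of_real (freq k powr (2 * \<alpha>)) * X N u k) + cmod (advect (X N u) k)"
      by (rule norm_triangle_ineq4)
    also have "cmod (- of_real (freq k powr (2 * \<alpha>)) * X N u k) \<le> freq k powr (2 * \<alpha>) * K k"
      using K[OF u] by (simp add: norm_mult mult_left_mono)
    also have "cmod (advect (X N u) k) \<le> (freq k)\<^sup>2 / 2 * M"
    proof -
      have "(hs_norm s_crit (X N u))\<^sup>2 \<le> (hs_norm r (X N u))\<^sup>2"
        by (intro power_mono Hs_mono(2)[OF XHr(1)[OF u] rq(1)]) simp
      then have "(hs_norm s_crit (X N u))\<^sup>2 \<le> M" using XMr[OF u, of N] by linarith
      then have "(freq k)\<^sup>2 / 2 * (hs_norm s_crit (X N u))\<^sup>2 \<le> (freq k)\<^sup>2 / 2 * M"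
        by (intro mult_left_mono) auto
      then show ?thesis using advect_bound[OF XHr(2)[OF u], of N k] by linarith
    qed
    finally show ?thesis by (simp add: w_def norm_mult)
  qed
  have XLc: "X N \<in> L2Hs T s_crit" for N by (rule L2Hs_mono[OF XL rq(3)])
  have rhsi: "integrable (lebesgue_on {0..t}) (\<lambda>s. mode_rhs \<alpha> \<beta> (X N s) (g s) k)" if "t \<le> T" for N t k
    by (rule integrable_initial[OF mode_rhs_integrable[OF XLc g] that])
  obtain d h where d: "strict_mono (d :: nat \<Rightarrow> nat)" and ul: "\<And>k. uniform_limit {0..T} (\<lambda>i t. X (d i) t k) (h k) sequentially"
  proof (rule mode_compactness[where X=X and T=T and K=K and W="\<lambda>k t. LINT s|lebesgue_on {0..t}. w k s"])
    show "cmod (X n t k) \<le> K k" if "t \<in> {0..T}" for n t k by (rule K[OF that])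
    show "continuous_on {0..T} (\<lambda>t. LINT s|lebesgue_on {0..t}. w k s)" for k
      by (rule indefinite_integral_continuous_real[OF wi]) simp
    fix n k t t' assume k: "k \<in> fbox n" and t: "t \<in> {0..T}" "t' \<in> {0..T}" "t' \<le> t"
    have tT: "t \<le> T" using t by simp
    have "X n t k - X n t' k = (LINT s|lebesgue_on {0..t}. mode_rhs \<alpha> \<beta> (X n s) (g s) k) - (LINT s|lebesgue_on {0..t'}. mode_rhs \<alpha> \<beta> (X n s) (g s) k)"
      unfolding Xeq[OF k t(1)] Xeq[OF k t(2)] by simp
    also have "cmod \<dots> \<le> (LINT s|lebesgue_on {0..t}. w k s) - (LINT s|lebesgue_on {0..t'}. w k s)"
      by (rule integral_increment_le[OF rhsi[OF tT] wi[OF tT] rhs_le t(3)]) (use t in auto)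
    finally show "cmod (X n t k - X n t' k) \<le> (LINT s|lebesgue_on {0..t}. w k s) - (LINT s|lebesgue_on {0..t'}. w k s)" .
  qed (rule that)
  define Y where "Y i = X (d i)" for i
  \<comment> \<open>The value off the interval makes the path extensional, as \<open>CwHs\<close>
    demands.\<close>
  define \<theta> where "\<theta> t = (if t \<in> {0..T} then (\<lambda>k. h k t) else undefined)" for t
  have pt: "(\<lambda>i. Y i t k) \<longlonglongrightarrow> \<theta> t k" if t: "t \<in> {0..T}" for t k
    using tendsto_uniform_limitI[OF ul[of k] t] t by (simp add: Y_def \<theta>_def)
  have hc: "continuous_on {0..T} (h k)" for k
    by (rule uniform_limit_theorem[OF always_eventually[OF allI[OF Xc]] ul]) simp
  have \<theta>c: "continuous_on {0..T} (\<lambda>t. \<theta> t k)" for k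
    by (rule continuous_on_eq[OF hc[of k]]) (simp add: \<theta>_def)
  have Yc: "continuous_on {0..T} (\<lambda>t. Y i t k)" for i k unfolding Y_def by (rule Xc)
  have \<theta>H: "\<theta> t \<in> Hs r" "(hs_norm r (\<theta> t))\<^sup>2 \<le> M" if t: "t \<in> {0..T}" for t
    using Hs_box_limit[where f="\<lambda>i. Y i t" and h="\<theta> t" and r=r and M=M] XHr(1)[OF t] XMr[OF t] pt[OF t]
    unfolding Y_def by blast+
  have YK: "cmod (Y i t k) \<le> K k" if "t \<in> {0..T}" for i t k unfolding Y_def by (rule K[OF that])
  have \<theta>K: "cmod (\<theta> t k) \<le> K k" if t: "t \<in> {0..T}" for t k
    by (rule LIMSEQ_le_const2[OF tendsto_norm[OF pt[OF t]]]) (use YK[OF t] in blast)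
  \<comment> \<open>Norms are only lower semicontinuous, so limits are taken in box sums first and
    the boxes are exhausted afterwards.\<close>
  have boxlim: "(\<lambda>i. LINT s|lebesgue_on {0..t}. (\<Sum>k\<in>fbox m. (freq k powr \<rho> * cmod (Y i s k))\<^sup>2)) \<longlonglongrightarrow>
      (LINT s|lebesgue_on {0..t}. (\<Sum>k\<in>fbox m. (freq k powr \<rho> * cmod (\<theta> s k))\<^sup>2))" if "t \<le> T" for t m \<rho>
  proof (rule bounded_convergence_interval[where T=T and B="\<Sum>k\<in>fbox m. (freq k powr \<rho> * K k)\<^sup>2"])
    show "continuous_on {0..T} (\<lambda>s. \<Sum>k\<in>fbox m. (freq k powr \<rho> * cmod (Y i s k))\<^sup>2)" for i
      by (intro continuous_intros Yc)
    show "continuous_on {0..T} (\<lambda>s. \<Sum>k\<in>fbox m. (freq k powr \<rho> * cmod (\<theta> s k))\<^sup>2)"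
      by (intro continuous_intros \<theta>c)
    show "(\<lambda>i. \<Sum>k\<in>fbox m. (freq k powr \<rho> * cmod (Y i s k))\<^sup>2) \<longlonglongrightarrow> (\<Sum>k\<in>fbox m. (freq k powr \<rho> * cmod (\<theta> s k))\<^sup>2)"
      if "s \<in> {0..T}" for s by (intro tendsto_intros pt[OF that])
    show "norm (\<Sum>k\<in>fbox m. (freq k powr \<rho> * cmod (Y i s k))\<^sup>2) \<le> (\<Sum>k\<in>fbox m. (freq k powr \<rho> * K k)\<^sup>2)"
      if "s \<in> {0..T}" for i s
    proof -
      have "norm (\<Sum>k\<in>fbox m. (freq k powr \<rho> * cmod (Y i s k))\<^sup>2) = (\<Sum>k\<in>fbox m. (freq k powr \<rho> * cmod (Y i s k))\<^sup>2)"
        by (simp add: sum_nonneg)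
      also have "\<dots> \<le> (\<Sum>k\<in>fbox m. (freq k powr \<rho> * K k)\<^sup>2)"
        by (intro sum_mono power_mono mult_left_mono YK[OF that]) auto
      finally show ?thesis .
    qed
  qed (rule that)
  have boxi: "integrable (lebesgue_on {0..t}) (\<lambda>s. \<Sum>k\<in>fbox m. (freq k powr \<rho> * cmod (x s k))\<^sup>2)"
    if "t \<le> T" "\<And>k. continuous_on {0..T} (\<lambda>s. x s k)" for t m \<rho> and x :: "real \<Rightarrow> fourier"
  proof -
    have c: "continuous_on {0..T} (\<lambda>s. \<Sum>k\<in>fbox m. (freq k powr \<rho> * cmod (x s k))\<^sup>2)" by (intro continuous_intros that(2))
    show ?thesis by (rule continuous_imp_integrable_real[OF continuous_on_subset[OF c]]) (use that(1) in auto)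
  qed
  have YL: "Y i \<in> L2Hs T q" for i unfolding Y_def by (rule XL)
  have boxle: "(LINT s|lebesgue_on {0..t}. (\<Sum>k\<in>fbox m. (freq k powr q * cmod (Y i s k))\<^sup>2)) \<le> (LINT s|lebesgue_on {0..t}. (hs_norm q (Y i s))\<^sup>2)"
    if t: "t \<le> T" for t i m
  proof (rule integral_mono_AE[OF boxi[OF t Yc]])
    show "integrable (lebesgue_on {0..t}) (\<lambda>s. (hs_norm q (Y i s))\<^sup>2)"
      by (rule L2Hs_norm_integrable(2)[OF L2Hs_initial[OF YL t]])
    show "AE s in lebesgue_on {0..t}. (\<Sum>k\<in>fbox m. (freq k powr q * cmod (Y i s k))\<^sup>2) \<le> (hs_norm q (Y i s))\<^sup>2"
      using AE_in_interval
    proof eventually_elim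
      case (elim s)
      then have "s \<in> {0..T}" using t by auto
      then have "Y i s \<in> Hs q" unfolding Y_def by (rule XH)
      then show ?case unfolding hs_norm_sq by (intro box_sum_le_infsum HsD(3)) auto
    qed
  qed
  have \<theta>m: "coord_measurable T \<theta>" by (rule continuous_coord_measurable[OF \<theta>c])
  have \<theta>L: "\<theta> \<in> L2Hs T q"
  proof (rule L2Hs_boxI[OF \<theta>m])
    show "\<theta> t (- k) = cnj (\<theta> t k)" "\<theta> t 0 = 0" if "t \<in> {0..T}" for t k using HsD[OF \<theta>H(1)[OF that]] by blast+
    show "integrable (lebesgue_on {0..T}) (\<lambda>t. \<Sum>k\<in>fbox n. (freq k powr q * cmod (\<theta> t k))\<^sup>2)" for n
      by (rule boxi[OF order_refl \<theta>c])
    show "(LINT t|lebesgue_on {0..T}. (\<Sum>k\<in>fbox n. (freq k powr q * cmod (\<theta> t k))\<^sup>2)) \<le> M" for n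
    proof (rule LIMSEQ_le_const2[OF boxlim[OF order_refl]])
      have "(LINT s|lebesgue_on {0..T}. (\<Sum>k\<in>fbox n. (freq k powr q * cmod (Y i s k))\<^sup>2)) \<le> M" for i
        using boxle[OF order_refl, of i n] XMq[of "d i"] unfolding Y_def by linarith
      then show "\<exists>N. \<forall>i\<ge>N. (LINT s|lebesgue_on {0..T}. (\<Sum>k\<in>fbox n. (freq k powr q * cmod (Y i s k))\<^sup>2)) \<le> M" by blast
    qed
  qed
  have DL: "(\<lambda>s. Y i s - \<theta> s) \<in> L2Hs T q" for i by (rule L2Hs_diff[OF YL \<theta>L])
  define C where "C = 2 * M + 2 * (LINT s|lebesgue_on {0..T}. (hs_norm q (\<theta> s))\<^sup>2)"
  have DC: "(LINT s|lebesgue_on {0..T}. (hs_norm q (Y i s - \<theta> s))\<^sup>2) \<le> C" for i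
    using L2Hs_diff_sq_le[OF YL[of i] \<theta>L] XMq[of "d i"] unfolding C_def Y_def by linarith
  have \<theta>Lc: "\<theta> \<in> L2Hs T s_crit" by (rule L2Hs_mono[OF \<theta>L rq(3)])
  have YLc: "Y i \<in> L2Hs T s_crit" for i unfolding Y_def by (rule XLc)
  have strong: "(\<lambda>i. LINT s|lebesgue_on {0..T}. (hs_norm s_crit (Y i s - \<theta> s))\<^sup>2) \<longlonglongrightarrow> 0"
  proof (rule strong_limit[OF DL DC \<alpha> rq(4)])
    fix k
    have "(\<lambda>i. LINT s|lebesgue_on {0..T}. (cmod ((Y i s - \<theta> s) k))\<^sup>2) \<longlonglongrightarrow> (LINT s|lebesgue_on {0..T}. 0)"
    proof (rule bounded_convergence_interval[where T=T and B="(2 * K k)\<^sup>2"])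
      show "continuous_on {0..T} (\<lambda>s. (cmod ((Y i s - \<theta> s) k))\<^sup>2)" for i
        unfolding minus_apply by (intro continuous_intros Yc \<theta>c)
      show "(\<lambda>i. (cmod ((Y i s - \<theta> s) k))\<^sup>2) \<longlonglongrightarrow> 0" if "s \<in> {0..T}" for s
      proof -
        have "(\<lambda>i. (cmod (Y i s k - \<theta> s k))\<^sup>2) \<longlonglongrightarrow> (cmod (\<theta> s k - \<theta> s k))\<^sup>2" by (intro tendsto_intros pt[OF that])
        then show ?thesis by simp
      qed
      show "norm ((cmod ((Y i s - \<theta> s) k))\<^sup>2) \<le> (2 * K k)\<^sup>2" if "s \<in> {0..T}" for i s
      proof -
        have "cmod ((Y i s - \<theta> s) k) \<le> 2 * K k"
          using norm_triangle_ineq4[of "Y i s k" "\<theta> s k"] YK[OF that, of i k] \<theta>K[OF that, of k] by simp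
        from power_mono[OF this norm_ge_zero, of 2] show ?thesis unfolding real_norm_def abs_power2 .
      qed
    qed auto
    then show "(\<lambda>i. LINT s|lebesgue_on {0..T}. (cmod ((Y i s - \<theta> s) k))\<^sup>2) \<longlonglongrightarrow> 0" by simp
  qed
  have YCc: "L2Hs_norm T s_crit (Y i) \<le> sqrt M" for i
    unfolding L2Hs_norm_def
  proof (rule real_sqrt_le_mono)
    have "(LINT s|lebesgue_on {0..T}. (hs_norm s_crit (Y i s))\<^sup>2) \<le> (LINT s|lebesgue_on {0..T}. (hs_norm q (Y i s))\<^sup>2)"
    proof (rule integral_mono_AE[OF L2Hs_norm_integrable(2)[OF YLc] L2Hs_norm_integrable(2)[OF YL]])
      have "AE s in lebesgue_on {0..T}. Y i s \<in> Hs q" using YL[of i] unfolding L2Hs_iff by blast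
      then show "AE s in lebesgue_on {0..T}. (hs_norm s_crit (Y i s))\<^sup>2 \<le> (hs_norm q (Y i s))\<^sup>2"
        by eventually_elim (intro power_mono Hs_mono(2)[OF _ rq(3)], auto)
    qed
    then show "(LINT s|lebesgue_on {0..T}. (hs_norm s_crit (Y i s))\<^sup>2) \<le> M" using XMq[of "d i"] unfolding Y_def by linarith
  qed
  have \<theta>eq: "\<theta> t k = \<theta>0 k + (LINT s|lebesgue_on {0..t}. mode_rhs \<alpha> \<beta> (\<theta> s) (g s) k)" if t: "t \<in> {0..T}" for t k
  proof (rule LIMSEQ_unique[OF pt[OF t]])
    have tT: "t \<le> T" using t by simp
    have expand: "(LINT s|lebesgue_on {0..t}. mode_rhs \<alpha> \<beta> (x s) (g s) k) =
       - of_real (freq k powr (2 * \<alpha>)) * (LINT s|lebesgue_on {0..t}. x s k) - (LINT s|lebesgue_on {0..t}. advect (x s) k) + of_real (freq k powr (2 * \<beta>)) * (LINT s|lebesgue_on {0..t}. g s k)"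
      if x: "x \<in> L2Hs T s_crit" for x
      unfolding mode_rhs_def
      using integrable_initial[OF L2Hs_coord_integrable[OF x] tT, of k] integrable_initial[OF advect_integrable[OF x] tT, of k]
        integrable_initial[OF L2Hs_coord_integrable[OF g] tT, of k] by simp
    have "(\<lambda>i. \<theta>0 k + (LINT s|lebesgue_on {0..t}. mode_rhs \<alpha> \<beta> (Y i s) (g s) k)) \<longlonglongrightarrow> \<theta>0 k + (LINT s|lebesgue_on {0..t}. mode_rhs \<alpha> \<beta> (\<theta> s) (g s) k)"
      unfolding expand[OF YLc] expand[OF \<theta>Lc]
    proof (intro tendsto_add tendsto_diff tendsto_mult tendsto_const)
      show "(\<lambda>i. LINT s|lebesgue_on {0..t}. Y i s k) \<longlonglongrightarrow> (LINT s|lebesgue_on {0..t}. \<theta> s k)"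
        by (rule bounded_convergence_interval[where T=T and B="K k"]) (use Yc \<theta>c pt YK tT in auto)
      show "(\<lambda>i. LINT s|lebesgue_on {0..t}. advect (Y i s) k) \<longlonglongrightarrow> (LINT s|lebesgue_on {0..t}. advect (\<theta> s) k)"
        by (rule advect_integral_limit[OF YLc \<theta>Lc YCc strong t])
    qed
    \<comment> \<open>The Galerkin equation for mode \<open>k\<close> holds as soon as the box
      contains \<open>k\<close>.\<close>
    moreover have "\<forall>\<^sub>F i in sequentially. \<theta>0 k + (LINT s|lebesgue_on {0..t}. mode_rhs \<alpha> \<beta> (Y i s) (g s) k) = Y i t k"
    proof -
      obtain n0 where n0: "k \<in> fbox n0" using ex_box by blast
      show ?thesis
      proof (rule eventually_sequentiallyI[of n0])
        fix i assume "n0 \<le> i"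
        then have "n0 \<le> d i" using seq_suble[OF d, of i] by simp
        then have "k \<in> fbox (d i)" using box_mono n0 by blast
        from Xeq[OF this t] show "\<theta>0 k + (LINT s|lebesgue_on {0..t}. mode_rhs \<alpha> \<beta> (Y i s) (g s) k) = Y i t k"
          by (simp add: Y_def)
      qed
    qed
    ultimately show "(\<lambda>i. Y i t k) \<longlonglongrightarrow> \<theta>0 k + (LINT s|lebesgue_on {0..t}. mode_rhs \<alpha> \<beta> (\<theta> s) (g s) k)"
      by (rule Lim_transform_eventually)
  qed
  have \<theta>00: "\<theta> 0 = \<theta>0" by (intro ext) (use \<theta>eq[OF TT(2)] in \<open>simp only: integral_point add_0_right\<close>)
  have ms: "mode_solution \<alpha> \<beta> T g \<theta>" unfolding mode_solution_def \<theta>00 using \<theta>eq by blast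
  have bound: "hs_norm r (\<theta> t) \<le> sqrt M" if "t \<in> {0..T}" for t using \<theta>H(2)[OF that] by (rule real_le_rsqrt)
  have Linf: "\<theta> \<in> LinfHs T r"
    unfolding LinfHs_iff
  proof (intro conjI exI[of _ "sqrt M"] \<theta>m)
    show "AE t in lebesgue_on {0..T}. \<theta> t \<in> Hs r" using AE_in_interval by eventually_elim (rule \<theta>H(1))
    show "AE t in lebesgue_on {0..T}. hs_norm r (\<theta> t) \<le> sqrt M" using AE_in_interval by eventually_elim (rule bound)
  qed
  have Cw: "\<theta> \<in> CwHs T r"
  proof (rule CwHsI)
    show "\<theta> \<in> extensional {0..T}" by (simp add: \<theta>_def extensional_def)
    show "\<theta> t \<in> Hs r" if "t \<in> {0..T}" for t by (rule \<theta>H(1)[OF that])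
    show "continuous_on {0..T} (\<lambda>t. pair (\<theta> t) \<psi>)" if "\<psi> \<in> Hs (- r)" for \<psi>
      by (rule pair_continuous[OF \<theta>H(1) bound \<theta>c that])
  qed
  have weak: "weak_solution \<alpha> \<beta> T g (\<theta> 0) \<theta>"
    by (rule mode_solution_imp_weak_solution[OF ms g T])
       (use rq \<alpha> Linf \<theta>L Cw in \<open>simp_all add: r_def q_def\<close>)
  have energy: "1/2 * (hs_norm r (\<theta> t))\<^sup>2 + (LINT s|lebesgue_on {0..t}. (hs_norm q (\<theta> s))\<^sup>2)
     \<le> 1/2 * (hs_norm r \<theta>0)\<^sup>2 + (LINT s|lebesgue_on {0..t}. pair (Lam q (\<theta> s)) (g s))" if t: "t \<in> {0..T}" for t
  proof -
    have tT: "t \<le> T" using t by simp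
    note gt = L2Hs_initial[OF g tT] and Dt = L2Hs_initial[OF DL tT] and \<theta>t = L2Hs_initial[OF \<theta>L tT] and Yt = L2Hs_initial[OF YL tT]
    have Gt: "(\<lambda>s. Lam q (g s)) \<in> L2Hs t (- q)" using L2Hs_Lam[OF gt, of q] by simp
    \<comment> \<open>The work is linear in the path, so weak convergence in order \<open>q\<close>
      suffices; boundedness in that order reduces it to single modes.\<close>
    have wk: "(\<lambda>i. LINT s|lebesgue_on {0..t}. pair (Y i s - \<theta> s) (Lam q (g s))) \<longlonglongrightarrow> 0"
    proof (rule weak_pair_limit[OF Dt _ Gt])
      show "L2Hs_norm t q (\<lambda>s. Y i s - \<theta> s) \<le> sqrt C" for i
      proof (rule real_le_rsqrt)
        show "(L2Hs_norm t q (\<lambda>s. Y i s - \<theta> s))\<^sup>2 \<le> C"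
          using L2Hs_norm_initial_le[OF DL t, of i] DC[of i] by (simp add: L2Hs_norm_def)
      qed
      fix k
      have Gi: "integrable (lebesgue_on {0..t}) (\<lambda>s. Lam q (g s) k)" by (rule L2Hs_coord_integrable[OF Gt])
      have [measurable]: "cnj \<in> borel_measurable borel" by (intro borel_measurable_continuous_onI continuous_intros)
      have "(\<lambda>i. LINT s|lebesgue_on {0..t}. Re ((Y i s - \<theta> s) k * cnj (Lam q (g s) k))) \<longlonglongrightarrow> (LINT s|lebesgue_on {0..t}. 0)"
      proof (rule integral_dominated_convergence[where w="\<lambda>s. 2 * K k * cmod (Lam q (g s) k)"])
        have "coord_measurable t (\<lambda>s. Y i s - \<theta> s)" for i using Dt[of i] unfolding L2Hs_iff by blast
        note [measurable] = coord_measurableD[OF this] borel_measurable_integrable[OF Gi]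
        show "(\<lambda>s. Re ((Y i s - \<theta> s) k * cnj (Lam q (g s) k))) \<in> borel_measurable (lebesgue_on {0..t})" for i
          by measurable
        show "integrable (lebesgue_on {0..t}) (\<lambda>s. 2 * K k * cmod (Lam q (g s) k))" using Gi by simp
        show "AE s in lebesgue_on {0..t}. (\<lambda>i. Re ((Y i s - \<theta> s) k * cnj (Lam q (g s) k))) \<longlonglongrightarrow> 0"
          using AE_in_interval
        proof eventually_elim
          case (elim s)
          then have s: "s \<in> {0..T}" using tT by auto
          have "(\<lambda>i. Re ((Y i s k - \<theta> s k) * cnj (Lam q (g s) k))) \<longlonglongrightarrow> Re ((\<theta> s k - \<theta> s k) * cnj (Lam q (g s) k))"
            by (intro tendsto_intros pt[OF s])
          then show ?case by simp
        qed
        show "AE s in lebesgue_on {0..t}. norm (Re ((Y i s - \<theta> s) k * cnj (Lam q (g s) k))) \<le> 2 * K k * cmod (Lam q (g s) k)" for i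
          using AE_in_interval
        proof eventually_elim
          case (elim s)
          then have s: "s \<in> {0..T}" using tT by auto
          have "cmod ((Y i s - \<theta> s) k) \<le> 2 * K k"
            using norm_triangle_ineq4[of "Y i s k" "\<theta> s k"] YK[OF s, of i k] \<theta>K[OF s, of k] by simp
          then have "cmod ((Y i s - \<theta> s) k * cnj (Lam q (g s) k)) \<le> 2 * K k * cmod (Lam q (g s) k)"
            unfolding norm_mult complex_mod_cnj by (intro mult_right_mono) auto
          then show ?case using abs_Re_le_cmod order_trans unfolding real_norm_def by blast
        qed
      qed simp
      then show "(\<lambda>i. LINT s|lebesgue_on {0..t}. Re ((Y i s - \<theta> s) k * cnj (Lam q (g s) k))) \<longlonglongrightarrow> 0" by simp
    qed
    have pl: "pair (Lam q (x s)) (g s) = pair (x s) (Lam q (g s))" for x s by (rule pair_Lam)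
    have Pd: "(LINT s|lebesgue_on {0..t}. pair (Y i s - \<theta> s) (Lam q (g s))) =
       (LINT s|lebesgue_on {0..t}. pair (Y i s) (Lam q (g s))) - (LINT s|lebesgue_on {0..t}. pair (\<theta> s) (Lam q (g s)))" for i
    proof -
      note iY = L2Hs_pair_integrable(1)[OF Yt[of i] Gt] and i\<theta> = L2Hs_pair_integrable(1)[OF \<theta>t Gt] and iD = L2Hs_pair_integrable(1)[OF Dt[of i] Gt]
      have "(LINT s|lebesgue_on {0..t}. pair (Y i s - \<theta> s) (Lam q (g s))) = (LINT s|lebesgue_on {0..t}. pair (Y i s) (Lam q (g s)) - pair (\<theta> s) (Lam q (g s)))"
      proof (rule integral_cong_AE)
        have "AE s in lebesgue_on {0..t}. Y i s \<in> Hs q \<and> \<theta> s \<in> Hs q \<and> Lam q (g s) \<in> Hs (- q)"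
          using Yt[of i] \<theta>t Gt unfolding L2Hs_iff by (intro AE_conjI) blast+
        then show "AE s in lebesgue_on {0..t}. pair (Y i s - \<theta> s) (Lam q (g s)) = pair (Y i s) (Lam q (g s)) - pair (\<theta> s) (Lam q (g s))"
          by eventually_elim (elim conjE, rule pair_diff_left)
      qed (use borel_measurable_integrable[OF iY] borel_measurable_integrable[OF i\<theta>] borel_measurable_integrable[OF iD] in auto)
      also have "\<dots> = (LINT s|lebesgue_on {0..t}. pair (Y i s) (Lam q (g s))) - (LINT s|lebesgue_on {0..t}. pair (\<theta> s) (Lam q (g s)))"
        by (rule Bochner_Integration.integral_diff[OF iY i\<theta>])
      finally show ?thesis .
    qed
    have Plim: "(\<lambda>i. LINT s|lebesgue_on {0..t}. pair (Lam q (Y i s)) (g s)) \<longlonglongrightarrow> (LINT s|lebesgue_on {0..t}. pair (Lam q (\<theta> s)) (g s))"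
      unfolding pl using wk unfolding Pd by (rule LIM_zero_cancel)
    define Sr where "Sr m f = (\<Sum>k\<in>fbox m. (freq k powr r * cmod (f k))\<^sup>2)" for m f
    define Sq where "Sq m f = (\<Sum>k\<in>fbox m. (freq k powr q * cmod (f k))\<^sup>2)" for m f
    have box: "1/2 * Sr m (\<theta> t) + (LINT s|lebesgue_on {0..t}. Sq m (\<theta> s)) \<le> 1/2 * (hs_norm r \<theta>0)\<^sup>2 + (LINT s|lebesgue_on {0..t}. pair (Lam q (\<theta> s)) (g s))" for m
    proof (rule LIMSEQ_le)
      show "(\<lambda>i. 1/2 * Sr m (Y i t) + (LINT s|lebesgue_on {0..t}. Sq m (Y i s))) \<longlonglongrightarrow> 1/2 * Sr m (\<theta> t) + (LINT s|lebesgue_on {0..t}. Sq m (\<theta> s))"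
        unfolding Sr_def Sq_def by (intro tendsto_add tendsto_mult tendsto_const tendsto_sum tendsto_power tendsto_norm pt[OF t] boxlim[OF tT])
      show "(\<lambda>i. 1/2 * (hs_norm r \<theta>0)\<^sup>2 + (LINT s|lebesgue_on {0..t}. pair (Lam q (Y i s)) (g s))) \<longlonglongrightarrow> 1/2 * (hs_norm r \<theta>0)\<^sup>2 + (LINT s|lebesgue_on {0..t}. pair (Lam q (\<theta> s)) (g s))"
        by (intro tendsto_add tendsto_const Plim)
      have "1/2 * Sr m (Y i t) + (LINT s|lebesgue_on {0..t}. Sq m (Y i s)) \<le> 1/2 * (hs_norm r \<theta>0)\<^sup>2 + (LINT s|lebesgue_on {0..t}. pair (Lam q (Y i s)) (g s))" for i
      proof -
        have "Sr m (Y i t) \<le> (hs_norm r (Y i t))\<^sup>2"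
          unfolding Sr_def hs_norm_sq Y_def by (intro box_sum_le_infsum HsD(3) XHr(1)[OF t]) simp
        then show ?thesis using boxle[OF tT, of i m] XE[OF t, of "d i"] unfolding Sq_def Y_def by linarith
      qed
      then show "\<exists>N. \<forall>i\<ge>N. 1/2 * Sr m (Y i t) + (LINT s|lebesgue_on {0..t}. Sq m (Y i s)) \<le> 1/2 * (hs_norm r \<theta>0)\<^sup>2 + (LINT s|lebesgue_on {0..t}. pair (Lam q (Y i s)) (g s))" by blast
    qed
    show ?thesis
    proof (rule LIMSEQ_le_const2)
      have "(\<lambda>m. Sr m (\<theta> t)) \<longlonglongrightarrow> (hs_norm r (\<theta> t))\<^sup>2"
        unfolding Sr_def hs_norm_sq by (rule box_sum_tendsto[OF HsD(3)[OF \<theta>H(1)[OF t]]])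
      moreover have "(\<lambda>m. LINT s|lebesgue_on {0..t}. Sq m (\<theta> s)) \<longlonglongrightarrow> (LINT s|lebesgue_on {0..t}. (hs_norm q (\<theta> s))\<^sup>2)"
      proof (rule integral_dominated_convergence[where w="\<lambda>s. (hs_norm q (\<theta> s))\<^sup>2"])
        show i: "integrable (lebesgue_on {0..t}) (\<lambda>s. (hs_norm q (\<theta> s))\<^sup>2)" by (rule L2Hs_norm_integrable(2)[OF \<theta>t])
        show "(\<lambda>s. (hs_norm q (\<theta> s))\<^sup>2) \<in> borel_measurable (lebesgue_on {0..t})" by (rule borel_measurable_integrable[OF i])
        show "(\<lambda>s. Sq m (\<theta> s)) \<in> borel_measurable (lebesgue_on {0..t})" for m
          unfolding Sq_def by (rule borel_measurable_integrable[OF boxi[OF tT \<theta>c]])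
        have ae: "AE s in lebesgue_on {0..t}. \<theta> s \<in> Hs q" using \<theta>t unfolding L2Hs_iff by blast
        show "AE s in lebesgue_on {0..t}. (\<lambda>m. Sq m (\<theta> s)) \<longlonglongrightarrow> (hs_norm q (\<theta> s))\<^sup>2"
          using ae by eventually_elim (unfold Sq_def hs_norm_sq, rule box_sum_tendsto, rule HsD(3))
        show "AE s in lebesgue_on {0..t}. norm (Sq m (\<theta> s)) \<le> (hs_norm q (\<theta> s))\<^sup>2" for m
          using ae
        proof eventually_elim
          case (elim s)
          have "0 \<le> Sq m (\<theta> s)" unfolding Sq_def by (intro sum_nonneg) simp
          moreover have "Sq m (\<theta> s) \<le> (hs_norm q (\<theta> s))\<^sup>2"
            unfolding Sq_def hs_norm_sq by (intro box_sum_le_infsum HsD(3)[OF elim]) simp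
          ultimately show ?case by simp
        qed
      qed
      ultimately show "(\<lambda>m. 1/2 * Sr m (\<theta> t) + (LINT s|lebesgue_on {0..t}. Sq m (\<theta> s))) \<longlonglongrightarrow> 1/2 * (hs_norm r (\<theta> t))\<^sup>2 + (LINT s|lebesgue_on {0..t}. (hs_norm q (\<theta> s))\<^sup>2)"
        by (intro tendsto_add tendsto_mult tendsto_const)
    qed (use box in blast)
  qed
  have "energy_inequality \<alpha> \<beta> T g \<theta>"
    unfolding energy_inequality_def r_def[symmetric] q_def[symmetric] \<theta>00 using energy by blast
  then show ?thesis using \<theta>00 weak by blast
qed

section \<open>The energy inequality on the closure\<close>

lemma L2_torus_Hs_0:
  assumes f: "f \<in> Hs 0" shows "f \<in> L2_torus" "l2_norm f = hs_norm 0 f"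
proof -
  have eq: "freq k powr (2 * 0) * (cmod (f k))\<^sup>2 = (cmod (f k))\<^sup>2" if "k \<in> - {0}" for k
    using that freq_pos[of k] by simp
  have z: "f 0 = 0" by (rule HsD(2)[OF f])
  have "(\<lambda>k. freq k powr (2 * 0) * (cmod (f k))\<^sup>2) summable_on (- {0})" "f \<in> torus_distr"
    using f unfolding Hs_def by blast+
  moreover have "(\<lambda>k. freq k powr (2 * 0) * (cmod (f k))\<^sup>2) summable_on (- {0}) \<longleftrightarrow> (\<lambda>k. (cmod (f k))\<^sup>2) summable_on UNIV"
    by (rule summable_on_cong_neutral) (use z eq in auto)
  ultimately show "f \<in> L2_torus" unfolding L2_torus_def by blast
  have "(\<Sum>\<^sub>\<infinity>k. (cmod (f k))\<^sup>2) = (\<Sum>\<^sub>\<infinity>k\<in>- {0}. freq k powr (2 * 0) * (cmod (f k))\<^sup>2)"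
    by (rule infsum_cong_neutral) (use z eq in auto)
  then show "l2_norm f = hs_norm 0 f" unfolding l2_norm_def hs_norm_def by (rule arg_cong)
qed

text \<open>The uniqueness class quantifies over controls in the larger space \<open>L2L2\<close>;
  this embedding makes it applicable to mean-zero controls.\<close>

lemma L2Hs_subset_L2L2: "f \<in> L2Hs T 0 \<Longrightarrow> f \<in> L2L2 T"
proof -
  assume f: "f \<in> L2Hs T 0"
  obtain s where s: "\<And>n. simple_function (lebesgue_on {0..T}) (s n)" "\<And>n t. t \<in> {0..T} \<Longrightarrow> s n t \<in> Hs 0"
    and ae: "AE t in lebesgue_on {0..T}. f t \<in> Hs 0 \<and> (\<lambda>n. hs_norm 0 (s n t - f t)) \<longlonglongrightarrow> 0"
    using f unfolding L2_time_def bochner_measurable_def by blast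
  have "AE t in lebesgue_on {0..T}. f t \<in> L2_torus \<and> (\<lambda>n. l2_norm (s n t - f t)) \<longlonglongrightarrow> 0"
    using ae AE_in_interval
  proof eventually_elim
    case (elim t)
    have "l2_norm (s n t - f t) = hs_norm 0 (s n t - f t)" for n
      by (rule L2_torus_Hs_0(2)) (rule Hs_diff(1); use elim s(2) in blast)
    then show ?case using elim L2_torus_Hs_0(1) by presburger
  qed
  then have b: "bochner_measurable L2_torus l2_norm T f"
    unfolding bochner_measurable_def using s L2_torus_Hs_0(1) by blast
  have i: "integrable (lebesgue_on {0..T}) (\<lambda>t. (hs_norm 0 (f t))\<^sup>2)" by (rule L2Hs_norm_integrable(2)[OF f])
  have eq: "AE t in lebesgue_on {0..T}. (l2_norm (f t))\<^sup>2 = (hs_norm 0 (f t))\<^sup>2"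
    using ae by eventually_elim (simp only: L2_torus_Hs_0(2))
  have m: "(\<lambda>t. (l2_norm (f t))\<^sup>2) \<in> borel_measurable (lebesgue_on {0..T})"
    by (rule borel_measurable_lebesgue_on_AE[OF _ borel_measurable_integrable[OF i] eq]) simp
  have "integrable (lebesgue_on {0..T}) (\<lambda>t. (l2_norm (f t))\<^sup>2)"
    using integrable_cong_AE[OF m borel_measurable_integrable[OF i] eq] i by blast
  with b show "f \<in> L2L2 T" unfolding L2_time_def by blast
qed

lemma uniqueness_class_energy_inequality:
  assumes C0: "weak_strong_uniqueness_class \<alpha> \<beta> T C0" and T: "0 < T"
    and s: "\<alpha> - 2 * \<beta> = 0 \<or> \<alpha> - 2 * \<beta> = s_crit" and \<alpha>: "0 < \<alpha>"
    and \<theta>: "\<theta> \<in> C0" and g: "g \<in> L2Hs T 0" and w: "weak_solution \<alpha> \<beta> T g (\<theta> 0) \<theta>"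
  shows "energy_inequality \<alpha> \<beta> T g \<theta>"
proof -
  have "\<theta> 0 \<in> Hs (\<alpha> - 2 * \<beta>)" using w unfolding weak_solution_def by blast
  from Leray_solution_exists[OF T this g s \<alpha>]
  obtain \<theta>' where \<theta>': "\<theta>' 0 = \<theta> 0" "weak_solution \<alpha> \<beta> T g (\<theta>' 0) \<theta>'" "energy_inequality \<alpha> \<beta> T g \<theta>'" by blast
  have "\<theta> = \<theta>'"
    using C0 L2Hs_subset_L2L2[OF g] w \<theta>'(2,3) \<theta>'(1)[symmetric] \<theta> unfolding weak_strong_uniqueness_class_def by blast
  then show ?thesis using \<theta>'(3) by blast
qed

section \<open>Weak convergence of scalar functions of time\<close>

lemma weak_null_closure:
  fixes h v :: "nat \<Rightarrow> 'a \<Rightarrow> real"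
  assumes h: "\<And>n. h n \<in> borel_measurable M" and hi: "\<And>n. integrable M (\<lambda>x. (h n x)\<^sup>2)" and C: "\<And>n. (LINT x|M. (h n x)\<^sup>2) \<le> C"
    and v: "\<And>j. v j \<in> borel_measurable M" and u: "u \<in> borel_measurable M" and wi: "integrable M (\<lambda>x. (w x)\<^sup>2)"
    and le: "\<And>j x. x \<in> space M \<Longrightarrow> \<bar>v j x\<bar> \<le> w x" and lim: "AE x in M. (\<lambda>j. v j x) \<longlonglongrightarrow> u x"
    and null: "\<And>j. (\<lambda>n. LINT x|M. h n x * v j x) \<longlonglongrightarrow> 0"
  shows "(\<lambda>n. LINT x|M. h n x * u x) \<longlonglongrightarrow> 0"
proof -
  note [measurable] = v u
  have ule: "AE x in M. \<bar>u x\<bar> \<le> w x"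
    using lim AE_space
  proof eventually_elim
    case (elim x)
    then show ?case by (intro LIMSEQ_le_const2[OF tendsto_rabs]) (use le in blast)+
  qed
  have vi: "integrable M (\<lambda>x. (v j x)\<^sup>2)" for j
  proof (rule Bochner_Integration.integrable_bound[OF wi])
    show "AE x in M. norm ((v j x)\<^sup>2) \<le> norm ((w x)\<^sup>2)"
      using AE_space
    proof eventually_elim
      case (elim x)
      from power_mono[OF le[OF elim, of j] abs_ge_zero, of 2] show ?case by simp
    qed
  qed measurable
  have ui: "integrable M (\<lambda>x. (u x)\<^sup>2)"
  proof (rule Bochner_Integration.integrable_bound[OF wi])
    show "AE x in M. norm ((u x)\<^sup>2) \<le> norm ((w x)\<^sup>2)"
      using ule
    proof eventually_elim
      case (elim x)
      from power_mono[OF elim abs_ge_zero, of 2] show ?case by simp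
    qed
  qed measurable
  have db: "AE x in M. norm ((v j x - u x)\<^sup>2) \<le> 4 * (w x)\<^sup>2" for j
    using ule AE_space
  proof eventually_elim
    case (elim x)
    have "\<bar>v j x - u x\<bar> \<le> 2 * w x" using le[OF elim(2), of j] elim(1) by linarith
    from power_mono[OF this abs_ge_zero, of 2] show ?case by (simp add: power_mult_distrib)
  qed
  have wi4: "integrable M (\<lambda>x. 4 * (w x)\<^sup>2)" using wi by simp
  have di: "integrable M (\<lambda>x. (v j x - u x)\<^sup>2)" for j
    by (rule Bochner_Integration.integrable_bound[OF wi4]) (use db[of j] in auto)
  define D where "D j = (LINT x|M. (v j x - u x)\<^sup>2)" for j
  have "D \<longlonglongrightarrow> (LINT x|M. 0)" unfolding D_def
  proof (rule integral_dominated_convergence[OF _ _ wi4 _ db])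
    show "AE x in M. (\<lambda>j. (v j x - u x)\<^sup>2) \<longlonglongrightarrow> 0"
      using lim
    proof eventually_elim
      case (elim x)
      then have "(\<lambda>j. (v j x - u x)\<^sup>2) \<longlonglongrightarrow> (u x - u x)\<^sup>2" by (intro tendsto_intros)
      then show ?case by simp
    qed
  qed measurable
  then have "(\<lambda>j. sqrt C * sqrt (D j)) \<longlonglongrightarrow> sqrt C * sqrt 0" by (intro tendsto_intros) simp
  then have D0: "(\<lambda>j. sqrt C * sqrt (D j)) \<longlonglongrightarrow> 0" by simp
  \<comment> \<open>Exchanging \<open>u\<close> for \<open>v j\<close> costs the same for all
    \<open>n\<close>, by the uniform bound on \<open>h n\<close>; hence \<open>j\<close> can be
    fixed before \<open>n\<close> grows.\<close>
  have diff: "\<bar>(LINT x|M. h n x * u x) - (LINT x|M. h n x * v j x)\<bar> \<le> sqrt C * sqrt (D j)" for n j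
  proof -
    have i: "integrable M (\<lambda>x. h n x * u x)" "integrable M (\<lambda>x. h n x * v j x)"
      by (rule integrable_mult_L2[OF h u hi ui], rule integrable_mult_L2[OF h v hi vi])
    have m: "(\<lambda>x. v j x - u x) \<in> borel_measurable M" by measurable
    have "\<bar>(LINT x|M. h n x * u x) - (LINT x|M. h n x * v j x)\<bar> = \<bar>LINT x|M. h n x * u x - h n x * v j x\<bar>"
      by (simp only: Bochner_Integration.integral_diff[OF i])
    also have "\<dots> \<le> (LINT x|M. \<bar>h n x * u x - h n x * v j x\<bar>)" by (rule integral_abs_bound)
    also have "\<dots> = (LINT x|M. \<bar>h n x * (v j x - u x)\<bar>)"
      by (simp only: right_diff_distrib abs_minus_commute)
    also have "\<dots> \<le> sqrt (LINT x|M. (h n x)\<^sup>2) * sqrt (D j)"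
      unfolding D_def by (rule Cauchy_Schwarz_integral[OF h m hi di])
    also have "\<dots> \<le> sqrt C * sqrt (D j)"
      by (intro mult_right_mono real_sqrt_le_mono C) (simp add: D_def)
    finally show ?thesis .
  qed
  show ?thesis
  proof (rule LIMSEQ_I)
    fix e :: real assume e: "0 < e"
    then have "\<forall>\<^sub>F j in sequentially. sqrt C * sqrt (D j) < e / 2" by (intro order_tendstoD(2)[OF D0]) simp
    then obtain j where j: "sqrt C * sqrt (D j) < e / 2" by (auto simp: eventually_sequentially)
    obtain n0 where n0: "\<And>n. n \<ge> n0 \<Longrightarrow> norm ((LINT x|M. h n x * v j x) - 0) < e / 2"
      using LIMSEQ_D[OF null[of j], of "e / 2"] e by auto
    have "norm ((LINT x|M. h n x * u x) - 0) < e" if "n \<ge> n0" for n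
      using diff[of n j] n0[OF that] j unfolding real_norm_def by linarith
    then show "\<exists>n0. \<forall>n\<ge>n0. norm ((LINT x|M. h n x * u x) - 0) < e" by blast
  qed
qed

text \<open>Convergence of primitives is convergence against indicators of initial intervals. Step
  functions reach the continuous functions, these reach the bounded measurable ones, and truncations
  in height reach all of L^2; \<open>weak_null_closure\<close> makes each passage.\<close>

lemma primitives_weak_null:
  fixes h :: "nat \<Rightarrow> real \<Rightarrow> real"
  assumes h: "\<And>n. h n \<in> borel_measurable (lebesgue_on {0..T})" and hi: "\<And>n. integrable (lebesgue_on {0..T}) (\<lambda>x. (h n x)\<^sup>2)"
    and C: "\<And>n. (LINT x|lebesgue_on {0..T}. (h n x)\<^sup>2) \<le> C"
    and prim: "\<And>t. t \<in> {0..T} \<Longrightarrow> (\<lambda>n. LINT x|lebesgue_on {0..t}. h n x) \<longlonglongrightarrow> 0"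
    and u: "u \<in> borel_measurable (lebesgue_on {0..T})" and ui: "integrable (lebesgue_on {0..T}) (\<lambda>x. (u x)\<^sup>2)"
    and T: "0 < T"
  shows "(\<lambda>n. LINT x|lebesgue_on {0..T}. h n x * u x) \<longlonglongrightarrow> 0"
proof -
  let ?M = "lebesgue_on {0..T}"
  have const: "integrable ?M (\<lambda>x. c\<^sup>2)" for c :: real by simp
  have hI: "integrable ?M (h n)" for n
    using integrable_mult_L2[OF h[of n] borel_measurable_const[of 1] hi] const[of 1] by simp
  define S where "S a = (\<lambda>x :: real. if x \<le> a then 1 else 0 :: real)" for a
  have Sm [measurable]: "S a \<in> borel_measurable ?M" for a
  proof -
    have "S a \<in> borel_measurable lborel" unfolding S_def by measurable
    then show ?thesis by (intro measurable_restrict_space1 measurable_completion)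
  qed
  have hS: "integrable ?M (\<lambda>x. h n x * S a x)" for n a
    by (rule Bochner_Integration.integrable_bound[OF hI[of n]]) (use h Sm in \<open>auto simp: S_def\<close>)
  have S: "(\<lambda>n. LINT x|?M. h n x * S a x) \<longlonglongrightarrow> 0" for a
  proof (cases "a < 0")
    case True
    have "(LINT x|?M. h n x * S a x) = (LINT x|?M. 0)" for n
      by (rule Bochner_Integration.integral_cong) (use True in \<open>auto simp: S_def\<close>)
    then show ?thesis by simp
  next
    case False
    define b where "b = min a T"
    have b: "b \<in> {0..T}" using False T by (auto simp: b_def)
    have "(LINT x|?M. h n x * S a x) = (LINT x|?M. (if x \<le> b then h n x else 0))" for n
      by (rule Bochner_Integration.integral_cong) (auto simp: S_def b_def)
    also have "(LINT x|?M. (if x \<le> b then h n x else 0)) = (LINT x|lebesgue_on {0..b}. h n x)" for n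
      by (rule integral_initial_part) (use b in auto)
    finally show ?thesis using prim[OF b] by presburger
  qed
  have cont: "(\<lambda>n. LINT x|?M. h n x * v x) \<longlonglongrightarrow> 0"
    if v: "continuous_on UNIV v" and B: "\<And>x. \<bar>v x\<bar> \<le> B" for v :: "real \<Rightarrow> real" and B
  proof (rule weak_null_closure[OF h hi C])
    \<comment> \<open>Step function on a mesh of width \<open>1 / Suc j\<close> that takes the value
      of \<open>v\<close> at the right end of each half-open cell. The cell with
      \<open>i = 0\<close> is there for the point \<open>x = 0\<close>.\<close>
    define V where "V j x = (\<Sum>i\<in>{0..\<lceil>T * real (Suc j)\<rceil>}. v (of_int i / real (Suc j)) *
      (S (of_int i / real (Suc j)) x - S ((of_int i - 1) / real (Suc j)) x))" for j x
    have Veq: "V j x = v (of_int \<lceil>x * real (Suc j)\<rceil> / real (Suc j))" if x: "x \<in> {0..T}" for j x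
    proof -
      have sp: "0 < real (Suc j)" by simp
      have eq: "v (of_int i / real (Suc j)) * (S (of_int i / real (Suc j)) x - S ((of_int i - 1) / real (Suc j)) x)
          = (if \<lceil>x * real (Suc j)\<rceil> = i then v (of_int i / real (Suc j)) else 0)" for i
      proof -
        have "\<lceil>x * real (Suc j)\<rceil> = i \<longleftrightarrow> of_int i - 1 < x * real (Suc j) \<and> x * real (Suc j) \<le> of_int i"
          by linarith
        moreover have "x \<le> of_int i / real (Suc j) \<longleftrightarrow> x * real (Suc j) \<le> of_int i"
          "x \<le> (of_int i - 1) / real (Suc j) \<longleftrightarrow> x * real (Suc j) \<le> of_int i - 1"
          by (rule pos_le_divide_eq[OF sp])+
        ultimately show ?thesis unfolding S_def by auto
      qed
      have "0 \<le> x * real (Suc j)" "x * real (Suc j) \<le> T * real (Suc j)"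
        using x by (auto intro!: mult_right_mono simp del: of_nat_Suc)
      then have "\<lceil>x * real (Suc j)\<rceil> \<in> {0..\<lceil>T * real (Suc j)\<rceil>}" unfolding atLeastAtMost_iff by linarith
      then show ?thesis unfolding V_def eq by (simp add: sum.delta)
    qed
    show "V j \<in> borel_measurable ?M" for j unfolding V_def by measurable
    show "v \<in> borel_measurable ?M"
      by (intro measurable_restrict_space1 measurable_completion) (use borel_measurable_continuous_onI[OF v] in simp)
    show "integrable ?M (\<lambda>x. B\<^sup>2)" by (rule const)
    show "\<bar>V j x\<bar> \<le> B" if "x \<in> space ?M" for j x
      using Veq[of x j] B that by simp
    show "AE x in ?M. (\<lambda>j. V j x) \<longlonglongrightarrow> v x"
      using AE_in_interval
    proof eventually_elim
      case (elim x)
      have "(\<lambda>j. of_int \<lceil>x * real (Suc j)\<rceil> / real (Suc j)) \<longlonglongrightarrow> x"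
      proof (rule Lim_null[THEN iffD2], rule Lim_null_comparison[OF _ LIMSEQ_inverse_real_of_nat])
        have "norm (of_int \<lceil>x * real (Suc j)\<rceil> / real (Suc j) - x) \<le> inverse (real (Suc j))" for j
        proof -
          have sp: "real (Suc j) \<noteq> 0" by simp
          have "of_int \<lceil>x * real (Suc j)\<rceil> / real (Suc j) - x = (of_int \<lceil>x * real (Suc j)\<rceil> - x * real (Suc j)) / real (Suc j)"
            using sp by (simp only: diff_divide_distrib nonzero_mult_div_cancel_right not_False_eq_True)
          moreover have "\<bar>of_int \<lceil>x * real (Suc j)\<rceil> - x * real (Suc j)\<bar> \<le> 1" by linarith
          ultimately show ?thesis by (simp add: divide_right_mono inverse_eq_divide del: of_nat_Suc)
        qed
        then show "\<forall>\<^sub>F j in sequentially. norm (of_int \<lceil>x * real (Suc j)\<rceil> / real (Suc j) - x) \<le> inverse (real (Suc j))" by simp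
      qed
      moreover have "isCont v x" using v continuous_on_eq_continuous_at[OF open_UNIV] by blast
      ultimately show ?case unfolding Veq[OF elim] by (rule isCont_tendsto_compose[rotated])
    qed
    show "(\<lambda>n. LINT x|?M. h n x * V j x) \<longlonglongrightarrow> 0" for j
    proof -
      let ?c = "\<lambda>i. v (of_int i / real (Suc j))" and ?I = "{0..\<lceil>T * real (Suc j)\<rceil>}"
      let ?S = "\<lambda>i. S (of_int i / real (Suc j))" and ?S' = "\<lambda>i. S ((of_int i - 1) / real (Suc j))"
      have "(LINT x|?M. h n x * V j x) = (LINT x|?M. (\<Sum>i\<in>?I. ?c i * (h n x * ?S i x - h n x * ?S' i x)))" for n
        unfolding V_def by (intro Bochner_Integration.integral_cong) (simp_all add: sum_distrib_left algebra_simps del: of_nat_Suc)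
      also have "(LINT x|?M. (\<Sum>i\<in>?I. ?c i * (h n x * ?S i x - h n x * ?S' i x))) =
         (\<Sum>i\<in>?I. ?c i * ((LINT x|?M. h n x * ?S i x) - (LINT x|?M. h n x * ?S' i x)))" for n
        using hS[of n] by (subst Bochner_Integration.integral_sum) (auto intro!: sum.cong simp del: of_nat_Suc)
      finally have eq: "(LINT x|?M. h n x * V j x) = (\<Sum>i\<in>?I. ?c i * ((LINT x|?M. h n x * ?S i x) - (LINT x|?M. h n x * ?S' i x)))" for n .
      have "(\<lambda>n. \<Sum>i\<in>?I. ?c i * ((LINT x|?M. h n x * ?S i x) - (LINT x|?M. h n x * ?S' i x))) \<longlonglongrightarrow> (\<Sum>i\<in>?I. ?c i * (0 - 0))"
        by (intro tendsto_intros S)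
      then show ?thesis unfolding eq by simp
    qed
  qed
  have bdd: "(\<lambda>n. LINT x|?M. h n x * v x) \<longlonglongrightarrow> 0"
    if v: "v \<in> borel_measurable ?M" and B: "\<And>x. \<bar>v x\<bar> \<le> B" for v :: "real \<Rightarrow> real" and B
  proof -
    have "v measurable_on {0..T}" using v by (simp add: measurable_on_iff_borel_measurable)
    then obtain N f where N: "negligible N" and f: "\<And>n. continuous_on UNIV (f n)"
      and lim: "\<And>x. x \<notin> N \<Longrightarrow> (\<lambda>n. f n x) \<longlonglongrightarrow> (if x \<in> {0..T} then v x else 0)"
      unfolding measurable_on_def by blast
    have B0: "0 \<le> B" using B[of 0] by linarith
    \<comment> \<open>The continuous approximants come from the definition of
      \<open>measurable_on\<close>; clipping at \<open>B\<close> supplies the dominating constant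
      and does not affect the limit.\<close>
    define F where "F n x = max (- B) (min B (f n x))" for n x
    have Fc: "continuous_on UNIV (F n)" for n unfolding F_def by (intro continuous_intros f)
    have FB: "\<bar>F n x\<bar> \<le> B" for n x using B0 by (auto simp: F_def)
    show ?thesis
    proof (rule weak_null_closure[OF h hi C, where v=F and w="\<lambda>_. B"])
      show "F j \<in> borel_measurable ?M" for j
        by (intro measurable_restrict_space1 measurable_completion) (use borel_measurable_continuous_onI[OF Fc] in simp)
      have "AE x in lebesgue. x \<notin> N" using N by (intro AE_not_in) (simp add: negligible_iff_null_sets)
      then have "AE x in ?M. x \<notin> N" by (simp add: AE_restrict_space_iff eventually_mono)
      then show "AE x in ?M. (\<lambda>j. F j x) \<longlonglongrightarrow> v x"
        using AE_in_interval
      proof eventually_elim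
        case (elim x)
        have "(\<lambda>j. F j x) \<longlonglongrightarrow> max (- B) (min B (v x))"
          unfolding F_def using lim[OF elim(1)] elim(2) by (intro tendsto_intros) simp
        moreover have "max (- B) (min B (v x)) = v x" using B[of x] by (simp add: max_def min_def) linarith
        ultimately show ?case by simp
      qed
    qed (use v FB cont[OF Fc FB] const in auto)
  qed
  show ?thesis
  proof (rule weak_null_closure[OF h hi C, where w="\<lambda>x. \<bar>u x\<bar>"])
    define U where "U j x = max (- real j) (min (real j) (u x))" for j x
    note [measurable] = u
    show Um: "U j \<in> borel_measurable ?M" for j unfolding U_def by measurable
    have "\<bar>U j x\<bar> \<le> real j" for j x by (auto simp: U_def)
    then show "(\<lambda>n. LINT x|?M. h n x * U j x) \<longlonglongrightarrow> 0" for j by (rule bdd[OF Um])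
    show "\<bar>U j x\<bar> \<le> \<bar>u x\<bar>" for j x by (auto simp: U_def max_def min_def)
    show "AE x in ?M. (\<lambda>j. U j x) \<longlonglongrightarrow> u x"
    proof (rule AE_I2)
      fix x
      obtain j0 where j0: "\<bar>u x\<bar> \<le> real j0" using real_arch_simple by blast
      have "U j x = u x" if "j0 \<le> j" for j
        using j0 that of_nat_mono[OF that, where 'a=real] unfolding U_def by (simp add: max_def min_def) linarith
      then show "(\<lambda>j. U j x) \<longlonglongrightarrow> u x" by (intro tendsto_eventually) (auto simp: eventually_sequentially)
    qed
  qed (use u ui in auto)
qed

text \<open>The members of \<open>D\<close> are arbitrary functions, so \<open>d x x < e\<close> is
  asked for explicitly.\<close>

lemma pseudometrics_eventually:
  assumes "limitin (pseudometrics_topology S D) f x F" "x \<in> S" "d \<in> D" "d x x < e" "0 < e"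
  shows "\<forall>\<^sub>F n in F. d x (f n) < e"
proof -
  have "openin (pseudometrics_topology S D) {y \<in> S. d x y < e}"
    unfolding pseudometrics_topology_def by (rule topology_generated_by_Basis) (use assms in blast)
  then have "\<forall>\<^sub>F n in F. f n \<in> {y \<in> S. d x y < e}" using assms unfolding limitin_def by blast
  then show ?thesis by (rule eventually_mono) blast
qed

lemma Lam_diff: "Lam \<sigma> (f - g) = Lam \<sigma> f - Lam \<sigma> g"
  by (rule ext) (simp add: Lam_def right_diff_distrib)

text \<open>Expansion of a square in the Hilbert space \<open>Hs r\<close>, whose inner product is
  the pairing with \<open>Lam (2 * r)\<close>. It turns weak convergence into bounds on
  norms.\<close>

lemma hs_norm_diff_sq:
  assumes f: "f \<in> Hs r" and g: "g \<in> Hs r"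
  shows "(hs_norm r (f - g))\<^sup>2 = (hs_norm r f)\<^sup>2 - 2 * pair f (Lam (2 * r) g) + (hs_norm r g)\<^sup>2"
proof -
  have L: "Lam (2 * r) f \<in> Hs (- r)" "Lam (2 * r) g \<in> Hs (- r)"
    using Lam_Hs[OF f, of "2 * r"] Lam_Hs[OF g, of "2 * r"] by simp_all
  have "(hs_norm r (f - g))\<^sup>2 = pair (f - g) (Lam (2 * r) f - Lam (2 * r) g)"
    using pair_Lam_self[OF Hs_diff(1)[OF f g]] unfolding Lam_diff by presburger
  also have "\<dots> = pair f (Lam (2 * r) f) - pair f (Lam (2 * r) g) - (pair g (Lam (2 * r) f) - pair g (Lam (2 * r) g))"
    by (simp only: pair_diff_left[OF f g Hs_diff(1)[OF L]] pair_diff_right[OF f L] pair_diff_right[OF g L])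
  also have "pair g (Lam (2 * r) f) = pair f (Lam (2 * r) g)" by (simp only: pair_commute[of g] pair_Lam)
  finally show ?thesis by (simp only: pair_Lam_self[OF f] pair_Lam_self[OF g])
qed

lemma L2Hs_pair_diff_left:
  assumes f: "f \<in> L2Hs T r" and f': "f' \<in> L2Hs T r" and g: "g \<in> L2Hs T (- r)"
  shows "(LINT s|lebesgue_on {0..T}. pair (f s - f' s) (g s)) =
    (LINT s|lebesgue_on {0..T}. pair (f s) (g s)) - (LINT s|lebesgue_on {0..T}. pair (f' s) (g s))"
proof -
  note i = L2Hs_pair_integrable(1)[OF f g] and i' = L2Hs_pair_integrable(1)[OF f' g] and iD = L2Hs_pair_integrable(1)[OF L2Hs_diff[OF f f'] g]
  have "(LINT s|lebesgue_on {0..T}. pair (f s - f' s) (g s)) = (LINT s|lebesgue_on {0..T}. pair (f s) (g s) - pair (f' s) (g s))"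
  proof (rule integral_cong_AE)
    have "AE s in lebesgue_on {0..T}. f s \<in> Hs r \<and> f' s \<in> Hs r \<and> g s \<in> Hs (- r)"
      using f f' g unfolding L2Hs_iff by (intro AE_conjI) blast+
    then show "AE s in lebesgue_on {0..T}. pair (f s - f' s) (g s) = pair (f s) (g s) - pair (f' s) (g s)"
      by eventually_elim (elim conjE, rule pair_diff_left)
  qed (use borel_measurable_integrable[OF i] borel_measurable_integrable[OF i'] borel_measurable_integrable[OF iD] in auto)
  also have "\<dots> = (LINT s|lebesgue_on {0..T}. pair (f s) (g s)) - (LINT s|lebesgue_on {0..T}. pair (f' s) (g s))"
    by (rule Bochner_Integration.integral_diff[OF i i'])
  finally show ?thesis .
qed

lemma L2Hs_diff_sq:
  assumes f: "f \<in> L2Hs T r" and g: "g \<in> L2Hs T r"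
  shows "(LINT s|lebesgue_on {0..T}. (hs_norm r (f s - g s))\<^sup>2) = (LINT s|lebesgue_on {0..T}. (hs_norm r (f s))\<^sup>2)
    - 2 * (LINT s|lebesgue_on {0..T}. pair (f s) (Lam (2 * r) (g s))) + (LINT s|lebesgue_on {0..T}. (hs_norm r (g s))\<^sup>2)"
proof -
  have L: "(\<lambda>s. Lam (2 * r) (g s)) \<in> L2Hs T (- r)" using L2Hs_Lam[OF g, of "2 * r"] by simp
  note iF = L2Hs_norm_integrable(2)[OF f] and iG = L2Hs_norm_integrable(2)[OF g] and iP = L2Hs_pair_integrable(1)[OF f L]
    and iD = L2Hs_norm_integrable(2)[OF L2Hs_diff[OF f g]]
  note ms = borel_measurable_integrable[OF iF] borel_measurable_integrable[OF iG] borel_measurable_integrable[OF iP] borel_measurable_integrable[OF iD]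
  have "(LINT s|lebesgue_on {0..T}. (hs_norm r (f s - g s))\<^sup>2) =
      (LINT s|lebesgue_on {0..T}. (hs_norm r (f s))\<^sup>2 - 2 * pair (f s) (Lam (2 * r) (g s)) + (hs_norm r (g s))\<^sup>2)"
  proof (rule integral_cong_AE)
    have "AE s in lebesgue_on {0..T}. f s \<in> Hs r \<and> g s \<in> Hs r"
      using f g unfolding L2Hs_iff by (intro AE_conjI) blast+
    then show "AE s in lebesgue_on {0..T}. (hs_norm r (f s - g s))\<^sup>2 = (hs_norm r (f s))\<^sup>2 - 2 * pair (f s) (Lam (2 * r) (g s)) + (hs_norm r (g s))\<^sup>2"
      by eventually_elim (elim conjE, rule hs_norm_diff_sq)
  qed (use ms in \<open>auto intro!: borel_measurable_add borel_measurable_diff\<close>)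
  also have "\<dots> = (LINT s|lebesgue_on {0..T}. (hs_norm r (f s))\<^sup>2) - 2 * (LINT s|lebesgue_on {0..T}. pair (f s) (Lam (2 * r) (g s)))
      + (LINT s|lebesgue_on {0..T}. (hs_norm r (g s))\<^sup>2)"
    using iF iG iP by simp
  finally show ?thesis .
qed

section \<open>Costs of controls and convergence in the path space\<close>

lemma rate_le:
  assumes "g \<in> L2Hs T 0" "weak_solution \<alpha> \<beta> T g (\<theta> 0) \<theta>"
  shows "rate \<alpha> \<beta> T \<theta> \<le> ennreal ((hs_norm (\<alpha> - 2 * \<beta>) (\<theta> 0))\<^sup>2 + 1/2 * (L2Hs_norm T 0 g)\<^sup>2)"
proof -
  have "I_dyna \<alpha> \<beta> T \<theta> \<le> ennreal (1/2) * ennreal ((L2Hs_norm T 0 g)\<^sup>2)"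
    unfolding I_dyna_def by (intro mult_left_mono INF_lower) (use assms in auto)
  also have "\<dots> = ennreal (1/2 * (L2Hs_norm T 0 g)\<^sup>2)" by (rule ennreal_mult'[symmetric]) simp
  finally have "rate \<alpha> \<beta> T \<theta> \<le> ennreal ((hs_norm (\<alpha> - 2 * \<beta>) (\<theta> 0))\<^sup>2) + ennreal (1/2 * (L2Hs_norm T 0 g)\<^sup>2)"
    unfolding rate_def by (rule add_left_mono)
  then show ?thesis by simp
qed

text \<open>A near-minimal control is all that the limit argument asks for, and it exists whenever
  the infimum is below the threshold.\<close>

lemma rate_less_control:
  assumes "rate \<alpha> \<beta> T \<theta> < ennreal B"
  shows "\<exists>g. g \<in> L2Hs T 0 \<and> weak_solution \<alpha> \<beta> T g (\<theta> 0) \<theta> \<and> (hs_norm (\<alpha> - 2 * \<beta>) (\<theta> 0))\<^sup>2 + 1/2 * (L2Hs_norm T 0 g)\<^sup>2 < B"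
proof (rule ccontr)
  assume none: "\<not> ?thesis"
  define E where "E = (hs_norm (\<alpha> - 2 * \<beta>) (\<theta> 0))\<^sup>2"
  have E0: "0 \<le> E" by (simp add: E_def)
  have le: "2 * (B - E) \<le> (L2Hs_norm T 0 g)\<^sup>2" if "g \<in> L2Hs T 0" "weak_solution \<alpha> \<beta> T g (\<theta> 0) \<theta>" for g
  proof -
    have "\<not> E + 1/2 * (L2Hs_norm T 0 g)\<^sup>2 < B" using none that unfolding E_def by blast
    then show ?thesis by simp
  qed
  have "ennreal (1/2) * ennreal (2 * (B - E)) \<le> I_dyna \<alpha> \<beta> T \<theta>"
    unfolding I_dyna_def by (intro mult_left_mono INF_greatest ennreal_leI le) auto
  then have "ennreal E + ennreal (1/2) * ennreal (2 * (B - E)) \<le> rate \<alpha> \<beta> T \<theta>"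
    unfolding rate_def E_def by (rule add_left_mono)
  moreover have "ennreal (1/2) * ennreal (2 * (B - E)) = ennreal (B - E)"
  proof -
    have "ennreal (1/2) * ennreal (2 * (B - E)) = ennreal (1/2 * (2 * (B - E)))"
      by (rule ennreal_mult'[symmetric]) simp
    also have "1/2 * (2 * (B - E)) = B - E" by simp
    finally show ?thesis .
  qed
  \<comment> \<open>\<open>ennreal\<close> of a negative number is \<open>0\<close>, so the case
    \<open>B < E\<close> is treated apart.\<close>
  moreover have "ennreal B \<le> ennreal E + ennreal (B - E)"
  proof (cases "E \<le> B")
    case True
    then show ?thesis using ennreal_plus[OF E0, of "B - E"] by simp
  next
    case False
    then show ?thesis by (simp add: ennreal_leI add_increasing2)
  qed
  ultimately show False using assms by (simp only: not_less[symmetric])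
qed

lemma L2Hs_pair_Lam_self:
  assumes f: "f \<in> L2Hs T r"
  shows "(LINT s|lebesgue_on {0..T}. pair (f s) (Lam (2 * r) (f s))) = (LINT s|lebesgue_on {0..T}. (hs_norm r (f s))\<^sup>2)"
proof (rule integral_cong_AE)
  have L: "(\<lambda>s. Lam (2 * r) (f s)) \<in> L2Hs T (- r)" using L2Hs_Lam[OF f, of "2 * r"] by simp
  show "(\<lambda>s. pair (f s) (Lam (2 * r) (f s))) \<in> borel_measurable (lebesgue_on {0..T})"
    by (rule borel_measurable_integrable[OF L2Hs_pair_integrable(1)[OF f L]])
  show "(\<lambda>s. (hs_norm r (f s))\<^sup>2) \<in> borel_measurable (lebesgue_on {0..T})"
    by (rule borel_measurable_integrable[OF L2Hs_norm_integrable(2)[OF f]])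
  have "AE s in lebesgue_on {0..T}. f s \<in> Hs r" using f unfolding L2Hs_iff by blast
  then show "AE s in lebesgue_on {0..T}. pair (f s) (Lam (2 * r) (f s)) = (hs_norm r (f s))\<^sup>2"
    by eventually_elim (rule pair_Lam_self)
qed

lemma L2Hs_norm_sq: "(L2Hs_norm T r f)\<^sup>2 = (LINT s|lebesgue_on {0..T}. (hs_norm r (f s))\<^sup>2)"
  unfolding L2Hs_norm_def by (rule real_sqrt_pow2) simp

text \<open>Real and imaginary parts of a coefficient are scalar functions to which
  \<open>primitives_weak_null\<close> applies. Convergence of primitives is assumed at nonzero
  frequencies, so \<open>\<psi>\<close> is taken to vanish at frequency zero.\<close>

lemma L2Hs_primitives_weak_limit:
  assumes D: "\<And>m :: nat. D m \<in> L2Hs T 0" and C: "\<And>m. (L2Hs_norm T 0 (D m))\<^sup>2 \<le> C"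
    and \<psi>: "\<psi> \<in> L2Hs T 0" and T: "0 < T" and \<psi>0: "\<And>s. \<psi> s 0 = 0"
    and prim: "\<And>k t. k \<noteq> 0 \<Longrightarrow> t \<in> {0..T} \<Longrightarrow> (\<lambda>m. LINT s|lebesgue_on {0..t}. D m s k) \<longlonglongrightarrow> 0"
  shows "(\<lambda>m. LINT s|lebesgue_on {0..T}. pair (D m s) (\<psi> s)) \<longlonglongrightarrow> 0"
proof (rule weak_pair_limit[where r=0 and C="sqrt C"])
  let ?M = "lebesgue_on {0..T}"
  show "D m \<in> L2Hs T 0" for m by (rule D)
  show "\<psi> \<in> L2Hs T (- 0)" using \<psi> by simp
  show "L2Hs_norm T 0 (D m) \<le> sqrt C" for m using C by (rule real_le_rsqrt)
  fix k :: "int \<times> int"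
  show "(\<lambda>m. LINT s|?M. Re (D m s k * cnj (\<psi> s k))) \<longlonglongrightarrow> 0"
  proof (cases "k = 0")
    case True
    then show ?thesis by (simp add: \<psi>0)
  next
    case False
    have part: "(\<lambda>s. L (f s k)) \<in> borel_measurable ?M" "integrable ?M (\<lambda>s. (L (f s k))\<^sup>2)"
      "(LINT s|?M. (L (f s k))\<^sup>2) \<le> (L2Hs_norm T 0 f)\<^sup>2"
      if L: "bounded_linear L" "\<And>z. \<bar>L z\<bar> \<le> cmod z" and f: "f \<in> L2Hs T 0" for L :: "complex \<Rightarrow> real" and f
    proof -
      have c: "coord_measurable T f" and ae: "AE s in ?M. f s \<in> Hs 0" using f unfolding L2Hs_iff by blast+
      have Lm: "L \<in> borel_measurable borel" by (rule borel_measurable_continuous_onI[OF linear_continuous_on[OF L(1)]])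
      show m: "(\<lambda>s. L (f s k)) \<in> borel_measurable ?M" by (rule measurable_compose[OF coord_measurableD[OF c] Lm])
      note i = L2Hs_norm_integrable(2)[OF f]
      have le: "AE s in ?M. (L (f s k))\<^sup>2 \<le> (hs_norm 0 (f s))\<^sup>2"
        using ae
      proof eventually_elim
        case (elim s)
        have "\<bar>L (f s k)\<bar> \<le> cmod (f s k)" by (rule L(2))
        also have "\<dots> \<le> freq k powr (- 0) * hs_norm 0 (f s)" by (rule Hs_cmod_le[OF elim])
        finally have "\<bar>L (f s k)\<bar> \<le> hs_norm 0 (f s)" using freq_pos[of k] False by simp
        from power_mono[OF this abs_ge_zero, of 2] show ?case by simp
      qed
      show i2: "integrable ?M (\<lambda>s. (L (f s k))\<^sup>2)"
        by (rule Bochner_Integration.integrable_bound[OF i]) (use le m in auto)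
      show "(LINT s|?M. (L (f s k))\<^sup>2) \<le> (L2Hs_norm T 0 f)\<^sup>2"
        unfolding L2Hs_norm_sq by (rule integral_mono_AE[OF i2 i le])
    qed
    have lim: "(\<lambda>m. LINT s|?M. L (D m s k) * L (\<psi> s k)) \<longlonglongrightarrow> 0"
      if L: "bounded_linear L" "\<And>z. \<bar>L z\<bar> \<le> cmod z" for L :: "complex \<Rightarrow> real"
    proof (rule primitives_weak_null[OF _ _ _ _ _ _ T, where C=C])
      note pD = part[OF L D] and p\<psi> = part[OF L \<psi>]
      show "(\<lambda>s. L (D m s k)) \<in> borel_measurable ?M" for m by (rule pD)
      show "integrable ?M (\<lambda>s. (L (D m s k))\<^sup>2)" for m by (rule pD)
      show "(LINT s|?M. (L (D m s k))\<^sup>2) \<le> C" for m using pD(3)[of m] C[of m] by linarith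
      show "(\<lambda>s. L (\<psi> s k)) \<in> borel_measurable ?M" "integrable ?M (\<lambda>s. (L (\<psi> s k))\<^sup>2)" by (rule p\<psi>)+
      fix t assume t: "t \<in> {0..T}"
      have "(\<lambda>m. L (LINT s|lebesgue_on {0..t}. D m s k)) \<longlonglongrightarrow> L 0"
        by (rule bounded_linear.tendsto[OF L(1) prim[OF False t]])
      moreover have "(LINT s|lebesgue_on {0..t}. L (D m s k)) = L (LINT s|lebesgue_on {0..t}. D m s k)" for m
        by (rule integral_bounded_linear[OF L(1) L2Hs_coord_integrable[OF L2Hs_initial[OF D]]]) (use t in simp)
      moreover have "L 0 = 0" using L(2)[of 0] by simp
      ultimately show "(\<lambda>m. LINT s|lebesgue_on {0..t}. L (D m s k)) \<longlonglongrightarrow> 0" by (simp only:)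
    qed
    note Rl = bounded_linear_Re abs_Re_le_cmod and Il = bounded_linear_Im abs_Im_le_cmod
    have "(LINT s|?M. Re (D m s k * cnj (\<psi> s k))) = (LINT s|?M. Re (D m s k) * Re (\<psi> s k)) + (LINT s|?M. Im (D m s k) * Im (\<psi> s k))" for m
      using integrable_mult_L2[OF part(1)[OF Rl D] part(1)[OF Rl \<psi>] part(2)[OF Rl D] part(2)[OF Rl \<psi>], of m]
        integrable_mult_L2[OF part(1)[OF Il D] part(1)[OF Il \<psi>] part(2)[OF Il D] part(2)[OF Il \<psi>], of m] by simp
    then show ?thesis using tendsto_add[OF lim[OF Rl] lim[OF Il]] by simp
  qed
qed

lemma Xtop_limit_pair:
  assumes lim: "limitin (Xtop \<alpha> \<beta> T) f \<theta> sequentially" and f: "\<And>n. f n \<in> Xspace \<alpha> \<beta> T" and \<theta>: "\<theta> \<in> Xspace \<alpha> \<beta> T"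
  shows "\<psi> \<in> L2Hs T (- (2 * \<alpha> - 2 * \<beta>)) \<Longrightarrow>
      (\<lambda>n. LINT s|lebesgue_on {0..T}. pair (f n s) (\<psi> s)) \<longlonglongrightarrow> (LINT s|lebesgue_on {0..T}. pair (\<theta> s) (\<psi> s))"
    and "\<phi> \<in> Hs (- (\<alpha> - 2 * \<beta>)) \<Longrightarrow> t \<in> {0..T} \<Longrightarrow> (\<lambda>n. pair (f n t) \<phi>) \<longlonglongrightarrow> pair (\<theta> t) \<phi>"
proof -
  have close: "\<forall>\<^sub>F n in sequentially. d \<theta> (f n) < e"
    if "d \<in> L2Hs_strong_metrics T (\<alpha> - 2*\<beta>) \<union> L2Hs_weak_metrics T (2*\<alpha> - 2*\<beta>) \<union> CwHs_metrics T (\<alpha> - 2*\<beta>)" "d \<theta> \<theta> = 0" "0 < e" for d e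
    by (rule pseudometrics_eventually[OF lim[unfolded Xtop_def] \<theta> that(1)]) (use that in simp_all)
  show "(\<lambda>n. LINT s|lebesgue_on {0..T}. pair (f n s) (\<psi> s)) \<longlonglongrightarrow> (LINT s|lebesgue_on {0..T}. pair (\<theta> s) (\<psi> s))"
    if \<psi>: "\<psi> \<in> L2Hs T (- (2 * \<alpha> - 2 * \<beta>))"
  proof (rule tendstoI)
    fix e :: real assume e: "0 < e"
    let ?d = "\<lambda>f g. \<bar>LINT t|lebesgue_on {0..T}. pair (f t - g t) (\<psi> t)\<bar>"
    have d: "?d \<theta> h = \<bar>(LINT s|lebesgue_on {0..T}. pair (\<theta> s) (\<psi> s)) - (LINT s|lebesgue_on {0..T}. pair (h s) (\<psi> s))\<bar>"
      if h: "h \<in> Xspace \<alpha> \<beta> T" for h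
      by (subst L2Hs_pair_diff_left[OF _ _ \<psi>]) (use h \<theta> in \<open>unfold Xspace_def, blast+\<close>)
    have mem: "?d \<in> L2Hs_weak_metrics T (2*\<alpha> - 2*\<beta>)" unfolding L2Hs_weak_metrics_def using \<psi> by blast
    have "?d \<theta> \<theta> = 0" unfolding d[OF \<theta>] by (simp only: diff_self abs_zero)
    from close[OF UnI1[OF UnI2[OF mem]] this e]
    have "\<forall>\<^sub>F n in sequentially. ?d \<theta> (f n) < e" .
    then show "\<forall>\<^sub>F n in sequentially. dist (LINT s|lebesgue_on {0..T}. pair (f n s) (\<psi> s)) (LINT s|lebesgue_on {0..T}. pair (\<theta> s) (\<psi> s)) < e"
      unfolding d[OF f] dist_real_def by (simp only: abs_minus_commute)
  qed
  show "(\<lambda>n. pair (f n t) \<phi>) \<longlonglongrightarrow> pair (\<theta> t) \<phi>" if \<phi>: "\<phi> \<in> Hs (- (\<alpha> - 2 * \<beta>))" and t: "t \<in> {0..T}"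
  proof (rule tendstoI)
    fix e :: real assume e: "0 < e"
    let ?d = "\<lambda>f g. SUP t\<in>{0..T}. \<bar>pair (f t - g t) \<phi>\<bar>"
    have CX: "h \<in> CwHs T (\<alpha> - 2 * \<beta>)" if "h \<in> Xspace \<alpha> \<beta> T" for h using that unfolding Xspace_def by blast
    have d: "pair (\<theta> u - h u) \<phi> = pair (\<theta> u) \<phi> - pair (h u) \<phi>" if h: "h \<in> Xspace \<alpha> \<beta> T" and u: "u \<in> {0..T}" for h u
      by (rule pair_diff_left[OF CwHsD(2)[OF CX[OF \<theta>] u] CwHsD(2)[OF CX[OF h] u] \<phi>])
    have mem: "?d \<in> CwHs_metrics T (\<alpha> - 2*\<beta>)" unfolding CwHs_metrics_def using \<phi> by blast
    have "?d \<theta> \<theta> = (SUP t\<in>{0..T}. 0)" by (rule SUP_cong[OF refl]) (simp only: d[OF \<theta>] diff_self abs_zero)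
    also have "\<dots> = 0" using t by (intro cSUP_const) auto
    finally have "?d \<theta> \<theta> = 0" .
    from close[OF UnI2[OF mem] this e]
    have "\<forall>\<^sub>F n in sequentially. ?d \<theta> (f n) < e" .
    then show "\<forall>\<^sub>F n in sequentially. dist (pair (f n t) \<phi>) (pair (\<theta> t) \<phi>) < e"
    proof eventually_elim
      case (elim n)
      have "continuous_on {0..T} (\<lambda>u. \<bar>pair (\<theta> u) \<phi> - pair (f n u) \<phi>\<bar>)"
        by (intro continuous_intros CwHsD(3)[OF CX[OF \<theta>] \<phi>] CwHsD(3)[OF CX[OF f] \<phi>])
      then have c: "continuous_on {0..T} (\<lambda>u. \<bar>pair (\<theta> u - f n u) \<phi>\<bar>)"
        by (rule continuous_on_eq) (simp only: d[OF f])
      \<comment> \<open>A real supremum bounds its terms only if they are bounded; weak continuity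
        on a compact interval ensures this.\<close>
      have "bdd_above ((\<lambda>u. \<bar>pair (\<theta> u - f n u) \<phi>\<bar>) ` {0..T})"
        by (intro bounded_imp_bdd_above compact_imp_bounded compact_continuous_image[OF c]) simp
      then have "\<bar>pair (\<theta> t - f n t) \<phi>\<bar> \<le> ?d \<theta> (f n)" by (rule cSUP_upper[OF t])
      then show ?case using elim d[OF f t, of n] unfolding dist_real_def by linarith
    qed
  qed
qed

lemma tendsto_coord_of_pair:
  assumes f: "\<And>n. f n \<in> Hs r" and h: "h \<in> Hs r" and lim: "\<And>\<phi>. \<phi> \<in> Hs (- r) \<Longrightarrow> (\<lambda>n. pair (f n) \<phi>) \<longlonglongrightarrow> pair h \<phi>"
  shows "(\<lambda>n :: nat. f n k) \<longlonglongrightarrow> h k"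
proof (cases "k = 0")
  case True
  then show ?thesis using HsD(2)[OF f] HsD(2)[OF h] by simp
next
  case False
  have "(\<lambda>n. 2 * Re (f n k * cnj z)) \<longlonglongrightarrow> 2 * Re (h k * cnj z)" for z
  proof -
    have "pair (f n) (single_mode k z) = 2 * Re (f n k * cnj z)" for n
      by (rule pair_single_mode[where f="f n", OF False HsD(1)[OF f]])
    moreover have "pair h (single_mode k z) = 2 * Re (h k * cnj z)"
      by (rule pair_single_mode[where f=h, OF False HsD(1)[OF h]])
    ultimately show ?thesis using lim[OF single_mode_Hs[OF False], of z] by (simp only:)
  qed
  then have "(\<lambda>n. Re (f n k * cnj z)) \<longlonglongrightarrow> Re (h k * cnj z)" for z
    by (simp only: tendsto_mult_left_iff[of "2 :: real"] zero_neq_numeral[symmetric] not_False_eq_True simp_thms)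
  from this[of 1] this[of \<i>] show ?thesis by (intro tendsto_complex_iff[THEN iffD2]) simp
qed

lemma weak_solution_energy_bound:
  assumes E: "energy_inequality \<alpha> \<beta> T g \<theta>" and \<theta>: "\<theta> \<in> L2Hs T (2 * \<alpha> - 2 * \<beta>)" and g: "g \<in> L2Hs T 0" and t: "t \<in> {0..T}"
  shows "(hs_norm (\<alpha> - 2 * \<beta>) (\<theta> t))\<^sup>2 + (LINT s|lebesgue_on {0..t}. (hs_norm (2 * \<alpha> - 2 * \<beta>) (\<theta> s))\<^sup>2)
    \<le> (hs_norm (\<alpha> - 2 * \<beta>) (\<theta> 0))\<^sup>2 + (L2Hs_norm T 0 g)\<^sup>2"
proof -
  have tT: "t \<le> T" using t by simp
  note energy_absorb[OF L2Hs_initial[OF \<theta> tT] L2Hs_initial[OF g tT]] L2Hs_norm_initial_le[OF g t]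
  moreover have "1/2 * (hs_norm (\<alpha> - 2 * \<beta>) (\<theta> t))\<^sup>2 + (LINT s|lebesgue_on {0..t}. (hs_norm (2 * \<alpha> - 2 * \<beta>) (\<theta> s))\<^sup>2)
     \<le> 1/2 * (hs_norm (\<alpha> - 2 * \<beta>) (\<theta> 0))\<^sup>2 + (LINT s|lebesgue_on {0..t}. pair (Lam (2 * \<alpha> - 2 * \<beta>) (\<theta> s)) (g s))"
    using E t unfolding energy_inequality_def by blast
  ultimately show ?thesis by linarith
qed

text \<open>The mode equation solved for the primitive of the control: all other terms depend on the
  path alone, so convergence of paths forces convergence of these primitives.\<close>

lemma mode_solution_expand:
  assumes m: "mode_solution \<alpha> \<beta> T g x" and x: "x \<in> L2Hs T s_crit" and g: "g \<in> L2Hs T 0" and t: "t \<in> {0..T}"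
  shows "of_real (freq k powr (2 * \<beta>)) * (LINT s|lebesgue_on {0..t}. g s k) =
    x t k - x 0 k + of_real (freq k powr (2 * \<alpha>)) * (LINT s|lebesgue_on {0..t}. x s k) + (LINT s|lebesgue_on {0..t}. advect (x s) k)"
proof -
  have tT: "t \<le> T" using t by simp
  have "x t k = x 0 k + (LINT s|lebesgue_on {0..t}. mode_rhs \<alpha> \<beta> (x s) (g s) k)"
    using m t unfolding mode_solution_def by blast
  also have "(LINT s|lebesgue_on {0..t}. mode_rhs \<alpha> \<beta> (x s) (g s) k) =
     - of_real (freq k powr (2 * \<alpha>)) * (LINT s|lebesgue_on {0..t}. x s k) - (LINT s|lebesgue_on {0..t}. advect (x s) k)
       + of_real (freq k powr (2 * \<beta>)) * (LINT s|lebesgue_on {0..t}. g s k)"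
    unfolding mode_rhs_def
    using integrable_initial[OF L2Hs_coord_integrable[OF x] tT, of k] integrable_initial[OF advect_integrable[OF x] tT, of k]
      integrable_initial[OF L2Hs_coord_integrable[OF g] tT, of k] by simp
  finally show ?thesis by simp
qed

text \<open>Stability of the mode equations: bounded solutions which converge mode by mode have
  controls whose primitives converge mode by mode. The nonlinearity passes to the limit because
  \<open>\<alpha> > 0\<close> upgrades the convergence to a strong one in \<open>L^2([0,T]; H^{-1/2})\<close>.\<close>

lemma mode_solution_control_limit:
  fixes x \<gamma> :: "nat \<Rightarrow> real \<Rightarrow> fourier"
  assumes m: "\<And>m. mode_solution \<alpha> \<beta> T (\<gamma> m) (x m)" and m': "mode_solution \<alpha> \<beta> T g \<theta>"
    and \<gamma>: "\<And>m. \<gamma> m \<in> L2Hs T 0" and g: "g \<in> L2Hs T 0"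
    and x: "\<And>m. x m \<in> L2Hs T q" "\<And>m. x m \<in> CwHs T r" and \<theta>: "\<theta> \<in> L2Hs T q" "\<theta> \<in> CwHs T r"
    and M: "\<And>m t. t \<in> {0..T} \<Longrightarrow> (hs_norm r (x m t))\<^sup>2 \<le> M" "\<And>m. (LINT s|lebesgue_on {0..T}. (hs_norm q (x m s))\<^sup>2) \<le> M"
    and lim: "\<And>t k. t \<in> {0..T} \<Longrightarrow> (\<lambda>m. x m t k) \<longlonglongrightarrow> \<theta> t k"
    and \<alpha>: "0 < \<alpha>" "s_crit + \<alpha> \<le> q" and k: "k \<noteq> 0" and t: "t \<in> {0..T}"
  shows "(\<lambda>m. LINT s|lebesgue_on {0..t}. (\<gamma> m s - g s) k) \<longlonglongrightarrow> 0"
proof -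
  have T: "0 \<le> T" "t \<le> T" using t by simp_all
  have sq: "s_crit \<le> q" using \<alpha> by linarith
  define K where "K k = freq k powr (- r) * sqrt M" for k
  have xK: "cmod (x m s k) \<le> K k" if s: "s \<in> {0..T}" for m s k
  proof -
    have "cmod (x m s k) \<le> freq k powr (- r) * hs_norm r (x m s)" by (rule Hs_cmod_le[OF CwHsD(2)[OF x(2) s]])
    also have "\<dots> \<le> K k" unfolding K_def by (intro mult_left_mono real_le_rsqrt M(1)[OF s]) simp
    finally show ?thesis .
  qed
  have \<theta>K: "cmod (\<theta> s k) \<le> K k" if s: "s \<in> {0..T}" for s k
    by (rule LIMSEQ_le_const2[OF tendsto_norm[OF lim[OF s]]]) (use xK[OF s] in blast)
  have xc: "continuous_on {0..T} (\<lambda>s. x m s k)" for m k by (rule CwHs_coord_continuous[OF x(2)])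
  have \<theta>c: "continuous_on {0..T} (\<lambda>s. \<theta> s k)" for k by (rule CwHs_coord_continuous[OF \<theta>(2)])
  note DL = L2Hs_diff[OF x(1) \<theta>(1)] and xs = L2Hs_mono[OF x(1) sq] and \<theta>s = L2Hs_mono[OF \<theta>(1) sq]
  have DC: "(LINT s|lebesgue_on {0..T}. (hs_norm q (x m s - \<theta> s))\<^sup>2) \<le> 2 * M + 2 * (LINT s|lebesgue_on {0..T}. (hs_norm q (\<theta> s))\<^sup>2)" for m
    using L2Hs_diff_sq_le[OF x(1)[of m] \<theta>(1)] M(2)[of m] by linarith
  have strong: "(\<lambda>m. LINT s|lebesgue_on {0..T}. (hs_norm s_crit (x m s - \<theta> s))\<^sup>2) \<longlonglongrightarrow> 0"
  proof (rule strong_limit[OF DL DC \<alpha>])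
    fix k
    have "(\<lambda>m. LINT s|lebesgue_on {0..T}. (cmod (x m s k - \<theta> s k))\<^sup>2) \<longlonglongrightarrow> (LINT s|lebesgue_on {0..T}. 0)"
    proof (rule bounded_convergence_interval[where T=T and B="(2 * K k)\<^sup>2"])
      show "continuous_on {0..T} (\<lambda>s. (cmod (x m s k - \<theta> s k))\<^sup>2)" for m by (intro continuous_intros xc \<theta>c)
      show "(\<lambda>m. (cmod (x m s k - \<theta> s k))\<^sup>2) \<longlonglongrightarrow> 0" if "s \<in> {0..T}" for s
      proof -
        have "(\<lambda>m. (cmod (x m s k - \<theta> s k))\<^sup>2) \<longlonglongrightarrow> (cmod (\<theta> s k - \<theta> s k))\<^sup>2" by (intro tendsto_intros lim[OF that])
        then show ?thesis by simp
      qed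
      show "norm ((cmod (x m s k - \<theta> s k))\<^sup>2) \<le> (2 * K k)\<^sup>2" if "s \<in> {0..T}" for m s
      proof -
        have "cmod (x m s k - \<theta> s k) \<le> 2 * K k"
          using norm_triangle_ineq4[of "x m s k" "\<theta> s k"] xK[OF that, of m k] \<theta>K[OF that, of k] by linarith
        from power_mono[OF this norm_ge_zero, of 2] show ?thesis unfolding real_norm_def abs_power2 .
      qed
    qed auto
    then show "(\<lambda>m. LINT s|lebesgue_on {0..T}. (cmod ((x m s - \<theta> s) k))\<^sup>2) \<longlonglongrightarrow> 0" by simp
  qed
  have xC: "L2Hs_norm T s_crit (x m) \<le> sqrt M" for m
    unfolding L2Hs_norm_def
  proof (rule real_sqrt_le_mono)
    have "(LINT s|lebesgue_on {0..T}. (hs_norm s_crit (x m s))\<^sup>2) \<le> (LINT s|lebesgue_on {0..T}. (hs_norm q (x m s))\<^sup>2)"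
    proof (rule integral_mono_AE[OF L2Hs_norm_integrable(2)[OF xs] L2Hs_norm_integrable(2)[OF x(1)]])
      have "AE s in lebesgue_on {0..T}. x m s \<in> Hs q" using x(1)[of m] unfolding L2Hs_iff by blast
      then show "AE s in lebesgue_on {0..T}. (hs_norm s_crit (x m s))\<^sup>2 \<le> (hs_norm q (x m s))\<^sup>2"
        by eventually_elim (intro power_mono Hs_mono(2)[OF _ sq], auto)
    qed
    then show "(LINT s|lebesgue_on {0..T}. (hs_norm s_crit (x m s))\<^sup>2) \<le> M" using M(2)[of m] by linarith
  qed
  let ?c = "complex_of_real (freq k powr (2 * \<beta>))"
  have "(\<lambda>m. ?c * (LINT s|lebesgue_on {0..t}. \<gamma> m s k)) \<longlonglongrightarrow> ?c * (LINT s|lebesgue_on {0..t}. g s k)"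
    unfolding mode_solution_expand[OF m xs \<gamma> t] mode_solution_expand[OF m' \<theta>s g t]
  proof (intro tendsto_add tendsto_diff tendsto_mult tendsto_const lim t)
    show "0 \<in> {0..T}" using T by simp
    show "(\<lambda>m. LINT s|lebesgue_on {0..t}. x m s k) \<longlonglongrightarrow> (LINT s|lebesgue_on {0..t}. \<theta> s k)"
      by (rule bounded_convergence_interval[OF xc \<theta>c lim xK T(2)])
    show "(\<lambda>m. LINT s|lebesgue_on {0..t}. advect (x m s) k) \<longlonglongrightarrow> (LINT s|lebesgue_on {0..t}. advect (\<theta> s) k)"
      by (rule advect_integral_limit[OF xs \<theta>s xC strong t])
  qed
  \<comment> \<open>At a nonzero frequency the weight of the control can be divided out.\<close>
  moreover have "?c \<noteq> 0" using k freq_pos[OF k] by simp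
  ultimately have "(\<lambda>m. LINT s|lebesgue_on {0..t}. \<gamma> m s k) \<longlonglongrightarrow> (LINT s|lebesgue_on {0..t}. g s k)"
    by (simp only: tendsto_mult_left_iff not_False_eq_True)
  moreover have "(LINT s|lebesgue_on {0..t}. (\<gamma> m s - g s) k) = (LINT s|lebesgue_on {0..t}. \<gamma> m s k) - (LINT s|lebesgue_on {0..t}. g s k)" for m
    unfolding minus_apply
    by (rule Bochner_Integration.integral_diff[OF integrable_initial[OF L2Hs_coord_integrable[OF \<gamma>] T(2)] integrable_initial[OF L2Hs_coord_integrable[OF g] T(2)]])
  ultimately show ?thesis by (simp only: Lim_null[symmetric])
qed

text \<open>Along a recovery sequence the costs of the initial data and of the controls converge
  together while each is weakly lower semicontinuous; hence both converge strongly, and the energy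
  inequality survives in the limit.\<close>

lemma closure_energy_inequality:
  assumes C0: "weak_strong_uniqueness_class \<alpha> \<beta> T C0" and T: "0 < T"
    and s: "\<alpha> - 2 * \<beta> = 0 \<or> \<alpha> - 2 * \<beta> = s_crit" and \<alpha>: "0 < \<alpha>"
    and \<theta>: "\<theta> \<in> I_closure \<alpha> \<beta> T C0" and g: "g \<in> L2Hs T 0" and w: "weak_solution \<alpha> \<beta> T g (\<theta> 0) \<theta>"
  shows "1/2 * (hs_norm (\<alpha> - 2 * \<beta>) (\<theta> T))\<^sup>2 + (LINT s|lebesgue_on {0..T}. (hs_norm (2 * \<alpha> - 2 * \<beta>) (\<theta> s))\<^sup>2)
    \<le> 1/2 * (hs_norm (\<alpha> - 2 * \<beta>) (\<theta> 0))\<^sup>2 + (LINT s|lebesgue_on {0..T}. pair (Lam (2 * \<alpha> - 2 * \<beta>) (\<theta> s)) (g s))"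
proof -
  define r q where "r = \<alpha> - 2 * \<beta>" and "q = 2 * \<alpha> - 2 * \<beta>"
  have sr: "s_crit \<le> r" using s by (auto simp: r_def s_crit_def)
  have sq: "s_crit + \<alpha> \<le> q" using sr by (simp add: r_def q_def)
  have TT: "0 \<in> {0..T}" "T \<in> {0..T}" using T by simp_all
  obtain y where y: "\<And>n. y n \<in> C0" and ylim: "limitin (Xtop \<alpha> \<beta> T) y \<theta> sequentially"
    and yrate: "(\<lambda>n. rate \<alpha> \<beta> T (y n)) \<longlonglongrightarrow> rate \<alpha> \<beta> T \<theta>" and \<theta>X: "\<theta> \<in> Xspace \<alpha> \<beta> T"
    using \<theta> unfolding I_closure_def by blast
  have C0X: "f \<in> Xspace \<alpha> \<beta> T" if "f \<in> C0" for f using C0 that unfolding weak_strong_uniqueness_class_def by blast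
  \<comment> \<open>\<open>A\<close> is the cost along the given control, hence an upper bound for
    the rate of the limit; convergence of the rates enters through this bound.\<close>
  define E G A where "E = (hs_norm r (\<theta> 0))\<^sup>2" and "G = (L2Hs_norm T 0 g)\<^sup>2" and "A = E + 1/2 * G"
  define \<delta> where "\<delta> m = inverse (real (Suc m))" for m
  have A0: "0 \<le> A" by (simp add: A_def E_def G_def)
  \<comment> \<open>Requiring \<open>m \<le> n\<close> makes the selected indices tend to infinity,
    although the selection need not be increasing.\<close>
  define Q where "Q m n \<gamma> \<longleftrightarrow> m \<le> n \<and> \<gamma> \<in> L2Hs T 0 \<and> weak_solution \<alpha> \<beta> T \<gamma> (y n 0) (y n) \<and>
    (hs_norm r (y n 0))\<^sup>2 + 1/2 * (L2Hs_norm T 0 \<gamma>)\<^sup>2 < A + \<delta> m" for m n \<gamma>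
  have "\<exists>n \<gamma>. Q m n \<gamma>" for m
  proof -
    have \<delta>: "0 < \<delta> m" by (simp add: \<delta>_def)
    have "rate \<alpha> \<beta> T \<theta> \<le> ennreal A" using rate_le[OF g w] unfolding A_def E_def G_def r_def .
    also have "ennreal A < ennreal (A + \<delta> m)" using A0 \<delta> by (simp add: ennreal_less_iff)
    finally have "\<forall>\<^sub>F n in sequentially. rate \<alpha> \<beta> T (y n) < ennreal (A + \<delta> m)" by (rule order_tendstoD(2)[OF yrate])
    then obtain N where N: "\<And>n. N \<le> n \<Longrightarrow> rate \<alpha> \<beta> T (y n) < ennreal (A + \<delta> m)" unfolding eventually_sequentially by blast
    from rate_less_control[OF N[of "max N m"]] show ?thesis
      unfolding Q_def r_def by (intro exI[of _ "max N m"]) auto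
  qed
  then obtain \<nu> \<gamma> where Q: "\<And>m. Q m (\<nu> m) (\<gamma> m)" by metis
  define x where "x m = y (\<nu> m)" for m
  have \<nu>: "m \<le> \<nu> m" and \<gamma>: "\<gamma> m \<in> L2Hs T 0" and xw: "weak_solution \<alpha> \<beta> T (\<gamma> m) (x m 0) (x m)"
    and cost: "(hs_norm r (x m 0))\<^sup>2 + 1/2 * (L2Hs_norm T 0 (\<gamma> m))\<^sup>2 < A + \<delta> m" for m
    using Q[of m] unfolding Q_def x_def by blast+
  have \<nu>top: "filterlim \<nu> sequentially sequentially"
    by (rule filterlim_at_top_mono[OF filterlim_ident]) (simp add: \<nu>)
  have xC0: "x m \<in> C0" for m unfolding x_def by (rule y)
  have xL: "x m \<in> L2Hs T q" and xCw: "x m \<in> CwHs T r" for m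
    using C0X[OF xC0[of m]] unfolding Xspace_def q_def r_def by blast+
  have \<theta>L: "\<theta> \<in> L2Hs T q" and \<theta>Cw: "\<theta> \<in> CwHs T r" using \<theta>X unfolding Xspace_def q_def r_def by blast+
  have qlim: "(\<lambda>m. LINT s|lebesgue_on {0..T}. pair (x m s) (\<psi> s)) \<longlonglongrightarrow> (LINT s|lebesgue_on {0..T}. pair (\<theta> s) (\<psi> s))"
    if "\<psi> \<in> L2Hs T (- q)" for \<psi>
    using filterlim_compose[OF Xtop_limit_pair(1)[OF ylim C0X[OF y] \<theta>X that[unfolded q_def]] \<nu>top] unfolding x_def .
  have rlim: "(\<lambda>m. pair (x m t) \<phi>) \<longlonglongrightarrow> pair (\<theta> t) \<phi>" if "\<phi> \<in> Hs (- r)" "t \<in> {0..T}" for \<phi> t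
    using filterlim_compose[OF Xtop_limit_pair(2)[OF ylim C0X[OF y] \<theta>X that(1)[unfolded r_def] that(2)] \<nu>top] unfolding x_def .
  have klim: "(\<lambda>m. x m t k) \<longlonglongrightarrow> \<theta> t k" if t: "t \<in> {0..T}" for t k
    by (rule tendsto_coord_of_pair[OF CwHsD(2)[OF xCw t] CwHsD(2)[OF \<theta>Cw t] rlim[OF _ t]])
  have xE: "energy_inequality \<alpha> \<beta> T (\<gamma> m) (x m)" for m
    by (rule uniqueness_class_energy_inequality[OF C0 T s \<alpha> xC0 \<gamma> xw])
  \<comment> \<open>The cost stays below \<open>A + 1\<close>; doubling absorbs the factor
    \<open>1/2\<close> in front of the control.\<close>
  define M where "M = 2 * (A + 1)"
  have M0: "0 \<le> M" using A0 by (simp add: M_def)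
  have \<delta>1: "\<delta> m \<le> 1" for m unfolding \<delta>_def by (simp add: inverse_le_1_iff)
  have costM: "(hs_norm r (x m 0))\<^sup>2 + (L2Hs_norm T 0 (\<gamma> m))\<^sup>2 \<le> M" for m
  proof -
    have arith: "X + Y \<le> 2 * (A + 1)" if "X + 1/2 * Y < A + d" "d \<le> 1" "0 \<le> X" for X Y d :: real
    proof -
      have "2 * X + Y < 2 * A + 2 * d" using that(1) by simp
      then show ?thesis using that by simp
    qed
    show ?thesis unfolding M_def by (rule arith[OF cost \<delta>1 zero_le_power2])
  qed
  have bound: "(hs_norm r (x m t))\<^sup>2 + (LINT s|lebesgue_on {0..t}. (hs_norm q (x m s))\<^sup>2) \<le> M" if "t \<in> {0..T}" for m t
    using weak_solution_energy_bound[OF xE xL[unfolded q_def] \<gamma> that, of m] costM[of m] unfolding r_def q_def by linarith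
  have F0: "0 \<le> (LINT s|lebesgue_on {0..t}. (hs_norm q (x m s))\<^sup>2)" for t m by simp
  have xM: "(hs_norm r (x m t))\<^sup>2 \<le> M" if "t \<in> {0..T}" for m t using bound[OF that, of m] F0[of t m] by linarith
  have xMq: "(LINT s|lebesgue_on {0..T}. (hs_norm q (x m s))\<^sup>2) \<le> M" for m
    using bound[OF TT(2), of m] zero_le_power2[of "hs_norm r (x m T)"] by linarith
  have s': "s_crit \<le> \<alpha> - 2 * \<beta>" "0 \<le> \<alpha>" using sr \<alpha> unfolding r_def by simp_all
  have prim: "(\<lambda>m. LINT s|lebesgue_on {0..t}. (\<gamma> m s - g s) k) \<longlonglongrightarrow> 0" if "k \<noteq> 0" "t \<in> {0..T}" for k t
    by (rule mode_solution_control_limit[OF weak_solution_imp_mode_solution[OF xw \<gamma> T s'] weak_solution_imp_mode_solution[OF w g T s']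
      \<gamma> g xL xCw \<theta>L \<theta>Cw xM xMq klim \<alpha> sq that])
  note \<eta>L = L2Hs_diff[OF \<gamma> g]
  have gL: "(\<lambda>s. Lam (2 * 0) (g s)) \<in> L2Hs T 0" using L2Hs_Lam[OF g, of "2 * 0"] by simp
  \<comment> \<open>Almost everywhere \<open>Lam (2 * 0)\<close> leaves \<open>g s\<close>
    unchanged. It is kept so that the expansion of squares applies at order zero, and so that the
    zero mode vanishes at every time.\<close>
  define c where "c m = (LINT s|lebesgue_on {0..T}. pair (\<gamma> m s) (Lam (2 * 0) (g s)))" for m
  have cG: "c \<longlonglongrightarrow> G"
  proof -
    have "(L2Hs_norm T 0 (\<lambda>s. \<gamma> m s - g s))\<^sup>2 \<le> 2 * M + 2 * G" for m
      using L2Hs_diff_sq_le[OF \<gamma>[of m] g] costM[of m] zero_le_power2[of "hs_norm r (x m 0)"]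
      unfolding L2Hs_norm_sq G_def by linarith
    then have "(\<lambda>m. LINT s|lebesgue_on {0..T}. pair (\<gamma> m s - g s) (Lam (2 * 0) (g s))) \<longlonglongrightarrow> 0"
      by (rule L2Hs_primitives_weak_limit[OF \<eta>L _ gL T _ prim]) (simp_all add: Lam_def)
    moreover have "(LINT s|lebesgue_on {0..T}. pair (\<gamma> m s - g s) (Lam (2 * 0) (g s))) = c m - G" for m
      using L2Hs_pair_diff_left[OF \<gamma>[of m] g, of "\<lambda>s. Lam (2 * 0) (g s)"] gL L2Hs_pair_Lam_self[OF g]
      unfolding c_def G_def L2Hs_norm_sq minus_zero by presburger
    ultimately show ?thesis by (simp only: Lim_null[symmetric])
  qed
  define H where "H m = (L2Hs_norm T 0 (\<lambda>s. \<gamma> m s - g s))\<^sup>2" for m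
  have H: "H m = (L2Hs_norm T 0 (\<gamma> m))\<^sup>2 - 2 * c m + G" for m
    using L2Hs_diff_sq[OF \<gamma>[of m] g] unfolding H_def c_def G_def L2Hs_norm_sq .
  have H0: "0 \<le> H m" for m by (simp add: H_def)
  have \<theta>H: "\<theta> t \<in> Hs r" if "t \<in> {0..T}" for t by (rule CwHsD(2)[OF \<theta>Cw that])
  have LH: "Lam (2 * r) (\<theta> t) \<in> Hs (- r)" if "t \<in> {0..T}" for t using Lam_Hs[OF \<theta>H[OF that], of "2 * r"] by simp
  define e where "e t m = pair (x m t) (Lam (2 * r) (\<theta> t))" for t m
  have eE: "e t \<longlonglongrightarrow> (hs_norm r (\<theta> t))\<^sup>2" if "t \<in> {0..T}" for t
    using rlim[OF LH[OF that] that] unfolding e_def pair_Lam_self[OF \<theta>H[OF that]] .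
  \<comment> \<open>Weak lower semicontinuity in quantitative form: the nonnegative squared distance
    gives a lower bound for the energy that is affine in a convergent pairing. \<open>flow\<close>
    is the analogue for the dissipation.\<close>
  have elow: "2 * e t m - (hs_norm r (\<theta> t))\<^sup>2 \<le> (hs_norm r (x m t))\<^sup>2" if "t \<in> {0..T}" for t m
    using hs_norm_diff_sq[OF CwHsD(2)[OF xCw[of m] that] \<theta>H[OF that]] zero_le_power2[of "hs_norm r (x m t - \<theta> t)"]
    unfolding e_def by linarith
  define f where "f m = (LINT s|lebesgue_on {0..T}. pair (x m s) (Lam (2 * q) (\<theta> s)))" for m
  define F where "F = (LINT s|lebesgue_on {0..T}. (hs_norm q (\<theta> s))\<^sup>2)"
  have "(\<lambda>s. Lam (2 * q) (\<theta> s)) \<in> L2Hs T (- q)" using L2Hs_Lam[OF \<theta>L, of "2 * q"] by simp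
  from qlim[OF this] have fF: "f \<longlonglongrightarrow> F" unfolding f_def F_def L2Hs_pair_Lam_self[OF \<theta>L] .
  have flow: "2 * f m - F \<le> (LINT s|lebesgue_on {0..T}. (hs_norm q (x m s))\<^sup>2)" for m
  proof -
    have "0 \<le> (LINT s|lebesgue_on {0..T}. (hs_norm q (x m s - \<theta> s))\<^sup>2)" by (rule integral_nonneg_AE) simp
    then show ?thesis using L2Hs_diff_sq[OF xL[of m] \<theta>L] unfolding f_def F_def by linarith
  qed
  define p where "p m = (LINT s|lebesgue_on {0..T}. pair (x m s) (Lam q (g s)))" for m
  define P where "P = (LINT s|lebesgue_on {0..T}. pair (Lam q (\<theta> s)) (g s))"
  have LgL: "(\<lambda>s. Lam q (g s)) \<in> L2Hs T (- q)" using L2Hs_Lam[OF g, of q] by simp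
  have pP: "p \<longlonglongrightarrow> P" using qlim[OF LgL] unfolding p_def P_def pair_Lam .
  \<comment> \<open>The control is replaced by its limit at a price proportional to their distance;
    the remaining work is linear in the path and converges.\<close>
  have work: "(LINT s|lebesgue_on {0..T}. pair (Lam q (x m s)) (\<gamma> m s)) \<le> sqrt (H m) * sqrt M + p m" for m
  proof -
    have LxL: "(\<lambda>s. Lam q (x m s)) \<in> L2Hs T (- 0)" using L2Hs_Lam[OF xL[of m], of q] by simp
    have px: "p m = (LINT s|lebesgue_on {0..T}. pair (g s) (Lam q (x m s)))"
      unfolding p_def by (intro Bochner_Integration.integral_cong refl) (metis pair_Lam pair_commute)
    have wx: "(LINT s|lebesgue_on {0..T}. pair (Lam q (x m s)) (\<gamma> m s)) = (LINT s|lebesgue_on {0..T}. pair (\<gamma> m s) (Lam q (x m s)))"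
      by (intro Bochner_Integration.integral_cong refl pair_commute)
    have "(LINT s|lebesgue_on {0..T}. pair (Lam q (x m s)) (\<gamma> m s)) - p m = (LINT s|lebesgue_on {0..T}. pair (\<gamma> m s - g s) (Lam q (x m s)))"
      by (simp only: px wx L2Hs_pair_diff_left[OF \<gamma> g LxL])
    also have "\<dots> \<le> L2Hs_norm T 0 (\<lambda>s. \<gamma> m s - g s) * L2Hs_norm T (- 0) (\<lambda>s. Lam q (x m s))"
      using L2Hs_pair_integrable(2)[OF \<eta>L LxL, of m] by linarith
    also have "\<dots> \<le> sqrt (H m) * sqrt M"
    proof (rule mult_mono)
      have "L2Hs_norm T (- 0) (\<lambda>s. Lam q (x m s)) = L2Hs_norm T q (x m)"
        unfolding L2Hs_norm_def using hs_norm_Lam[of q q] by simp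
      also have "\<dots> \<le> sqrt M" unfolding L2Hs_norm_def using xMq by (rule real_sqrt_le_mono)
      finally show "L2Hs_norm T (- 0) (\<lambda>s. Lam q (x m s)) \<le> sqrt M" .
      show "0 \<le> L2Hs_norm T (- 0) (\<lambda>s. Lam q (x m s))" unfolding L2Hs_norm_def by simp
      show "L2Hs_norm T 0 (\<lambda>s. \<gamma> m s - g s) \<le> sqrt (H m)" unfolding H_def by simp
    qed (use H0 in simp)
    finally show ?thesis by linarith
  qed
  \<comment> \<open>The cost bound minus the lower bound for the control yields \<open>a\<close>, an
    upper bound for the initial energy; minus the lower bound for the initial data it yields
    \<open>h\<close>, an upper bound for \<open>H\<close>. In the limit \<open>a\<close> becomes
    \<open>E\<close> and \<open>h\<close> becomes \<open>0\<close>.\<close>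
  define a h where "a m = A + \<delta> m - 1/2 * (2 * c m - G)" and "h m = 2 * (A + \<delta> m - (2 * e 0 m - E) - c m + 1/2 * G)" for m
  have Hh: "H m \<le> h m" for m
  proof -
    have arith: "Z \<le> 2 * (A + d - (2 * e' - E) - c' + 1/2 * G)"
      if "X + 1/2 * Y < A + d" "2 * e' - E \<le> X" "Z = Y - 2 * c' + G" for X Y Z d c' e' :: real
    proof -
      have "2 * X + Y < 2 * A + 2 * d" using that(1) by simp
      then have "Z \<le> 2 * A + 2 * d - 4 * e' + 2 * E - 2 * c' + G" using that(2,3) by linarith
      also have "\<dots> = 2 * (A + d - (2 * e' - E) - c' + 1/2 * G)" by (simp add: algebra_simps)
      finally show ?thesis .
    qed
    show ?thesis unfolding h_def by (rule arith[OF cost elow[OF TT(1), folded E_def] H])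
  qed
  have main: "1/2 * (2 * e T m - (hs_norm r (\<theta> T))\<^sup>2) + (2 * f m - F) \<le> 1/2 * a m + (sqrt (h m) * sqrt M + p m)" for m
  proof -
    have arith: "X \<le> A + d - 1/2 * (2 * c' - G)" if "X + 1/2 * Y < A + d" "Z = Y - 2 * c' + G" "0 \<le> Z" for X Y Z d c' :: real
    proof -
      have "2 * X + Y < 2 * A + 2 * d" using that(1) by simp
      then have "2 * X \<le> 2 * A + 2 * d - 2 * c' + G" using that(2,3) by linarith
      also have "\<dots> = 2 * (A + d - 1/2 * (2 * c' - G))" by (simp add: algebra_simps)
      finally show ?thesis by (rule mult_left_le_imp_le) simp
    qed
    have "(hs_norm r (x m 0))\<^sup>2 \<le> a m" unfolding a_def by (rule arith[OF cost H H0])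
    moreover have "sqrt (H m) * sqrt M \<le> sqrt (h m) * sqrt M" by (intro mult_right_mono real_sqrt_le_mono Hh) (simp add: M0)
    moreover have "1/2 * (hs_norm r (x m T))\<^sup>2 + (LINT s|lebesgue_on {0..T}. (hs_norm q (x m s))\<^sup>2)
       \<le> 1/2 * (hs_norm r (x m 0))\<^sup>2 + (LINT s|lebesgue_on {0..T}. pair (Lam q (x m s)) (\<gamma> m s))"
      using xE[of m] TT(2) unfolding energy_inequality_def r_def q_def by blast
    moreover have "1/2 * (2 * e' - D) + (2 * f' - F) \<le> 1/2 * a' + (h' + p')"
      if "X \<le> a'" "h \<le> h'" "1/2 * Y + Z \<le> 1/2 * X + W" "2 * e' - D \<le> Y" "2 * f' - F \<le> Z" "W \<le> h + p'"
      for X Y Z W e' D f' a' h h' p' :: real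
    proof -
      have "1/2 * (2 * e' - D) + (2 * f' - F) \<le> 1/2 * Y + Z" by (intro add_mono mult_left_mono that) simp
      also have "\<dots> \<le> 1/2 * X + W" by (rule that)
      also have "\<dots> \<le> 1/2 * a' + (h + p')" by (intro add_mono[of "1/2 * X"] mult_left_mono that) simp
      also have "\<dots> \<le> 1/2 * a' + (h' + p')" by (intro add_left_mono add_right_mono that)
      finally show ?thesis .
    qed
    ultimately show ?thesis using elow[OF TT(2), of m] flow[of m] work[of m] by blast
  qed
  have \<delta>0: "\<delta> \<longlonglongrightarrow> 0" unfolding \<delta>_def by (rule LIMSEQ_inverse_real_of_nat)
  have hlim: "h \<longlonglongrightarrow> 2 * (A + 0 - (2 * E - E) - G + 1/2 * G)" unfolding h_def E_def
    by (intro tendsto_intros \<delta>0 cG eE TT)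
  have "(\<lambda>m. 1/2 * (2 * e T m - (hs_norm r (\<theta> T))\<^sup>2) + (2 * f m - F)) \<longlonglongrightarrow> 1/2 * (2 * (hs_norm r (\<theta> T))\<^sup>2 - (hs_norm r (\<theta> T))\<^sup>2) + (2 * F - F)"
    by (intro tendsto_intros eE fF TT)
  moreover have "(\<lambda>m. 1/2 * a m + (sqrt (h m) * sqrt M + p m)) \<longlonglongrightarrow>
      1/2 * (A + 0 - 1/2 * (2 * G - G)) + (sqrt (2 * (A + 0 - (2 * E - E) - G + 1/2 * G)) * sqrt M + P)"
    unfolding a_def by (intro tendsto_intros \<delta>0 cG hlim pP)
  ultimately have "1/2 * (2 * (hs_norm r (\<theta> T))\<^sup>2 - (hs_norm r (\<theta> T))\<^sup>2) + (2 * F - F) \<le>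
      1/2 * (A + 0 - 1/2 * (2 * G - G)) + (sqrt (2 * (A + 0 - (2 * E - E) - G + 1/2 * G)) * sqrt M + P)"
    by (rule LIMSEQ_le) (use main in blast)
  also have "2 * (A + 0 - (2 * E - E) - G + 1/2 * G) = 0" unfolding A_def by simp
  finally have "1/2 * (hs_norm r (\<theta> T))\<^sup>2 + F \<le> 1/2 * E + P" unfolding A_def by simp
  then show ?thesis unfolding E_def F_def P_def r_def q_def .
qed

section \<open>Time reversal\<close>

lemma integral_reflect_initial:
  fixes f :: "real \<Rightarrow> complex"
  assumes i: "integrable (lebesgue_on {0..T}) f" and t: "t \<in> {0..T}"
  shows "(LINT s|lebesgue_on {0..t}. f (T - s)) = (LINT s|lebesgue_on {0..T}. f s) - (LINT s|lebesgue_on {0..T - t}. f s)"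
proof -
  let ?M = "lebesgue_on {0..T}"
  have id: "(\<lambda>x :: real. x) \<in> borel_measurable ?M" by (intro measurable_restrict_space1 measurable_completion) simp
  note [measurable] = id borel_measurable_integrable[OF i]
  have i1: "integrable ?M (\<lambda>s. if T - s \<le> t then f s else 0)"
  proof (rule Bochner_Integration.integrable_bound[OF i])
    show "(\<lambda>s. if T - s \<le> t then f s else 0) \<in> borel_measurable ?M" by measurable
    show "AE s in ?M. norm (if T - s \<le> t then f s else 0) \<le> norm (f s)" by (rule AE_I2) simp
  qed
  have i2: "integrable ?M (\<lambda>s. if s \<le> T - t then f s else 0)"
  proof (rule Bochner_Integration.integrable_bound[OF i])
    show "(\<lambda>s. if s \<le> T - t then f s else 0) \<in> borel_measurable ?M" by measurable
    show "AE s in ?M. norm (if s \<le> T - t then f s else 0) \<le> norm (f s)" by (rule AE_I2) simp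
  qed
  have "(LINT s|lebesgue_on {0..t}. f (T - s)) = (LINT s|?M. (if s \<le> t then f (T - s) else 0))"
    by (rule integral_initial_part[symmetric]) (use t in auto)
  also have "\<dots> = (LINT s|?M. (if T - s \<le> t then f s else 0))"
    using integral_reflect(2)[OF i1] by simp
  also have "\<dots> = (LINT s|?M. f s - (if s \<le> T - t then f s else 0))"
  proof (rule integral_cong_AE)
    \<comment> \<open>The two closed pieces share the point \<open>T - t\<close>.\<close>
    have "AE s in ?M. s \<noteq> T - t" by (rule AE_neq_lebesgue_on) simp
    then show "AE s in ?M. (if T - s \<le> t then f s else 0) = f s - (if s \<le> T - t then f s else 0)"
      by eventually_elim auto
  qed measurable
  also have "\<dots> = (LINT s|?M. f s) - (LINT s|?M. (if s \<le> T - t then f s else 0))"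
    by (rule Bochner_Integration.integral_diff[OF i i2])
  also have "(LINT s|?M. (if s \<le> T - t then f s else 0)) = (LINT s|lebesgue_on {0..T - t}. f s)"
    by (rule integral_initial_part) (use t in auto)
  finally show ?thesis .
qed

text \<open>Negating the path and reversing time each flip the sign of the time derivative, so the
  right-hand side has to stay the same. Of the two copies of \<open>Lam q f\<close> one cancels the
  anti-dissipation of the reversed path and the other restores the dissipation.\<close>

lemma mode_rhs_reversal:
  assumes q: "q = 2 * \<alpha> - 2 * \<beta>"
  shows "mode_rhs \<alpha> \<beta> (- f) (h - Lam q f - Lam q f) k = mode_rhs \<alpha> \<beta> f h k"
proof -
  have "freq k powr (2 * \<beta>) * freq k powr q = freq k powr (2 * \<alpha>)"
    by (simp add: powr_add[symmetric] q)
  then have "complex_of_real (freq k powr (2 * \<beta>)) * (complex_of_real (freq k powr q) * f k) = complex_of_real (freq k powr (2 * \<alpha>)) * f k"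
    by (simp only: mult.assoc[symmetric] of_real_mult[symmetric])
  then have "complex_of_real (freq k powr (2 * \<beta>)) * Lam q f k = complex_of_real (freq k powr (2 * \<alpha>)) * f k"
    by (cases "k = 0") (simp_all add: Lam_def)
  then show ?thesis unfolding mode_rhs_def advect_minus uminus_apply minus_apply by (simp add: right_diff_distrib)
qed

text \<open>Integrated in time, the work done on the reversed path is twice the dissipation minus
  the original work.\<close>

lemma pair_reversal:
  assumes f: "f \<in> Hs q" and h: "h \<in> Hs 0"
  shows "pair (Lam q (- f)) (h - Lam q f - Lam q f) = 2 * (hs_norm q f)\<^sup>2 - pair (Lam q f) h"
proof -
  have L: "Lam q f \<in> Hs 0" using Lam_Hs[OF f, of q] by simp
  then have L': "Lam q f \<in> Hs (- 0)" and h': "h \<in> Hs (- 0)" using h by simp_all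
  have "Lam q (- f) = - Lam q f" by (rule ext) (simp add: Lam_def)
  then have "pair (Lam q (- f)) (h - Lam q f - Lam q f) = - (pair (Lam q f) h - pair (Lam q f) (Lam q f) - pair (Lam q f) (Lam q f))"
    by (simp only: pair_minus_left pair_diff_right[OF L Hs_diff(1)[OF h' L'] L'] pair_diff_right[OF L h' L'])
  moreover have "pair (Lam q f) (Lam q f) = (hs_norm q f)\<^sup>2"
    using pair_self[OF L] hs_norm_Lam[of q q f] by simp
  ultimately show ?thesis by linarith
qed

text \<open>The dissipative term is subtracted twice instead of being scaled by 2, so that closure
  of \<open>L2Hs\<close> under differences suffices.\<close>

definition reversed_control :: "real \<Rightarrow> real \<Rightarrow> (real \<Rightarrow> fourier) \<Rightarrow> (real \<Rightarrow> fourier) \<Rightarrow> real \<Rightarrow> fourier" where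
  "reversed_control T q \<theta> g t = g (T - t) - Lam q (\<theta> (T - t)) - Lam q (\<theta> (T - t))"

lemma reversed_control_L2Hs:
  assumes "\<theta> \<in> L2Hs T q" "g \<in> L2Hs T 0" shows "reversed_control T q \<theta> g \<in> L2Hs T 0"
proof -
  have L: "(\<lambda>t. Lam q (\<theta> (T - t))) \<in> L2Hs T 0" using L2Hs_Lam[OF L2Hs_reflect[OF assms(1)], of q] by simp
  show ?thesis unfolding reversed_control_def[abs_def] by (intro L2Hs_diff L2Hs_reflect assms L)
qed

text \<open>The nonlinearity is quadratic and the reversal changes the sign of \<open>\<theta>\<close>, so only the dissipation
  has the wrong sign after reversal; the control \<open>- 2 \<Lambda>^{2\<alpha>-2\<beta>} \<theta>\<close> repairs it.\<close>

lemma weak_solution_time_reversal: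
  assumes w: "weak_solution \<alpha> \<beta> T g (\<theta> 0) \<theta>" and g: "g \<in> L2Hs T 0" and T: "0 < T"
    and s: "s_crit \<le> \<alpha> - 2 * \<beta>" "0 \<le> \<alpha>" and X: "time_reversal T \<theta> \<in> Xspace \<alpha> \<beta> T"
  defines "\<theta>' \<equiv> time_reversal T \<theta>" and "g' \<equiv> reversed_control T (2 * \<alpha> - 2 * \<beta>) \<theta> g"
  shows "weak_solution \<alpha> \<beta> T g' (\<theta>' 0) \<theta>'"
proof (rule mode_solution_imp_weak_solution)
  let ?q = "2 * \<alpha> - 2 * \<beta>" and ?r = "\<alpha> - 2 * \<beta>"
  have \<theta>L: "\<theta> \<in> L2Hs T ?q" and \<theta>I: "\<theta> \<in> LinfHs T ?r" using w unfolding weak_solution_def by blast+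
  show "g' \<in> L2Hs T 0" unfolding g'_def by (rule reversed_control_L2Hs[OF \<theta>L g])
  show "0 < T" "s_crit \<le> ?r" "0 \<le> \<alpha>" by (rule T s)+
  have X': "\<theta>' \<in> L2Hs T ?r" "\<theta>' \<in> L2Hs T ?q" "\<theta>' \<in> CwHs T ?r" using X unfolding \<theta>'_def Xspace_def by blast+
  show "\<theta>' \<in> L2Hs T ?q" "\<theta>' \<in> CwHs T ?r" by (rule X')+
  have rev: "\<theta>' t = - \<theta> (T - t)" if "t \<in> {0..T}" for t using that by (simp add: \<theta>'_def time_reversal_def)
  obtain M where "AE t in lebesgue_on {0..T}. hs_norm ?r (\<theta> t) \<le> M" using \<theta>I unfolding LinfHs_iff by blast
  then have "AE t in lebesgue_on {0..T}. hs_norm ?r (\<theta> (T - t)) \<le> M" by (rule AE_reflect)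
  then have "AE t in lebesgue_on {0..T}. hs_norm ?r (\<theta>' t) \<le> M"
    using AE_in_interval by eventually_elim (simp only: rev hs_norm_minus)
  then show "\<theta>' \<in> LinfHs T ?r" using X'(1) unfolding LinfHs_iff L2Hs_iff by blast
  have \<theta>s: "\<theta> \<in> L2Hs T s_crit" by (rule L2Hs_mono[OF \<theta>L]) (use s in linarith)
  have m: "\<theta> t k = \<theta> 0 k + (LINT s|lebesgue_on {0..t}. mode_rhs \<alpha> \<beta> (\<theta> s) (g s) k)" if "t \<in> {0..T}" for t k
    using weak_solution_imp_mode_solution[OF w g T s] that unfolding mode_solution_def by blast
  show "mode_solution \<alpha> \<beta> T g' \<theta>'"
    unfolding mode_solution_def
  proof (intro allI ballI)
    fix k t assume t: "t \<in> {0..T}"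
    then have tT: "t \<in> {0..T}" "T - t \<in> {0..T}" "0 \<in> {0..T}" "T \<in> {0..T}" using T by simp_all
    have "(LINT s|lebesgue_on {0..t}. mode_rhs \<alpha> \<beta> (\<theta>' s) (g' s) k) = (LINT s|lebesgue_on {0..t}. mode_rhs \<alpha> \<beta> (\<theta> (T - s)) (g (T - s)) k)"
    proof (rule Bochner_Integration.integral_cong[OF refl])
      fix s assume "s \<in> space (lebesgue_on {0..t})"
      then have "s \<in> {0..T}" using t by simp
      then show "mode_rhs \<alpha> \<beta> (\<theta>' s) (g' s) k = mode_rhs \<alpha> \<beta> (\<theta> (T - s)) (g (T - s)) k"
        by (simp only: rev g'_def reversed_control_def mode_rhs_reversal[OF refl])
    qed
    \<comment> \<open>In reflected time, the integral over the initial piece of length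
      \<open>t\<close> is that of the original equation from \<open>T - t\<close> to
      \<open>T\<close>.\<close>
    also have "\<dots> = (LINT s|lebesgue_on {0..T}. mode_rhs \<alpha> \<beta> (\<theta> s) (g s) k) - (LINT s|lebesgue_on {0..T - t}. mode_rhs \<alpha> \<beta> (\<theta> s) (g s) k)"
      by (rule integral_reflect_initial[OF mode_rhs_integrable[OF \<theta>s g] t])
    also have "\<dots> = \<theta> T k - \<theta> (T - t) k" using m[OF tT(4), of k] m[OF tT(2), of k] by simp
    finally show "\<theta>' t k = \<theta>' 0 k + (LINT s|lebesgue_on {0..t}. mode_rhs \<alpha> \<beta> (\<theta>' s) (g' s) k)"
      unfolding rev[OF t] rev[OF tT(3)] by simp
  qed
qed

theorem theorem1:
  fixes \<alpha> \<beta> T :: real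
    and C0 R :: "(real \<Rightarrow> fourier) set"
    and \<theta> g :: "real \<Rightarrow> fourier"
  assumes "0 < T"
    and "(0 < \<alpha> \<and> \<alpha> < 1/2 \<and> \<beta> = \<alpha>/2) \<or>
         (1/2 \<le> \<alpha> \<and> \<alpha> < 1 \<and> (\<beta> = \<alpha>/2 \<or> \<beta> = \<alpha>/2 + 1/4))"
    and "weak_strong_uniqueness_class \<alpha> \<beta> T C0"
    and "\<exists>R' \<subseteq> I_closure \<alpha> \<beta> T C0. R' \<noteq> {} \<and> time_reversible T R'"
    and "R \<subseteq> I_closure \<alpha> \<beta> T C0"
    and "time_reversible T R"
    and "\<theta> \<in> R"
    and "g \<in> L2Hs T 0"
    and "weak_solution \<alpha> \<beta> T g (\<theta> 0) \<theta>"
  shows "1/2 * (hs_norm (\<alpha> - 2*\<beta>) (\<theta> T))\<^sup>2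
           + (LINT s|lebesgue_on {0..T}. (hs_norm (2*\<alpha> - 2*\<beta>) (\<theta> s))\<^sup>2)
         = 1/2 * (hs_norm (\<alpha> - 2*\<beta>) (\<theta> 0))\<^sup>2
           + (LINT s|lebesgue_on {0..T}. pair (Lam (2*\<alpha> - 2*\<beta>) (\<theta> s)) (g s))"
proof -
  define r q where "r = \<alpha> - 2 * \<beta>" and "q = 2 * \<alpha> - 2 * \<beta>"
  define \<theta>' g' where "\<theta>' = time_reversal T \<theta>" and "g' = reversed_control T q \<theta> g"
  note T = assms(1) and C0 = assms(3) and g = assms(8) and w = assms(9)
  \<comment> \<open>\<open>\<beta> = \<alpha>/2\<close> gives the order \<open>0\<close>, and
    \<open>\<beta> = \<alpha>/2 + 1/4\<close> gives the order \<open>- 1/2\<close>.\<close>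
  have s: "\<alpha> - 2 * \<beta> = 0 \<or> \<alpha> - 2 * \<beta> = s_crit" and \<alpha>: "0 < \<alpha>" using assms(2) by (auto simp: s_crit_def)
  have s': "s_crit \<le> \<alpha> - 2 * \<beta>" "0 \<le> \<alpha>" using s \<alpha> by (auto simp: s_crit_def)
  have \<theta>I: "\<theta> \<in> I_closure \<alpha> \<beta> T C0" using assms(5,7) by blast
  have \<theta>'I: "\<theta>' \<in> I_closure \<alpha> \<beta> T C0" using assms(5-7) unfolding time_reversible_def \<theta>'_def by blast
  have \<theta>L: "\<theta> \<in> L2Hs T q" and X: "\<theta>' \<in> Xspace \<alpha> \<beta> T" using w \<theta>'I unfolding weak_solution_def I_closure_def q_def by blast+
  have \<theta>'L: "\<theta>' \<in> L2Hs T q" using X unfolding Xspace_def q_def by blast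
  have g': "g' \<in> L2Hs T 0" unfolding g'_def by (rule reversed_control_L2Hs[OF \<theta>L g])
  have w': "weak_solution \<alpha> \<beta> T g' (\<theta>' 0) \<theta>'"
    unfolding \<theta>'_def g'_def q_def by (rule weak_solution_time_reversal[OF w g T s' X[unfolded \<theta>'_def]])
  have rev: "\<theta>' t = - \<theta> (T - t)" if "t \<in> {0..T}" for t using that by (simp add: \<theta>'_def time_reversal_def)
  define F P where "F = (LINT s|lebesgue_on {0..T}. (hs_norm q (\<theta> s))\<^sup>2)" and "P = (LINT s|lebesgue_on {0..T}. pair (Lam q (\<theta> s)) (g s))"
  have Fi: "integrable (lebesgue_on {0..T}) (\<lambda>s. (hs_norm q (\<theta> s))\<^sup>2)" by (rule L2Hs_norm_integrable(2)[OF \<theta>L])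
  have LL: "(\<lambda>s. Lam q (x s)) \<in> L2Hs T 0" if "x \<in> L2Hs T q" for x using L2Hs_Lam[OF that, of q] by simp
  have Pi: "integrable (lebesgue_on {0..T}) (\<lambda>s. pair (Lam q (\<theta> s)) (g s))"
    using L2Hs_pair_integrable(1)[OF LL[OF \<theta>L], of g] g by simp
  have Pi': "integrable (lebesgue_on {0..T}) (\<lambda>s. pair (Lam q (\<theta>' s)) (g' s))"
    using L2Hs_pair_integrable(1)[OF LL[OF \<theta>'L], of g'] g' by simp
  have "(LINT s|lebesgue_on {0..T}. (hs_norm q (\<theta>' s))\<^sup>2) = (LINT s|lebesgue_on {0..T}. (hs_norm q (\<theta> (T - s)))\<^sup>2)"
    by (rule Bochner_Integration.integral_cong[OF refl]) (simp add: rev hs_norm_minus del: fun_Compl_def)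
  then have F': "(LINT s|lebesgue_on {0..T}. (hs_norm q (\<theta>' s))\<^sup>2) = F" unfolding F_def using integral_reflect(2)[OF Fi] by simp
  have Wi: "integrable (lebesgue_on {0..T}) (\<lambda>s. 2 * (hs_norm q (\<theta> s))\<^sup>2 - pair (Lam q (\<theta> s)) (g s))" using Fi Pi by simp
  have "(LINT s|lebesgue_on {0..T}. pair (Lam q (\<theta>' s)) (g' s)) = (LINT s|lebesgue_on {0..T}. 2 * (hs_norm q (\<theta> (T - s)))\<^sup>2 - pair (Lam q (\<theta> (T - s))) (g (T - s)))"
  proof (rule integral_cong_AE[OF borel_measurable_integrable[OF Pi'] borel_measurable_integrable[OF integral_reflect(1)[OF Wi]]])
    have "AE s in lebesgue_on {0..T}. \<theta> s \<in> Hs q \<and> g s \<in> Hs 0" using \<theta>L g unfolding L2Hs_iff by (intro AE_conjI) blast+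
    then have "AE s in lebesgue_on {0..T}. \<theta> (T - s) \<in> Hs q \<and> g (T - s) \<in> Hs 0" by (rule AE_reflect)
    then show "AE s in lebesgue_on {0..T}. pair (Lam q (\<theta>' s)) (g' s) = 2 * (hs_norm q (\<theta> (T - s)))\<^sup>2 - pair (Lam q (\<theta> (T - s))) (g (T - s))"
      using AE_in_interval
    proof eventually_elim
      case (elim s)
      then show ?case unfolding rev[OF elim(2)] g'_def reversed_control_def by (elim conjE) (rule pair_reversal)
    qed
  qed
  also have "\<dots> = 2 * F - P" unfolding integral_reflect(2)[OF Wi] F_def P_def using Fi Pi by simp
  finally have P': "(LINT s|lebesgue_on {0..T}. pair (Lam q (\<theta>' s)) (g' s)) = 2 * F - P" .
  have ends: "hs_norm r (\<theta>' T) = hs_norm r (\<theta> 0)" "hs_norm r (\<theta>' 0) = hs_norm r (\<theta> T)"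
    using T rev[of T] rev[of 0] hs_norm_minus[of r "\<theta> 0"] hs_norm_minus[of r "\<theta> T"] by simp_all
  have "1/2 * (hs_norm r (\<theta> T))\<^sup>2 + F \<le> 1/2 * (hs_norm r (\<theta> 0))\<^sup>2 + P"
    using closure_energy_inequality[OF C0 T s \<alpha> \<theta>I g w] unfolding r_def q_def F_def P_def .
  \<comment> \<open>Reversal exchanges the end points, and cancelling one \<open>F\<close> leaves
    the opposite of the first inequality.\<close>
  moreover have "1/2 * (hs_norm r (\<theta> 0))\<^sup>2 + F \<le> 1/2 * (hs_norm r (\<theta> T))\<^sup>2 + (2 * F - P)"
    using closure_energy_inequality[OF C0 T s \<alpha> \<theta>'I g' w'] unfolding r_def[symmetric] q_def[symmetric] ends F' P' .
  ultimately have "1/2 * (hs_norm r (\<theta> T))\<^sup>2 + F = 1/2 * (hs_norm r (\<theta> 0))\<^sup>2 + P" by linarith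
  then show ?thesis unfolding r_def q_def F_def P_def .
qed

end
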